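(* Let $(M,g)$ be a connected quaternionic-Kähler manifold of dimension $4n\geq 8$, let $\mathcal C_2(M)$ be the space of compatible conformal-Killing $2$-forms on $(M,g)$, and for conformal-Killing $2$-forms $\psi_1,\psi_2$ on $(M,g)$ set $$[\psi_{1},\psi_{2}]:=\frac12\left(L_{\delta\psi_{1}}\psi_{2}-L_{\delta\psi_{2}}\psi_{1}\right).$$ (i) The bracket $[\cdot,\cdot]$ preserves the subspace $\mathcal C_{2}(M)$, i.e. $[\psi_1,\psi_2]\in\mathcal C_2(M)$ for all $\psi_1,\psi_2\in\mathcal C_2(M)$. (ii) Assume that $(M,g)$ is not Ricci-flat. Then $(\mathcal C_{2}(M),[\cdot,\cdot])$ is a Lie algebra and the codifferential $$\delta:\mathcal C_{2}(M)\to \mathrm{isom}(M,g)$$ is a Lie algebra homomorphism.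
   Context: A quaternionic-Kähler manifold is a Riemannian manifold $(M,g)$ of dimension $4n\geq 8$ with holonomy group included in $\mathrm{Sp}(1)\mathrm{Sp}(n)$; equivalently, there is a rank three sub-bundle $Q\subset \mathrm{End}(TM)$, preserved by the Levi-Civita connection $\nabla$ of $g$, locally generated by three anti-commuting $g$-orthogonal almost complex structures $J_1,J_2,J_3$ with $J_3=J_1J_2$, with Kähler forms $\omega_i:=g(J_i\cdot,\cdot)$. The metric $g$ is Einstein. As real bundles, $S^2H\subset\Lambda^2(M)$ is the bundle spanned locally by $\omega_1,\omega_2,\omega_3$, and $S^2E\subset\Lambda^2(M)$ is the bundle of $2$-forms $\psi$ with $\psi(J_i\cdot,J_i\cdot)=\psi$ for $i=1,2,3$. A $2$-form is compatible if it is a section of $S^2H\oplus S^2E$. Tangent vectors are identified with $1$-forms using $g$; in particular the codifferential $\delta\psi=-\sum_k i_{e_k}\nabla_{e_k}\psi$ of a $2$-form ($\{e_k\}$ a local orthonormal frame) is regarded as a vector field. A $2$-form $\psi$ on $(M,g)$ is conformal-Killing if $\nabla_Y\psi=\frac13 i_Yd\psi-\frac{1}{4n-1}Y\wedge\delta\psi$ for all $Y\in TM$. On an Einstein manifold the codifferential of a conformal-Killing $2$-form is a Killing vector field. $L$ denotes the Lie derivative, and $\mathrm{isom}(M,g)$ is the Lie algebra of Killing vector fields of $(M,g)$ with the usual bracket of vector fields. *)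

theory Defs
  imports "HOL-Analysis.Analysis" "HOL-Library.Function_Algebras"
begin

section \<open>Pointwise vector space structure and Lie algebras\<close>

text \<open>
  Sections of vector bundles are functions on the manifold, and bilinear forms and endomorphisms are
  curried functions, so the pointwise structure turns all of them into real vector spaces.
\<close>

instantiation "fun" :: (type, real_vector) real_vector
begin

definition scaleR_fun :: "real \<Rightarrow> ('a \<Rightarrow> 'b) \<Rightarrow> 'a \<Rightarrow> 'b" where
  "scaleR_fun r f = (\<lambda>x. r *\<^sub>R f x)"

instance
  by standard (auto simp: scaleR_fun_def fun_eq_iff algebra_simps)

end

definition lie_algebra :: "'v::real_vector set \<Rightarrow> ('v \<Rightarrow> 'v \<Rightarrow> 'v) \<Rightarrow> bool" where
  "lie_algebra L br \<longleftrightarrow>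
     subspace L \<and>
     (\<forall>x\<in>L. \<forall>y\<in>L. br x y \<in> L) \<and>
     (\<forall>x\<in>L. \<forall>y\<in>L. \<forall>z\<in>L. \<forall>a b.
        br (a *\<^sub>R x + b *\<^sub>R y) z = a *\<^sub>R br x z + b *\<^sub>R br y z \<and>
        br z (a *\<^sub>R x + b *\<^sub>R y) = a *\<^sub>R br z x + b *\<^sub>R br z y) \<and>
     (\<forall>x\<in>L. br x x = 0) \<and>
     (\<forall>x\<in>L. \<forall>y\<in>L. \<forall>z\<in>L. br x (br y z) + br y (br z x) + br z (br x y) = 0)"

definition lie_algebra_hom ::
  "'v::real_vector set \<Rightarrow> ('v \<Rightarrow> 'v \<Rightarrow> 'v) \<Rightarrow> 'w::real_vector set \<Rightarrow> ('w \<Rightarrow> 'w \<Rightarrow> 'w) \<Rightarrow> ('v \<Rightarrow> 'w) \<Rightarrow> bool"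
  where
  "lie_algebra_hom L br L' br' f \<longleftrightarrow>
     lie_algebra L br \<and> lie_algebra L' br' \<and>
     (\<forall>x\<in>L. f x \<in> L') \<and>
     (\<forall>x\<in>L. \<forall>y\<in>L. \<forall>a b. f (a *\<^sub>R x + b *\<^sub>R y) = a *\<^sub>R f x + b *\<^sub>R f y) \<and>
     (\<forall>x\<in>L. \<forall>y\<in>L. f (br x y) = br' (f x) (f y))"


section \<open>Smooth manifolds\<close>

primrec Ck_on :: "nat \<Rightarrow> ('a::euclidean_space \<Rightarrow> 'b::real_normed_vector) \<Rightarrow> 'a set \<Rightarrow> bool" where
  "Ck_on 0 f S \<longleftrightarrow> continuous_on S f"
| "Ck_on (Suc k) f S \<longleftrightarrow>
     (\<forall>x\<in>S. f differentiable (at x)) \<and> (\<forall>v. Ck_on k (\<lambda>x. frechet_derivative f (at x) v) S)"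

text \<open>Only used for open sets.\<close>

definition smooth_on :: "('a::euclidean_space \<Rightarrow> 'b::real_normed_vector) \<Rightarrow> 'a set \<Rightarrow> bool" where
  "smooth_on f S \<longleftrightarrow> (\<forall>k. Ck_on k f S)"

text \<open>
  A chart is a domain together with a coordinate map; the map is irrelevant outside the domain.
  The manifold is a whole type \<open>'m\<close>, modelled on the Euclidean space \<open>'e\<close>.
\<close>

type_synonym ('m, 'e) chart = "'m set \<times> ('m \<Rightarrow> 'e)"

definition chart_inv :: "('m, 'e) chart \<Rightarrow> 'e \<Rightarrow> 'm" where
  "chart_inv c = inv_into (fst c) (snd c)"

definition smooth_atlas ::
  "('m::{t2_space,second_countable_topology}, 'e::euclidean_space) chart set \<Rightarrow> bool" where
  "smooth_atlas A \<longleftrightarrow>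
     (\<forall>c\<in>A. open (fst c) \<and> open (snd c ` fst c) \<and>
        homeomorphism (fst c) (snd c ` fst c) (snd c) (chart_inv c)) \<and>
     (\<Union>c\<in>A. fst c) = UNIV \<and>
     (\<forall>c\<in>A. \<forall>c'\<in>A. smooth_on (snd c' \<circ> chart_inv c) (snd c ` (fst c \<inter> fst c')))"

text \<open>
  Each point has a preferred chart, and the tangent space at \<open>p\<close> is identified with \<open>'e\<close> by means of
  it: \<open>v :: 'e\<close> stands for the tangent vector at \<open>p\<close> with components \<open>v\<close> in \<open>chart_at A p\<close>.
  The maps \<open>to_chart A c p\<close> and \<open>from_chart A c p\<close> convert between these components
  and the components in another chart \<open>c\<close> around \<open>p\<close>.
\<close>

definition chart_at :: "('m, 'e) chart set \<Rightarrow> 'm \<Rightarrow> ('m, 'e) chart" where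
  "chart_at A p = (SOME c. c \<in> A \<and> p \<in> fst c)"

definition base_pt :: "('m, 'e) chart set \<Rightarrow> 'm \<Rightarrow> 'e" where
  "base_pt A p = snd (chart_at A p) p"

definition to_chart ::
  "('m, 'e::euclidean_space) chart set \<Rightarrow> ('m, 'e) chart \<Rightarrow> 'm \<Rightarrow> 'e \<Rightarrow> 'e" where
  "to_chart A c p = frechet_derivative (snd c \<circ> chart_inv (chart_at A p)) (at (base_pt A p))"

definition from_chart ::
  "('m, 'e::euclidean_space) chart set \<Rightarrow> ('m, 'e) chart \<Rightarrow> 'm \<Rightarrow> 'e \<Rightarrow> 'e" where
  "from_chart A c p = frechet_derivative (snd (chart_at A p) \<circ> chart_inv c) (at (snd c p))"


section \<open>Tensor fields\<close>

type_synonym ('m, 'e) vfield = "'m \<Rightarrow> 'e"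
type_synonym ('m, 'e) cov2 = "'m \<Rightarrow> 'e \<Rightarrow> 'e \<Rightarrow> real"
type_synonym ('m, 'e) endfield = "'m \<Rightarrow> 'e \<Rightarrow> 'e"

text \<open>
  Local expressions in a chart \<open>c\<close>, as functions on the image of \<open>c\<close>. In the preferred chart
  at \<open>p\<close> their values at \<open>base_pt A p\<close> are the values of the field at \<open>p\<close>.
\<close>

definition vf_rep ::
  "('m, 'e::euclidean_space) chart set \<Rightarrow> ('m, 'e) chart \<Rightarrow> ('m, 'e) vfield \<Rightarrow> 'e \<Rightarrow> 'e" where
  "vf_rep A c X x = to_chart A c (chart_inv c x) (X (chart_inv c x))"

definition cov2_rep ::
  "('m, 'e::euclidean_space) chart set \<Rightarrow> ('m, 'e) chart \<Rightarrow> ('m, 'e) cov2 \<Rightarrow> 'e \<Rightarrow> 'e \<Rightarrow> 'e \<Rightarrow> real" where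
  "cov2_rep A c t x u v =
     t (chart_inv c x) (from_chart A c (chart_inv c x) u) (from_chart A c (chart_inv c x) v)"

definition end_rep ::
  "('m, 'e::euclidean_space) chart set \<Rightarrow> ('m, 'e) chart \<Rightarrow> ('m, 'e) endfield \<Rightarrow> 'e \<Rightarrow> 'e \<Rightarrow> 'e" where
  "end_rep A c S x u =
     to_chart A c (chart_inv c x) (S (chart_inv c x) (from_chart A c (chart_inv c x) u))"

definition smooth_vfield :: "('m, 'e::euclidean_space) chart set \<Rightarrow> ('m, 'e) vfield \<Rightarrow> bool" where
  "smooth_vfield A X \<longleftrightarrow> (\<forall>c\<in>A. smooth_on (vf_rep A c X) (snd c ` fst c))"

definition smooth_cov2 :: "('m, 'e::euclidean_space) chart set \<Rightarrow> ('m, 'e) cov2 \<Rightarrow> bool" where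
  "smooth_cov2 A t \<longleftrightarrow>
     (\<forall>p. bilinear (t p)) \<and>
     (\<forall>c\<in>A. \<forall>u v. smooth_on (\<lambda>x. cov2_rep A c t x u v) (snd c ` fst c))"

text \<open>Smooth sections of the endomorphism bundle over an open set \<open>U\<close>; values outside \<open>U\<close> play no role.\<close>

definition smooth_endfield_on ::
  "('m, 'e::euclidean_space) chart set \<Rightarrow> 'm set \<Rightarrow> ('m, 'e) endfield \<Rightarrow> bool" where
  "smooth_endfield_on A U S \<longleftrightarrow>
     (\<forall>p\<in>U. linear (S p)) \<and>
     (\<forall>c\<in>A. \<forall>u. smooth_on (\<lambda>x. end_rep A c S x u) (snd c ` (fst c \<inter> U)))"

definition two_form :: "('m, 'e::euclidean_space) chart set \<Rightarrow> ('m, 'e) cov2 \<Rightarrow> bool" where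
  "two_form A \<psi> \<longleftrightarrow> smooth_cov2 A \<psi> \<and> (\<forall>p u. \<psi> p u u = 0)"

text \<open>
  Derivatives at \<open>p\<close>, in direction \<open>v\<close>, of the components with respect to the preferred chart at \<open>p\<close>.
\<close>

definition dvf ::
  "('m, 'e::euclidean_space) chart set \<Rightarrow> ('m, 'e) vfield \<Rightarrow> 'm \<Rightarrow> 'e \<Rightarrow> 'e" where
  "dvf A X p v = frechet_derivative (vf_rep A (chart_at A p) X) (at (base_pt A p)) v"

definition dcov2 ::
  "('m, 'e::euclidean_space) chart set \<Rightarrow> ('m, 'e) cov2 \<Rightarrow> 'm \<Rightarrow> 'e \<Rightarrow> 'e \<Rightarrow> 'e \<Rightarrow> real" where
  "dcov2 A t p v a b =
     frechet_derivative (\<lambda>x. cov2_rep A (chart_at A p) t x a b) (at (base_pt A p)) v"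

definition dend ::
  "('m, 'e::euclidean_space) chart set \<Rightarrow> ('m, 'e) endfield \<Rightarrow> 'm \<Rightarrow> 'e \<Rightarrow> 'e \<Rightarrow> 'e" where
  "dend A S p v a =
     frechet_derivative (\<lambda>x. end_rep A (chart_at A p) S x a) (at (base_pt A p)) v"

definition lie_bracket ::
  "('m, 'e::euclidean_space) chart set \<Rightarrow> ('m, 'e) vfield \<Rightarrow> ('m, 'e) vfield \<Rightarrow> ('m, 'e) vfield" where
  "lie_bracket A X Y = (\<lambda>p. dvf A Y p (X p) - dvf A X p (Y p))"

definition lie_deriv ::
  "('m, 'e::euclidean_space) chart set \<Rightarrow> ('m, 'e) vfield \<Rightarrow> ('m, 'e) cov2 \<Rightarrow> ('m, 'e) cov2" where
  "lie_deriv A X t =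
     (\<lambda>p a b. dcov2 A t p (X p) a b + t p (dvf A X p a) b + t p a (dvf A X p b))"

definition ext_d ::
  "('m, 'e::euclidean_space) chart set \<Rightarrow> ('m, 'e) cov2 \<Rightarrow> 'm \<Rightarrow> 'e \<Rightarrow> 'e \<Rightarrow> 'e \<Rightarrow> real" where
  "ext_d A \<psi> p a b c = dcov2 A \<psi> p a b c - dcov2 A \<psi> p b a c + dcov2 A \<psi> p c a b"


section \<open>Riemannian geometry\<close>

definition riemannian_metric :: "('m, 'e::euclidean_space) chart set \<Rightarrow> ('m, 'e) cov2 \<Rightarrow> bool" where
  "riemannian_metric A g \<longleftrightarrow>
     smooth_cov2 A g \<and> (\<forall>p u v. g p u v = g p v u) \<and> (\<forall>p u. u \<noteq> 0 \<longrightarrow> g p u u > 0)"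

text \<open>
  Connection form of the Levi-Civita connection in a chart: the unique symmetric (torsion-free)
  bilinear map for which the metric is parallel.
\<close>

definition christoffel ::
  "('m, 'e::euclidean_space) chart set \<Rightarrow> ('m, 'e) cov2 \<Rightarrow> ('m, 'e) chart \<Rightarrow> 'e \<Rightarrow> 'e \<Rightarrow> 'e \<Rightarrow> 'e" where
  "christoffel A g c x =
     (THE \<Gamma>. bilinear \<Gamma> \<and> (\<forall>u v. \<Gamma> u v = \<Gamma> v u) \<and>
        (\<forall>w u v. frechet_derivative (\<lambda>y. cov2_rep A c g y u v) (at x) w =
           cov2_rep A c g x (\<Gamma> w u) v + cov2_rep A c g x u (\<Gamma> w v)))"

definition conn_at ::
  "('m, 'e::euclidean_space) chart set \<Rightarrow> ('m, 'e) cov2 \<Rightarrow> 'm \<Rightarrow> 'e \<Rightarrow> 'e \<Rightarrow> 'e" where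
  "conn_at A g p = christoffel A g (chart_at A p) (base_pt A p)"

definition nabla_cov2 ::
  "('m, 'e::euclidean_space) chart set \<Rightarrow> ('m, 'e) cov2 \<Rightarrow> ('m, 'e) cov2 \<Rightarrow> 'm \<Rightarrow> 'e \<Rightarrow> 'e \<Rightarrow> 'e \<Rightarrow> real"
  where
  "nabla_cov2 A g t p v a b =
     dcov2 A t p v a b - t p (conn_at A g p v a) b - t p a (conn_at A g p v b)"

definition nabla_end ::
  "('m, 'e::euclidean_space) chart set \<Rightarrow> ('m, 'e) cov2 \<Rightarrow> ('m, 'e) endfield \<Rightarrow> 'm \<Rightarrow> 'e \<Rightarrow> 'e \<Rightarrow> 'e"
  where
  "nabla_end A g S p v a =
     dend A S p v a + conn_at A g p v (S p a) - S p (conn_at A g p v a)"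

definition orthonormal_frame :: "('m, 'e::euclidean_space) cov2 \<Rightarrow> 'm \<Rightarrow> 'e set \<Rightarrow> bool" where
  "orthonormal_frame g p B \<longleftrightarrow>
     finite B \<and> card B = DIM('e) \<and> (\<forall>e\<in>B. \<forall>e'\<in>B. g p e e' = (if e = e' then 1 else 0))"

definition on_frame :: "('m, 'e::euclidean_space) cov2 \<Rightarrow> 'm \<Rightarrow> 'e set" where
  "on_frame g p = (SOME B. orthonormal_frame g p B)"

text \<open>The vector corresponding to a covector under the identification by the metric.\<close>

definition sharp :: "('m, 'e::euclidean_space) cov2 \<Rightarrow> 'm \<Rightarrow> ('e \<Rightarrow> real) \<Rightarrow> 'e" where
  "sharp g p \<alpha> = (THE w. \<forall>v. g p w v = \<alpha> v)"

definition codiff ::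
  "('m, 'e::euclidean_space) chart set \<Rightarrow> ('m, 'e) cov2 \<Rightarrow> ('m, 'e) cov2 \<Rightarrow> ('m, 'e) vfield" where
  "codiff A g \<psi> = (\<lambda>p. sharp g p (\<lambda>v. - (\<Sum>e\<in>on_frame g p. nabla_cov2 A g \<psi> p e e v)))"

text \<open>The wedge product of the one-forms dual to two tangent vectors.\<close>

definition wedge :: "('m, 'e::euclidean_space) cov2 \<Rightarrow> 'm \<Rightarrow> 'e \<Rightarrow> 'e \<Rightarrow> 'e \<Rightarrow> 'e \<Rightarrow> real" where
  "wedge g p Y Z u v = g p Y u * g p Z v - g p Y v * g p Z u"

definition conformal_killing ::
  "('m, 'e::euclidean_space) chart set \<Rightarrow> ('m, 'e) cov2 \<Rightarrow> ('m, 'e) cov2 \<Rightarrow> bool" where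
  "conformal_killing A g \<psi> \<longleftrightarrow>
     two_form A \<psi> \<and>
     (\<forall>p Y u v. nabla_cov2 A g \<psi> p Y u v =
        1 / 3 * ext_d A \<psi> p Y u v
        - 1 / (real DIM('e) - 1) * wedge g p Y (codiff A g \<psi> p) u v)"

definition isom ::
  "('m, 'e::euclidean_space) chart set \<Rightarrow> ('m, 'e) cov2 \<Rightarrow> ('m, 'e) vfield set" where
  "isom A g = {X. smooth_vfield A X \<and> lie_deriv A X g = 0}"

text \<open>
  \<open>curv A g p a b w\<close> is \<open>R(a,b)w = \<nabla>\<^sub>a\<nabla>\<^sub>bw - \<nabla>\<^sub>b\<nabla>\<^sub>aw\<close> for vector fields \<open>a\<close>, \<open>b\<close>, \<open>w\<close> that are constant
  in the preferred chart at \<open>p\<close>.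
\<close>

definition curv ::
  "('m, 'e::euclidean_space) chart set \<Rightarrow> ('m, 'e) cov2 \<Rightarrow> 'm \<Rightarrow> 'e \<Rightarrow> 'e \<Rightarrow> 'e \<Rightarrow> 'e" where
  "curv A g p a b w =
     (let \<Gamma> = christoffel A g (chart_at A p); x = base_pt A p in
        frechet_derivative (\<lambda>y. \<Gamma> y b w) (at x) a - frechet_derivative (\<lambda>y. \<Gamma> y a w) (at x) b
        + \<Gamma> x a (\<Gamma> x b w) - \<Gamma> x b (\<Gamma> x a w))"

definition ricci :: "('m, 'e::euclidean_space) chart set \<Rightarrow> ('m, 'e) cov2 \<Rightarrow> ('m, 'e) cov2" where
  "ricci A g = (\<lambda>p u v. \<Sum>e\<in>on_frame g p. g p (curv A g p e u v) e)"

definition ricci_flat :: "('m, 'e::euclidean_space) chart set \<Rightarrow> ('m, 'e) cov2 \<Rightarrow> bool" where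
  "ricci_flat A g \<longleftrightarrow> ricci A g = 0"


section \<open>Quaternionic-Kaehler manifolds\<close>

definition quaternionic_triple ::
  "('m, 'e::euclidean_space) cov2 \<Rightarrow> 'm \<Rightarrow> ('e \<Rightarrow> 'e) \<Rightarrow> ('e \<Rightarrow> 'e) \<Rightarrow> ('e \<Rightarrow> 'e) \<Rightarrow> bool" where
  "quaternionic_triple g p J1 J2 J3 \<longleftrightarrow>
     (\<forall>J\<in>{J1, J2, J3}. linear J \<and> J \<circ> J = - id \<and> (\<forall>u v. g p (J u) (J v) = g p u v)) \<and>
     J1 \<circ> J2 = - (J2 \<circ> J1) \<and> J2 \<circ> J3 = - (J3 \<circ> J2) \<and> J1 \<circ> J3 = - (J3 \<circ> J1) \<and>
     J3 = J1 \<circ> J2"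

text \<open>The fibre of the bundle \<open>Q\<close> at \<open>p\<close> is \<open>Q p\<close>.\<close>

definition quaternionic_kahler ::
  "('m::{t2_space,second_countable_topology}, 'e::euclidean_space) chart set
     \<Rightarrow> ('m, 'e) cov2 \<Rightarrow> ('m \<Rightarrow> ('e \<Rightarrow> 'e) set) \<Rightarrow> bool" where
  "quaternionic_kahler A g Q \<longleftrightarrow>
     smooth_atlas A \<and> riemannian_metric A g \<and>
     (\<exists>n\<ge>2. DIM('e) = 4 * n) \<and>
     (\<forall>p. \<exists>U J1 J2 J3. open U \<and> p \<in> U \<and>
        (\<forall>J\<in>{J1, J2, J3}. smooth_endfield_on A U J) \<and>
        (\<forall>q\<in>U. quaternionic_triple g q (J1 q) (J2 q) (J3 q) \<and>
           Q q = span {J1 q, J2 q, J3 q})) \<and>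
     (\<forall>U S. open U \<and> smooth_endfield_on A U S \<and> (\<forall>q\<in>U. S q \<in> Q q) \<longrightarrow>
        (\<forall>q\<in>U. \<forall>v. nabla_end A g S q v \<in> Q q))"

definition kahler_form ::
  "('m, 'e::euclidean_space) cov2 \<Rightarrow> 'm \<Rightarrow> ('e \<Rightarrow> 'e) \<Rightarrow> 'e \<Rightarrow> 'e \<Rightarrow> real" where
  "kahler_form g p J = (\<lambda>u v. g p (J u) v)"

text \<open>
  Fibres at \<open>p\<close> of the two subbundles of two-forms. Neither depends on the triple that generates \<open>Q p\<close>.
\<close>

definition S2H ::
  "('m, 'e::euclidean_space) cov2 \<Rightarrow> ('m \<Rightarrow> ('e \<Rightarrow> 'e) set) \<Rightarrow> 'm \<Rightarrow> ('e \<Rightarrow> 'e \<Rightarrow> real) set" where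
  "S2H g Q p = {\<sigma>. \<exists>J1 J2 J3. quaternionic_triple g p J1 J2 J3 \<and> Q p = span {J1, J2, J3} \<and>
     \<sigma> \<in> span {kahler_form g p J1, kahler_form g p J2, kahler_form g p J3}}"

definition S2E ::
  "('m, 'e::euclidean_space) cov2 \<Rightarrow> ('m \<Rightarrow> ('e \<Rightarrow> 'e) set) \<Rightarrow> 'm \<Rightarrow> ('e \<Rightarrow> 'e \<Rightarrow> real) set" where
  "S2E g Q p = {\<sigma>. bilinear \<sigma> \<and> (\<forall>u. \<sigma> u u = 0) \<and>
     (\<exists>J1 J2 J3. quaternionic_triple g p J1 J2 J3 \<and> Q p = span {J1, J2, J3} \<and>
        (\<forall>J\<in>{J1, J2, J3}. \<forall>u v. \<sigma> (J u) (J v) = \<sigma> u v))}"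

definition compatible ::
  "('m, 'e::euclidean_space) cov2 \<Rightarrow> ('m \<Rightarrow> ('e \<Rightarrow> 'e) set) \<Rightarrow> ('m, 'e) cov2 \<Rightarrow> bool" where
  "compatible g Q \<psi> \<longleftrightarrow> (\<forall>p. \<exists>\<sigma>\<in>S2H g Q p. \<exists>\<tau>\<in>S2E g Q p. \<psi> p = \<sigma> + \<tau>)"

definition C2 ::
  "('m, 'e::euclidean_space) chart set \<Rightarrow> ('m, 'e) cov2 \<Rightarrow> ('m \<Rightarrow> ('e \<Rightarrow> 'e) set) \<Rightarrow> ('m, 'e) cov2 set"
  where
  "C2 A g Q = {\<psi>. conformal_killing A g \<psi> \<and> compatible g Q \<psi>}"

definition ck_bracket ::
  "('m, 'e::euclidean_space) chart set \<Rightarrow> ('m, 'e) cov2 \<Rightarrow> ('m, 'e) cov2 \<Rightarrow> ('m, 'e) cov2 \<Rightarrow> ('m, 'e) cov2"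
  where
  "ck_bracket A g \<psi>1 \<psi>2 =
     (1 / 2) *\<^sub>R (lie_deriv A (codiff A g \<psi>1) \<psi>2 - lie_deriv A (codiff A g \<psi>2) \<psi>1)"

end

theory Submission
  imports Defs
begin

text \<open>
  Write a two-form as \<open>\<psi> = g (\<Psi> \<cdot>) \<cdot>\<close>. It is compatible iff \<open>\<Psi>\<close> normalises \<open>Q\<close>, and a compatible form with
  \<open>X = \<delta>\<psi>\<close> is conformal-Killing iff \<open>\<nabla>\<^sub>Y \<Psi> = - c E(Y, X)\<close>, where \<open>c = 1 / (4n - 1)\<close> and \<open>E(Y, X)\<close> (\<open>qwedge\<close>) is
  algebraic, bilinear and equivariant under skew endomorphisms that normalise \<open>Q\<close>. Differentiating once more
  and using the algebraic form of the curvature of a quaternionic-Kaehler metric, one finds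
  that \<open>A = \<nabla>X\<close> is skew, normalises \<open>Q\<close> and commutes with \<open>\<Psi>\<close>. So \<open>X\<close> is a Killing field whose flow preserves
  \<open>Q\<close>, and \<open>L\<^bsub>\<delta>\<psi>\<^esub> \<psi> = 0\<close>. Polarising, \<open>L\<^bsub>\<delta>\<psi>\<^sub>1\<^esub> \<psi>\<^sub>2 = - L\<^bsub>\<delta>\<psi>\<^sub>2\<^esub> \<psi>\<^sub>1\<close>, so the bracket of \<open>\<psi>\<^sub>1\<close> and \<open>\<psi>\<^sub>2\<close> is
  \<open>L\<^bsub>\<delta>\<psi>\<^sub>1\<^esub> \<psi>\<^sub>2\<close>. It satisfies the same first order equation with \<open>[\<delta>\<psi>\<^sub>1, \<delta>\<psi>\<^sub>2]\<close> in place of \<open>X\<close>,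
  and the Jacobi identity is \<open>L\<^bsub>[X, Y]\<^esub> = [L\<^sub>X, L\<^sub>Y]\<close>.
\<close>

section \<open>Smooth functions on open sets\<close>

text \<open>The first order equation rests on one algebraic fact: a three-form whose contraction
  with every vector normalises \<open>Q\<close> vanishes once the dimension is at least 8. The
  conformal-Killing equation fixes \<open>\<nabla>\<Psi>\<close> up to such a three-form, so
  \<open>X\<close> determines it. That \<open>A\<close> commutes with \<open>\<Psi>\<close> is the
  delicate point, because the \<open>sp(n)\<close>-part of the curvature is unknown. The
  integrability condition is contracted in two ways; both results contain the same unknown
  contraction of the curvature, and its elimination leaves a nonzero multiple of the commutator.
  Only the \<open>sp(1)\<close>-part and the Ricci contraction of the curvature enter explicitly,
  and at each point both are governed by one number. A second obstacle is the encoding: fields at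
  \<open>p\<close> are written in the chart \<open>chart_at A p\<close>, which may jump with
  \<open>p\<close>, so that derivatives cannot be iterated there. The analysis is therefore done on
  open subsets of the Euclidean space for a connection \<open>\<Gamma>\<close>, and invariance under
  changes of charts carries it to one fixed chart around the point.\<close>

lemma frechet_derivative_eqI:
  "(f has_derivative f') (at x) \<Longrightarrow> frechet_derivative f (at x) = f'"
  using frechet_derivative_at by metis

text \<open>No differentiability is assumed: \<open>frechet_derivative\<close> is a choice among all
  derivatives, and functions that agree near \<open>x\<close> have the same derivatives, if
  any.\<close>

lemma frechet_derivative_cong_open:
  assumes "open S" "x \<in> S" "\<And>y. y \<in> S \<Longrightarrow> f y = g y"
  shows "frechet_derivative f (at x) = frechet_derivative g (at x)"
proof -
  have "(f has_derivative f') (at x) \<longleftrightarrow> (g has_derivative f') (at x)" for f'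
    using has_derivative_transform_within_open[OF _ assms(1,2), of f f' UNIV g]
      has_derivative_transform_within_open[OF _ assms(1,2), of g f' UNIV f] assms(3) by auto
  then show ?thesis by (simp add: frechet_derivative_def)
qed

section \<open>Calculus of k times continuously differentiable functions\<close>

lemma Ck_on_cong:
  assumes "open S" "\<And>x. x \<in> S \<Longrightarrow> f x = g x" "Ck_on k f S"
  shows "Ck_on k g S"
  using assms(2,3)
proof (induction k arbitrary: f g)
  case 0
  then show ?case using continuous_on_cong[of S S f g] by simp
next
  case (Suc k)
  have "g differentiable (at x)" if "x \<in> S" for x
    using Suc.prems that has_derivative_transform_within_open[OF _ assms(1) that, of f _ UNIV g]
    unfolding differentiable_def by (metis Ck_on.simps(2) differentiable_def)
  moreover have "Ck_on k (\<lambda>x. frechet_derivative g (at x) v) S" for v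
    using Suc.IH[of "\<lambda>x. frechet_derivative f (at x) v"] Suc.prems
      frechet_derivative_cong_open[OF assms(1), of _ f g] by simp
  ultimately show ?case by simp
qed

lemma Ck_on_subset: "Ck_on k f S \<Longrightarrow> T \<subseteq> S \<Longrightarrow> Ck_on k f T"
  by (induction k arbitrary: f) (auto intro: continuous_on_subset)

lemma Ck_on_SucD: "Ck_on (Suc k) f S \<Longrightarrow> Ck_on k f S"
proof (induction k arbitrary: f)
  case 0
  then show ?case
    by (auto intro!: continuous_at_imp_continuous_on differentiable_imp_continuous_within)
qed auto

lemma Ck_on_const: "Ck_on k (\<lambda>_. c) S"
  by (induction k arbitrary: c) auto

lemma Ck_on_add:
  assumes "open S"
  shows "Ck_on k f S \<Longrightarrow> Ck_on k g S \<Longrightarrow> Ck_on k (\<lambda>x. f x + g x) S"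
proof (induction k arbitrary: f g)
  case 0
  then show ?case by (simp add: continuous_on_add)
next
  case (Suc k)
  have D: "((\<lambda>x. f x + g x) has_derivative
      (\<lambda>v. frechet_derivative f (at x) v + frechet_derivative g (at x) v)) (at x)" if "x \<in> S" for x
    using Suc.prems that by (intro has_derivative_add) (auto simp: frechet_derivative_works)
  have "Ck_on k (\<lambda>x. frechet_derivative (\<lambda>x. f x + g x) (at x) v) S" for v
    using Ck_on_cong[OF assms, of "\<lambda>x. frechet_derivative f (at x) v + frechet_derivative g (at x) v"]
      Suc frechet_derivative_eqI[OF D] by simp
  with D show ?case by (auto simp: differentiable_def)
qed

text \<open>Stated for any bounded bilinear product, so that scalar multiplication, multiplication
  and inner product are instances. In each summand of the product rule one factor has lost a
  derivative, and the other is lowered by \<open>Ck_on_SucD\<close> to match.\<close>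

lemma Ck_on_prod:
  assumes "open S" "bounded_bilinear pr"
  shows "Ck_on k f S \<Longrightarrow> Ck_on k g S \<Longrightarrow> Ck_on k (\<lambda>x. pr (f x) (g x)) S"
proof (induction k arbitrary: f g)
  case 0
  then show ?case using bounded_bilinear.continuous_on[OF assms(2)] by auto
next
  case (Suc k)
  have D: "((\<lambda>x. pr (f x) (g x)) has_derivative
      (\<lambda>v. pr (f x) (frechet_derivative g (at x) v) + pr (frechet_derivative f (at x) v) (g x))) (at x)"
    if "x \<in> S" for x
    using Suc.prems that
    by (intro bounded_bilinear.FDERIV[OF assms(2)]) (auto simp: frechet_derivative_works)
  have "Ck_on k (\<lambda>x. frechet_derivative (\<lambda>x. pr (f x) (g x)) (at x) v) S" for v
  proof (rule Ck_on_cong[OF assms(1), of "\<lambda>x. pr (f x) (frechet_derivative g (at x) v) + pr (frechet_derivative f (at x) v) (g x)"])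
    show "Ck_on k (\<lambda>x. pr (f x) (frechet_derivative g (at x) v) + pr (frechet_derivative f (at x) v) (g x)) S"
      using Suc.prems Ck_on_SucD[OF Suc.prems(1)] Ck_on_SucD[OF Suc.prems(2)]
      by (intro Ck_on_add assms(1) Suc.IH) auto
  qed (simp add: frechet_derivative_eqI[OF D])
  with D show ?case by (auto simp: differentiable_def)
qed

lemma smooth_on_cong: "smooth_on f S \<Longrightarrow> open S \<Longrightarrow> (\<And>x. x \<in> S \<Longrightarrow> f x = g x) \<Longrightarrow> smooth_on g S"
  unfolding smooth_on_def using Ck_on_cong by blast

lemma smooth_on_subset: "smooth_on f S \<Longrightarrow> T \<subseteq> S \<Longrightarrow> smooth_on f T"
  unfolding smooth_on_def using Ck_on_subset by blast

lemma smooth_on_const [simp, intro!]: "smooth_on (\<lambda>_. c) S"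
  by (simp add: smooth_on_def Ck_on_const)

lemma smooth_on_add: "open S \<Longrightarrow> smooth_on f S \<Longrightarrow> smooth_on g S \<Longrightarrow> smooth_on (\<lambda>x. f x + g x) S"
  by (simp add: smooth_on_def Ck_on_add)

lemma smooth_on_scaleR:
  "open S \<Longrightarrow> smooth_on f S \<Longrightarrow> smooth_on g S \<Longrightarrow> smooth_on (\<lambda>x. f x *\<^sub>R g x) S"
  by (simp add: smooth_on_def Ck_on_prod[OF _ bounded_bilinear_scaleR])

lemma smooth_on_mult:
  fixes f g :: "'a::euclidean_space \<Rightarrow> real"
  shows "open S \<Longrightarrow> smooth_on f S \<Longrightarrow> smooth_on g S \<Longrightarrow> smooth_on (\<lambda>x. f x * g x) S"
  by (simp add: smooth_on_def Ck_on_prod[OF _ bounded_bilinear_mult])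

lemma smooth_on_inner:
  fixes f g :: "'a::euclidean_space \<Rightarrow> 'b::real_inner"
  shows "open S \<Longrightarrow> smooth_on f S \<Longrightarrow> smooth_on g S \<Longrightarrow> smooth_on (\<lambda>x. f x \<bullet> g x) S"
  by (simp add: smooth_on_def Ck_on_prod[OF _ bounded_bilinear_inner])

lemma smooth_on_minus: "open S \<Longrightarrow> smooth_on f S \<Longrightarrow> smooth_on (\<lambda>x. - f x) S"
  using smooth_on_scaleR[of S "\<lambda>_. -1" f] by simp

lemma smooth_on_diff: "open S \<Longrightarrow> smooth_on f S \<Longrightarrow> smooth_on g S \<Longrightarrow> smooth_on (\<lambda>x. f x - g x) S"
  using smooth_on_add[of S f "\<lambda>x. - g x"] smooth_on_minus[of S g] by simp

lemma smooth_on_sum: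
  "open S \<Longrightarrow> (\<And>i. i \<in> I \<Longrightarrow> smooth_on (f i) S) \<Longrightarrow> smooth_on (\<lambda>x. \<Sum>i\<in>I. f i x) S"
  by (induction I rule: infinite_finite_induct) (auto intro: smooth_on_add)

lemma smooth_on_differentiable: "smooth_on f S \<Longrightarrow> x \<in> S \<Longrightarrow> f differentiable (at x)"
  unfolding smooth_on_def by (metis Ck_on.simps(2))

lemma smooth_on_has_derivative:
  "smooth_on f S \<Longrightarrow> x \<in> S \<Longrightarrow> (f has_derivative frechet_derivative f (at x)) (at x)"
  using smooth_on_differentiable frechet_derivative_works by blast

lemma smooth_on_linear_derivative:
  "smooth_on f S \<Longrightarrow> x \<in> S \<Longrightarrow> linear (frechet_derivative f (at x))"
  using smooth_on_differentiable linear_frechet_derivative by blast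

lemma smooth_on_frechet_derivative:
  "smooth_on f S \<Longrightarrow> smooth_on (\<lambda>x. frechet_derivative f (at x) v) S"
  unfolding smooth_on_def by (metis Ck_on.simps(2))

lemma smooth_on_continuous: "smooth_on f S \<Longrightarrow> continuous_on S f"
  unfolding smooth_on_def by (metis Ck_on.simps(1))

section \<open>Smooth families of linear maps\<close>

lemma linear_basis_expand:
  fixes L :: "'a::euclidean_space \<Rightarrow> 'b::real_vector"
  assumes "linear L"
  shows "L u = (\<Sum>b\<in>Basis. (u \<bullet> b) *\<^sub>R L b)"
  using linear_sum[OF assms, of "\<lambda>b. (u \<bullet> b) *\<^sub>R b" Basis] linear_scale[OF assms]
  by (simp add: euclidean_representation)

text \<open>Families of linear maps stay curried, with smoothness asked for each fixed argument.
  Expansion in \<open>Basis\<close> replaces a varying argument by finitely many fixed ones; the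
  same device proves \<open>has_derivative_apply\<close>.\<close>

lemma smooth_on_apply:
  fixes M :: "'a::euclidean_space \<Rightarrow> 'b::euclidean_space \<Rightarrow> 'c::real_normed_vector"
  assumes "open S" "\<And>x. x \<in> S \<Longrightarrow> linear (M x)" "\<And>u. smooth_on (\<lambda>x. M x u) S" "smooth_on X S"
  shows "smooth_on (\<lambda>x. M x (X x)) S"
proof (rule smooth_on_cong[OF _ assms(1)])
  show "smooth_on (\<lambda>x. \<Sum>b\<in>Basis. (X x \<bullet> b) *\<^sub>R M x b) S"
    by (intro smooth_on_sum smooth_on_scaleR smooth_on_inner assms smooth_on_const)
qed (simp add: linear_basis_expand[OF assms(2)])

lemma linear_family_derivative:
  fixes M :: "'a::euclidean_space \<Rightarrow> 'b::euclidean_space \<Rightarrow> 'c::real_normed_vector"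
  assumes S: "open S" "x \<in> S" and lin: "\<And>y. y \<in> S \<Longrightarrow> linear (M y)"
    and M: "\<And>u. (\<lambda>y. M y u) differentiable (at x)"
  shows "linear (\<lambda>u. frechet_derivative (\<lambda>y. M y u) (at x) v)"
proof (rule linearI)
  have D: "((\<lambda>y. M y u) has_derivative frechet_derivative (\<lambda>y. M y u) (at x)) (at x)" for u
    using M frechet_derivative_works by blast
  fix a b
  have "frechet_derivative (\<lambda>y. M y (a + b)) (at x) = frechet_derivative (\<lambda>y. M y a + M y b) (at x)"
    by (rule frechet_derivative_cong_open[OF S]) (simp add: linear_add[OF lin])
  then show "frechet_derivative (\<lambda>y. M y (a + b)) (at x) v =
      frechet_derivative (\<lambda>y. M y a) (at x) v + frechet_derivative (\<lambda>y. M y b) (at x) v"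
    by (simp add: frechet_derivative_eqI[OF has_derivative_add[OF D D]])
  fix r
  have "frechet_derivative (\<lambda>y. M y (r *\<^sub>R b)) (at x) = frechet_derivative (\<lambda>y. r *\<^sub>R M y b) (at x)"
    by (rule frechet_derivative_cong_open[OF S]) (simp add: linear_scale[OF lin])
  then show "frechet_derivative (\<lambda>y. M y (r *\<^sub>R b)) (at x) v =
      r *\<^sub>R frechet_derivative (\<lambda>y. M y b) (at x) v"
    by (simp add: frechet_derivative_eqI[OF has_derivative_scaleR_right[OF D]])
qed

text \<open>The Leibniz rule for a linear map applied to a vector, both depending on the point.
  Linearity of \<open>M' v\<close> is inherited from the family through
  \<open>linear_family_derivative\<close>.\<close>

lemma has_derivative_apply:
  fixes M :: "'a::euclidean_space \<Rightarrow> 'b::euclidean_space \<Rightarrow> 'c::real_normed_vector"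
  assumes "open S" "x \<in> S" and lin: "\<And>y. y \<in> S \<Longrightarrow> linear (M y)"
    and M: "\<And>u. ((\<lambda>y. M y u) has_derivative (\<lambda>v. M' v u)) (at x)"
    and X: "(X has_derivative X') (at x)"
  shows "((\<lambda>y. M y (X y)) has_derivative (\<lambda>v. M' v (X x) + M x (X' v))) (at x)"
proof -
  have linM': "linear (M' v)" for v
  proof -
    have eq: "M' v = (\<lambda>u. frechet_derivative (\<lambda>y. M y u) (at x) v)"
      by (simp add: frechet_derivative_eqI[OF M])
    show ?thesis unfolding eq
      by (rule linear_family_derivative[OF assms(1,2) lin differentiableI[OF M]])
  qed
  have "((\<lambda>y. \<Sum>b\<in>Basis. (X y \<bullet> b) *\<^sub>R M y b) has_derivative
     (\<lambda>v. \<Sum>b\<in>Basis. (X x \<bullet> b) *\<^sub>R M' v b + (X' v \<bullet> b) *\<^sub>R M x b)) (at x)"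
    by (intro has_derivative_sum has_derivative_scaleR M has_derivative_inner_left X)
  then have "((\<lambda>y. M y (X y)) has_derivative
     (\<lambda>v. \<Sum>b\<in>Basis. (X x \<bullet> b) *\<^sub>R M' v b + (X' v \<bullet> b) *\<^sub>R M x b)) (at x)"
    by (rule has_derivative_transform_within_open[OF _ assms(1,2)])
      (simp add: linear_basis_expand[OF lin])
  then show ?thesis
    by (simp add: sum.distrib linear_basis_expand[OF lin[OF assms(2)], symmetric]
        linear_basis_expand[OF linM', symmetric])
qed

text \<open>The classical argument: the second difference \<open>h v w t\<close> is symmetric in
  \<open>v\<close> and \<open>w\<close>, and divided by \<open>t\<^sup>2\<close> it tends to the
  second derivative in the directions \<open>v\<close> and \<open>w\<close>.\<close>

lemma second_derivative_symmetric_real: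
  fixes f :: "'a::euclidean_space \<Rightarrow> real"
  assumes "open S" "smooth_on f S" "x \<in> S"
  shows "frechet_derivative (\<lambda>y. frechet_derivative f (at y) v) (at x) w =
         frechet_derivative (\<lambda>y. frechet_derivative f (at y) w) (at x) v"
proof -
  define D2 where "D2 v w y = frechet_derivative (\<lambda>y. frechet_derivative f (at y) v) (at y) w" for v w y
  define h where "h v w t = f (x + t *\<^sub>R v + t *\<^sub>R w) - f (x + t *\<^sub>R v) - f (x + t *\<^sub>R w) + f x" for v w and t :: real
  have swap: "h v w t = h w v t" for v w t by (simp add: h_def add.commute add.left_commute)
  have sm2: "smooth_on (D2 v w) S" for v w
    unfolding D2_def[abs_def] using assms(2) smooth_on_frechet_derivative by blast
  have key: "\<exists>\<delta>>0. \<forall>t. 0 < t \<and> t < \<delta> \<longrightarrow> \<bar>h v w t / t\<^sup>2 - D2 v w x\<bar> < e" if "e > 0" for e v w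
  proof -
    have "isCont (D2 v w) x"
      using smooth_on_continuous[OF sm2] assms continuous_on_eq_continuous_at by blast
    then obtain d0 where d0: "d0 > 0" "\<And>y. dist y x < d0 \<Longrightarrow> \<bar>D2 v w y - D2 v w x\<bar> < e"
      unfolding continuous_at_eps_delta using \<open>e > 0\<close> by (metis dist_real_def)
    obtain d1 where d1: "d1 > 0" "ball x d1 \<subseteq> S" using assms open_contains_ball by blast
    define d where "d = min d0 d1"
    \<comment> \<open>With this bound the whole parallelogram with sides
      \<open>t *\<^sub>R v\<close> and \<open>t *\<^sub>R w\<close> stays in the ball of radius
      \<open>d\<close>; the \<open>+ 1\<close> keeps the denominator positive when both vectors
      vanish.\<close>
    define \<delta> where "\<delta> = d / (norm v + norm w + 1)"
    have "\<delta> > 0" using d0 d1 by (simp add: \<delta>_def d_def add_nonneg_pos)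
    have near: "x + a *\<^sub>R v + b *\<^sub>R w \<in> ball x d" if "0 \<le> a" "a \<le> t" "0 \<le> b" "b \<le> t" "t < \<delta>" for a b t
    proof -
      have "norm (a *\<^sub>R v + b *\<^sub>R w) \<le> a * norm v + b * norm w"
        using norm_triangle_ineq[of "a *\<^sub>R v" "b *\<^sub>R w"] that by simp
      also have "\<dots> \<le> t * norm v + t * norm w" using that by (intro add_mono mult_right_mono) auto
      also have "\<dots> \<le> t * (norm v + norm w + 1)" using that by (simp add: algebra_simps)
      also have "\<dots> < d" using that(5) by (simp add: \<delta>_def pos_less_divide_eq add_nonneg_pos)
      finally show ?thesis by (simp only: mem_ball dist_norm add.assoc norm_minus_commute[of x] add_diff_cancel_left')
    qed
    have nearS: "x + a *\<^sub>R v + b *\<^sub>R w \<in> S" if "0 \<le> a" "a \<le> t" "0 \<le> b" "b \<le> t" "t < \<delta>" for a b t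
      using near[OF that] d1 unfolding d_def by auto
    have "\<bar>h v w t / t\<^sup>2 - D2 v w x\<bar> < e" if t: "0 < t" "t < \<delta>" for t
    proof -
      have fd: "(f has_derivative frechet_derivative f (at y)) (at y)" if "y \<in> S" for y
        using assms(2) that smooth_on_has_derivative by blast
      have fd2: "((\<lambda>y. frechet_derivative f (at y) v) has_derivative
          (\<lambda>w. D2 v w y)) (at y)" if "y \<in> S" for y
        using smooth_on_has_derivative[OF smooth_on_frechet_derivative[OF assms(2)] that]
        unfolding D2_def .
      \<comment> \<open>The mean value theorem is applied to the difference of two opposite sides,
        not to each side, so that one and the same \<open>s\<close> serves both and a second
        application in the direction \<open>w\<close> is possible.\<close>
      define p where "p s = f (x + s *\<^sub>R v + t *\<^sub>R w) - f (x + s *\<^sub>R v)" for s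
      have "\<exists>s. s \<in> {0..t} \<and> p t - p 0 = (\<lambda>s a. a * (frechet_derivative f (at (x + s *\<^sub>R v + t *\<^sub>R w)) v
           - frechet_derivative f (at (x + s *\<^sub>R v)) v)) s (t - 0)"
      proof (rule bexE[OF mvt_very_simple[of 0 t p]])
        fix s assume s: "0 \<le> s" "s \<le> t"
        have S1: "x + s *\<^sub>R v + t *\<^sub>R w \<in> S" "x + s *\<^sub>R v \<in> S"
          using nearS[of s t t] nearS[of s t 0] s t by auto
        have "(p has_derivative (\<lambda>a. frechet_derivative f (at (x + s *\<^sub>R v + t *\<^sub>R w)) (a *\<^sub>R v)
             - frechet_derivative f (at (x + s *\<^sub>R v)) (a *\<^sub>R v))) (at s)"
          unfolding p_def
          by (rule has_derivative_diff; rule has_derivative_compose[OF _ fd])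
            (auto intro!: derivative_eq_intros S1)
        then show "(p has_derivative (\<lambda>a. a * (frechet_derivative f (at (x + s *\<^sub>R v + t *\<^sub>R w)) v
             - frechet_derivative f (at (x + s *\<^sub>R v)) v))) (at s within {0..t})"
          using S1 smooth_on_linear_derivative[OF assms(2)]
          by (simp add: linear_scale right_diff_distrib has_derivative_at_withinI)
      qed (use t in auto)
      then obtain s where s: "0 \<le> s" "s \<le> t" "h v w t = t * (frechet_derivative f (at (x + s *\<^sub>R v + t *\<^sub>R w)) v
           - frechet_derivative f (at (x + s *\<^sub>R v)) v)"
        by (auto simp: h_def p_def algebra_simps)
      define q where "q r = frechet_derivative f (at (x + s *\<^sub>R v + r *\<^sub>R w)) v" for r
      have "\<exists>r. r \<in> {0..t} \<and> q t - q 0 = (\<lambda>r a. a * D2 v w (x + s *\<^sub>R v + r *\<^sub>R w)) r (t - 0)"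
      proof (rule bexE[OF mvt_very_simple[of 0 t q]])
        fix r assume r: "0 \<le> r" "r \<le> t"
        have S1: "x + s *\<^sub>R v + r *\<^sub>R w \<in> S" using nearS[of s t r] r s t by auto
        have lin: "linear (\<lambda>w. D2 v w (x + s *\<^sub>R v + r *\<^sub>R w'))" if "x + s *\<^sub>R v + r *\<^sub>R w' \<in> S" for w'
          using fd2[OF that] has_derivative_linear by blast
        have "(q has_derivative (\<lambda>a. D2 v (a *\<^sub>R w) (x + s *\<^sub>R v + r *\<^sub>R w))) (at r)"
          unfolding q_def
          by (rule has_derivative_compose[where g = "\<lambda>y. frechet_derivative f (at y) v"
                and f = "\<lambda>r. x + s *\<^sub>R v + r *\<^sub>R w", OF _ fd2[OF S1]])
            (auto intro!: derivative_eq_intros)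
        then show "(q has_derivative (\<lambda>a. a * D2 v w (x + s *\<^sub>R v + r *\<^sub>R w))) (at r within {0..t})"
          using linear_scale[OF lin[OF S1]] by (simp add: has_derivative_at_withinI)
      qed (use t in auto)
      then obtain r where r: "0 \<le> r" "r \<le> t" "q t - q 0 = t * D2 v w (x + s *\<^sub>R v + r *\<^sub>R w)" by auto
      have "h v w t = t\<^sup>2 * D2 v w (x + s *\<^sub>R v + r *\<^sub>R w)"
        using s(3) r(3) by (simp add: q_def power2_eq_square)
      moreover have "dist (x + s *\<^sub>R v + r *\<^sub>R w) x < d0"
        using near[of s t r] s r t by (auto simp: d_def dist_commute)
      ultimately show ?thesis using d0(2) t by simp
    qed
    with \<open>\<delta> > 0\<close> show ?thesis by blast
  qed
  have "D2 v w x = D2 w v x"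
  proof (rule ccontr)
    assume ne: "D2 v w x \<noteq> D2 w v x"
    \<comment> \<open>Half of the supposed gap: the same quotient cannot be closer than
      \<open>e\<close> to both second derivatives.\<close>
    define e where "e = \<bar>D2 v w x - D2 w v x\<bar> / 2"
    have "e > 0" using ne by (simp add: e_def)
    from key[OF this, of v w] key[OF this, of w v] obtain a b where ab: "a > 0" "b > 0"
      "\<And>t. 0 < t \<Longrightarrow> t < a \<Longrightarrow> \<bar>h v w t / t\<^sup>2 - D2 v w x\<bar> < e"
      "\<And>t. 0 < t \<Longrightarrow> t < b \<Longrightarrow> \<bar>h w v t / t\<^sup>2 - D2 w v x\<bar> < e" by metis
    define t where "t = min a b / 2"
    have "\<bar>h v w t / t\<^sup>2 - D2 v w x\<bar> < e" "\<bar>h v w t / t\<^sup>2 - D2 w v x\<bar> < e"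
      using ab(3)[of t] ab(4)[of t] ab(1,2) swap[of v w t] by (simp_all add: t_def min_def split: if_splits)
    then show False unfolding e_def by (smt (verit) field_sum_of_halves)
  qed
  then show ?thesis by (simp add: D2_def)
qed

lemma second_derivative_symmetric:
  fixes f :: "'a::euclidean_space \<Rightarrow> 'b::euclidean_space"
  assumes "open S" "smooth_on f S" "x \<in> S"
  shows "frechet_derivative (\<lambda>y. frechet_derivative f (at y) v) (at x) w =
         frechet_derivative (\<lambda>y. frechet_derivative f (at y) w) (at x) v"
proof (rule euclidean_eqI)
  fix b :: 'b
  have D: "frechet_derivative (\<lambda>y. f y \<bullet> b) (at y) v = frechet_derivative f (at y) v \<bullet> b" if "y \<in> S" for y v
    by (subst frechet_derivative_eqI[where f = "\<lambda>y. f y \<bullet> b"])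
      (auto intro: has_derivative_inner_left smooth_on_has_derivative[OF assms(2) that])
  have D2: "frechet_derivative (\<lambda>y. frechet_derivative (\<lambda>y. f y \<bullet> b) (at y) v) (at x) w =
        frechet_derivative (\<lambda>y. frechet_derivative f (at y) v) (at x) w \<bullet> b" for v w
  proof -
    have "frechet_derivative (\<lambda>y. frechet_derivative (\<lambda>y. f y \<bullet> b) (at y) v) (at x) =
      frechet_derivative (\<lambda>y. frechet_derivative f (at y) v \<bullet> b) (at x)"
      by (rule frechet_derivative_cong_open[OF assms(1,3)]) (rule D)
    also have "\<dots> = (\<lambda>w. frechet_derivative (\<lambda>y. frechet_derivative f (at y) v) (at x) w \<bullet> b)"
      by (intro frechet_derivative_eqI has_derivative_inner_left
          smooth_on_has_derivative[OF smooth_on_frechet_derivative[OF assms(2)] assms(3)])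
    finally show ?thesis by simp
  qed
  have "smooth_on (\<lambda>y. f y \<bullet> b) S" by (intro smooth_on_inner assms smooth_on_const)
  from second_derivative_symmetric_real[OF assms(1) this assms(3), of v w]
  show "frechet_derivative (\<lambda>y. frechet_derivative f (at y) v) (at x) w \<bullet> b =
        frechet_derivative (\<lambda>y. frechet_derivative f (at y) w) (at x) v \<bullet> b" by (simp add: D2)
qed

text \<open>Pointwise continuity gives continuity in operator norm because the dimension is finite:
  each of the \<open>DIM('b)\<close> basis vectors contributes at most the share
  \<open>e'\<close>.\<close>

lemma linear_family_small:
  fixes M :: "'a::euclidean_space \<Rightarrow> 'b::euclidean_space \<Rightarrow> 'c::real_normed_vector"
  assumes "open S" "x \<in> S" "\<And>y. y \<in> S \<Longrightarrow> linear (M y)" "\<And>u. continuous_on S (\<lambda>y. M y u)" "e > 0"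
  shows "\<forall>\<^sub>F y in at x. \<forall>u. norm (M y u - M x u) \<le> e * norm u"
proof -
  define e' where "e' = e / DIM('b)"
  have "e' > 0" using assms(5) by (simp add: e'_def)
  have "\<forall>\<^sub>F y in at x. norm (M y b - M x b) < e'" for b
  proof -
    have "isCont (\<lambda>y. M y b) x" using assms continuous_on_eq_continuous_at by blast
    then have "((\<lambda>y. M y b) \<longlongrightarrow> M x b) (at x)" by (simp add: isCont_def)
    from tendstoD[OF this \<open>e' > 0\<close>] show ?thesis by (simp add: dist_norm)
  qed
  then have "\<forall>\<^sub>F y in at x. \<forall>b\<in>Basis. norm (M y b - M x b) < e'"
    by (intro eventually_ball_finite) auto
  moreover have "\<forall>\<^sub>F y in at x. y \<in> S" using assms(1,2) by (rule eventually_at_in_open')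
  ultimately show ?thesis
  proof eventually_elim
    case (elim y)
    show ?case
    proof
      fix u
      have "M y u - M x u = (\<Sum>b\<in>Basis. (u \<bullet> b) *\<^sub>R (M y b - M x b))"
        using elim assms by (simp add: linear_basis_expand[of "M _" u] scaleR_diff_right sum_subtractf)
      also have "norm \<dots> \<le> (\<Sum>b\<in>(Basis :: 'b set). norm u * e')"
      proof (rule sum_norm_le)
        fix b :: 'b assume b: "b \<in> Basis"
        have "\<bar>u \<bullet> b\<bar> * norm (M y b - M x b) \<le> norm u * e'"
          using elim(1) b by (intro mult_mono) (auto intro: Basis_le_norm less_imp_le)
        then show "norm ((u \<bullet> b) *\<^sub>R (M y b - M x b)) \<le> norm u * e'" by simp
      qed
      finally show "norm (M y u - M x u) \<le> e * norm u" by (simp add: e'_def mult.commute)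
    qed
  qed
qed

text \<open>\<open>N\<close> inverts \<open>M\<close> at the single point \<open>x\<close>, and the
  equation becomes \<open>X y = N (a y) - N (M y (X y) - M x (X y))\<close>, whose last term is a
  small perturbation near \<open>x\<close>. This yields first a bound for \<open>X\<close>, then
  continuity, then differentiability.\<close>

lemma solve_regularity:
  fixes M :: "'a::euclidean_space \<Rightarrow> 'b::euclidean_space \<Rightarrow> 'b"
  assumes S: "open S" "x \<in> S" and lin: "\<And>y. y \<in> S \<Longrightarrow> linear (M y)"
    and inj: "\<And>u. M x u = 0 \<Longrightarrow> u = 0"
    and smM: "\<And>u. smooth_on (\<lambda>y. M y u) S" and "isCont a x"
    and sol: "\<And>y. y \<in> S \<Longrightarrow> M y (X y) = a y"
  shows "isCont X x \<and> (a differentiable (at x) \<longrightarrow> X differentiable (at x))"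
proof -
  have "inj (M x)" using inj lin[OF S(2)] linear_injective_0 by blast
  then obtain N where N: "linear N" "\<And>u. N (M x u) = u"
    using linear_injective_left_inverse[OF lin[OF S(2)]] by (metis comp_apply id_apply)
  have "surj (M x)" using \<open>inj (M x)\<close> lin[OF S(2)] linear_injective_imp_surjective by blast
  then have N2: "M x (N u) = u" for u using N(2) by (metis surjD)
  interpret N: bounded_linear N using N(1) linear_conv_bounded_linear by blast
  obtain K where K: "K > 0" "\<And>u. norm (N u) \<le> norm u * K" using N.pos_bounded by blast
  have cM: "continuous_on S (\<lambda>y. M y u)" for u using smM smooth_on_continuous by blast
  have XN: "X y = N (a y) - N (M y (X y) - M x (X y))" if "y \<in> S" for y
    using that by (simp add: N.diff N(2) sol)
  have evS: "\<forall>\<^sub>F y in at x. y \<in> S" using S eventually_at_in_open' by blast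
  have small: "\<forall>\<^sub>F y in at x. \<forall>u. norm (M y u - M x u) \<le> e * norm u" if "e > 0" for e
    using linear_family_small[of S x M e] S lin cM that by blast
  \<comment> \<open>An error of this relative size, amplified by \<open>K\<close> at most, is half
    of \<open>norm (X y)\<close> and can be absorbed on the left.\<close>
  have half: "1 / (2 * K) > 0" using K(1) by simp
  have ev_le: "\<forall>\<^sub>F y in at x. norm (X y) \<le> 2 * K * norm (a y)"
    using small[OF half] evS
  proof eventually_elim
    case (elim y)
    then have y: "y \<in> S" "\<forall>u. norm (M y u - M x u) \<le> norm u / (2 * K)" by auto
    have "norm (X y) \<le> norm (N (a y)) + norm (N (M y (X y) - M x (X y)))"
      using norm_triangle_ineq4 XN[OF y(1)] by metis
    also have "\<dots> \<le> norm (a y) * K + norm (X y) / (2 * K) * K"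
      using y(2)[rule_format, of "X y"] K
      by (intro add_mono order_trans[OF K(2)] mult_right_mono) auto
    finally show "norm (X y) \<le> 2 * K * norm (a y)" using K(1) by (simp add: field_simps)
  qed
  have ca: "(a \<longlongrightarrow> a x) (at x)"
    using \<open>isCont a x\<close> by (simp add: isCont_def)
  define C where "C = 2 * K * (norm (a x) + 1)"
  have bnd: "\<forall>\<^sub>F y in at x. norm (X y) \<le> C"
    using ev_le tendstoD[OF ca zero_less_one]
  proof eventually_elim
    case (elim y)
    moreover have "norm (a y) \<le> norm (a x) + dist (a y) (a x)"
      by (metis add.commute dist_norm norm_triangle_sub)
    ultimately have "norm (X y) \<le> 2 * K * norm (a y)" "norm (a y) \<le> norm (a x) + 1" by auto
    then show "norm (X y) \<le> C" unfolding C_def using K(1)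
      by (smt (verit) mult_left_mono)
  qed
  have "C > 0" using K by (simp add: C_def add_nonneg_pos)
  have Xdiff: "X y - X x = N (a y - a x) - N (M y (X y) - M x (X y))" if "y \<in> S" for y
    using XN[OF that] XN[OF S(2)] by (simp add: N.diff)
  have cX: "(X \<longlongrightarrow> X x) (at x)"
  proof (rule tendstoI)
    fix e :: real assume "e > 0"
    define e1 where "e1 = e / (2 * K)"
    define e2 where "e2 = e / (3 * K * C)"
    have "e1 > 0" "e2 > 0" using \<open>e > 0\<close> K \<open>C > 0\<close> by (auto simp: e1_def e2_def)
    show "\<forall>\<^sub>F y in at x. dist (X y) (X x) < e"
      using small[OF \<open>e2 > 0\<close>] tendstoD[OF ca \<open>e1 > 0\<close>] bnd evS
    proof eventually_elim
      case (elim y)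
      have "dist (X y) (X x) \<le> norm (N (a y - a x)) + norm (N (M y (X y) - M x (X y)))"
        using Xdiff elim norm_triangle_ineq4 by (metis dist_norm)
      also have "\<dots> \<le> dist (a y) (a x) * K + (e2 * C) * K"
        using elim(1) elim(3) K \<open>e2 > 0\<close>
        by (intro add_mono order_trans[OF K(2)] mult_right_mono order_trans[OF elim(1)[rule_format]])
          (auto simp: dist_norm mult_left_mono)
      also have "\<dots> < e1 * K + (e2 * C) * K" using elim K by simp
      also have "\<dots> = e / 2 + e / 3" using K \<open>C > 0\<close> by (simp add: e1_def e2_def)
      also have "\<dots> < e" using \<open>e > 0\<close> by simp
      finally show ?case .
    qed
  qed
  \<comment> \<open>A factor that is only continuous at \<open>x\<close>, times a factor that is
    differentiable and vanishes at \<open>x\<close>, is differentiable at \<open>x\<close>. So the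
    continuity of \<open>X\<close> just proved is enough.\<close>
  have coef: "((\<lambda>y. (X y \<bullet> b) *\<^sub>R (M y b - M x b)) has_derivative
      (\<lambda>v. (X x \<bullet> b) *\<^sub>R frechet_derivative (\<lambda>y. M y b) (at x) v)) (at x)" for b
  proof -
    define F where "F = frechet_derivative (\<lambda>y. M y b) (at x)"
    have F: "((\<lambda>y. M y b - M x b) has_derivative F) (at x)"
      using has_derivative_diff[OF smooth_on_has_derivative[OF smM S(2)] has_derivative_const]
      by (simp add: F_def)
    have blF: "bounded_linear F" using F has_derivative_bounded_linear by blast
    have lim: "((\<lambda>y. (X y \<bullet> b) *\<^sub>R ((1 / norm (y - x)) *\<^sub>R (M y b - M x b - F (y - x))) +
        ((X y - X x) \<bullet> b) *\<^sub>R ((1 / norm (y - x)) *\<^sub>R F (y - x))) \<longlongrightarrow> (X x \<bullet> b) *\<^sub>R 0 + 0) (at x)"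
    proof (intro tendsto_add tendsto_scaleR tendsto_inner cX tendsto_const)
      show "((\<lambda>y. (1 / norm (y - x)) *\<^sub>R (M y b - M x b - F (y - x))) \<longlongrightarrow> 0) (at x)"
        using F unfolding has_derivative_at2 by (simp add: inverse_eq_divide)
      obtain L where L: "\<And>u. norm (F u) \<le> norm u * L" using bounded_linear.bounded[OF blF] by blast
      have "((\<lambda>y. (X y - X x) \<bullet> b) \<longlongrightarrow> (X x - X x) \<bullet> b) (at x)"
        by (intro tendsto_inner tendsto_diff cX tendsto_const)
      then have l0: "((\<lambda>y. (X y - X x) \<bullet> b) \<longlongrightarrow> 0) (at x)" by simp
      show "((\<lambda>y. ((X y - X x) \<bullet> b) *\<^sub>R ((1 / norm (y - x)) *\<^sub>R F (y - x))) \<longlongrightarrow> 0) (at x)"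
      proof (rule tendsto_0_le[OF l0, where K = "\<bar>L\<bar>"], intro always_eventually allI)
        fix y
        have "norm ((1 / norm (y - x)) *\<^sub>R F (y - x)) \<le> \<bar>L\<bar>"
        proof (cases "y = x")
          case False
          have "norm (F (y - x)) \<le> \<bar>L\<bar> * norm (y - x)"
            using L[of "y - x"] by (smt (verit) mult.commute mult_right_mono norm_ge_zero)
          then show ?thesis using False by (simp add: divide_le_eq)
        qed (use linear_0[OF bounded_linear.linear[OF blF]] in simp)
        then show "norm (((X y - X x) \<bullet> b) *\<^sub>R ((1 / norm (y - x)) *\<^sub>R F (y - x))) \<le> norm ((X y - X x) \<bullet> b) * \<bar>L\<bar>"
          by (subst norm_scaleR) (simp only: real_norm_def mult_left_mono abs_ge_zero)
      qed
    qed
    have eq: "(X y \<bullet> b) *\<^sub>R ((1 / norm (y - x)) *\<^sub>R (M y b - M x b - F (y - x))) +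
          ((X y - X x) \<bullet> b) *\<^sub>R ((1 / norm (y - x)) *\<^sub>R F (y - x)) =
        (1 / norm (y - x)) *\<^sub>R ((X y \<bullet> b) *\<^sub>R (M y b - M x b) -
          ((X x \<bullet> b) *\<^sub>R (M x b - M x b) + (X x \<bullet> b) *\<^sub>R F (y - x)))" for y
      by (simp add: scaleR_diff_right inner_diff_left scaleR_diff_left diff_divide_distrib mult.commute)
    have "bounded_linear (\<lambda>v. (X x \<bullet> b) *\<^sub>R F v)"
      by (rule bounded_linear_const_scaleR[OF blF])
    then show ?thesis unfolding F_def[symmetric] has_derivative_at2
      using lim unfolding eq by simp
  qed
  have "X differentiable (at x)" if "a differentiable (at x)"
  proof -
    have "((\<lambda>y. N (a y) - N (\<Sum>b\<in>Basis. (X y \<bullet> b) *\<^sub>R (M y b - M x b))) has_derivative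
       (\<lambda>v. N (frechet_derivative a (at x) v) -
          N (\<Sum>b\<in>Basis. (X x \<bullet> b) *\<^sub>R frechet_derivative (\<lambda>y. M y b) (at x) v))) (at x)"
      by (intro has_derivative_diff N.has_derivative has_derivative_sum coef
          that[unfolded frechet_derivative_works])
    then have "(X has_derivative
       (\<lambda>v. N (frechet_derivative a (at x) v) -
          N (\<Sum>b\<in>Basis. (X x \<bullet> b) *\<^sub>R frechet_derivative (\<lambda>y. M y b) (at x) v))) (at x)"
    proof (rule has_derivative_transform_within_open[OF _ S])
      fix y assume y: "y \<in> S"
      show "N (a y) - N (\<Sum>b\<in>Basis. (X y \<bullet> b) *\<^sub>R (M y b - M x b)) = X y"
        using XN[OF y] linear_basis_expand[OF lin[OF y], of "X y"] linear_basis_expand[OF lin[OF S(2)], of "X y"]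
        by (simp add: scaleR_diff_right sum_subtractf)
    qed
    then show ?thesis by (auto simp: differentiable_def)
  qed
  with cX show ?thesis by (simp add: isCont_def)
qed

text \<open>Bootstrapping: a directional derivative of \<open>X\<close> solves a system with the
  same \<open>M\<close>, and its right-hand side, the derivative of \<open>a\<close> minus
  \<open>M' y (X y)\<close>, is as smooth as the induction hypothesis requires. Hence the induction
  runs over all \<open>a\<close> and \<open>X\<close> at once.\<close>

lemma smooth_on_solve:
  fixes M :: "'a::euclidean_space \<Rightarrow> 'b::euclidean_space \<Rightarrow> 'b"
  assumes S: "open S" and lin: "\<And>y. y \<in> S \<Longrightarrow> linear (M y)"
    and inj: "\<And>y u. y \<in> S \<Longrightarrow> M y u = 0 \<Longrightarrow> u = 0"
    and smM: "\<And>u. smooth_on (\<lambda>y. M y u) S" and sma: "smooth_on a S"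
    and sol: "\<And>y. y \<in> S \<Longrightarrow> M y (X y) = a y"
  shows "smooth_on X S"
proof -
  have comp: "Ck_on k (\<lambda>y. M y (X y)) S" if "Ck_on k X S" and M: "\<And>y. y \<in> S \<Longrightarrow> linear (M y)"
     "\<And>u. smooth_on (\<lambda>y. M y u) S"  for k X and M :: "'a \<Rightarrow> 'b \<Rightarrow> 'b"
  proof (rule Ck_on_cong[OF S])
    have "Ck_on k (\<lambda>x. X x \<bullet> b) S" for b
      by (rule Ck_on_prod[OF S bounded_bilinear_inner that(1) Ck_on_const])
    then have "Ck_on k (\<lambda>x. (X x \<bullet> b) *\<^sub>R M x b) S" for b
      using Ck_on_prod[OF S bounded_bilinear_scaleR, of k "\<lambda>x. X x \<bullet> b" "\<lambda>x. M x b"] M(2)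
      unfolding smooth_on_def by blast
    moreover have "Ck_on k (\<lambda>x. \<Sum>i\<in>I. f i x) S" if "\<And>i. Ck_on k (f i) S" for f :: "'b \<Rightarrow> 'a \<Rightarrow> 'b" and I
      using that by (induction I rule: infinite_finite_induct) (auto intro: Ck_on_const Ck_on_add[OF S])
    note this[of "\<lambda>b x. (X x \<bullet> b) *\<^sub>R M x b" Basis]
    ultimately show "Ck_on k (\<lambda>x. \<Sum>b\<in>Basis. (X x \<bullet> b) *\<^sub>R M x b) S" by simp
  qed (simp add: linear_basis_expand[OF M(1)])
  have reg: "isCont X x \<and> (a differentiable (at x) \<longrightarrow> X differentiable (at x))"
    if "x \<in> S" "isCont a x" "\<And>y. y \<in> S \<Longrightarrow> M y (X y) = a y" for X a x
    using solve_regularity[of S x M a X] S lin inj smM that by blast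
  have "Ck_on k X S" if "Ck_on k a S" "\<And>y. y \<in> S \<Longrightarrow> M y (X y) = a y" for k X a
    using that
  proof (induction k arbitrary: a X)
    case 0
    then have "isCont a y" if "y \<in> S" for y using that S continuous_on_eq_continuous_at by auto
    then have "isCont X y" if "y \<in> S" for y
      using reg[OF that _ 0(2)] that by blast
    then show ?case by (simp add: continuous_at_imp_continuous_on)
  next
    case (Suc k)
    have D: "X differentiable (at y)" if "y \<in> S" for y
    proof -
      have "a differentiable (at y)" using Suc.prems(1) that by simp
      moreover from this have "isCont a y" by (rule differentiable_imp_continuous_within)
      ultimately show ?thesis
        using reg[OF that _ Suc.prems(2)] by blast
    qed
    have "Ck_on k (\<lambda>y. frechet_derivative X (at y) v) S" for v
    proof -
      define M' where "M' y u = frechet_derivative (\<lambda>y. M y u) (at y) v" for y u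
      have M': "linear (M' y)" if "y \<in> S" for y
        unfolding M'_def[abs_def]
        by (rule linear_family_derivative[OF S that lin smooth_on_differentiable[OF smM that]])
      have M'2: "smooth_on (\<lambda>y. M' y u) S" for u
        unfolding M'_def by (rule smooth_on_frechet_derivative[OF smM])
      have "Ck_on k X S" by (rule Suc.IH[OF Ck_on_SucD[OF Suc.prems(1)] Suc.prems(2)])
      then have "Ck_on k (\<lambda>y. M' y (X y)) S" using comp M' M'2 by blast
      then have "Ck_on k (\<lambda>y. (-1::real) *\<^sub>R M' y (X y)) S"
        using Ck_on_prod[OF S bounded_bilinear_scaleR Ck_on_const] by blast
      then have "Ck_on k (\<lambda>y. frechet_derivative a (at y) v + (-1) *\<^sub>R M' y (X y)) S"
        using Suc.prems(1) by (intro Ck_on_add[OF S]) auto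
      then show ?thesis
      proof (rule Suc.IH)
        fix y assume y: "y \<in> S"
        have "((\<lambda>y. M y (X y)) has_derivative
           (\<lambda>v. frechet_derivative (\<lambda>z. M z (X y)) (at y) v + M y (frechet_derivative X (at y) v))) (at y)"
          using D[OF y] frechet_derivative_works
          by (intro has_derivative_apply[OF S y lin] smooth_on_has_derivative[OF smM y]) auto
        then have "(a has_derivative
           (\<lambda>v. frechet_derivative (\<lambda>z. M z (X y)) (at y) v + M y (frechet_derivative X (at y) v))) (at y)"
          by (rule has_derivative_transform_within_open[OF _ S y]) (rule Suc.prems(2))
        from frechet_derivative_eqI[OF this]
        show "M y (frechet_derivative X (at y) v) = frechet_derivative a (at y) v + (-1) *\<^sub>R M' y (X y)"
          by (simp add: M'_def)
      qed
    qed
    with D show ?case by simp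
  qed
  then show ?thesis using sma sol unfolding smooth_on_def by blast
qed

section \<open>Linear algebra of a quaternionic Hermitian space\<close>

text \<open>The metric of a manifold varies with the point, so it is a parameter here; the inner
  product of the type \<open>'e\<close> only supplies coordinates.\<close>

locale metric_form =
  fixes G :: "'e::euclidean_space \<Rightarrow> 'e \<Rightarrow> real"
  assumes bilinear_G: "bilinear G"
    and G_sym: "G u v = G v u"
    and G_pos: "u \<noteq> 0 \<Longrightarrow> G u u > 0"
begin

lemmas G_lin = bilinear_ladd[OF bilinear_G] bilinear_radd[OF bilinear_G]
  bilinear_lsub[OF bilinear_G] bilinear_rsub[OF bilinear_G]
  bilinear_lneg[OF bilinear_G] bilinear_rneg[OF bilinear_G]
  bilinear_lmul[OF bilinear_G] bilinear_rmul[OF bilinear_G]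
  bilinear_lzero[OF bilinear_G] bilinear_rzero[OF bilinear_G]

lemma G_linear: "linear (\<lambda>u. G u v)" "linear (G u)"
  using bilinear_G by (auto simp: bilinear_def)

lemma G_sum_left: "G (\<Sum>i\<in>I. f i) v = (\<Sum>i\<in>I. G (f i) v)"
  using linear_sum[OF G_linear(1)] by simp

lemma G_eqI: "(\<And>v. G u v = G w v) \<Longrightarrow> u = w"
  using G_pos[of "u - w"] by (fastforce simp: G_lin)

definition frame :: "'e set \<Rightarrow> bool" where
  "frame B \<longleftrightarrow> finite B \<and> card B = DIM('e) \<and> (\<forall>e\<in>B. \<forall>f\<in>B. G e f = (if e = f then 1 else 0))"

lemma orthonormal_independent:
  assumes "finite B" "\<And>e f. e \<in> B \<Longrightarrow> f \<in> B \<Longrightarrow> G e f = (if e = f then 1 else 0)"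
  shows "independent B"
proof -
  have "r f = 0" if "(\<Sum>e\<in>B. r e *\<^sub>R e) = 0" "f \<in> B" for r f
  proof -
    have "0 = G (\<Sum>e\<in>B. r e *\<^sub>R e) f" using that by (simp add: G_lin)
    also have "\<dots> = (\<Sum>e\<in>B. if e = f then r e else 0)"
      unfolding G_sum_left using assms(2) that by (intro sum.cong) (auto simp: G_lin)
    finally show ?thesis using that assms(1) by simp
  qed
  then show ?thesis using assms(1) by (subst independent_explicit) blast
qed

text \<open>One step of the Gram-Schmidt process.\<close>

lemma orthonormal_extend:
  assumes "finite B" "\<And>e f. e \<in> B \<Longrightarrow> f \<in> B \<Longrightarrow> G e f = (if e = f then 1 else 0)" "card B < DIM('e)"
  shows "\<exists>v. v \<notin> B \<and> (\<forall>e\<in>insert v B. \<forall>f\<in>insert v B. G e f = (if e = f then 1 else 0))"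
proof -
  have "span B \<noteq> UNIV"
    using assms(1,3) by (metis dim_UNIV dim_le_card linorder_not_le span_superset top_greatest)
  then obtain u where u: "u \<notin> span B" by auto
  define w where "w = u - (\<Sum>e\<in>B. G u e *\<^sub>R e)"
  have "(\<Sum>e\<in>B. G u e *\<^sub>R e) \<in> span B" by (intro span_sum span_scale span_base)
  then have "w \<noteq> 0" using u by (auto simp: w_def)
  then have pw: "G w w > 0" by (rule G_pos)
  have ort: "G w f = 0" if "f \<in> B" for f
  proof -
    have "G (\<Sum>e\<in>B. G u e *\<^sub>R e) f = (\<Sum>e\<in>B. if e = f then G u e else 0)"
      unfolding G_sum_left using assms(2) that by (intro sum.cong) (auto simp: G_lin)
    then show ?thesis using that assms(1) by (simp add: w_def G_lin)
  qed
  define v where "v = (1 / sqrt (G w w)) *\<^sub>R w"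
  have "G v v = 1" using pw by (simp add: v_def G_lin flip: power2_eq_square)
  moreover have "G v f = 0" "G f v = 0" if "f \<in> B" for f
    using ort[OF that] G_sym[of f v] by (auto simp: v_def G_lin)
  moreover have "v \<notin> B" using \<open>G v v = 1\<close> ort[of v] by (auto simp: v_def G_lin)
  ultimately show ?thesis using assms(2) by (intro exI[of _ v]) auto
qed

lemma frame_exists: "\<exists>B. frame B"
proof -
  have "\<exists>B. finite B \<and> card B = k \<and> (\<forall>e\<in>B. \<forall>f\<in>B. G e f = (if e = f then 1 else 0))" if "k \<le> DIM('e)" for k
    using that
  proof (induction k)
    case (Suc k)
    then obtain B where "finite B" "card B = k" "\<forall>e\<in>B. \<forall>f\<in>B. G e f = (if e = f then 1 else 0)" by auto
    moreover from this obtain v where "v \<notin> B" "\<forall>e\<in>insert v B. \<forall>f\<in>insert v B. G e f = (if e = f then 1 else 0)"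
      using orthonormal_extend[of B] Suc.prems by auto
    ultimately show ?case by (intro exI[of _ "insert v B"]) auto
  qed auto
  from this[of "DIM('e)"] show ?thesis by (auto simp: frame_def)
qed

lemma frame_expand:
  assumes "frame B"
  shows "(\<Sum>e\<in>B. G u e *\<^sub>R e) = u"
proof (rule ccontr)
  have B: "finite B" "\<And>e f. e \<in> B \<Longrightarrow> f \<in> B \<Longrightarrow> G e f = (if e = f then 1 else 0)" "card B = DIM('e)"
    using assms by (auto simp: frame_def)
  have "independent B" using orthonormal_independent[OF B(1,2)] .
  then have "span B = UNIV" using B by (metis dim_UNIV card_eq_dim subset_UNIV top.extremum_uniqueI)
  assume ne: "\<not> ?thesis"
  define w where "w = u - (\<Sum>e\<in>B. G u e *\<^sub>R e)"
  have ort: "G w f = 0" if "f \<in> B" for f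
  proof -
    have "G (\<Sum>e\<in>B. G u e *\<^sub>R e) f = (\<Sum>e\<in>B. if e = f then G u e else 0)"
      unfolding G_sum_left using B(2) that by (intro sum.cong) (auto simp: G_lin)
    then show ?thesis using that B(1) by (simp add: w_def G_lin)
  qed
  have "G w x = 0" if "x \<in> span B" for x
    using that by (induction rule: span_induct_alt) (auto simp: G_lin ort)
  then have "G w w = 0" using \<open>span B = UNIV\<close> by simp
  then show False using G_pos[of w] ne by (auto simp: w_def)
qed

lemma frame_linear:
  assumes "frame B" "linear f"
  shows "(\<Sum>e\<in>B. G u e *\<^sub>R f e) = f u"
  using linear_sum[OF assms(2), of "\<lambda>e. G u e *\<^sub>R e" B] linear_scale[OF assms(2)]
  by (simp add: frame_expand[OF assms(1)])

lemma frame_linear_real: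
  fixes f :: "'e \<Rightarrow> real"
  assumes "frame B" "linear f"
  shows "(\<Sum>e\<in>B. f e * G e u) = f u"
proof -
  have "f e * G e u = G u e *\<^sub>R f e" for e by (simp add: G_sym[of e u])
  then show ?thesis by (simp only: frame_linear[OF assms])
qed

lemma frame_dim_real: "frame B \<Longrightarrow> (\<Sum>e\<in>B. G e e) = real DIM('e)"
  by (simp add: frame_def)

lemma riesz: "linear \<alpha> \<Longrightarrow> \<exists>!w. \<forall>v. G w v = \<alpha> v"
proof (rule ex_ex1I)
  assume "linear \<alpha>"
  obtain B where B: "frame B" using frame_exists by blast
  have "G (\<Sum>e\<in>B. \<alpha> e *\<^sub>R e) v = \<alpha> v" for v
    using frame_linear_real[OF B \<open>linear \<alpha>\<close>] by (simp add: G_sum_left G_lin)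
  then show "\<exists>w. \<forall>v. G w v = \<alpha> v" by blast
qed (metis G_eqI)

text \<open>Later uses all have a skew \<open>S\<close>, with adjoint \<open>- S\<close>: rotations
  of the frame by a \<open>J\<close>, and rearrangements of contractions of the curvature.\<close>

lemma frame_adjoint:
  assumes B: "frame B" and h: "bilinear h" and ST: "\<And>u v. G (S u) v = G u (T v)"
  shows "(\<Sum>e\<in>B. h (S e) e) = (\<Sum>e\<in>B. h e (T e))"
proof -
  have "(\<Sum>e\<in>B. h (S e) e) = (\<Sum>e\<in>B. \<Sum>f\<in>B. G (S e) f *\<^sub>R h f e)"
    using frame_linear[OF B, of "\<lambda>f. h f _"] h by (simp add: bilinear_def)
  also have "\<dots> = (\<Sum>f\<in>B. \<Sum>e\<in>B. G (T f) e *\<^sub>R h f e)"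
    by (subst sum.swap) (simp add: ST G_sym[of _ "T _"])
  also have "\<dots> = (\<Sum>f\<in>B. h f (T f))"
    using frame_linear[OF B, of "h _"] h by (simp add: bilinear_def)
  finally show ?thesis .
qed

lemma frame_independent:
  assumes B: "frame B" "frame C" and h: "bilinear h"
  shows "(\<Sum>e\<in>B. h e e) = (\<Sum>e\<in>C. h e e)"
proof -
  have "(\<Sum>e\<in>B. h e e) = (\<Sum>e\<in>B. \<Sum>f\<in>C. G e f *\<^sub>R h f e)"
    using frame_linear[OF B(2), of "\<lambda>f. h f _"] h by (simp add: bilinear_def)
  also have "\<dots> = (\<Sum>f\<in>C. \<Sum>e\<in>B. G f e *\<^sub>R h f e)"
    by (subst sum.swap) (simp add: G_sym)
  also have "\<dots> = (\<Sum>f\<in>C. h f f)"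
    using frame_linear[OF B(1), of "h _"] h by (simp add: bilinear_def)
  finally show ?thesis .
qed

text \<open>\<open>Basis\<close> does not vary with the point, whereas an orthonormal frame of a
  varying metric would first have to be chosen smoothly. Traces over \<open>Basis\<close> are
  visibly smooth.\<close>

lemma frame_Basis_trace:
  assumes B: "frame B" and S: "linear S"
  shows "(\<Sum>b\<in>Basis. S b \<bullet> b) = (\<Sum>e\<in>B. G (S e) e)"
proof -
  have "(\<Sum>b\<in>Basis. S b \<bullet> b) = (\<Sum>b\<in>Basis. (\<Sum>e\<in>B. G (S b) e *\<^sub>R e) \<bullet> b)"
    by (simp add: frame_expand[OF B])
  also have "\<dots> = (\<Sum>e\<in>B. \<Sum>b\<in>Basis. (e \<bullet> b) *\<^sub>R G (S b) e)"
    by (subst sum.swap) (simp add: inner_sum_left mult.commute)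
  also have "\<dots> = (\<Sum>e\<in>B. G (S e) e)"
  proof (intro sum.cong refl)
    fix e
    have "linear (\<lambda>b. G (S b) e)" using linear_compose[OF S G_linear(1)[of e]] by (simp add: o_def)
    from linear_basis_expand[OF this, of e] show "(\<Sum>b\<in>Basis. (e \<bullet> b) *\<^sub>R G (S b) e) = G (S e) e" by simp
  qed
  finally show ?thesis .
qed

end

lemma sharp_eqI:
  assumes "metric_form (g p)" "\<And>v. g p w v = \<alpha> v"
  shows "sharp g p \<alpha> = w"
  unfolding sharp_def
proof (rule the_equality)
  fix z assume z: "\<forall>v. g p z v = \<alpha> v"
  show "z = w" by (rule metric_form.G_eqI[OF assms(1)]) (simp add: z assms(2))
qed (simp add: assms(2))

text \<open>
  The endomorphism corresponding to \<open>Y \<and> X + (\<Sum>i. J\<^sub>i Y \<and> J\<^sub>i X) + (\<Sum>i. G (J\<^sub>i X) Y *\<^sub>R \<omega>\<^sub>i)\<close>; up to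
  a factor it is the projection of \<open>Y \<and> X\<close> on \<open>S\<^sup>2E\<close> plus a section of \<open>S\<^sup>2H\<close>, chosen such that the
  difference with \<open>Y \<and> X\<close> is the contraction of a three-form with \<open>Y\<close>.
\<close>

definition qwedge :: "('e::real_vector \<Rightarrow> 'e \<Rightarrow> real) \<Rightarrow> ('e \<Rightarrow> 'e) \<Rightarrow> ('e \<Rightarrow> 'e) \<Rightarrow> ('e \<Rightarrow> 'e) \<Rightarrow> 'e \<Rightarrow> 'e \<Rightarrow> 'e \<Rightarrow> 'e" where
  "qwedge G J1 J2 J3 Y X u =
     (G Y u *\<^sub>R X - G X u *\<^sub>R Y) + (G (J1 Y) u *\<^sub>R J1 X - G (J1 X) u *\<^sub>R J1 Y)
     + (G (J2 Y) u *\<^sub>R J2 X - G (J2 X) u *\<^sub>R J2 Y) + (G (J3 Y) u *\<^sub>R J3 X - G (J3 X) u *\<^sub>R J3 Y)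
     + (G (J1 X) Y *\<^sub>R J1 u + G (J2 X) Y *\<^sub>R J2 u + G (J3 X) Y *\<^sub>R J3 u)"

text \<open>The products are listed as rewrite rules towards a single \<open>J\<close>, and
  orthogonality appears as skewness, so that \<open>J_simps\<close> and \<open>J_skew\<close> bring
  every expression to a normal form that linear arithmetic can compare.\<close>

locale quaternionic_space = metric_form G for G :: "'e::euclidean_space \<Rightarrow> 'e \<Rightarrow> real" +
  fixes J1 J2 J3 :: "'e \<Rightarrow> 'e"
  assumes linear_J: "linear J1" "linear J2" "linear J3"
    and J_sq: "J1 (J1 u) = - u" "J2 (J2 u) = - u" "J3 (J3 u) = - u"
    and J_mult: "J1 (J2 u) = J3 u" "J2 (J3 u) = J1 u" "J3 (J1 u) = J2 u"
      "J2 (J1 u) = - J3 u" "J3 (J2 u) = - J1 u" "J1 (J3 u) = - J2 u"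
    and J_skew: "G (J1 u) v = - G u (J1 v)" "G (J2 u) v = - G u (J2 v)" "G (J3 u) v = - G u (J3 v)"
    and dim8: "DIM('e) \<ge> 8"
begin

lemmas J_lin = linear_add[OF linear_J(1)] linear_add[OF linear_J(2)] linear_add[OF linear_J(3)]
  linear_diff[OF linear_J(1)] linear_diff[OF linear_J(2)] linear_diff[OF linear_J(3)]
  linear_neg[OF linear_J(1)] linear_neg[OF linear_J(2)] linear_neg[OF linear_J(3)]
  linear_scale[OF linear_J(1)] linear_scale[OF linear_J(2)] linear_scale[OF linear_J(3)]
  linear_0[OF linear_J(1)] linear_0[OF linear_J(2)] linear_0[OF linear_J(3)]

lemmas J_simps = J_lin J_sq J_mult

lemma J_orth: "G (J1 u) u = 0" "G (J2 u) u = 0" "G (J3 u) u = 0" "G u (J1 u) = 0" "G u (J2 u) = 0" "G u (J3 u) = 0"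
  using J_skew[of u u] G_sym[of u "J1 u"] G_sym[of u "J2 u"] G_sym[of u "J3 u"] by linarith+

lemma J_iso: "G (J1 u) (J1 v) = G u v" "G (J2 u) (J2 v) = G u v" "G (J3 u) (J3 v) = G u v"
  by (simp_all add: J_skew J_sq G_lin)

definition in_Q :: "('e \<Rightarrow> 'e) \<Rightarrow> bool" where
  "in_Q S \<longleftrightarrow> (\<exists>a b c. \<forall>u. S u = a *\<^sub>R J1 u + b *\<^sub>R J2 u + c *\<^sub>R J3 u)"

definition commutes :: "('e \<Rightarrow> 'e) \<Rightarrow> bool" where
  "commutes T \<longleftrightarrow> (\<forall>u. T (J1 u) = J1 (T u) \<and> T (J2 u) = J2 (T u) \<and> T (J3 u) = J3 (T u))"

definition skew :: "('e \<Rightarrow> 'e) \<Rightarrow> bool" where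
  "skew T \<longleftrightarrow> (\<forall>u v. G (T u) v = - G u (T v))"

text \<open>The infinitesimal version of preserving \<open>Q\<close>. For linear \<open>T\<close>
  the condition depends only on the span of the three structures.\<close>

definition normalises :: "('e \<Rightarrow> 'e) \<Rightarrow> bool" where
  "normalises T \<longleftrightarrow> in_Q (\<lambda>u. T (J1 u) - J1 (T u)) \<and> in_Q (\<lambda>u. T (J2 u) - J2 (T u)) \<and>
     in_Q (\<lambda>u. T (J3 u) - J3 (T u))"

text \<open>The four vectors are pairwise orthogonal and of equal length. Endomorphisms in the span
  of the identity and \<open>Q\<close> can thus be compared at one nonzero vector.\<close>

lemma J_independent:
  assumes "a *\<^sub>R J1 u + b *\<^sub>R J2 u + c *\<^sub>R J3 u + r *\<^sub>R u = 0" "u \<noteq> 0"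
  shows "a = 0" "b = 0" "c = 0" "r = 0"
proof -
  let ?w = "a *\<^sub>R J1 u + b *\<^sub>R J2 u + c *\<^sub>R J3 u + r *\<^sub>R u"
  have "G ?w (J1 u) = a * G u u" "G ?w (J2 u) = b * G u u" "G ?w (J3 u) = c * G u u" "G ?w u = r * G u u"
    by (simp_all add: G_lin J_skew J_simps J_orth)
  then have "a * G u u = 0" "b * G u u = 0" "c * G u u = 0" "r * G u u = 0"
    unfolding assms(1) by (simp_all add: G_lin)
  moreover have "G u u \<noteq> 0" using G_pos[OF assms(2)] by simp
  ultimately show "a = 0" "b = 0" "c = 0" "r = 0" by simp_all
qed

lemma nonzero_vector: "\<exists>u::'e. u \<noteq> 0"
  using nonempty_Basis nonzero_Basis by blast

text \<open>The combination of the \<open>J\<close> equals \<open>- T\<close> and so commutes with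
  \<open>J1\<close> and \<open>J2\<close>; only the zero combination does.\<close>

lemma decomposition_unique:
  assumes "commutes T" "\<And>u. a *\<^sub>R J1 u + b *\<^sub>R J2 u + c *\<^sub>R J3 u + T u = 0"
  shows "a = 0" "b = 0" "c = 0" "T u = 0"
proof -
  obtain v :: 'e where v: "v \<noteq> 0" using nonzero_vector by blast
  have T: "T u = - (a *\<^sub>R J1 u + b *\<^sub>R J2 u + c *\<^sub>R J3 u)" for u
    using assms(2)[of u] by (simp only: eq_neg_iff_add_eq_0 add.commute)
  have "T (J1 v) = J1 (T v)" "T (J2 v) = J2 (T v)" using assms(1) by (auto simp: commutes_def)
  then have e: "G (T (J1 v)) z = G (J1 (T v)) z" "G (T (J2 v)) z = G (J2 (T v)) z" for z by auto
  have f1: "0 *\<^sub>R J1 v + (2 * c) *\<^sub>R J2 v + (- 2 * b) *\<^sub>R J3 v + 0 *\<^sub>R v = 0"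
    by (rule G_eqI) (use e(1) in \<open>simp add: T J_simps G_lin algebra_simps\<close>)
  have "(2 * c) *\<^sub>R J1 v + 0 *\<^sub>R J2 v + (- 2 * a) *\<^sub>R J3 v + 0 *\<^sub>R v = 0"
    by (rule G_eqI) (use e(2) in \<open>simp add: T J_simps G_lin algebra_simps\<close>)
  note f2 = this
  from J_independent[OF f1 v] J_independent[OF f2 v] show "a = 0" "b = 0" "c = 0" by auto
  then show "T u = 0" using T by simp
qed

text \<open>The normaliser of \<open>sp(1)\<close> in \<open>so(4n)\<close> is
  \<open>sp(1) + sp(n)\<close>. The commutator with \<open>\<Psi>\<close> is a derivation of the
  quaternions, and every such derivation is inner; subtracting the imaginary quaternion that induces
  it leaves a part that commutes with \<open>Q\<close>.\<close>

lemma decomposition: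
  assumes "normalises \<Psi>" "skew \<Psi>" "linear \<Psi>"
  obtains a b c T where "linear T" "skew T" "commutes T"
    "\<And>u. \<Psi> u = a *\<^sub>R J1 u + b *\<^sub>R J2 u + c *\<^sub>R J3 u + T u"
proof -
  note lin = linear_add[OF assms(3)] linear_diff[OF assms(3)] linear_neg[OF assms(3)] linear_scale[OF assms(3)]
  obtain a1 b1 c1 a2 b2 c2 a3 b3 c3 where
    h: "\<And>u. \<Psi> (J1 u) = J1 (\<Psi> u) + (a1 *\<^sub>R J1 u + b1 *\<^sub>R J2 u + c1 *\<^sub>R J3 u)"
     "\<And>u. \<Psi> (J2 u) = J2 (\<Psi> u) + (a2 *\<^sub>R J1 u + b2 *\<^sub>R J2 u + c2 *\<^sub>R J3 u)"
     "\<And>u. \<Psi> (J3 u) = J3 (\<Psi> u) + (a3 *\<^sub>R J1 u + b3 *\<^sub>R J2 u + c3 *\<^sub>R J3 u)"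
    using assms(1) unfolding normalises_def in_Q_def diff_eq_eq by (auto simp: add.commute[of "J1 _"] add.commute[of "J2 _"] add.commute[of "J3 _"])
  obtain v :: 'e where v: "v \<noteq> 0" using nonzero_vector by blast
  \<comment> \<open>Pushing \<open>\<Psi>\<close> through the squares of the \<open>J\<close> and
    through \<open>J1 (J2 v) = J3 v\<close> gives linear conditions on the nine coefficients; they
    make the coefficient matrix antisymmetric.\<close>
  have "G (\<Psi> (J1 (J1 v))) z = - G (\<Psi> v) z" "G (\<Psi> (J2 (J2 v))) z = - G (\<Psi> v) z"
    "G (\<Psi> (J3 (J3 v))) z = - G (\<Psi> v) z" "G (\<Psi> (J1 (J2 v))) z = G (\<Psi> (J3 v)) z" for z
    by (simp_all add: J_simps lin G_lin)
  note e = this[unfolded h]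
  have f1: "0 *\<^sub>R J1 v + 0 *\<^sub>R J2 v + 0 *\<^sub>R J3 v + (- 2 * a1) *\<^sub>R v = 0"
    by (rule G_eqI) (use e(1) in \<open>simp add: J_simps G_lin algebra_simps\<close>)
  have f2: "0 *\<^sub>R J1 v + 0 *\<^sub>R J2 v + 0 *\<^sub>R J3 v + (- 2 * b2) *\<^sub>R v = 0"
    by (rule G_eqI) (use e(2) in \<open>simp add: J_simps G_lin algebra_simps\<close>)
  have f3: "0 *\<^sub>R J1 v + 0 *\<^sub>R J2 v + 0 *\<^sub>R J3 v + (- 2 * c3) *\<^sub>R v = 0"
    by (rule G_eqI) (use e(3) in \<open>simp add: J_simps G_lin algebra_simps\<close>)
  have "(- c1 - a3) *\<^sub>R J1 v + (- c2 - b3) *\<^sub>R J2 v + (a1 + b2 - c3) *\<^sub>R J3 v + (- a2 - b1) *\<^sub>R v = 0"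
    by (rule G_eqI) (use e(4) in \<open>simp add: J_simps G_lin algebra_simps\<close>)
  note f4 = this
  from J_independent[OF f1 v] J_independent[OF f2 v] J_independent[OF f3 v] J_independent[OF f4 v]
  have z: "a1 = 0" "b2 = 0" "c3 = 0" "a3 = - c1" "b3 = - c2" "a2 = - b1" by auto
  \<comment> \<open>Halved because the commutator of two different \<open>J\<close> is, up to sign,
    twice the third.\<close>
  define a b c where "a = c2 / 2" and "b = - c1 / 2" and "c = b1 / 2"
  define T where "T u = \<Psi> u - (a *\<^sub>R J1 u + b *\<^sub>R J2 u + c *\<^sub>R J3 u)" for u
  have lT: "linear T" unfolding T_def[abs_def]
    by (intro linear_compose_sub linear_compose_add assms(3) linear_compose_scale_right linear_J)
  moreover have "skew T" using assms(2) by (auto simp: skew_def T_def G_lin J_skew)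
  moreover have "commutes T"
    unfolding commutes_def T_def h z a_def b_def c_def
    by (intro allI conjI; rule G_eqI) (simp_all add: J_simps G_lin algebra_simps)
  moreover have "\<And>u. \<Psi> u = a *\<^sub>R J1 u + b *\<^sub>R J2 u + c *\<^sub>R J3 u + T u" by (simp add: T_def)
  ultimately show thesis using that by blast
qed

lemma normalisesI:
  assumes "linear T" "skew T" "commutes T" "\<And>u. \<Psi> u = a *\<^sub>R J1 u + b *\<^sub>R J2 u + c *\<^sub>R J3 u + T u"
  shows "normalises \<Psi>"
proof -
  have T: "T (J1 u) = J1 (T u)" "T (J2 u) = J2 (T u)" "T (J3 u) = J3 (T u)" for u
    using assms(3) by (auto simp: commutes_def)
  have "\<Psi> (J1 u) - J1 (\<Psi> u) = 0 *\<^sub>R J1 u + (2 * c) *\<^sub>R J2 u + (- 2 * b) *\<^sub>R J3 u" for u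
    by (rule G_eqI) (simp add: assms(4) T J_simps G_lin algebra_simps)
  moreover have "\<Psi> (J2 u) - J2 (\<Psi> u) = (- 2 * c) *\<^sub>R J1 u + 0 *\<^sub>R J2 u + (2 * a) *\<^sub>R J3 u" for u
    by (rule G_eqI) (simp add: assms(4) T J_simps G_lin algebra_simps)
  moreover have "\<Psi> (J3 u) - J3 (\<Psi> u) = (2 * b) *\<^sub>R J1 u + (- 2 * a) *\<^sub>R J2 u + 0 *\<^sub>R J3 u" for u
    by (rule G_eqI) (simp add: assms(4) T J_simps G_lin algebra_simps)
  ultimately show ?thesis unfolding normalises_def in_Q_def by metis
qed

lemma frame_J:
  assumes B: "frame B" and h: "bilinear h"
  shows "(\<Sum>e\<in>B. h (J1 e) (J1 e)) = (\<Sum>e\<in>B. h e e)" "(\<Sum>e\<in>B. h (J2 e) (J2 e)) = (\<Sum>e\<in>B. h e e)"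
    "(\<Sum>e\<in>B. h (J3 e) (J3 e)) = (\<Sum>e\<in>B. h e e)"
proof -
  have "(\<Sum>e\<in>B. h (J e) (J e)) = (\<Sum>e\<in>B. h e e)"
    if J: "linear J" "\<And>u. J (J u) = - u" "\<And>u v. G (J u) v = - G u (J v)" for J
  proof -
    have "bilinear (\<lambda>u v. h u (J v))"
      using h J(1) by (auto simp: bilinear_def linear_iff)
    from frame_adjoint[OF B this, of J "\<lambda>v. - J v"]
    show ?thesis using J by (simp add: G_lin linear_neg)
  qed
  then show "(\<Sum>e\<in>B. h (J1 e) (J1 e)) = (\<Sum>e\<in>B. h e e)" "(\<Sum>e\<in>B. h (J2 e) (J2 e)) = (\<Sum>e\<in>B. h e e)"
    "(\<Sum>e\<in>B. h (J3 e) (J3 e)) = (\<Sum>e\<in>B. h e e)"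
    using linear_J J_sq J_skew by auto
qed

text \<open>For \<open>J1\<close>, say, the frame is rotated by \<open>J2\<close>. By
  \<open>frame_J\<close> the sum does not change, but every term changes sign, because
  \<open>J2\<close> anticommutes with \<open>J1\<close> while \<open>T\<close> commutes with
  both.\<close>

lemma trace_commuting:
  assumes B: "frame B" and T: "linear T" "commutes T"
    and "J = J1 \<or> J = J2 \<or> J = J3"
  shows "(\<Sum>e\<in>B. G (T e) (J e)) = 0"
proof -
  note T' = T(2)[unfolded commutes_def, rule_format]
  have b: "bilinear (\<lambda>u v. G (T u) (J v))" if "linear J" for J
    using T(1) that by (auto simp: bilinear_def linear_iff G_lin)
  have "(\<Sum>e\<in>B. G (T e) (J1 e)) = 0"
    using frame_J(2)[OF B b[OF linear_J(1)]] by (simp add: T' J_skew J_simps G_lin sum_negf)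
  moreover have "(\<Sum>e\<in>B. G (T e) (J2 e)) = 0"
    using frame_J(3)[OF B b[OF linear_J(2)]] by (simp add: T' J_skew J_simps G_lin sum_negf)
  moreover have "(\<Sum>e\<in>B. G (T e) (J3 e)) = 0"
    using frame_J(1)[OF B b[OF linear_J(3)]] by (simp add: T' J_skew J_simps G_lin sum_negf)
  ultimately show ?thesis using assms(4) by auto
qed

text \<open>Traces recover the coefficients of the \<open>Q\<close>-part. They thereby become linear
  in \<open>\<Psi>\<close> and smooth in the point, which their mere existence in
  \<open>in_Q\<close> or \<open>decomposition\<close> does not give.\<close>

lemma trace_coefficient:
  assumes B: "frame B" and T: "linear T" "commutes T"
    and \<Psi>: "\<And>u. \<Psi> u = a *\<^sub>R J1 u + b *\<^sub>R J2 u + c *\<^sub>R J3 u + T u"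
  shows "(\<Sum>e\<in>B. G (\<Psi> e) (J1 e)) = real DIM('e) * a" "(\<Sum>e\<in>B. G (\<Psi> e) (J2 e)) = real DIM('e) * b"
    "(\<Sum>e\<in>B. G (\<Psi> e) (J3 e)) = real DIM('e) * c"
proof -
  have "G (\<Psi> e) (J1 e) = a * G e e + G (T e) (J1 e)" "G (\<Psi> e) (J2 e) = b * G e e + G (T e) (J2 e)"
    "G (\<Psi> e) (J3 e) = c * G e e + G (T e) (J3 e)" for e
    by (simp_all add: \<Psi> G_lin J_iso) (simp_all add: J_skew J_simps J_orth G_lin)
  then show "(\<Sum>e\<in>B. G (\<Psi> e) (J1 e)) = real DIM('e) * a" "(\<Sum>e\<in>B. G (\<Psi> e) (J2 e)) = real DIM('e) * b"
    "(\<Sum>e\<in>B. G (\<Psi> e) (J3 e)) = real DIM('e) * c"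
    using trace_commuting[OF B T] frame_dim_real[OF B]
    by (simp_all add: sum.distrib flip: sum_distrib_left)
qed

text \<open>No nonzero three-form takes values in \<open>sp(1) + sp(n)\<close> if
  \<open>n \<ge> 2\<close>. The \<open>Q\<close>-coefficients \<open>f1\<close>, \<open>f2\<close>,
  \<open>f3\<close> of \<open>N Y\<close> are one-forms in \<open>Y\<close>, and contractions give
  linear equations that make them vanish. The rest commutes with \<open>Q\<close>, and a three-form
  with this property is zero.\<close>

lemma alternating_compatible_zero:
  assumes N: "bilinear N" and sk: "\<And>Y. skew (N Y)" and nrm: "\<And>Y. normalises (N Y)"
    and alt: "\<And>Y u v. G (N Y u) v = - G (N u Y) v"
  shows "N Y u = 0"
proof -
  obtain B where B: "frame B" using frame_exists by blast
  have linN: "linear (N Y)" "linear (\<lambda>Y. N Y u)" for Y u using N by (auto simp: bilinear_def)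
  define d where "d = real DIM('e)"
  have d: "d \<ge> 8" using dim8 by (simp add: d_def)
  have sk': "G (N Y u) v = - G (N Y v) u" for Y u v
    using sk[of Y] unfolding skew_def by (metis G_sym)
  have cyc: "G (N Y u) v = G (N v Y) u" for Y u v using alt[of Y v u] sk'[of Y u v] by simp
  define f1 f2 f3 where "f1 Y = (\<Sum>e\<in>B. G (N Y e) (J1 e)) / d" and "f2 Y = (\<Sum>e\<in>B. G (N Y e) (J2 e)) / d"
    and "f3 Y = (\<Sum>e\<in>B. G (N Y e) (J3 e)) / d" for Y
  have linf: "linear f1" "linear f2" "linear f3"
    unfolding f1_def[abs_def] f2_def[abs_def] f3_def[abs_def]
    by (auto simp: linear_iff bilinear_ladd[OF N] bilinear_lmul[OF N] G_lin sum.distrib add_divide_distrib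
        sum_distrib_left)
  define T where "T Y u = N Y u - (f1 Y *\<^sub>R J1 u + f2 Y *\<^sub>R J2 u + f3 Y *\<^sub>R J3 u)" for Y u
  have T: "commutes (T Y)" "skew (T Y)" for Y
  proof -
    from decomposition[OF nrm sk linN(1), of Y] obtain a b c T' where
      *: "linear T'" "skew T'" "commutes T'" "\<And>u. N Y u = a *\<^sub>R J1 u + b *\<^sub>R J2 u + c *\<^sub>R J3 u + T' u" by metis
    have "f1 Y = a" "f2 Y = b" "f3 Y = c"
      using trace_coefficient[OF B *(1,3,4)] d by (auto simp: f1_def f2_def f3_def d_def)
    then have "T Y = T'" by (auto simp: T_def *(4))
    with * show "commutes (T Y)" "skew (T Y)" by auto
  qed
  note T' = T(1)[unfolded commutes_def, rule_format]
  have N_eq: "N Y u = f1 Y *\<^sub>R J1 u + f2 Y *\<^sub>R J2 u + f3 Y *\<^sub>R J3 u + T Y u" for Y u by (simp add: T_def)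
  \<comment> \<open>Cyclic invariance turns the trace in the definition of each \<open>f\<close>
    into a contraction of the first two slots.\<close>
  have contr: "(\<Sum>e\<in>B. G (N e (J1 e)) v) = d * f1 v" "(\<Sum>e\<in>B. G (N e (J2 e)) v) = d * f2 v"
     "(\<Sum>e\<in>B. G (N e (J3 e)) v) = d * f3 v" for v
    using d cyc[of _ "J1 _" v] cyc[of _ "J2 _" v] cyc[of _ "J3 _" v] by (auto simp: f1_def f2_def f3_def)
  have lr: "(\<Sum>e\<in>B. f e * G e u) = f u" if "linear f" for f :: "'e \<Rightarrow> real" and u
    by (rule frame_linear_real[OF B that])
  have lr1: "(\<Sum>e\<in>B. f e * G (J1 e) v) = - f (J1 v)" "(\<Sum>e\<in>B. f e * G (J2 e) v) = - f (J2 v)"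
     "(\<Sum>e\<in>B. f e * G (J3 e) v) = - f (J3 v)" if "linear f" for f :: "'e \<Rightarrow> real" and v
    using lr[OF that] by (simp_all add: J_skew sum_negf)
  \<comment> \<open>In the difference of the two contractions the commuting part cancels, as
    \<open>G (T e (J3 e)) (J1 v) = G (T e (J2 e)) v\<close>; only terms in the \<open>f\<close> are
    left.\<close>
  have "d * f3 (J1 v) - d * f2 v = 2 * f2 v - 2 * f3 (J1 v)" "d * f1 (J2 v) - d * f3 v = 2 * f3 v - 2 * f1 (J2 v)"
    "d * f2 (J3 v) - d * f1 v = 2 * f1 v - 2 * f2 (J3 v)" for v
  proof -
    have "(\<Sum>e\<in>B. G (N e (J3 e)) (J1 v) - G (N e (J2 e)) v) = (\<Sum>e\<in>B. 2 * (f2 e * G e v) + 2 * (f3 e * G (J1 e) v))"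
      "(\<Sum>e\<in>B. G (N e (J1 e)) (J2 v) - G (N e (J3 e)) v) = (\<Sum>e\<in>B. 2 * (f3 e * G e v) + 2 * (f1 e * G (J2 e) v))"
      "(\<Sum>e\<in>B. G (N e (J2 e)) (J3 v) - G (N e (J1 e)) v) = (\<Sum>e\<in>B. 2 * (f1 e * G e v) + 2 * (f2 e * G (J3 e) v))"
      by ((rule sum.cong[OF refl], simp add: N_eq T' G_lin J_iso J_simps, simp add: J_skew J_simps G_lin algebra_simps)+)
    from this show
      "d * f3 (J1 v) - d * f2 v = 2 * f2 v - 2 * f3 (J1 v)" "d * f1 (J2 v) - d * f3 v = 2 * f3 v - 2 * f1 (J2 v)"
      "d * f2 (J3 v) - d * f1 v = 2 * f1 v - 2 * f2 (J3 v)"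
      unfolding sum_subtractf sum.distrib sum_distrib_left[symmetric] contr lr[OF linf(1)] lr[OF linf(2)]
        lr[OF linf(3)] lr1[OF linf(1)] lr1[OF linf(2)] lr1[OF linf(3)] by simp_all
  qed
  then have "(d + 2) * (f3 (J1 v) - f2 v) = 0" "(d + 2) * (f1 (J2 v) - f3 v) = 0" "(d + 2) * (f2 (J3 v) - f1 v) = 0" for v
    by (simp_all add: algebra_simps)
  then have f: "f3 (J1 v) = f2 v" "f1 (J2 v) = f3 v" "f2 (J3 v) = f1 v" for v using d by simp_all
  have "G (N e e) v = 0" for e v using alt[of e e v] by simp
  then have T_eq: "G (T e e) v = - (f1 e * G (J1 e) v + f2 e * G (J2 e) v + f3 e * G (J3 e) v)" for e v
    by (simp add: T_def G_lin)
  have tr: "(\<Sum>e\<in>B. G (T e e) v) = f1 (J1 v) + f2 (J2 v) + f3 (J3 v)" for v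
    unfolding T_eq sum.distrib sum_negf lr1[OF linf(1)] lr1[OF linf(2)] lr1[OF linf(3)] by simp
  have N_J1: "G (N e (J1 e)) v = - (f1 e * G e v) - f2 e * G (J3 e) v + f3 e * G (J2 e) v - G (T e e) (J1 v)" for e v
    by (simp add: N_eq T' G_lin J_simps) (simp add: J_skew)
  \<comment> \<open>\<open>T e e\<close> has been expressed by the \<open>f\<close> because
    \<open>N e e = 0\<close>. With the relations between the \<open>f\<close> this becomes
    \<open>(d - 4) * f1 v = 0\<close>, which is where dimension 4 is excluded.\<close>
  have "d * f1 v = - f1 v + f2 (J3 v) - f3 (J2 v) - (f1 (J1 (J1 v)) + f2 (J2 (J1 v)) + f3 (J3 (J1 v)))" for v
    using contr(1)[of v] unfolding N_J1 sum_subtractf sum.distrib sum_negf contr tr lr[OF linf(1)] lr1[OF linf(2)] lr1[OF linf(3)] by simp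
  moreover have "f3 (J2 v) = - f1 v" for v using f(2)[of "J2 v"] by (simp add: J_simps linear_neg[OF linf(1)])
  ultimately have "(d - 4) * f1 v = 0" for v
    using linear_neg[OF linf(1)] linear_neg[OF linf(2)] by (simp add: J_simps f algebra_simps)
  then have f1: "f1 v = 0" for v using d by simp
  then have f0: "f1 v = 0" "f2 v = 0" "f3 v = 0" for v using f[of v] f(2)[of "J1 v"] by simp_all
  \<comment> \<open>From here \<open>J1\<close> can be moved from slot to slot of the three-form,
    each time with a change of sign; after three moves it is back in its place with the opposite
    sign.\<close>
  have inv: "G (N Y (J1 u)) (J1 v) = G (N Y u) v" for Y u v
    by (simp add: N_eq f0 T' J_iso)
  have "G (N (J1 a) (J1 b)) v = G (N a b) v" for a b v
    using inv[of v a b] cyc[of "J1 a" "J1 b" v] cyc[of a b v] by simp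
  from this[of _ "J1 _"] have 1: "G (N (J1 a) b) v = - G (N a (J1 b)) v" for a b v
    by (simp add: J_simps linear_neg[OF linN(1)] G_lin) (metis minus_minus)
  have 2: "G (N a (J1 b)) v = - G (N a b) (J1 v)" for a b v
    using inv[of a b "J1 v"] by (simp add: J_simps G_lin)
  have "G (N (J1 a) b) v = 0" for a b v
    using 1[of a b v] 2[of a b v] cyc[of "J1 a" b v] 2[of v a b] cyc[of a b "J1 v"] cyc[of "J1 v" a b]
      1[of v a b] cyc[of v "J1 a" b] cyc[of a b v] by simp
  from this[of "J1 Y" u] have "G (N Y u) v = 0" for v
    by (simp add: J_simps linear_neg[OF linN(2)] G_lin)
  then show ?thesis by (intro G_eqI) (simp add: G_lin)
qed

section \<open>Algebra of \<open>qwedge\<close> and the conformal-Killing equation at a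
  point\<close>

lemma qwedge_simps:
  "G (qwedge G J1 J2 J3 Y X u) v =
     (G Y u * G X v - G X u * G Y v) + (G (J1 Y) u * G (J1 X) v - G (J1 X) u * G (J1 Y) v)
     + (G (J2 Y) u * G (J2 X) v - G (J2 X) u * G (J2 Y) v) + (G (J3 Y) u * G (J3 X) v - G (J3 X) u * G (J3 Y) v)
     + (G (J1 X) Y * G (J1 u) v + G (J2 X) Y * G (J2 u) v + G (J3 X) Y * G (J3 u) v)"
  by (simp add: qwedge_def G_lin)

lemma J_swap: "G (J1 X) Y = - G (J1 Y) X" "G (J2 X) Y = - G (J2 Y) X" "G (J3 X) Y = - G (J3 Y) X"
  using J_skew[of X Y] G_sym[of X "J1 Y"] G_sym[of X "J2 Y"] G_sym[of X "J3 Y"] by simp_all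

lemma linear_qwedge:
  "linear (qwedge G J1 J2 J3 Y X)" "linear (\<lambda>Y. qwedge G J1 J2 J3 Y X u)" "linear (\<lambda>X. qwedge G J1 J2 J3 Y X u)"
  by (intro linearI; rule G_eqI; simp add: qwedge_simps G_lin J_simps algebra_simps)+

lemma qwedge_skew: "skew (qwedge G J1 J2 J3 Y X)"
  unfolding skew_def
proof (intro allI)
  fix u v
  have "G u (qwedge G J1 J2 J3 Y X v) = G (qwedge G J1 J2 J3 Y X v) u" by (rule G_sym)
  then show "G (qwedge G J1 J2 J3 Y X u) v = - G u (qwedge G J1 J2 J3 Y X v)"
    by (simp add: qwedge_simps J_swap[of u v] algebra_simps)
qed

lemma qwedge_self [simp]: "qwedge G J1 J2 J3 X X u = 0"
  by (rule G_eqI) (simp add: G_lin qwedge_simps J_orth)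

text \<open>The part of \<open>qwedge\<close> that commutes with \<open>Q\<close>: four times the
  projection of \<open>Y \<and> X\<close> to \<open>S2E\<close>, as the sum of its images under the
  identity, \<open>J1\<close>, \<open>J2\<close> and \<open>J3\<close>.\<close>

definition pwedge :: "'e \<Rightarrow> 'e \<Rightarrow> 'e \<Rightarrow> 'e" where
  "pwedge Y X u = qwedge G J1 J2 J3 Y X u - (G (J1 X) Y *\<^sub>R J1 u + G (J2 X) Y *\<^sub>R J2 u + G (J3 X) Y *\<^sub>R J3 u)"

lemma pwedge_simps:
  "G (pwedge Y X u) v =
     (G Y u * G X v - G X u * G Y v) + (G (J1 Y) u * G (J1 X) v - G (J1 X) u * G (J1 Y) v)
     + (G (J2 Y) u * G (J2 X) v - G (J2 X) u * G (J2 Y) v) + (G (J3 Y) u * G (J3 X) v - G (J3 X) u * G (J3 Y) v)"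
  by (simp add: pwedge_def G_lin qwedge_simps)

lemma pwedge_commutes: "commutes (pwedge Y X)"
  unfolding commutes_def
  by (intro allI conjI; rule G_eqI; simp add: pwedge_simps J_skew[of "pwedge _ _ _"])
    (simp_all add: J_skew J_simps G_lin algebra_simps)

lemma linear_pwedge: "linear (pwedge Y X)" "linear (\<lambda>Y. pwedge Y X u)" "linear (\<lambda>X. pwedge Y X u)"
  by (intro linearI; rule G_eqI; simp add: pwedge_simps G_lin J_simps algebra_simps)+

lemma pwedge_skew: "skew (pwedge Y X)"
  unfolding skew_def
proof (intro allI)
  fix u v
  have "G u (pwedge Y X v) = G (pwedge Y X v) u" by (rule G_sym)
  then show "G (pwedge Y X u) v = - G u (pwedge Y X v)"
    by (simp add: pwedge_simps algebra_simps)
qed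

lemma qwedge_normalises: "normalises (qwedge G J1 J2 J3 Y X)"
  by (rule normalisesI[OF linear_pwedge(1)[of Y X] pwedge_skew pwedge_commutes, of _ "G (J1 X) Y" "G (J2 X) Y" "G (J3 X) Y"])
    (simp add: pwedge_def)

lemma in_Q_add_scale: "in_Q S \<Longrightarrow> in_Q S' \<Longrightarrow> in_Q (\<lambda>u. S u + r *\<^sub>R S' u)"
proof -
  assume "in_Q S" "in_Q S'"
  then obtain a b c a' b' c' where "\<And>u. S u = a *\<^sub>R J1 u + b *\<^sub>R J2 u + c *\<^sub>R J3 u"
    "\<And>u. S' u = a' *\<^sub>R J1 u + b' *\<^sub>R J2 u + c' *\<^sub>R J3 u" unfolding in_Q_def by metis
  then have "S u + r *\<^sub>R S' u = (a + r * a') *\<^sub>R J1 u + (b + r * b') *\<^sub>R J2 u + (c + r * c') *\<^sub>R J3 u" for u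
    by (simp add: algebra_simps)
  then show ?thesis unfolding in_Q_def by blast
qed

lemma normalises_add_scale:
  assumes "normalises S" "normalises S'"
  shows "normalises (\<lambda>u. S u + r *\<^sub>R S' u)"
proof -
  have eq: "(S (J u) + r *\<^sub>R S' (J u)) - J (S u + r *\<^sub>R S' u) = (S (J u) - J (S u)) + r *\<^sub>R (S' (J u) - J (S' u))"
    if "linear J" for J :: "'e \<Rightarrow> 'e" and u
    by (simp add: linear_add[OF that] linear_scale[OF that] algebra_simps)
  show ?thesis using assms in_Q_add_scale unfolding normalises_def
    by (simp add: eq linear_J)
qed

lemma skew_add_scale: "skew S \<Longrightarrow> skew S' \<Longrightarrow> skew (\<lambda>u. S u + r *\<^sub>R S' u)"
  by (simp add: skew_def G_lin)

text \<open>\<open>N\<close> stands for the covariant derivative of the form and \<open>X\<close>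
  for its codifferential. Both \<open>N\<close> and \<open>- c\<close> times \<open>qwedge\<close>
  consist of a three-form and \<open>- c\<close> times \<open>Y \<and> X\<close>, so they differ by
  a three-form that normalises \<open>Q\<close>, and \<open>alternating_compatible_zero\<close>
  applies.\<close>

lemma conformal_killing_algebra:
  assumes N: "bilinear N" and sk: "\<And>Y. skew (N Y)" and nrm: "\<And>Y. normalises (N Y)"
    and ck: "\<And>Y u v. G (N Y u) v = 1 / 3 * (G (N Y u) v - G (N u Y) v + G (N v Y) u) - c * (G Y u * G X v - G Y v * G X u)"
  shows "N Y u = - (c *\<^sub>R qwedge G J1 J2 J3 Y X u)"
proof -
  define M where "M Y u = N Y u + c *\<^sub>R qwedge G J1 J2 J3 Y X u" for Y u
  have linN: "linear (N Y)" "linear (\<lambda>Y. N Y u)" for Y u using N by (auto simp: bilinear_def)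
  have "bilinear M" unfolding bilinear_def M_def
    by (auto intro!: linear_compose_add linear_compose_scale_right linN linear_qwedge)
  moreover have "skew (M Y)" "normalises (M Y)" for Y
    unfolding M_def by (intro skew_add_scale normalises_add_scale sk nrm qwedge_skew qwedge_normalises)+
  moreover have "G (M Y u) v = - G (M u Y) v" for Y u v
  proof -
    have s: "G (N a b) d = - G (N a d) b" for a b d
      using sk[of a] G_sym[of b "N a d"] by (simp add: skew_def)
    have "G (N Y u) v + c * (G Y u * G X v - G Y v * G X u) = 1 / 3 * (G (N Y u) v - G (N u Y) v + G (N v Y) u)"
      "G (N u Y) v + c * (G u Y * G X v - G u v * G X Y) = 1 / 3 * (G (N u Y) v - G (N Y u) v + G (N v u) Y)"
      using ck[of Y u v] ck[of u Y v] by linarith+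
    then have "G (N Y u) v + c * (G Y u * G X v - G Y v * G X u) = - (G (N u Y) v + c * (G u Y * G X v - G u v * G X Y))"
      using s[of v Y u] by simp
    then show ?thesis
      unfolding M_def G_lin qwedge_simps
      using J_swap[of u Y] J_swap[of X Y] J_swap[of X u] G_sym[of u Y] G_sym[of u X] G_sym[of Y X]
      by (simp add: algebra_simps)
  qed
  ultimately have "M Y u = 0" by (rule alternating_compatible_zero)
  then show ?thesis by (simp add: M_def eq_neg_iff_add_eq_0)
qed

text \<open>Alternation over the three slots kills \<open>Y \<and> X\<close> and triples the
  three-form in \<open>qwedge\<close>; this matches the factor \<open>1 / 3\<close>.\<close>

lemma qwedge_conformal_killing:
  assumes "\<And>Y u v. n Y u v = - c * G (qwedge G J1 J2 J3 Y X u) v"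
  shows "n Y u v = 1 / 3 * (n Y u v - n u Y v + n v Y u) - c * (G Y u * G X v - G Y v * G X u)"
  unfolding assms qwedge_simps
  using J_swap[of u Y] J_swap[of X Y] J_swap[of X u] J_swap[of X v] J_swap[of v Y] J_swap[of v u]
    G_sym[of u Y] G_sym[of u X] G_sym[of Y X] G_sym[of v X] G_sym[of v Y] G_sym[of v u]
  by (simp add: algebra_simps)

text \<open>In this contraction the \<open>S2H\<close>-terms of \<open>qwedge\<close> cancel the
  terms \<open>J e \<and> J X\<close>, and only \<open>e \<and> X\<close> contributes. The factor is
  the reason why \<open>c = 1 / (real DIM('e) - 1)\<close> makes \<open>X\<close> the
  codifferential.\<close>

lemma qwedge_trace:
  assumes B: "frame B"
  shows "(\<Sum>e\<in>B. G (qwedge G J1 J2 J3 e X e) v) = (real DIM('e) - 1) * G X v"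
proof -
  have *: "G (qwedge G J1 J2 J3 e X e) v = G X v * G e e - G X e * G e v" for e
    by (simp add: qwedge_simps J_orth algebra_simps)
  show ?thesis
    unfolding * sum_subtractf sum_distrib_left[symmetric] frame_dim_real[OF B] frame_linear_real[OF B G_linear(2)]
    by (simp add: algebra_simps)
qed

text \<open>The \<open>D\<close> are the images of the three structures under a derivation, which
  acts as an infinitesimal rotation of the triple. Needed both for the commutator with an
  endomorphism and for a covariant derivative.\<close>

lemma derivation_antisymmetric:
  assumes D: "\<And>u. D1 (J2 u) + J1 (D2 u) = D3 u" "\<And>u. D1 (J1 u) + J1 (D1 u) = 0" "\<And>u. D2 (J2 u) + J2 (D2 u) = 0"
      "\<And>u. D3 (J3 u) + J3 (D3 u) = 0"
    and Q: "in_Q D1" "in_Q D2" "in_Q D3"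
  obtains a b c where "\<And>u. D1 u = a *\<^sub>R J2 u + b *\<^sub>R J3 u" "\<And>u. D2 u = - a *\<^sub>R J1 u + c *\<^sub>R J3 u"
    "\<And>u. D3 u = - b *\<^sub>R J1 u - c *\<^sub>R J2 u"
proof -
  obtain a1 b1 c1 a2 b2 c2 a3 b3 c3 where h:
    "\<And>u. D1 u = a1 *\<^sub>R J1 u + b1 *\<^sub>R J2 u + c1 *\<^sub>R J3 u"
    "\<And>u. D2 u = a2 *\<^sub>R J1 u + b2 *\<^sub>R J2 u + c2 *\<^sub>R J3 u"
    "\<And>u. D3 u = a3 *\<^sub>R J1 u + b3 *\<^sub>R J2 u + c3 *\<^sub>R J3 u"
    using Q unfolding in_Q_def by metis
  obtain v :: 'e where v: "v \<noteq> 0" using nonzero_vector by blast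
  have "G (D1 (J2 v) + J1 (D2 v)) z = G (D3 v) z" "G (D1 (J1 v) + J1 (D1 v)) z = 0"
    "G (D2 (J2 v) + J2 (D2 v)) z = 0" "G (D3 (J3 v) + J3 (D3 v)) z = 0" for z
    by (simp_all add: D G_lin)
  note e = this[unfolded h]
  have f1: "0 *\<^sub>R J1 v + 0 *\<^sub>R J2 v + 0 *\<^sub>R J3 v + (- 2 * a1) *\<^sub>R v = 0"
    by (rule G_eqI) (use e(2) in \<open>simp add: J_simps G_lin algebra_simps\<close>)
  have f2: "0 *\<^sub>R J1 v + 0 *\<^sub>R J2 v + 0 *\<^sub>R J3 v + (- 2 * b2) *\<^sub>R v = 0"
    by (rule G_eqI) (use e(3) in \<open>simp add: J_simps G_lin algebra_simps\<close>)
  have f3: "0 *\<^sub>R J1 v + 0 *\<^sub>R J2 v + 0 *\<^sub>R J3 v + (- 2 * c3) *\<^sub>R v = 0"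
    by (rule G_eqI) (use e(4) in \<open>simp add: J_simps G_lin algebra_simps\<close>)
  have f4: "(- c1 - a3) *\<^sub>R J1 v + (- c2 - b3) *\<^sub>R J2 v + (a1 + b2 - c3) *\<^sub>R J3 v + (- a2 - b1) *\<^sub>R v = 0"
    by (rule G_eqI) (use e(1) in \<open>simp add: J_simps G_lin algebra_simps\<close>)
  from J_independent[OF f1 v] J_independent[OF f2 v] J_independent[OF f3 v] J_independent[OF f4 v]
  have z: "a1 = 0" "b2 = 0" "c3 = 0" "a3 = - c1" "b3 = - c2" "a2 = - b1" by auto
  show thesis by (rule that[of b1 c1 c2]) (simp_all add: h z)
qed

text \<open>\<open>qwedge\<close> depends only on the metric and on \<open>Q\<close>, not on the
  triple. Concretely, \<open>A\<close> rotates the triple by an antisymmetric matrix, whose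
  contributions to the sums over the three structures cancel.\<close>

lemma qwedge_equivariant:
  assumes A: "linear A" "skew A" "normalises A"
  shows "A (qwedge G J1 J2 J3 Y X u) - qwedge G J1 J2 J3 Y X (A u) =
    qwedge G J1 J2 J3 (A Y) X u + qwedge G J1 J2 J3 Y (A X) u"
proof -
  note A_lin = linear_add[OF A(1)] linear_diff[OF A(1)] linear_neg[OF A(1)] linear_scale[OF A(1)]
  define K1 K2 K3 where "K1 u = A (J1 u) - J1 (A u)" and "K2 u = A (J2 u) - J2 (A u)"
    and "K3 u = A (J3 u) - J3 (A u)" for u
  note K_defs = K1_def K2_def K3_def
  have "in_Q K1" "in_Q K2" "in_Q K3"
    using A(3) by (simp_all add: normalises_def K_defs[abs_def])
  moreover have "K1 (J2 u) + J1 (K2 u) = K3 u" "K1 (J1 u) + J1 (K1 u) = 0" "K2 (J2 u) + J2 (K2 u) = 0"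
    "K3 (J3 u) + J3 (K3 u) = 0" for u
    by (simp_all add: K_defs J_simps A_lin)
  ultimately obtain a b c where K: "\<And>u. K1 u = a *\<^sub>R J2 u + b *\<^sub>R J3 u" "\<And>u. K2 u = - a *\<^sub>R J1 u + c *\<^sub>R J3 u"
    "\<And>u. K3 u = - b *\<^sub>R J1 u - c *\<^sub>R J2 u"
    using derivation_antisymmetric[of K1 K2 K3] by blast
  have AJ: "A (J1 u) = J1 (A u) + (a *\<^sub>R J2 u + b *\<^sub>R J3 u)" "A (J2 u) = J2 (A u) + (- a *\<^sub>R J1 u + c *\<^sub>R J3 u)"
    "A (J3 u) = J3 (A u) + (- b *\<^sub>R J1 u - c *\<^sub>R J2 u)" for u
    using K[of u] by (simp_all add: K_defs algebra_simps)
  have sk: "G x (A y) = - G (A x) y" for x y using A(2) by (simp add: skew_def)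
  have sk2: "G (J1 (A x)) y = - G (A x) (J1 y)" "G (J2 (A x)) y = - G (A x) (J2 y)" "G (J3 (A x)) y = - G (A x) (J3 y)" for x y
    by (simp_all add: J_skew)
  show ?thesis
    by (rule G_eqI) (simp add: qwedge_def A_lin sk AJ G_lin J_lin algebra_simps)
qed

text \<open>The \<open>sp(1)\<close>-part of the curvature is that of a quaternionic projective
  space up to the factor \<open>m\<close>, and the same \<open>m\<close> determines the Ricci
  contraction. To see this, the contractions \<open>K J\<close> of \<open>R\<close> over
  \<open>e\<close> and \<open>J e\<close> are compared with the Ricci contraction by means of the
  Bianchi identity.\<close>

lemma curvature_algebra:
  assumes lin: "\<And>v w. linear (\<lambda>u. R u v w)" "\<And>u w. linear (\<lambda>v. R u v w)" "\<And>u v. linear (R u v)"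
    and anti: "\<And>u v w. R u v w = - R v u w"
    and sk: "\<And>u v. skew (R u v)"
    and bianchi: "\<And>u v w. R u v w + R v w u + R w u v = 0"
    and nrm: "\<And>u v. normalises (R u v)"
    and B: "frame B"
  obtains m where "\<And>Y Z. \<exists>T. linear T \<and> skew T \<and> commutes T \<and>
      (\<forall>u. R Y Z u = (m * G (J1 Y) Z) *\<^sub>R J1 u + (m * G (J2 Y) Z) *\<^sub>R J2 u + (m * G (J3 Y) Z) *\<^sub>R J3 u + T u)"
    and "\<And>Y. (\<Sum>e\<in>B. R Y e e) = (- (real DIM('e) + 8) / 2 * m) *\<^sub>R Y"
proof -
  define d where "d = real DIM('e)"
  have d: "d \<ge> 8" using dim8 by (simp add: d_def)
  \<comment> \<open>The usual symmetry between the two pairs of slots, from four instances of the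
    Bianchi identity.\<close>
  have pair: "G (R a b u) v = G (R u v a) b" for a b u v
  proof -
    have s: "G (R a b u) v = - G (R b a u) v" for a b u v using anti[of a b u] by (simp add: G_lin)
    have t: "G (R a b u) v = - G (R a b v) u" for a b u v
      using sk[of a b] G_sym[of u "R a b v"] by (simp add: skew_def)
    have c: "G (R a b u) v + G (R b u a) v + G (R u a b) v = 0" for a b u v
      using bianchi[of a b u] by (simp flip: bilinear_ladd[OF bilinear_G] add: G_lin(9))
    show ?thesis
      using c[of a b u v] c[of b u v a] c[of u v a b] c[of v a b u]
        s[of a b u v] s[of b u a v] s[of u a b v] t[of a b u v] t[of b u a v] t[of u a b v]
        s[of b u v a] s[of u v b a] s[of v b u a] t[of b u v a] t[of u v b a] t[of v b u a]
        s[of u v a b] s[of v a u b] s[of a u v b] t[of u v a b] t[of v a u b] t[of a u v b]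
        s[of v a b u] s[of a b v u] s[of b v a u] t[of v a b u] t[of a b v u] t[of b v a u]
      by linarith
  qed
  define \<Theta>1 \<Theta>2 \<Theta>3 where "\<Theta>1 u v = (\<Sum>e\<in>B. G (R u v e) (J1 e)) / d" and "\<Theta>2 u v = (\<Sum>e\<in>B. G (R u v e) (J2 e)) / d"
    and "\<Theta>3 u v = (\<Sum>e\<in>B. G (R u v e) (J3 e)) / d" for u v
  have dec: "\<exists>T. linear T \<and> skew T \<and> commutes T \<and>
      (\<forall>w. R u v w = \<Theta>1 u v *\<^sub>R J1 w + \<Theta>2 u v *\<^sub>R J2 w + \<Theta>3 u v *\<^sub>R J3 w + T w)" for u v
  proof -
    from decomposition[OF nrm sk lin(3), of u v] obtain a b c T where
      *: "linear T" "skew T" "commutes T" "\<And>w. R u v w = a *\<^sub>R J1 w + b *\<^sub>R J2 w + c *\<^sub>R J3 w + T w" by metis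
    have "\<Theta>1 u v = a" "\<Theta>2 u v = b" "\<Theta>3 u v = c"
      using trace_coefficient[OF B *(1,3,4)] d by (auto simp: \<Theta>1_def \<Theta>2_def \<Theta>3_def d_def)
    with * show ?thesis by auto
  qed
  have comm: "R u v (J1 w) = J1 (R u v w) - (2 * \<Theta>2 u v) *\<^sub>R J3 w + (2 * \<Theta>3 u v) *\<^sub>R J2 w"
    "R u v (J2 w) = J2 (R u v w) - (2 * \<Theta>3 u v) *\<^sub>R J1 w + (2 * \<Theta>1 u v) *\<^sub>R J3 w"
    "R u v (J3 w) = J3 (R u v w) - (2 * \<Theta>1 u v) *\<^sub>R J2 w + (2 * \<Theta>2 u v) *\<^sub>R J1 w" for u v w
  proof -
    obtain T where T: "commutes T" "\<And>w. R u v w = \<Theta>1 u v *\<^sub>R J1 w + \<Theta>2 u v *\<^sub>R J2 w + \<Theta>3 u v *\<^sub>R J3 w + T w"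
      using dec[of u v] by blast
    note T' = T(1)[unfolded commutes_def, rule_format]
    show "R u v (J1 w) = J1 (R u v w) - (2 * \<Theta>2 u v) *\<^sub>R J3 w + (2 * \<Theta>3 u v) *\<^sub>R J2 w"
      "R u v (J2 w) = J2 (R u v w) - (2 * \<Theta>3 u v) *\<^sub>R J1 w + (2 * \<Theta>1 u v) *\<^sub>R J3 w"
      "R u v (J3 w) = J3 (R u v w) - (2 * \<Theta>1 u v) *\<^sub>R J2 w + (2 * \<Theta>2 u v) *\<^sub>R J1 w"
      by (rule G_eqI, simp add: T(2) T' J_simps G_lin algebra_simps)+
  qed
  define K where "K J Y = (1 / d) *\<^sub>R (\<Sum>e\<in>B. R e (J e) Y)" for J Y
  define Ric where "Ric Y = (\<Sum>e\<in>B. R Y e e)" for Y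
  \<comment> \<open>By pair symmetry the coefficients of the \<open>sp(1)\<close>-part are also
    contractions of \<open>R\<close> over its first two slots.\<close>
  have K\<Theta>: "G (K J1 Y) Z = \<Theta>1 Y Z" "G (K J2 Y) Z = \<Theta>2 Y Z" "G (K J3 Y) Z = \<Theta>3 Y Z" for Y Z
    using d by (simp_all add: K_def \<Theta>1_def \<Theta>2_def \<Theta>3_def G_lin G_sum_left pair[of Y Z])
  have K_eq: "d *\<^sub>R K J Y = - 2 *\<^sub>R (\<Sum>e\<in>B. R Y e (J e))"
    if "linear J" "\<And>u v. G (J u) v = - G u (J v)" for J Y
  proof -
    have "bilinear (\<lambda>u v. R u Y v)" by (simp add: bilinear_def lin)
    from frame_adjoint[OF B this, of J "\<lambda>v. - J v"] that
    have 1: "(\<Sum>e\<in>B. R (J e) Y e) = (\<Sum>e\<in>B. R Y e (J e))"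
      by (simp add: G_lin linear_neg[OF lin(3)] anti[of _ Y])
    have "R e (J e) Y = - R (J e) Y e - R Y e (J e)" for e
      using bianchi[of e "J e" Y] by (simp add: algebra_simps eq_neg_iff_add_eq_0)
    then have "d *\<^sub>R K J Y = (\<Sum>e\<in>B. - R (J e) Y e - R Y e (J e))" using d by (simp add: K_def)
    then show ?thesis by (simp add: sum_subtractf sum_negf 1 scaleR_2)
  qed
  have JK: "(\<Sum>e\<in>B. \<Theta>1 Y e *\<^sub>R J e) = J (K J1 Y)" "(\<Sum>e\<in>B. \<Theta>2 Y e *\<^sub>R J e) = J (K J2 Y)" "(\<Sum>e\<in>B. \<Theta>3 Y e *\<^sub>R J e) = J (K J3 Y)"
    if "linear J" for J :: "'e \<Rightarrow> 'e" and Y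
    using frame_linear[OF B that] by (simp_all flip: K\<Theta>)
  have JRic: "(\<Sum>e\<in>B. J (R Y e e)) = J (Ric Y)" if "linear J" for J :: "'e \<Rightarrow> 'e" and Y
    by (simp add: Ric_def linear_sum[OF that])
  \<comment> \<open>Commuting \<open>J\<close> past \<open>R Y e\<close> turns the contraction in
    \<open>K_eq\<close> into the Ricci contraction; the corrections in \<open>comm\<close>
    contribute the \<open>K\<close> of the two other structures.\<close>
  have E: "d *\<^sub>R K J1 Y = - 2 *\<^sub>R J1 (Ric Y) + 4 *\<^sub>R J3 (K J2 Y) - 4 *\<^sub>R J2 (K J3 Y)"
    "d *\<^sub>R K J2 Y = - 2 *\<^sub>R J2 (Ric Y) + 4 *\<^sub>R J1 (K J3 Y) - 4 *\<^sub>R J3 (K J1 Y)"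
    "d *\<^sub>R K J3 Y = - 2 *\<^sub>R J3 (Ric Y) + 4 *\<^sub>R J2 (K J1 Y) - 4 *\<^sub>R J1 (K J2 Y)" for Y
    unfolding K_eq[OF linear_J(1) J_skew(1)] K_eq[OF linear_J(2) J_skew(2)] K_eq[OF linear_J(3) J_skew(3)]
      comm sum.distrib sum_subtractf scaleR_scaleR[symmetric] scaleR_sum_right[symmetric]
    by (simp_all add: JK linear_J JRic algebra_simps)
  \<comment> \<open>The three equations \<open>E\<close>, subtracted from each other, carry the
    factor \<open>d - 4\<close> and show that \<open>J2\<close> and \<open>J3\<close> would define
    the same \<open>M\<close>. Substituting this back relates \<open>M\<close> to the Ricci
    contraction.\<close>
  define M where "M Y = - J1 (K J1 Y)" for Y
  have M: "K J1 Y = J1 (M Y)" "K J2 Y = J2 (M Y)" "K J3 Y = J3 (M Y)" "(d + 8) *\<^sub>R M Y = - 2 *\<^sub>R Ric Y" for Y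
  proof -
    have e: "G (d *\<^sub>R K J1 Y) z = G (- 2 *\<^sub>R J1 (Ric Y) + 4 *\<^sub>R J3 (K J2 Y) - 4 *\<^sub>R J2 (K J3 Y)) z"
      "G (d *\<^sub>R K J2 Y) z = G (- 2 *\<^sub>R J2 (Ric Y) + 4 *\<^sub>R J1 (K J3 Y) - 4 *\<^sub>R J3 (K J1 Y)) z"
      "G (d *\<^sub>R K J3 Y) z = G (- 2 *\<^sub>R J3 (Ric Y) + 4 *\<^sub>R J2 (K J1 Y) - 4 *\<^sub>R J1 (K J2 Y)) z" for z
      by (simp_all add: E)
    define p1 p2 p3 r where "p1 z = - G (J1 (K J1 Y)) z" and "p2 z = - G (J2 (K J2 Y)) z" and "p3 z = - G (J3 (K J3 Y)) z"
      and "r z = G (Ric Y) z" for z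
    have q: "d * p1 z = - 2 * r z - 4 * p2 z - 4 * p3 z" "d * p2 z = - 2 * r z - 4 * p3 z - 4 * p1 z"
      "d * p3 z = - 2 * r z - 4 * p1 z - 4 * p2 z" for z
      using e(1)[of "J1 z"] e(2)[of "J2 z"] e(3)[of "J3 z"]
      by (simp_all add: G_lin p1_def p2_def p3_def r_def J_iso J_skew J_simps)
    then have "(d - 4) * (p1 z - p2 z) = 0" "(d - 4) * (p1 z - p3 z) = 0" "(d + 8) * p1 z = - 2 * r z + 4 * (p1 z - p2 z) + 4 * (p1 z - p3 z)" for z
      using q(1)[of z] q(2)[of z] q(3)[of z] by (simp_all add: left_diff_distrib right_diff_distrib distrib_right)
    then have p: "p2 z = p1 z" "p3 z = p1 z" "(d + 8) * p1 z = - 2 * r z" for z using d by simp_all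
    show "K J1 Y = J1 (M Y)" by (simp add: M_def J_simps)
    show "K J2 Y = J2 (M Y)"
    proof (rule G_eqI)
      fix z show "G (K J2 Y) z = G (J2 (M Y)) z"
        using p(1)[of "J2 z"] by (simp add: M_def p1_def p2_def J_skew J_simps G_lin)
    qed
    show "K J3 Y = J3 (M Y)"
    proof (rule G_eqI)
      fix z show "G (K J3 Y) z = G (J3 (M Y)) z"
        using p(2)[of "J3 z"] by (simp add: M_def p1_def p3_def J_skew J_simps G_lin)
    qed
    show "(d + 8) *\<^sub>R M Y = - 2 *\<^sub>R Ric Y"
      by (rule G_eqI) (use p(3) in \<open>simp add: M_def p1_def r_def G_lin\<close>)
  qed
  have Mskew: "G (J1 (M a)) b = - G a (J1 (M b))" "G (J2 (M a)) b = - G a (J2 (M b))" "G (J3 (M a)) b = - G a (J3 (M b))" for a b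
  proof -
    have "\<Theta>1 a b = - \<Theta>1 b a" "\<Theta>2 a b = - \<Theta>2 b a" "\<Theta>3 a b = - \<Theta>3 b a"
      by (simp_all add: \<Theta>1_def \<Theta>2_def \<Theta>3_def anti[of a b] G_lin sum_negf)
    then show "G (J1 (M a)) b = - G a (J1 (M b))" "G (J2 (M a)) b = - G a (J2 (M b))" "G (J3 (M a)) b = - G a (J3 (M b))"
      using G_sym[of a] by (simp_all flip: M(1,2,3) K\<Theta>)
  qed
  \<comment> \<open>The traces that arise when \<open>J2\<close> is commuted past the sum of the
    \<open>R e (J1 e)\<close>. Computing \<open>J1 (M (J2 Y))\<close> in this way and also from
    \<open>Mskew\<close> determines \<open>M\<close>.\<close>
  define a b where "a = (\<Sum>e\<in>B. \<Theta>1 e (J1 e)) / d" and "b = - (\<Sum>e\<in>B. \<Theta>3 e (J1 e)) / d"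
  have "J1 (M (J2 Y)) = J3 (M Y)" for Y
  proof (rule G_eqI)
    fix z
    have "G (J1 (M (J2 Y))) z = - G (J2 Y) (J1 (M z))" by (rule Mskew)
    also have "\<dots> = - G Y (J3 (M z))" by (simp add: J_skew J_simps G_lin)
    also have "\<dots> = G (J3 (M Y)) z" using Mskew(3)[of Y z] by simp
    finally show "G (J1 (M (J2 Y))) z = G (J3 (M Y)) z" .
  qed
  moreover have "J1 (M (J2 Y)) = - J3 (M Y) + (2 * b) *\<^sub>R J1 Y + (2 * a) *\<^sub>R J3 Y" for Y
  proof -
    have "J1 (M (J2 Y)) = (1 / d) *\<^sub>R (\<Sum>e\<in>B. R e (J1 e) (J2 Y))" by (simp flip: M(1) add: K_def)
    also have "\<dots> = (1 / d) *\<^sub>R (J2 (\<Sum>e\<in>B. R e (J1 e) Y) - (2 * (\<Sum>e\<in>B. \<Theta>3 e (J1 e))) *\<^sub>R J1 Y + (2 * (\<Sum>e\<in>B. \<Theta>1 e (J1 e))) *\<^sub>R J3 Y)"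
      by (simp add: comm sum.distrib sum_subtractf linear_sum[OF linear_J(2)] sum_distrib_left scaleR_sum_left)
    also have "\<dots> = J2 (K J1 Y) + (2 * b) *\<^sub>R J1 Y + (2 * a) *\<^sub>R J3 Y"
      by (simp add: K_def J_lin a_def b_def algebra_simps)
    finally show ?thesis by (simp add: M J_simps)
  qed
  ultimately have "2 *\<^sub>R J3 (M Y) = 2 *\<^sub>R (b *\<^sub>R J1 Y + a *\<^sub>R J3 Y)" for Y
    by (simp add: scaleR_2 algebra_simps)
  then have "J3 (M Y) = b *\<^sub>R J1 Y + a *\<^sub>R J3 Y" for Y by simp
  from arg_cong[OF this, of J3] have MY: "M Y = a *\<^sub>R Y - b *\<^sub>R J2 Y" for Y
    by (simp add: J_simps algebra_simps minus_equation_iff[of "M Y"])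
  obtain v :: 'e where v: "v \<noteq> 0" using nonzero_vector by blast
  \<comment> \<open>By \<open>Mskew\<close> the map \<open>J2 (M Y)\<close> is skew in
    \<open>Y\<close>, whereas the summand \<open>- b *\<^sub>R J2 Y\<close> of \<open>M Y\<close>
    contributes \<open>b\<close> times the identity to it.\<close>
  have "b * G v v = 0" using Mskew(2)[of v v] by (simp add: MY J_simps G_lin J_orth)
  then have "b = 0" using G_pos[OF v] by simp
  then have M_a: "M Y = a *\<^sub>R Y" for Y using MY by simp
  show thesis
  proof (rule that[of a])
    fix Y Z
    have "\<Theta>1 Y Z = a * G (J1 Y) Z" "\<Theta>2 Y Z = a * G (J2 Y) Z" "\<Theta>3 Y Z = a * G (J3 Y) Z"
      by (simp_all add: M M_a J_simps G_lin flip: K\<Theta>)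
    then show "\<exists>T. linear T \<and> skew T \<and> commutes T \<and>
      (\<forall>u. R Y Z u = (a * G (J1 Y) Z) *\<^sub>R J1 u + (a * G (J2 Y) Z) *\<^sub>R J2 u + (a * G (J3 Y) Z) *\<^sub>R J3 u + T u)"
      using dec[of Y Z] by simp
  next
    fix Y
    have "Ric Y = (- 1 / 2) *\<^sub>R (- 2 *\<^sub>R Ric Y)" by simp
    also have "\<dots> = (- (d + 8) / 2 * a) *\<^sub>R Y" unfolding M(4)[symmetric] M_a
      by (intro G_eqI) (simp add: G_lin field_simps)
    finally show "(\<Sum>e\<in>B. R Y e e) = (- (real DIM('e) + 8) / 2 * a) *\<^sub>R Y"
      by (simp add: Ric_def d_def)
  qed
qed

text \<open>The contractions of \<open>pwedge\<close> that occur in traces of the integrability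
  condition. The factor \<open>4\<close> counts its four summands. In the last two formulas the
  plain wedge product contributes \<open>-1\<close> and the terms with a \<open>J\<close> contribute
  \<open>3\<close>; the sign of the final one is due to the skewness of \<open>A\<close>.\<close>

lemma frame_pwedge:
  assumes B: "frame B" and A: "linear A" "skew A" "commutes A" and T: "linear T" "skew T" "commutes T"
  shows "(\<Sum>e\<in>B. pwedge (T e) (A e) u) = 4 *\<^sub>R (T (A u) - A (T u))"
    "(\<Sum>e\<in>B. pwedge e (A (T e)) u) = 4 *\<^sub>R (A (T u) - T (A u))"
    "(\<Sum>e\<in>B. pwedge e Y e) = (real DIM('e) + 2) *\<^sub>R Y"
    "(\<Sum>e\<in>B. pwedge Y (A e) e) = - 2 *\<^sub>R A Y"
proof -
  note A' = A(3)[unfolded commutes_def, rule_format] and T' = T(3)[unfolded commutes_def, rule_format]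
  have sk: "G (A x) y = - G x (A y)" "G (T x) y = - G x (T y)" for x y using A(2) T(2) by (auto simp: skew_def)
  note A_lin = linear_diff[OF A(1)] linear_neg[OF A(1)] and T_lin = linear_diff[OF T(1)] linear_neg[OF T(1)]
  have fl: "(\<Sum>e\<in>B. G e x * G e y) = G x y" for x y
    using frame_linear_real[OF B G_linear(2)[of x], of y] by (simp add: G_sym)
  have fl1: "(\<Sum>e\<in>B. G x e * G e y) = G x y" "(\<Sum>e\<in>B. G e x * G y e) = G x y" "(\<Sum>e\<in>B. G x e * G y e) = G x y"
    for x y using fl[of x y] by (simp_all add: G_sym)
  note fls = fl fl1
  show "(\<Sum>e\<in>B. pwedge (T e) (A e) u) = 4 *\<^sub>R (T (A u) - A (T u))"
  proof (rule G_eqI)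
    fix v
    have *: "G (pwedge (T e) (A e) u) v =
       G e (T u) * G e (A v) - G e (A u) * G e (T v)
       + (G e (T (J1 u)) * G e (A (J1 v)) - G e (A (J1 u)) * G e (T (J1 v)))
       + (G e (T (J2 u)) * G e (A (J2 v)) - G e (A (J2 u)) * G e (T (J2 v)))
       + (G e (T (J3 u)) * G e (A (J3 v)) - G e (A (J3 u)) * G e (T (J3 v)))" for e
      by (simp add: pwedge_simps sk J_skew A' T' G_lin)
    show "G (\<Sum>e\<in>B. pwedge (T e) (A e) u) v = G (4 *\<^sub>R (T (A u) - A (T u))) v"
      unfolding G_sum_left * sum.distrib sum_subtractf fls
      by (simp add: A' T' J_iso G_lin sk)
  qed
  show "(\<Sum>e\<in>B. pwedge e (A (T e)) u) = 4 *\<^sub>R (A (T u) - T (A u))"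
  proof (rule G_eqI)
    fix v
    have *: "G (pwedge e (A (T e)) u) v =
       G e u * G e (T (A v)) - G e (T (A u)) * G e v
       + (G e (J1 u) * G e (T (A (J1 v))) - G e (T (A (J1 u))) * G e (J1 v))
       + (G e (J2 u) * G e (T (A (J2 v))) - G e (T (A (J2 u))) * G e (J2 v))
       + (G e (J3 u) * G e (T (A (J3 v))) - G e (T (A (J3 u))) * G e (J3 v))" for e
      by (simp add: pwedge_simps sk J_skew A' T' G_lin)
    have **: "G u (T (A v)) = G (A (T u)) v" by (simp add: sk G_lin)
    show "G (\<Sum>e\<in>B. pwedge e (A (T e)) u) v = G (4 *\<^sub>R (A (T u) - T (A u))) v"
      unfolding G_sum_left * sum.distrib sum_subtractf fls
      by (simp add: A' T' J_iso G_lin **)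
  qed
  show "(\<Sum>e\<in>B. pwedge e Y e) = (real DIM('e) + 2) *\<^sub>R Y"
  proof (rule G_eqI)
    fix v
    have *: "G (pwedge e Y e) v = G e e * G Y v - G e Y * G e v
        + G e (J1 Y) * G e (J1 v) + G e (J2 Y) * G e (J2 v) + G e (J3 Y) * G e (J3 v)" for e
    proof -
      have "G Y e = G e Y" "G (J1 Y) e = G e (J1 Y)" "G (J2 Y) e = G e (J2 Y)" "G (J3 Y) e = G e (J3 Y)"
        by (rule G_sym)+
      then show ?thesis by (simp only: pwedge_simps J_orth) (simp add: J_skew[of e])
    qed
    show "G (\<Sum>e\<in>B. pwedge e Y e) v = G ((real DIM('e) + 2) *\<^sub>R Y) v"
      unfolding G_sum_left * sum.distrib sum_subtractf fls sum_distrib_right[symmetric] frame_dim_real[OF B]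
      by (simp add: J_iso G_lin algebra_simps)
  qed
  show "(\<Sum>e\<in>B. pwedge Y (A e) e) = - 2 *\<^sub>R A Y"
  proof (rule G_eqI)
    fix v
    have "G (A e) e = 0" for e using sk(1)[of e e] G_sym[of e "A e"] by simp
    then have tr: "(\<Sum>e\<in>B. G (A e) e) = 0" by simp
    have trJ: "(\<Sum>e\<in>B. G (A e) (J1 e)) = 0" "(\<Sum>e\<in>B. G (A e) (J2 e)) = 0" "(\<Sum>e\<in>B. G (A e) (J3 e)) = 0"
      by (rule trace_commuting[OF B A(1,3)]; simp)+
    have *: "G (pwedge Y (A e) e) v = G (A e) (J1 e) * G (J1 Y) v + G (A e) (J2 e) * G (J2 Y) v
        + G (A e) (J3 e) * G (J3 Y) v - G (A e) e * G Y v - G e Y * G e (A v)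
        + G e (J1 Y) * G e (A (J1 v)) + G e (J2 Y) * G e (A (J2 v)) + G e (J3 Y) * G e (A (J3 v))" for e
    proof -
      have "G Y e = G e Y" "G (J1 Y) e = G e (J1 Y)" "G (J2 Y) e = G e (J2 Y)" "G (J3 Y) e = G e (J3 Y)"
        by (rule G_sym)+
      then show ?thesis
        by (simp only: pwedge_simps) (simp add: J_skew[of "A e"] sk(1)[of e "J1 v"] sk(1)[of e "J2 v"] sk(1)[of e "J3 v"] sk(1)[of e v])
    qed
    show "G (\<Sum>e\<in>B. pwedge Y (A e) e) v = G (- 2 *\<^sub>R A Y) v"
      unfolding G_sum_left * sum.distrib sum_subtractf fls sum_distrib_right[symmetric] tr trJ
      by (simp add: J_iso G_lin A' sk)
  qed
qed

text \<open>\<open>eq\<close> is the integrability condition of the first order equation, with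
  \<open>A\<close> in the role of \<open>\<nabla>X\<close>. Its \<open>Q\<close>-part determines
  \<open>A\<close> up to a skew part commuting with \<open>Q\<close>. Its commuting part contains
  the \<open>sp(n)\<close>-curvature, which is eliminated between two contractions.\<close>

lemma prolongation_algebra:
  assumes R_lin: "\<And>v w. linear (\<lambda>u. R u v w)" "\<And>u w. linear (\<lambda>v. R u v w)" "\<And>u v. linear (R u v)"
    and R_anti: "\<And>u v w. R u v w = - R v u w"
    and bianchi: "\<And>u v w. R u v w + R v w u + R w u v = 0"
    and R_dec: "\<And>Y Z. \<exists>T. linear T \<and> skew T \<and> commutes T \<and>
      (\<forall>u. R Y Z u = (m * G (J1 Y) Z) *\<^sub>R J1 u + (m * G (J2 Y) Z) *\<^sub>R J2 u + (m * G (J3 Y) Z) *\<^sub>R J3 u + T u)"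
    and B: "frame B"
    and Ric: "\<And>Y. (\<Sum>e\<in>B. R Y e e) = \<rho> *\<^sub>R Y"
    and \<Psi>: "linear \<Psi>" "skew \<Psi>" "normalises \<Psi>" and A: "linear A" and c: "c \<noteq> 0"
    and eq: "\<And>Y Z u. R Y Z (\<Psi> u) - \<Psi> (R Y Z u) =
      - (c *\<^sub>R (qwedge G J1 J2 J3 Z (A Y) u - qwedge G J1 J2 J3 Y (A Z) u))"
  shows "skew A" "normalises A" "A (\<Psi> u) = \<Psi> (A u)"
proof -
  obtain s1 s2 s3 T where T: "linear T" "skew T" "commutes T"
    and \<Psi>_eq: "\<And>u. \<Psi> u = s1 *\<^sub>R J1 u + s2 *\<^sub>R J2 u + s3 *\<^sub>R J3 u + T u"
    using decomposition[OF \<Psi>(3,2,1)] by metis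
  note T' = T(3)[unfolded commutes_def, rule_format]
  note T_lin = linear_add[OF T(1)] linear_diff[OF T(1)] linear_neg[OF T(1)] linear_scale[OF T(1)] linear_sum[OF T(1)]
  note A_lin = linear_add[OF A] linear_diff[OF A] linear_neg[OF A] linear_scale[OF A]
  \<comment> \<open>Shifting by \<open>m / c\<close> times the \<open>Q\<close>-part of
    \<open>\<Psi>\<close> absorbs the curvature terms of the three scalar equations in
    \<open>split\<close>; \<open>A'\<close> satisfies the homogeneous ones.\<close>
  define A' where "A' u = A u - (m / c) *\<^sub>R (s1 *\<^sub>R J1 u + s2 *\<^sub>R J2 u + s3 *\<^sub>R J3 u)" for u
  have A_eq: "A u = (m / c * s1) *\<^sub>R J1 u + (m / c * s2) *\<^sub>R J2 u + (m / c * s3) *\<^sub>R J3 u + A' u" for u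
    by (simp add: A'_def algebra_simps)
  have A'1: "linear A'" unfolding A'_def[abs_def]
    by (intro linear_compose_sub linear_compose_add A linear_compose_scale_right linear_J)
  note A'_lin = linear_add[OF A'1] linear_diff[OF A'1] linear_neg[OF A'1] linear_scale[OF A'1]
  \<comment> \<open>The components along \<open>J1\<close>, \<open>J2\<close>, \<open>J3\<close> and
    the part commuting with \<open>Q\<close>, separated by \<open>decomposition_unique\<close>. Only
    the last equation sees the \<open>sp(n)\<close>-part of the curvature.\<close>
  have split: "c * (G (J1 (A Y)) Z - G (J1 (A Z)) Y) + 2 * m * (G (J2 Y) Z * s3 - G (J3 Y) Z * s2) = 0"
     "c * (G (J2 (A Y)) Z - G (J2 (A Z)) Y) + 2 * m * (G (J3 Y) Z * s1 - G (J1 Y) Z * s3) = 0"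
     "c * (G (J3 (A Y)) Z - G (J3 (A Z)) Y) + 2 * m * (G (J1 Y) Z * s2 - G (J2 Y) Z * s1) = 0"
     "R Y Z (T u) - T (R Y Z u) + c *\<^sub>R (pwedge Z (A Y) u - pwedge Y (A Z) u) = 0" for Y Z u
  proof -
    obtain T1 where T1: "linear T1" "commutes T1"
      and RT: "\<And>u. R Y Z u = (m * G (J1 Y) Z) *\<^sub>R J1 u + (m * G (J2 Y) Z) *\<^sub>R J2 u + (m * G (J3 Y) Z) *\<^sub>R J3 u + T1 u"
      using R_dec[of Y Z] by blast
    note T1' = T1(2)[unfolded commutes_def, rule_format]
    define W where "W u = T1 (T u) - T (T1 u) + c *\<^sub>R (pwedge Z (A Y) u - pwedge Y (A Z) u)" for u
    have Wc: "commutes W"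
      using pwedge_commutes unfolding commutes_def W_def by (simp add: T' T1' J_lin)
    have Wz: "(c * (G (J1 (A Y)) Z - G (J1 (A Z)) Y) + 2 * m * (G (J2 Y) Z * s3 - G (J3 Y) Z * s2)) *\<^sub>R J1 u
      + (c * (G (J2 (A Y)) Z - G (J2 (A Z)) Y) + 2 * m * (G (J3 Y) Z * s1 - G (J1 Y) Z * s3)) *\<^sub>R J2 u
      + (c * (G (J3 (A Y)) Z - G (J3 (A Z)) Y) + 2 * m * (G (J1 Y) Z * s2 - G (J2 Y) Z * s1)) *\<^sub>R J3 u + W u = 0" for u
    proof -
      have "R Y Z (\<Psi> u) - \<Psi> (R Y Z u) + c *\<^sub>R (qwedge G J1 J2 J3 Z (A Y) u - qwedge G J1 J2 J3 Y (A Z) u) = 0"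
        by (simp add: eq)
      then have "G (R Y Z (\<Psi> u) - \<Psi> (R Y Z u) + c *\<^sub>R (qwedge G J1 J2 J3 Z (A Y) u - qwedge G J1 J2 J3 Y (A Z) u)) z = 0" for z
        by (simp add: G_lin)
      moreover have "qwedge G J1 J2 J3 V X u = pwedge V X u + (G (J1 X) V *\<^sub>R J1 u + G (J2 X) V *\<^sub>R J2 u + G (J3 X) V *\<^sub>R J3 u)" for V X
        by (simp add: pwedge_def)
      ultimately show ?thesis
        by (intro G_eqI)
          (simp add: W_def RT \<Psi>_eq G_lin J_simps T_lin linear_add[OF T1(1)] linear_scale[OF T1(1)] T' T1' algebra_simps)
    qed
    note uniq = decomposition_unique[OF Wc Wz]
    show "c * (G (J1 (A Y)) Z - G (J1 (A Z)) Y) + 2 * m * (G (J2 Y) Z * s3 - G (J3 Y) Z * s2) = 0"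
     "c * (G (J2 (A Y)) Z - G (J2 (A Z)) Y) + 2 * m * (G (J3 Y) Z * s1 - G (J1 Y) Z * s3) = 0"
     "c * (G (J3 (A Y)) Z - G (J3 (A Z)) Y) + 2 * m * (G (J1 Y) Z * s2 - G (J2 Y) Z * s1) = 0"
      by (rule uniq(1) uniq(2) uniq(3))+
    have "R Y Z (T u) - T (R Y Z u) = T1 (T u) - T (T1 u)"
      by (simp add: RT T_lin T' algebra_simps)
    then show "R Y Z (T u) - T (R Y Z u) + c *\<^sub>R (pwedge Z (A Y) u - pwedge Y (A Z) u) = 0"
      using uniq(4)[of u] by (simp only: W_def)
  qed
  have sym: "G (J1 (A' Y)) Z = G (J1 (A' Z)) Y" "G (J2 (A' Y)) Z = G (J2 (A' Z)) Y" "G (J3 (A' Y)) Z = G (J3 (A' Z)) Y" for Y Z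
  proof -
    have "c * (G (J1 (A' Y)) Z - G (J1 (A' Z)) Y) = 0" "c * (G (J2 (A' Y)) Z - G (J2 (A' Z)) Y) = 0"
      "c * (G (J3 (A' Y)) Z - G (J3 (A' Z)) Y) = 0"
      using split(1-3)[of Y Z] c J_swap[of Z Y] G_sym[of Z Y]
      by (simp_all add: A_eq G_lin J_simps algebra_simps)
    then show "G (J1 (A' Y)) Z = G (J1 (A' Z)) Y" "G (J2 (A' Y)) Z = G (J2 (A' Z)) Y" "G (J3 (A' Y)) Z = G (J3 (A' Z)) Y"
      using c by simp_all
  qed
  \<comment> \<open>The adjoint of \<open>A'\<close> is \<open>J A' J\<close> for each of the three
    structures. Equality of the three expressions forces \<open>A'\<close> to commute with them, and
    then the adjoint is \<open>- A'\<close>.\<close>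
  have A'_adj: "G (A' Y) Z = G (J1 (A' (J1 Z))) Y" "G (A' Y) Z = G (J2 (A' (J2 Z))) Y" "G (A' Y) Z = G (J3 (A' (J3 Z))) Y" for Y Z
    using sym(1)[of Y "J1 Z"] sym(2)[of Y "J2 Z"] sym(3)[of Y "J3 Z"] by (simp_all add: J_iso)
  then have JAJ: "J1 (A' (J1 Z)) = J2 (A' (J2 Z))" "J2 (A' (J2 Z)) = J3 (A' (J3 Z))" for Z
    by (intro G_eqI; metis)+
  have A'2: "commutes A'"
    unfolding commutes_def
  proof (intro allI conjI)
    fix w
    have "J2 (J2 (A' (J2 (J3 w)))) = J2 (J3 (A' (J3 (J3 w))))" "J3 (J3 (A' (J3 (J1 w)))) = J3 (J1 (A' (J1 (J1 w))))"
      "J1 (J1 (A' (J1 (J2 w)))) = J1 (J2 (A' (J2 (J2 w))))"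
      by (simp_all only: JAJ)
    then show "A' (J1 w) = J1 (A' w)" "A' (J2 w) = J2 (A' w)" "A' (J3 w) = J3 (A' w)"
      by (simp_all add: J_simps A'_lin)
  qed
  note A'' = A'2[unfolded commutes_def, rule_format]
  have A'3: "skew A'" unfolding skew_def
  proof (intro allI)
    fix Y Z
    have "G (A' Y) Z = - G (A' Z) Y" using A'_adj(1)[of Y Z] by (simp add: A'' J_sq G_lin)
    then show "G (A' Y) Z = - G Y (A' Z)" using G_sym[of Y "A' Z"] by simp
  qed
  show "skew A" using A'3 by (auto simp: skew_def A_eq G_lin J_skew)
  show "normalises A" by (rule normalisesI[OF A'1 A'3 A'2 A_eq])
  \<comment> \<open>The \<open>Q\<close>-part of \<open>A\<close> drops out because
    \<open>pwedge Z (J Y) u\<close> is symmetric in \<open>Y\<close> and \<open>Z\<close> for each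
    of the three structures.\<close>
  have RT: "R Y Z (T u) - T (R Y Z u) = - (c *\<^sub>R (pwedge Z (A' Y) u - pwedge Y (A' Z) u))" for Y Z u
  proof -
    have "pwedge Z (A Y) u - pwedge Y (A Z) u = pwedge Z (A' Y) u - pwedge Y (A' Z) u"
      by (rule G_eqI) (simp add: A_eq pwedge_simps G_lin J_simps algebra_simps)
    then show ?thesis using split(4)[of Y Z u] by (simp add: add_eq_0_iff2)
  qed
  \<comment> \<open>The unknown contraction of the curvature. Taking \<open>Y = e\<close>,
    \<open>Z = T e\<close> in \<open>RT\<close> gives its commutator with \<open>T\<close> in
    \<open>c1\<close>; taking \<open>Z = u = e\<close> gives \<open>S\<close> itself in
    \<open>c2\<close>, through the Bianchi identity and the Ricci contraction.\<close>
  define S where "S Y = (\<Sum>e\<in>B. R e (T e) Y)" for Y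
  have c1: "S (T u) - T (S u) = (8 * c) *\<^sub>R (A' (T u) - T (A' u))" for u
  proof -
    have "S (T u) - T (S u) = (\<Sum>e\<in>B. R e (T e) (T u) - T (R e (T e) u))"
      by (simp add: S_def sum_subtractf T_lin)
    also have "\<dots> = - (c *\<^sub>R ((\<Sum>e\<in>B. pwedge (T e) (A' e) u) - (\<Sum>e\<in>B. pwedge e (A' (T e)) u)))"
      by (simp add: RT sum_negf sum_subtractf flip: scaleR_sum_right)
    finally have e: "S (T u) - T (S u) = - (c *\<^sub>R (4 *\<^sub>R (T (A' u) - A' (T u)) - 4 *\<^sub>R (A' (T u) - T (A' u))))"
      unfolding frame_pwedge[OF B A'1 A'3 A'2 T] .
    show ?thesis unfolding e by (rule G_eqI) (simp add: G_lin algebra_simps)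
  qed
  have c2: "(1 / 2) *\<^sub>R S Y + \<rho> *\<^sub>R T Y = (c * (real DIM('e) + 4)) *\<^sub>R A' Y" for Y
  proof -
    have "bilinear (\<lambda>u v. R u Y v)" by (simp add: bilinear_def R_lin)
    from frame_adjoint[OF B this, of T "\<lambda>v. - T v"] T(2)
    have 1: "(\<Sum>e\<in>B. R (T e) Y e) = (\<Sum>e\<in>B. R Y e (T e))"
      by (simp add: skew_def G_lin linear_neg[OF R_lin(3)] R_anti[of _ Y])
    have "R e (T e) Y = - R (T e) Y e - R Y e (T e)" for e
      using bianchi[of e "T e" Y] by (simp add: algebra_simps eq_neg_iff_add_eq_0)
    then have "S Y = (\<Sum>e\<in>B. - R (T e) Y e - R Y e (T e))" by (simp add: S_def)
    then have S: "S Y = - 2 *\<^sub>R (\<Sum>e\<in>B. R Y e (T e))" by (simp add: sum_subtractf sum_negf 1 scaleR_2)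
    have "(\<Sum>e\<in>B. R Y e (T e)) - T (\<Sum>e\<in>B. R Y e e) = (\<Sum>e\<in>B. R Y e (T e) - T (R Y e e))"
      by (simp add: sum_subtractf T_lin)
    also have "\<dots> = - (c *\<^sub>R ((\<Sum>e\<in>B. pwedge e (A' Y) e) - (\<Sum>e\<in>B. pwedge Y (A' e) e)))"
      by (simp add: RT sum_negf sum_subtractf flip: scaleR_sum_right)
    finally have e: "(\<Sum>e\<in>B. R Y e (T e)) = \<rho> *\<^sub>R T Y - c *\<^sub>R ((real DIM('e) + 2) *\<^sub>R A' Y - - 2 *\<^sub>R A' Y)"
      unfolding frame_pwedge[OF B A'1 A'3 A'2 T] Ric by (simp add: T_lin algebra_simps)
    show ?thesis unfolding S e by (rule G_eqI) (simp add: G_lin algebra_simps)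
  qed
  have comm: "A' (T u) = T (A' u)" for u
  proof -
    define d where "d = real DIM('e)"
    have "c * d \<noteq> 0" using c by (simp add: d_def)
    have S: "S Y = (2 * c * (d + 4)) *\<^sub>R A' Y - (2 * \<rho>) *\<^sub>R T Y" for Y
      using arg_cong[OF c2[of Y], of "\<lambda>x. 2 *\<^sub>R x"] by (simp add: d_def scaleR_add_right eq_diff_eq mult.assoc)
    have "G (S (T u) - T (S u)) z = G ((8 * c) *\<^sub>R (A' (T u) - T (A' u))) z" for z using c1 by simp
    \<comment> \<open>The factor is \<open>2 * c * (d + 4) - 8 * c\<close>, the difference between
      the multiples of the commutator of \<open>A'\<close> and \<open>T\<close> that
      \<open>c2\<close> and \<open>c1\<close> yield.\<close>
    then have "2 * (c * d) * G (A' (T u) - T (A' u)) z = 0" for z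
      by (simp add: S T_lin G_lin algebra_simps)
    then have "G (A' (T u) - T (A' u)) z = 0" for z using \<open>c * d \<noteq> 0\<close> by simp
    then have "A' (T u) - T (A' u) = 0" by (intro G_eqI) (simp add: G_lin)
    then show ?thesis by simp
  qed
  show "A (\<Psi> u) = \<Psi> (A u)"
    by (rule G_eqI) (simp add: A_eq \<Psi>_eq comm A'_lin T_lin T' A'' J_simps G_lin algebra_simps)
qed

section \<open>Closure properties of \<open>in_Q\<close> and \<open>normalises\<close>\<close>

lemma in_QI: "(\<And>u. F u = a *\<^sub>R J1 u + b *\<^sub>R J2 u + c *\<^sub>R J3 u) \<Longrightarrow> in_Q F"
  unfolding in_Q_def by blast

lemma in_Q_scale: "in_Q F \<Longrightarrow> in_Q (\<lambda>u. r *\<^sub>R F u)"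
proof -
  assume "in_Q F"
  then obtain a b c where "\<And>u. F u = a *\<^sub>R J1 u + b *\<^sub>R J2 u + c *\<^sub>R J3 u" unfolding in_Q_def by blast
  then show ?thesis by (intro in_QI[of _ "r * a" "r * b" "r * c"]) (simp add: scaleR_add_right)
qed

lemma in_Q_J: "in_Q J1" "in_Q J2" "in_Q J3"
  by (rule in_QI[of _ 1 0 0], simp, rule in_QI[of _ 0 1 0], simp, rule in_QI[of _ 0 0 1], simp)

lemma in_Q_add: "in_Q F \<Longrightarrow> in_Q H \<Longrightarrow> in_Q (\<lambda>u. F u + H u)"
  using in_Q_add_scale[of F H 1] by simp

lemma in_Q_diff: "in_Q F \<Longrightarrow> in_Q H \<Longrightarrow> in_Q (\<lambda>u. F u - H u)"
  using in_Q_add_scale[of F H "-1"] by simp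

lemma normalises_in_Q:
  assumes "normalises \<Psi>" "linear \<Psi>" "in_Q F"
  shows "in_Q (\<lambda>u. \<Psi> (F u) - F (\<Psi> u))"
proof -
  obtain a b c where F: "\<And>u. F u = a *\<^sub>R J1 u + b *\<^sub>R J2 u + c *\<^sub>R J3 u"
    using assms(3) unfolding in_Q_def by blast
  have "(\<lambda>u. \<Psi> (F u) - F (\<Psi> u)) = (\<lambda>u. a *\<^sub>R (\<Psi> (J1 u) - J1 (\<Psi> u)) + b *\<^sub>R (\<Psi> (J2 u) - J2 (\<Psi> u)) + c *\<^sub>R (\<Psi> (J3 u) - J3 (\<Psi> u)))"
    by (simp add: F linear_add[OF assms(2)] linear_scale[OF assms(2)] algebra_simps)
  with assms(1) show ?thesis unfolding normalises_def by (simp add: in_Q_add in_Q_scale)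
qed

text \<open>\<open>sp(1) + sp(n)\<close> is a Lie algebra whose two summands commute with each
  other. In the \<open>Q\<close>-part the commutator is twice the cross product of the coefficient
  vectors.\<close>

lemma normalises_commutator:
  assumes A: "linear A" "skew A" "normalises A" and \<Psi>: "linear \<Psi>" "skew \<Psi>" "normalises \<Psi>"
  shows "skew (\<lambda>u. A (\<Psi> u) - \<Psi> (A u))" "normalises (\<lambda>u. A (\<Psi> u) - \<Psi> (A u))"
proof -
  have comm: "skew (\<lambda>u. A (\<Psi> u) - \<Psi> (A u))" if "skew A" "skew \<Psi>" for A \<Psi> :: "'e \<Rightarrow> 'e"
    unfolding skew_def
  proof (intro allI)
    fix u v
    note A = that(1)[unfolded skew_def, rule_format] and \<Psi> = that(2)[unfolded skew_def, rule_format]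
    show "G (A (\<Psi> u) - \<Psi> (A u)) v = - G u (A (\<Psi> v) - \<Psi> (A v))"
      using A[of "\<Psi> u" v] \<Psi>[of u "A v"] \<Psi>[of "A u" v] A[of u "\<Psi> v"] by (simp only: G_lin)
  qed
  show "skew (\<lambda>u. A (\<Psi> u) - \<Psi> (A u))" by (rule comm[OF A(2) \<Psi>(2)])
  obtain a1 a2 a3 S where S: "linear S" "skew S" "commutes S"
    and A_eq: "\<And>u. A u = a1 *\<^sub>R J1 u + a2 *\<^sub>R J2 u + a3 *\<^sub>R J3 u + S u"
    using decomposition[OF A(3,2,1)] by metis
  obtain b1 b2 b3 T where T: "linear T" "skew T" "commutes T"
    and \<Psi>_eq: "\<And>u. \<Psi> u = b1 *\<^sub>R J1 u + b2 *\<^sub>R J2 u + b3 *\<^sub>R J3 u + T u"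
    using decomposition[OF \<Psi>(3,2,1)] by metis
  note S' = S(3)[unfolded commutes_def, rule_format] and T' = T(3)[unfolded commutes_def, rule_format]
  show "normalises (\<lambda>u. A (\<Psi> u) - \<Psi> (A u))"
  proof (rule normalisesI)
    show "linear (\<lambda>u. S (T u) - T (S u))"
      using linear_compose_sub[OF linear_compose[OF T(1) S(1)] linear_compose[OF S(1) T(1)]] by (simp add: o_def)
    show "skew (\<lambda>u. S (T u) - T (S u))" by (rule comm[OF S(2) T(2)])
    show "commutes (\<lambda>u. S (T u) - T (S u))" by (simp add: commutes_def S' T' J_lin)
    show "A (\<Psi> u) - \<Psi> (A u) = (2 * (a2 * b3 - a3 * b2)) *\<^sub>R J1 u + (2 * (a3 * b1 - a1 * b3)) *\<^sub>R J2 u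
       + (2 * (a1 * b2 - a2 * b1)) *\<^sub>R J3 u + (S (T u) - T (S u))" for u
      by (rule G_eqI) (simp add: A_eq \<Psi>_eq S' T' linear_add[OF S(1)] linear_scale[OF S(1)]
          linear_add[OF T(1)] linear_scale[OF T(1)] J_simps G_lin algebra_simps)
  qed
qed

end

section \<open>Covariant derivatives on an open subset of a Euclidean space\<close>

text \<open>The connection is a parameter \<open>\<Gamma>\<close> and fields are functions on the
  Euclidean space, so that covariant derivatives can be iterated within one chart.\<close>

definition nabV :: "('e::euclidean_space \<Rightarrow> 'e \<Rightarrow> 'e \<Rightarrow> 'e) \<Rightarrow> ('e \<Rightarrow> 'e) \<Rightarrow> 'e \<Rightarrow> 'e \<Rightarrow> 'e" where
  "nabV \<Gamma> X x v = frechet_derivative X (at x) v + \<Gamma> x v (X x)"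

definition nabE :: "('e::euclidean_space \<Rightarrow> 'e \<Rightarrow> 'e \<Rightarrow> 'e) \<Rightarrow> ('e \<Rightarrow> 'e \<Rightarrow> 'e) \<Rightarrow> 'e \<Rightarrow> 'e \<Rightarrow> 'e \<Rightarrow> 'e" where
  "nabE \<Gamma> F x v u = frechet_derivative (\<lambda>y. F y u) (at x) v + \<Gamma> x v (F x u) - F x (\<Gamma> x v u)"

definition nab2 :: "('e::euclidean_space \<Rightarrow> 'e \<Rightarrow> 'e \<Rightarrow> 'e) \<Rightarrow> ('e \<Rightarrow> 'e \<Rightarrow> 'e \<Rightarrow> real) \<Rightarrow> 'e \<Rightarrow> 'e \<Rightarrow> 'e \<Rightarrow> 'e \<Rightarrow> real" where
  "nab2 \<Gamma> t x v a b = frechet_derivative (\<lambda>y. t y a b) (at x) v - t x (\<Gamma> x v a) b - t x a (\<Gamma> x v b)"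

locale local_metric =
  fixes S :: "'e::euclidean_space set" and G :: "'e \<Rightarrow> 'e \<Rightarrow> 'e \<Rightarrow> real" and \<Gamma> :: "'e \<Rightarrow> 'e \<Rightarrow> 'e \<Rightarrow> 'e"
  assumes open_S: "open S"
    and metric: "x \<in> S \<Longrightarrow> metric_form (G x)"
    and smooth_G: "smooth_on (\<lambda>x. G x u v) S"
    and \<Gamma>_bilinear: "x \<in> S \<Longrightarrow> bilinear (\<Gamma> x)"
    and \<Gamma>_sym: "x \<in> S \<Longrightarrow> \<Gamma> x u v = \<Gamma> x v u"
    and smooth_\<Gamma>: "smooth_on (\<lambda>x. \<Gamma> x u v) S"
    and \<Gamma>_metric: "x \<in> S \<Longrightarrow>
      frechet_derivative (\<lambda>y. G y u v) (at x) w = G x (\<Gamma> x w u) v + G x u (\<Gamma> x w v)"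
begin

lemma \<Gamma>_linear: "x \<in> S \<Longrightarrow> linear (\<Gamma> x v)" "x \<in> S \<Longrightarrow> linear (\<lambda>v. \<Gamma> x v u)"
  using \<Gamma>_bilinear by (auto simp: bilinear_def)

lemma \<Gamma>_lin:
  assumes "x \<in> S"
  shows "\<Gamma> x (a + b) u = \<Gamma> x a u + \<Gamma> x b u" "\<Gamma> x u (a + b) = \<Gamma> x u a + \<Gamma> x u b"
    "\<Gamma> x (r *\<^sub>R a) u = r *\<^sub>R \<Gamma> x a u" "\<Gamma> x u (r *\<^sub>R a) = r *\<^sub>R \<Gamma> x u a"
    "\<Gamma> x (a - b) u = \<Gamma> x a u - \<Gamma> x b u" "\<Gamma> x u (a - b) = \<Gamma> x u a - \<Gamma> x u b"
    "\<Gamma> x (- a) u = - \<Gamma> x a u" "\<Gamma> x u (- a) = - \<Gamma> x u a"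
  using \<Gamma>_linear[OF assms] by (auto simp: linear_add linear_scale linear_diff linear_neg
      linear_add[OF \<Gamma>_linear(2)[OF assms]] linear_scale[OF \<Gamma>_linear(2)[OF assms]]
      linear_diff[OF \<Gamma>_linear(2)[OF assms]] linear_neg[OF \<Gamma>_linear(2)[OF assms]])

lemma G_bilin: "x \<in> S \<Longrightarrow> linear (G x u)" "x \<in> S \<Longrightarrow> linear (\<lambda>u. G x u v)"
  using metric_form.bilinear_G[OF metric] by (auto simp: bilinear_def)

text \<open>A relational covariant derivative modelled on \<open>has_derivative\<close>. With the
  Christoffel term split off, rules such as \<open>cd_scaleR\<close> and \<open>cd_endfield\<close>
  can be chained without that term ever appearing.\<close>

definition cd :: "('e \<Rightarrow> 'e) \<Rightarrow> 'e \<Rightarrow> ('e \<Rightarrow> 'e) \<Rightarrow> bool" where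
  "cd X x X' \<longleftrightarrow> (X has_derivative (\<lambda>v. X' v - \<Gamma> x v (X x))) (at x)"

lemma cd_nabV: "smooth_on X S \<Longrightarrow> x \<in> S \<Longrightarrow> cd X x (nabV \<Gamma> X x)"
  unfolding cd_def nabV_def using smooth_on_has_derivative by auto

lemma cd_imp_nabV: "cd X x X' \<Longrightarrow> nabV \<Gamma> X x v = X' v"
  unfolding cd_def nabV_def by (simp add: frechet_derivative_eqI)

lemma cd_const: "cd (\<lambda>_. u) x (\<lambda>v. \<Gamma> x v u)"
  by (simp add: cd_def)

lemma cd_add: "x \<in> S \<Longrightarrow> cd X x X' \<Longrightarrow> cd Y x Y' \<Longrightarrow> cd (\<lambda>y. X y + Y y) x (\<lambda>v. X' v + Y' v)"
  unfolding cd_def by (rule has_derivative_eq_rhs[OF has_derivative_add]) (auto simp: \<Gamma>_lin)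

lemma cd_diff: "x \<in> S \<Longrightarrow> cd X x X' \<Longrightarrow> cd Y x Y' \<Longrightarrow> cd (\<lambda>y. X y - Y y) x (\<lambda>v. X' v - Y' v)"
  unfolding cd_def by (drule (1) has_derivative_diff) (auto simp: \<Gamma>_lin algebra_simps elim: has_derivative_eq_rhs)

lemma cd_scaleR: "x \<in> S \<Longrightarrow> (f has_derivative f') (at x) \<Longrightarrow> cd Y x Y' \<Longrightarrow>
    cd (\<lambda>y. f y *\<^sub>R Y y) x (\<lambda>v. f x *\<^sub>R Y' v + f' v *\<^sub>R Y x)"
  unfolding cd_def by (rule has_derivative_eq_rhs[OF has_derivative_scaleR]) (auto simp: \<Gamma>_lin algebra_simps)

lemma cd_cong:
  assumes "x \<in> S" "cd X x X'" "\<And>y. y \<in> S \<Longrightarrow> X y = Y y"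
  shows "cd Y x X'"
  using assms has_derivative_transform_within_open[OF _ open_S assms(1), of X _ UNIV Y] unfolding cd_def by simp

definition endfield :: "('e \<Rightarrow> 'e \<Rightarrow> 'e) \<Rightarrow> bool" where
  "endfield F \<longleftrightarrow> (\<forall>x\<in>S. linear (F x)) \<and> (\<forall>u. smooth_on (\<lambda>x. F x u) S)"

lemma endfieldD: "endfield F \<Longrightarrow> x \<in> S \<Longrightarrow> linear (F x)" "endfield F \<Longrightarrow> smooth_on (\<lambda>x. F x u) S"
  by (auto simp: endfield_def)

lemma endfield_apply: "endfield F \<Longrightarrow> smooth_on Y S \<Longrightarrow> smooth_on (\<lambda>y. F y (Y y)) S"
  using smooth_on_apply[OF open_S, of F Y] by (simp add: endfield_def)

lemma endfield_comp: "endfield F \<Longrightarrow> endfield H \<Longrightarrow> endfield (\<lambda>x u. F x (H x u))"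
  using endfield_apply[of F "\<lambda>x. H x u" for u] linear_compose[of "H _" "F _"]
  by (auto simp: endfield_def o_def)

lemma endfield_diff: "endfield F \<Longrightarrow> endfield H \<Longrightarrow> endfield (\<lambda>x u. F x u - H x u)"
  unfolding endfield_def by (auto intro!: linear_compose_sub smooth_on_diff open_S)

lemma endfield_scale: "endfield F \<Longrightarrow> endfield (\<lambda>x u. r *\<^sub>R F x u)"
  unfolding endfield_def by (auto intro!: linear_compose_scale_right smooth_on_scaleR open_S)

lemma smooth_\<Gamma>_apply:
  assumes "smooth_on X S" "smooth_on Y S"
  shows "smooth_on (\<lambda>y. \<Gamma> y (X y) (Y y)) S"
proof (rule smooth_on_apply[OF open_S _ _ assms(2)])
  show "smooth_on (\<lambda>y. \<Gamma> y (X y) u) S" for u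
    by (rule smooth_on_apply[OF open_S, of "\<lambda>y v. \<Gamma> y v u"]) (auto simp: \<Gamma>_linear smooth_\<Gamma> assms)
qed (rule \<Gamma>_linear)

lemma smooth_G_apply:
  assumes "smooth_on X S" "smooth_on Y S"
  shows "smooth_on (\<lambda>y. G y (X y) (Y y)) S"
proof (rule smooth_on_apply[OF open_S _ _ assms(2)])
  show "smooth_on (\<lambda>y. G y (X y) u) S" for u
    by (rule smooth_on_apply[OF open_S, of "\<lambda>y v. G y v u"]) (auto simp: G_bilin smooth_G assms)
qed (rule G_bilin)

lemma smooth_nabV: "smooth_on X S \<Longrightarrow> smooth_on (\<lambda>y. nabV \<Gamma> X y v) S"
  unfolding nabV_def
  by (intro smooth_on_add open_S smooth_on_frechet_derivative smooth_\<Gamma>_apply smooth_on_const)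

lemma linear_nabV: "smooth_on X S \<Longrightarrow> x \<in> S \<Longrightarrow> linear (nabV \<Gamma> X x)"
  unfolding nabV_def[abs_def]
  by (intro linear_compose_add smooth_on_linear_derivative \<Gamma>_linear)

lemma endfield_nabV: "smooth_on X S \<Longrightarrow> endfield (nabV \<Gamma> X)"
  by (simp add: endfield_def linear_nabV smooth_nabV)

lemma endfield_nabE:
  assumes "endfield F"
  shows "endfield (\<lambda>x. nabE \<Gamma> F x v)"
  unfolding endfield_def
proof (intro conjI ballI allI)
  fix x assume x: "x \<in> S"
  have "linear (\<lambda>u. frechet_derivative (\<lambda>y. F y u) (at x) v)"
    by (rule linear_family_derivative[OF open_S x])
      (auto intro: endfieldD[OF assms] smooth_on_differentiable[OF endfieldD(2)[OF assms] x])
  then show "linear (nabE \<Gamma> F x v)"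
    unfolding nabE_def[abs_def]
    using linear_compose[OF endfieldD(1)[OF assms x] \<Gamma>_linear(1)[OF x, of v]]
      linear_compose[OF \<Gamma>_linear(1)[OF x, of v] endfieldD(1)[OF assms x]]
    by (intro linear_compose_sub linear_compose_add) (auto simp: o_def)
next
  fix u
  show "smooth_on (\<lambda>x. nabE \<Gamma> F x v u) S"
    unfolding nabE_def
    by (intro smooth_on_diff smooth_on_add open_S smooth_on_frechet_derivative endfieldD(2)[OF assms]
        smooth_\<Gamma>_apply smooth_on_const endfield_apply[OF assms] smooth_\<Gamma>)
qed

lemma linear_nabE_direction:
  assumes "endfield F" "x \<in> S"
  shows "linear (\<lambda>v. nabE \<Gamma> F x v u)"
  unfolding nabE_def
  using linear_compose[OF \<Gamma>_linear(2)[OF assms(2), of u] endfieldD(1)[OF assms]]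
  by (intro linear_compose_sub linear_compose_add \<Gamma>_linear assms(2)
      smooth_on_linear_derivative[OF endfieldD(2)[OF assms(1)] assms(2)]) (auto simp: o_def)

lemma cd_endfield:
  assumes F: "endfield F" and x: "x \<in> S" and Y: "cd Y x Y'"
  shows "cd (\<lambda>y. F y (Y y)) x (\<lambda>v. nabE \<Gamma> F x v (Y x) + F x (Y' v))"
proof -
  have "((\<lambda>y. F y (Y y)) has_derivative
    (\<lambda>v. frechet_derivative (\<lambda>y. F y (Y x)) (at x) v + F x (Y' v - \<Gamma> x v (Y x)))) (at x)"
    using Y unfolding cd_def
    by (intro has_derivative_apply[OF open_S x, where M = F] endfieldD[OF F]
        smooth_on_has_derivative[OF endfieldD(2)[OF F] x]) auto
  then show ?thesis unfolding cd_def nabE_def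
    by (rule has_derivative_eq_rhs) (auto simp: linear_diff[OF endfieldD(1)[OF F x]])
qed

lemma cd_endfield_const: "endfield F \<Longrightarrow> x \<in> S \<Longrightarrow> cd (\<lambda>y. F y u) x (\<lambda>v. nabE \<Gamma> F x v u + F x (\<Gamma> x v u))"
  by (rule cd_endfield) (auto intro: cd_const)

text \<open>Reads off \<open>nabE\<close> from the values on a constant field \<open>u\<close>,
  whose own covariant derivative is \<open>\<Gamma> x v u\<close>.\<close>

lemma nabE_eqI:
  assumes "cd (\<lambda>y. F y u) x (\<lambda>v. F' v + F x (\<Gamma> x v u))"
  shows "nabE \<Gamma> F x v u = F' v"
  using cd_imp_nabV[OF assms, of v] by (simp add: nabE_def nabV_def algebra_simps)

lemma nabE_cong: "x \<in> S \<Longrightarrow> (\<And>y u. y \<in> S \<Longrightarrow> F y u = H y u) \<Longrightarrow> nabE \<Gamma> F x v u = nabE \<Gamma> H x v u"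
  unfolding nabE_def using frechet_derivative_cong_open[OF open_S, of x "\<lambda>y. F y u" "\<lambda>y. H y u"] by auto

lemma nabE_comp:
  assumes "endfield F" "endfield H" "x \<in> S"
  shows "nabE \<Gamma> (\<lambda>y u. F y (H y u)) x v u = nabE \<Gamma> F x v (H x u) + F x (nabE \<Gamma> H x v u)"
  using cd_endfield[OF assms(1,3) cd_endfield_const[OF assms(2,3)], of u]
  by (intro nabE_eqI) (simp add: linear_add[OF endfieldD(1)[OF assms(1,3)]] algebra_simps)

lemma nabE_diff:
  assumes "endfield F" "endfield H" "x \<in> S"
  shows "nabE \<Gamma> (\<lambda>y u. F y u - H y u) x v u = nabE \<Gamma> F x v u - nabE \<Gamma> H x v u"
  using cd_diff[OF assms(3) cd_endfield_const[OF assms(1,3)] cd_endfield_const[OF assms(2,3)], of u u]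
  by (intro nabE_eqI) (simp add: algebra_simps)

text \<open>The metric is parallel, hence no derivative of \<open>G\<close> appears: the Christoffel
  terms of \<open>\<Gamma>_metric\<close> cancel those hidden in \<open>cd\<close>.\<close>

lemma G_has_derivative:
  assumes x: "x \<in> S" and X: "cd X x X'" and Y: "cd Y x Y'"
  shows "((\<lambda>y. G y (X y) (Y y)) has_derivative (\<lambda>v. G x (X' v) (Y x) + G x (X x) (Y' v))) (at x)"
proof -
  interpret m: metric_form "G x" by (rule metric[OF x])
  have 1: "((\<lambda>y. G y u (Y y)) has_derivative
      (\<lambda>v. (G x (\<Gamma> x v u) (Y x) + G x u (\<Gamma> x v (Y x))) + G x u (Y' v - \<Gamma> x v (Y x)))) (at x)" for u
  proof (rule has_derivative_apply[OF open_S x, where M = "\<lambda>y. G y u"])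
    show "((\<lambda>y. G y u w) has_derivative (\<lambda>v. G x (\<Gamma> x v u) w + G x u (\<Gamma> x v w))) (at x)" for w
      using smooth_on_has_derivative[OF smooth_G[of u w] x] unfolding \<Gamma>_metric[OF x, of u w, abs_def] .
  qed (use Y in \<open>auto simp: cd_def G_bilin\<close>)
  have "((\<lambda>y. G y (X y) (Y y)) has_derivative
     (\<lambda>v. ((G x (\<Gamma> x v (X x)) (Y x) + G x (X x) (\<Gamma> x v (Y x))) + G x (X x) (Y' v - \<Gamma> x v (Y x)))
        + G x (X' v - \<Gamma> x v (X x)) (Y x))) (at x)"
    by (rule has_derivative_apply[OF open_S x, where M = "\<lambda>y u. G y u (Y y)"])
      (use 1 X in \<open>auto simp: cd_def G_bilin\<close>)
  then show ?thesis by (rule has_derivative_eq_rhs) (auto simp: m.G_lin)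
qed

text \<open>Raising an index commutes with covariant differentiation because the metric is
  parallel.\<close>

lemma nab2_eq_nabE:
  assumes F: "endfield F" and x: "x \<in> S" and t: "\<And>y a b. y \<in> S \<Longrightarrow> t y a b = G y (F y a) b"
  shows "nab2 \<Gamma> t x v a b = G x (nabE \<Gamma> F x v a) b"
proof -
  interpret m: metric_form "G x" by (rule metric[OF x])
  have "((\<lambda>y. G y (F y a) b) has_derivative
     (\<lambda>v. G x (nabE \<Gamma> F x v a + F x (\<Gamma> x v a)) b + G x (F x a) (\<Gamma> x v b))) (at x)"
    by (rule G_has_derivative[OF x cd_endfield_const[OF F x] cd_const])
  then have "frechet_derivative (\<lambda>y. t y a b) (at x) v =
     G x (nabE \<Gamma> F x v a + F x (\<Gamma> x v a)) b + G x (F x a) (\<Gamma> x v b)"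
    using frechet_derivative_cong_open[OF open_S x, of "\<lambda>y. t y a b" "\<lambda>y. G y (F y a) b"]
    by (simp add: t frechet_derivative_eqI)
  then show ?thesis by (simp add: nab2_def t[OF x] m.G_lin)
qed

lemma nabE_skew:
  assumes F: "endfield F" and x: "x \<in> S" and sk: "\<And>y a b. y \<in> S \<Longrightarrow> G y (F y a) b = - G y a (F y b)"
  shows "G x (nabE \<Gamma> F x v a) b = - G x a (nabE \<Gamma> F x v b)"
proof -
  interpret m: metric_form "G x" by (rule metric[OF x])
  have 1: "((\<lambda>y. G y (F y a) b + G y a (F y b)) has_derivative
     (\<lambda>v. (G x (nabE \<Gamma> F x v a + F x (\<Gamma> x v a)) b + G x (F x a) (\<Gamma> x v b))
      + (G x (\<Gamma> x v a) (F x b) + G x a (nabE \<Gamma> F x v b + F x (\<Gamma> x v b))))) (at x)"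
    by (intro has_derivative_add G_has_derivative[OF x] cd_endfield_const[OF F x] cd_const)
  have "((\<lambda>y. 0) has_derivative
     (\<lambda>v. (G x (nabE \<Gamma> F x v a + F x (\<Gamma> x v a)) b + G x (F x a) (\<Gamma> x v b))
      + (G x (\<Gamma> x v a) (F x b) + G x a (nabE \<Gamma> F x v b + F x (\<Gamma> x v b))))) (at x)"
    by (rule has_derivative_transform_within_open[OF 1 open_S x]) (simp add: sk)
  from has_derivative_unique[OF this has_derivative_const]
  have "G x (nabE \<Gamma> F x v a + F x (\<Gamma> x v a)) b + G x (F x a) (\<Gamma> x v b)
      + (G x (\<Gamma> x v a) (F x b) + G x a (nabE \<Gamma> F x v b + F x (\<Gamma> x v b))) = 0"
    by (metis (no_types))
  then show ?thesis using sk[OF x, of "\<Gamma> x v a" b] sk[OF x, of a "\<Gamma> x v b"] by (simp add: m.G_lin)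
qed

text \<open>\<open>\<Gamma> y v w\<close> is the covariant derivative of the constant field
  \<open>w\<close> along the constant field \<open>v\<close>. Constant fields commute, so the
  curvature has no bracket term.\<close>

definition R :: "'e \<Rightarrow> 'e \<Rightarrow> 'e \<Rightarrow> 'e \<Rightarrow> 'e" where
  "R x u v w = nabV \<Gamma> (\<lambda>y. \<Gamma> y v w) x u - nabV \<Gamma> (\<lambda>y. \<Gamma> y u w) x v"

lemma ricci_identity:
  assumes X: "smooth_on X S" and x: "x \<in> S"
  shows "nabV \<Gamma> (\<lambda>y. nabV \<Gamma> X y v) x u - nabV \<Gamma> (\<lambda>y. nabV \<Gamma> X y u) x v = R x u v (X x)"
proof -
  have D: "frechet_derivative (\<lambda>y. nabV \<Gamma> X y v) (at x) u =
     frechet_derivative (\<lambda>y. frechet_derivative X (at y) v) (at x) u +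
     (frechet_derivative (\<lambda>y. \<Gamma> y v (X x)) (at x) u + \<Gamma> x v (frechet_derivative X (at x) u))" for u v
  proof -
    have "((\<lambda>y. \<Gamma> y v (X y)) has_derivative
        (\<lambda>u. frechet_derivative (\<lambda>y. \<Gamma> y v (X x)) (at x) u + \<Gamma> x v (frechet_derivative X (at x) u))) (at x)"
      by (intro has_derivative_apply[OF open_S x, where M = "\<lambda>y. \<Gamma> y v"] \<Gamma>_linear
          smooth_on_has_derivative[OF smooth_\<Gamma> x] smooth_on_has_derivative[OF X x])
    from has_derivative_add[OF smooth_on_has_derivative[OF smooth_on_frechet_derivative[OF X, of v] x] this]
    show ?thesis unfolding nabV_def by (simp add: frechet_derivative_eqI)
  qed
  show ?thesis
    unfolding nabV_def[of _ "\<lambda>y. nabV \<Gamma> X y _"] D R_def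
    using second_derivative_symmetric[OF open_S X x, of u v]
    by (simp add: nabV_def \<Gamma>_lin[OF x] algebra_simps)
qed

text \<open>The curvature acts on endomorphisms by the commutator. This is
  \<open>ricci_identity\<close> for the vector field \<open>F y w\<close>, after the derivatives of
  the constant field \<open>w\<close> have been separated.\<close>

lemma nabE_ricci:
  assumes F: "endfield F" and x: "x \<in> S"
  shows "nabE \<Gamma> (\<lambda>y. nabE \<Gamma> F y v) x u w - nabE \<Gamma> (\<lambda>y. nabE \<Gamma> F y u) x v w = R x u v (F x w) - F x (R x u v w)"
proof -
  have e: "nabV \<Gamma> (\<lambda>y. F y w) y v = nabE \<Gamma> F y v w + F y (\<Gamma> y v w)" for y v
    by (simp add: nabE_def nabV_def)
  have s: "smooth_on (\<lambda>y. \<Gamma> y v w) S" for v by (rule smooth_\<Gamma>)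
  have "nabV \<Gamma> (\<lambda>y. nabV \<Gamma> (\<lambda>y. F y w) y v) x u =
     (nabE \<Gamma> (\<lambda>y. nabE \<Gamma> F y v) x u w + nabE \<Gamma> F x v (\<Gamma> x u w)) +
     (nabE \<Gamma> F x u (\<Gamma> x v w) + F x (nabV \<Gamma> (\<lambda>y. \<Gamma> y v w) x u))" for u v
    unfolding e
    by (rule cd_imp_nabV[OF cd_add[OF x cd_endfield_const[OF endfield_nabE[OF F] x]
          cd_endfield[OF F x cd_nabV[OF s x]]]])
  then show ?thesis
    using ricci_identity[OF endfieldD(2)[OF F] x, of w v u]
    by (simp add: R_def linear_diff[OF endfieldD(1)[OF F x]] algebra_simps)
qed

lemma R_anti: "R x u v w = - R x v u w"
  by (simp add: R_def)

lemma R_linear: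
  assumes x: "x \<in> S"
  shows "linear (\<lambda>u. R x u v w)" "linear (\<lambda>v. R x u v w)" "linear (R x u v)"
proof -
  have D1: "linear (\<lambda>w. frechet_derivative (\<lambda>y. \<Gamma> y v w) (at x) u)" for u v
    by (rule linear_family_derivative[OF open_S x \<Gamma>_linear(1) smooth_on_differentiable[OF smooth_\<Gamma> x]])
  have D2: "linear (\<lambda>v. frechet_derivative (\<lambda>y. \<Gamma> y v w) (at x) u)" for u w
    by (rule linear_family_derivative[OF open_S x \<Gamma>_linear(2) smooth_on_differentiable[OF smooth_\<Gamma> x]])
  have D3: "linear (frechet_derivative (\<lambda>y. \<Gamma> y v w) (at x))" for v w
    by (rule smooth_on_linear_derivative[OF smooth_\<Gamma> x])
  have C: "linear (\<lambda>w. \<Gamma> x u (\<Gamma> x v w))" "linear (\<lambda>v. \<Gamma> x u (\<Gamma> x v w))" "linear (\<lambda>u. \<Gamma> x u (\<Gamma> x v w))" for u v w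
    using linear_compose[OF \<Gamma>_linear(1)[OF x, of v] \<Gamma>_linear(1)[OF x, of u]]
      linear_compose[OF \<Gamma>_linear(2)[OF x, of w] \<Gamma>_linear(1)[OF x, of u]] \<Gamma>_linear(2)[OF x]
    by (auto simp: o_def)
  show "linear (\<lambda>u. R x u v w)" "linear (\<lambda>v. R x u v w)" "linear (R x u v)"
    unfolding R_def[abs_def] nabV_def by (intro linear_compose_sub linear_compose_add D1 D2 D3 C)+
qed

lemma R_bianchi:
  assumes x: "x \<in> S"
  shows "R x u v w + R x v w u + R x w u v = 0"
proof -
  have "frechet_derivative (\<lambda>y. \<Gamma> y u v) (at x) = frechet_derivative (\<lambda>y. \<Gamma> y v u) (at x)" for u v
    by (rule frechet_derivative_cong_open[OF open_S x \<Gamma>_sym])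
  from this[of v w] this[of w u] this[of u v] show ?thesis
    by (simp add: R_def nabV_def \<Gamma>_sym[OF x, of v w] \<Gamma>_sym[OF x, of w u] \<Gamma>_sym[OF x, of u v])
qed

text \<open>Second derivatives of \<open>G y a b\<close> are symmetric. Written with the connection,
  the products of two Christoffel terms are symmetric by themselves, and what remains is the
  skewness of the curvature.\<close>

lemma R_skew:
  assumes x: "x \<in> S"
  shows "G x (R x u v a) b = - G x a (R x u v b)"
proof -
  interpret m: metric_form "G x" by (rule metric[OF x])
  have D: "frechet_derivative (\<lambda>y. frechet_derivative (\<lambda>y. G y a b) (at y) v) (at x) u =
     (G x (nabV \<Gamma> (\<lambda>y. \<Gamma> y v a) x u) b + G x (\<Gamma> x v a) (\<Gamma> x u b)) +
     (G x (\<Gamma> x u a) (\<Gamma> x v b) + G x a (nabV \<Gamma> (\<lambda>y. \<Gamma> y v b) x u))" for u v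
  proof -
    have "frechet_derivative (\<lambda>y. frechet_derivative (\<lambda>y. G y a b) (at y) v) (at x) =
       frechet_derivative (\<lambda>y. G y (\<Gamma> y v a) b + G y a (\<Gamma> y v b)) (at x)"
      by (rule frechet_derivative_cong_open[OF open_S x]) (rule \<Gamma>_metric)
    also have "\<dots> = (\<lambda>u. (G x (nabV \<Gamma> (\<lambda>y. \<Gamma> y v a) x u) b + G x (\<Gamma> x v a) (\<Gamma> x u b)) +
     (G x (\<Gamma> x u a) (\<Gamma> x v b) + G x a (nabV \<Gamma> (\<lambda>y. \<Gamma> y v b) x u)))"
      by (intro frechet_derivative_eqI has_derivative_add G_has_derivative[OF x] cd_const
          cd_nabV[OF smooth_\<Gamma> x])
    finally show ?thesis by simp
  qed
  show ?thesis
    using second_derivative_symmetric[OF open_S smooth_G x, of a b v u]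
    unfolding D R_def by (simp add: m.G_lin)
qed

text \<open>Kostant's identity for Killing fields. The defect \<open>C\<close> is symmetric in its
  two arguments by the Ricci and Bianchi identities, and skew with respect to the metric because
  both of its terms are; such a tensor vanishes.\<close>

lemma nabV_killing:
  assumes X: "smooth_on X S" and x: "x \<in> S"
    and sk: "\<And>y a b. y \<in> S \<Longrightarrow> G y (nabV \<Gamma> X y a) b = - G y a (nabV \<Gamma> X y b)"
  shows "nabE \<Gamma> (nabV \<Gamma> X) x u v = R x u (X x) v"
proof -
  interpret m: metric_form "G x" by (rule metric[OF x])
  define B where "B u v = nabE \<Gamma> (nabV \<Gamma> X) x u v" for u v
  define C where "C u v = B u v - R x u (X x) v" for u v
  have "B u v - B v u = R x u v (X x)" for u v
    using ricci_identity[OF X x, of v u] unfolding B_def nabE_def nabV_def[of _ "\<lambda>y. nabV \<Gamma> X y _"]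
    by (simp add: \<Gamma>_sym[OF x, of u v])
  note B_anti = this
  have C_sym: "C u v = C v u" for u v
  proof -
    have "C u v - C v u = (B u v - B v u) - R x u (X x) v + R x v (X x) u" by (simp add: C_def)
    also have "\<dots> = R x u v (X x) + R x v (X x) u + R x (X x) u v"
      unfolding B_anti R_anti[of x u "X x" v] by simp
    finally show ?thesis using R_bianchi[OF x, of u v "X x"] by simp
  qed
  have C_skew: "G x (C u v) w = - G x (C u w) v" for u v w
  proof -
    have "G x (C u v) w = - G x v (C u w)"
      unfolding C_def B_def m.G_lin
      using nabE_skew[OF endfield_nabV[OF X] x sk, of u v w] R_skew[OF x, of u "X x" v w] by simp
    then show ?thesis using m.G_sym[of v "C u w"] by linarith
  qed
  have "G x (C u v) w = 0" for w
  proof -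
    have "G x (C u v) w = - G x (C w u) v" using C_skew[of u v w] unfolding C_sym[of u w] .
    also have "\<dots> = G x (C v w) u" using C_skew[of w u v] unfolding C_sym[of w v] by linarith
    also have "\<dots> = - G x (C u v) w" using C_skew[of v w u] unfolding C_sym[of v u] .
    finally show ?thesis by simp
  qed
  then have "C u v = 0" by (intro m.G_eqI) (simp add: m.G_lin)
  then show ?thesis by (simp add: C_def B_def)
qed

end

section \<open>Quaternionic structures on an open subset of a Euclidean space\<close>

locale local_qk = local_metric S G \<Gamma>
  for S :: "'e::euclidean_space set" and G :: "'e \<Rightarrow> 'e \<Rightarrow> 'e \<Rightarrow> real" and \<Gamma> :: "'e \<Rightarrow> 'e \<Rightarrow> 'e \<Rightarrow> 'e" +
  fixes J1 J2 J3 :: "'e \<Rightarrow> 'e \<Rightarrow> 'e"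
  assumes quat: "x \<in> S \<Longrightarrow> quaternionic_space (G x) (J1 x) (J2 x) (J3 x)"
    and endfield_J: "endfield J1" "endfield J2" "endfield J3"
    and nabE_J: "x \<in> S \<Longrightarrow> quaternionic_space.in_Q (J1 x) (J2 x) (J3 x) (nabE \<Gamma> J1 x v)"
      "x \<in> S \<Longrightarrow> quaternionic_space.in_Q (J1 x) (J2 x) (J3 x) (nabE \<Gamma> J2 x v)"
      "x \<in> S \<Longrightarrow> quaternionic_space.in_Q (J1 x) (J2 x) (J3 x) (nabE \<Gamma> J3 x v)"
begin

abbreviation "in_Q x \<equiv> quaternionic_space.in_Q (J1 x) (J2 x) (J3 x)"
abbreviation "normalises x \<equiv> quaternionic_space.normalises (J1 x) (J2 x) (J3 x)"
abbreviation "skew x \<equiv> quaternionic_space.skew (G x)"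
abbreviation "q x \<equiv> qwedge (G x) (J1 x) (J2 x) (J3 x)"

text \<open>At each point the coefficients of \<open>F\<close> in the triple are only known to
  exist. Recovered as traces they become smooth functions, and the Leibniz rule reduces the claim to
  the \<open>nabE_J\<close>.\<close>

lemma nabE_in_Q:
  assumes F: "endfield F" and Q: "\<And>y. y \<in> S \<Longrightarrow> in_Q y (F y)" and x: "x \<in> S"
  shows "in_Q x (nabE \<Gamma> F x v)"
proof -
  interpret x: quaternionic_space "G x" "J1 x" "J2 x" "J3 x" by (rule quat[OF x])
  \<comment> \<open>A trace formula as in \<open>trace_coefficient\<close>, but over the fixed
    \<open>Basis\<close>; the minus sign comes from moving the skew \<open>J\<close> across the
    metric.\<close>
  define f where "f J y = - (\<Sum>b\<in>Basis. J y (F y b) \<bullet> b) / real DIM('e)" for J :: "'e \<Rightarrow> 'e \<Rightarrow> 'e" and y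
  have sm: "smooth_on (f J) S" if "endfield J" for J
  proof -
    have "smooth_on (\<lambda>y. (- 1 / real DIM('e)) * (\<Sum>b\<in>Basis. J y (F y b) \<bullet> b)) S"
      by (intro smooth_on_mult smooth_on_const smooth_on_sum smooth_on_inner open_S endfield_apply[OF that] endfieldD(2)[OF F])
    then show ?thesis by (simp add: f_def[abs_def])
  qed
  have F_eq: "F y u = f J1 y *\<^sub>R J1 y u + f J2 y *\<^sub>R J2 y u + f J3 y *\<^sub>R J3 y u" if y: "y \<in> S" for y u
  proof -
    interpret y: quaternionic_space "G y" "J1 y" "J2 y" "J3 y" by (rule quat[OF y])
    obtain B where B: "y.frame B" using y.frame_exists by blast
    obtain a b c where abc: "\<And>u. F y u = a *\<^sub>R J1 y u + b *\<^sub>R J2 y u + c *\<^sub>R J3 y u"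
      using Q[OF y] unfolding y.in_Q_def by blast
    have tr: "f J y = (\<Sum>e\<in>B. G y (F y e) (J y e)) / real DIM('e)"
      if "linear (J y)" "\<And>u v. G y (J y u) v = - G y u (J y v)" for J
    proof -
      have "linear (\<lambda>b. J y (F y b))" using linear_compose[OF endfieldD(1)[OF F y] that(1)] by (simp add: o_def)
      from y.frame_Basis_trace[OF B this] show ?thesis unfolding f_def by (simp add: that(2) sum_negf)
    qed
    have z: "y.commutes (\<lambda>_. 0)" "linear (\<lambda>_. 0 :: 'e)"
      by (simp_all add: y.commutes_def y.J_lin linear_iff)
    have "F y u = a *\<^sub>R J1 y u + b *\<^sub>R J2 y u + c *\<^sub>R J3 y u + 0" for u by (simp add: abc)
    from y.trace_coefficient[OF B z(2,1) this]
    have "f J1 y = a" "f J2 y = b" "f J3 y = c"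
      using tr[of J1] tr[of J2] tr[of J3] y.linear_J y.J_skew by simp_all
    then show ?thesis by (simp add: abc)
  qed
  define D where "D J = frechet_derivative (f J) (at x)" for J
  have c: "cd (\<lambda>y. F y u) x (\<lambda>v. (f J1 x *\<^sub>R (nabE \<Gamma> J1 x v u + J1 x (\<Gamma> x v u)) + D J1 v *\<^sub>R J1 x u) +
      (f J2 x *\<^sub>R (nabE \<Gamma> J2 x v u + J2 x (\<Gamma> x v u)) + D J2 v *\<^sub>R J2 x u) +
      (f J3 x *\<^sub>R (nabE \<Gamma> J3 x v u + J3 x (\<Gamma> x v u)) + D J3 v *\<^sub>R J3 x u))" for u
  proof (rule cd_cong[OF x])
    show "cd (\<lambda>y. f J1 y *\<^sub>R J1 y u + f J2 y *\<^sub>R J2 y u + f J3 y *\<^sub>R J3 y u) x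
      (\<lambda>v. (f J1 x *\<^sub>R (nabE \<Gamma> J1 x v u + J1 x (\<Gamma> x v u)) + D J1 v *\<^sub>R J1 x u) +
      (f J2 x *\<^sub>R (nabE \<Gamma> J2 x v u + J2 x (\<Gamma> x v u)) + D J2 v *\<^sub>R J2 x u) +
      (f J3 x *\<^sub>R (nabE \<Gamma> J3 x v u + J3 x (\<Gamma> x v u)) + D J3 v *\<^sub>R J3 x u))"
      unfolding D_def
      by (intro cd_add cd_scaleR x cd_endfield_const endfield_J smooth_on_has_derivative[OF sm x])
  qed (simp add: F_eq)
  have "nabE \<Gamma> F x v u = (f J1 x *\<^sub>R nabE \<Gamma> J1 x v u + D J1 v *\<^sub>R J1 x u) +
      (f J2 x *\<^sub>R nabE \<Gamma> J2 x v u + D J2 v *\<^sub>R J2 x u) +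
      (f J3 x *\<^sub>R nabE \<Gamma> J3 x v u + D J3 v *\<^sub>R J3 x u)" for u
    using cd_imp_nabV[OF c, of u v] by (simp add: nabE_def[of _ F] nabV_def F_eq[OF x] algebra_simps)
  then have e: "nabE \<Gamma> F x v = (\<lambda>u. (f J1 x *\<^sub>R nabE \<Gamma> J1 x v u + D J1 v *\<^sub>R J1 x u) +
      (f J2 x *\<^sub>R nabE \<Gamma> J2 x v u + D J2 v *\<^sub>R J2 x u) +
      (f J3 x *\<^sub>R nabE \<Gamma> J3 x v u + D J3 v *\<^sub>R J3 x u))" by (rule ext)
  show ?thesis unfolding e by (intro x.in_Q_add x.in_Q_scale x.in_Q_J nabE_J[OF x])
qed

text \<open>By \<open>nabE_ricci\<close> the commutator of the curvature with a \<open>J\<close> is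
  an antisymmetrised second covariant derivative of \<open>J\<close>, and covariant derivatives do
  not leave \<open>Q\<close>.\<close>

lemma R_normalises:
  assumes x: "x \<in> S"
  shows "normalises x (R x u v)"
proof -
  interpret x: quaternionic_space "G x" "J1 x" "J2 x" "J3 x" by (rule quat[OF x])
  have "in_Q x (\<lambda>w. R x u v (J x w) - J x (R x u v w))" if J: "endfield J" and Q: "\<And>y v. y \<in> S \<Longrightarrow> in_Q y (nabE \<Gamma> J y v)" for J
    unfolding nabE_ricci[OF J x, symmetric]
    by (intro x.in_Q_diff nabE_in_Q[OF endfield_nabE[OF J] Q x])
  then show ?thesis unfolding x.normalises_def using endfield_J nabE_J by blast
qed

text \<open>The commutator of \<open>F\<close> with a \<open>J\<close> is a section of
  \<open>Q\<close>, hence so is its derivative. Solving for the commutator of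
  \<open>nabE \<Gamma> F x v\<close> with \<open>J\<close> leaves only a term that is in
  \<open>Q\<close> by \<open>normalises_in_Q\<close>.\<close>

lemma nabE_normalises:
  assumes F: "endfield F" and nrm: "\<And>y. y \<in> S \<Longrightarrow> normalises y (F y)" and x: "x \<in> S"
  shows "normalises x (nabE \<Gamma> F x v)"
proof -
  interpret x: quaternionic_space "G x" "J1 x" "J2 x" "J3 x" by (rule quat[OF x])
  have "in_Q x (\<lambda>w. nabE \<Gamma> F x v (J x w) - J x (nabE \<Gamma> F x v w))"
    if J: "endfield J" and Q: "in_Q x (nabE \<Gamma> J x v)" and n: "\<And>y. y \<in> S \<Longrightarrow> in_Q y (\<lambda>u. F y (J y u) - J y (F y u))" for J
  proof -
    have "nabE \<Gamma> (\<lambda>y u. F y (J y u) - J y (F y u)) x v w =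
       (nabE \<Gamma> F x v (J x w) + F x (nabE \<Gamma> J x v w)) - (nabE \<Gamma> J x v (F x w) + J x (nabE \<Gamma> F x v w))" for w
      by (simp add: nabE_diff endfield_comp F J x nabE_comp)
    then have e: "(\<lambda>w. nabE \<Gamma> F x v (J x w) - J x (nabE \<Gamma> F x v w)) =
       (\<lambda>w. nabE \<Gamma> (\<lambda>y u. F y (J y u) - J y (F y u)) x v w - (F x (nabE \<Gamma> J x v w) - nabE \<Gamma> J x v (F x w)))"
      by (simp add: fun_eq_iff)
    have "in_Q x (nabE \<Gamma> (\<lambda>y u. F y (J y u) - J y (F y u)) x v)"
      by (rule nabE_in_Q[OF endfield_diff[OF endfield_comp[OF F J] endfield_comp[OF J F]] n x])
    moreover have "in_Q x (\<lambda>w. F x (nabE \<Gamma> J x v w) - nabE \<Gamma> J x v (F x w))"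
      by (rule x.normalises_in_Q[OF nrm[OF x] endfieldD(1)[OF F x] Q])
    ultimately show ?thesis unfolding e by (rule x.in_Q_diff)
  qed
  moreover have "in_Q y (\<lambda>u. F y (J1 y u) - J1 y (F y u))" "in_Q y (\<lambda>u. F y (J2 y u) - J2 y (F y u))"
    "in_Q y (\<lambda>u. F y (J3 y u) - J3 y (F y u))" if "y \<in> S" for y
    using nrm[OF that] unfolding quaternionic_space.normalises_def[OF quat[OF that]] by auto
  ultimately show ?thesis unfolding x.normalises_def
    using endfield_J nabE_J(1)[OF x, of v] nabE_J(2)[OF x, of v] nabE_J(3)[OF x, of v] by simp
qed

text \<open>\<open>qwedge\<close> is parallel. The triple is not, but its covariant derivatives
  rotate it by an antisymmetric matrix, which cancels in the sums over the three structures just as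
  in \<open>qwedge_equivariant\<close>.\<close>

lemma cd_qwedge:
  assumes x: "x \<in> S" and Y: "cd Y x Y'" and X: "cd X x X'" and W: "cd W x W'"
  shows "cd (\<lambda>y. q y (Y y) (X y) (W y)) x
    (\<lambda>v. q x (Y' v) (X x) (W x) + q x (Y x) (X' v) (W x) + q x (Y x) (X x) (W' v))"
proof -
  interpret x: quaternionic_space "G x" "J1 x" "J2 x" "J3 x" by (rule quat[OF x])
  have var: "\<exists>a b c. (\<forall>u. nabE \<Gamma> J1 x v u = a *\<^sub>R J2 x u + b *\<^sub>R J3 x u) \<and>
    (\<forall>u. nabE \<Gamma> J2 x v u = - a *\<^sub>R J1 x u + c *\<^sub>R J3 x u) \<and> (\<forall>u. nabE \<Gamma> J3 x v u = - b *\<^sub>R J1 x u - c *\<^sub>R J2 x u)" for v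
  proof -
    \<comment> \<open>The relations between the \<open>J\<close> hold at every point of
      \<open>S\<close>, and differentiating them shows that the covariant derivative is a derivation
      on the triple.\<close>
    have d: "nabE \<Gamma> J x v (K x u) + J x (nabE \<Gamma> K x v u) = nabE \<Gamma> L x v u"
      if "endfield J" "endfield K" "\<And>y u. y \<in> S \<Longrightarrow> J y (K y u) = L y u" for J K L u
      using nabE_comp[OF that(1,2) x, of v u] nabE_cong[OF x that(3)] by simp
    have z: "nabE \<Gamma> (\<lambda>y u. - u) x v u = 0" for u
      by (simp add: nabE_def frechet_derivative_const \<Gamma>_lin[OF x])
    note qs = quaternionic_space.J_sq[OF quat] quaternionic_space.J_mult[OF quat]
    have "nabE \<Gamma> J1 x v (J2 x u) + J1 x (nabE \<Gamma> J2 x v u) = nabE \<Gamma> J3 x v u"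
      "nabE \<Gamma> J1 x v (J1 x u) + J1 x (nabE \<Gamma> J1 x v u) = 0" "nabE \<Gamma> J2 x v (J2 x u) + J2 x (nabE \<Gamma> J2 x v u) = 0"
      "nabE \<Gamma> J3 x v (J3 x u) + J3 x (nabE \<Gamma> J3 x v u) = 0" for u
      using d[OF endfield_J(1,2), of J3 u] d[OF endfield_J(1,1), of "\<lambda>y u. - u" u] d[OF endfield_J(2,2), of "\<lambda>y u. - u" u]
        d[OF endfield_J(3,3), of "\<lambda>y u. - u" u] by (simp_all add: qs z)
    then show ?thesis
      using x.derivation_antisymmetric[of "nabE \<Gamma> J1 x v" "nabE \<Gamma> J2 x v" "nabE \<Gamma> J3 x v"] nabE_J[OF x] by metis
  qed
  define K1 K2 K3 where "K1 v = nabE \<Gamma> J1 x v" and "K2 v = nabE \<Gamma> J2 x v" and "K3 v = nabE \<Gamma> J3 x v" for v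
  define U V T where "U = Y x" and "V = X x" and "T = W x"
  note cdJ = cd_endfield[OF endfield_J(1) x] cd_endfield[OF endfield_J(2) x] cd_endfield[OF endfield_J(3) x]
  \<comment> \<open>\<open>?D v\<close> has exactly the shape in which the rules for
    \<open>cd\<close> produce it; the cancellation is left to the algebra that follows.\<close>
  have "cd (\<lambda>y. q y (Y y) (X y) (W y)) x (\<lambda>v.
     (((G x U T *\<^sub>R X' v + (G x (Y' v) T + G x U (W' v)) *\<^sub>R V) - (G x V T *\<^sub>R Y' v + (G x (X' v) T + G x V (W' v)) *\<^sub>R U))
     + ((G x (J1 x U) T *\<^sub>R (K1 v V + J1 x (X' v)) + (G x (K1 v U + J1 x (Y' v)) T + G x (J1 x U) (W' v)) *\<^sub>R J1 x V)
       - (G x (J1 x V) T *\<^sub>R (K1 v U + J1 x (Y' v)) + (G x (K1 v V + J1 x (X' v)) T + G x (J1 x V) (W' v)) *\<^sub>R J1 x U))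
     + ((G x (J2 x U) T *\<^sub>R (K2 v V + J2 x (X' v)) + (G x (K2 v U + J2 x (Y' v)) T + G x (J2 x U) (W' v)) *\<^sub>R J2 x V)
       - (G x (J2 x V) T *\<^sub>R (K2 v U + J2 x (Y' v)) + (G x (K2 v V + J2 x (X' v)) T + G x (J2 x V) (W' v)) *\<^sub>R J2 x U))
     + ((G x (J3 x U) T *\<^sub>R (K3 v V + J3 x (X' v)) + (G x (K3 v U + J3 x (Y' v)) T + G x (J3 x U) (W' v)) *\<^sub>R J3 x V)
       - (G x (J3 x V) T *\<^sub>R (K3 v U + J3 x (Y' v)) + (G x (K3 v V + J3 x (X' v)) T + G x (J3 x V) (W' v)) *\<^sub>R J3 x U)))
     + ((G x (J1 x V) U *\<^sub>R (K1 v T + J1 x (W' v)) + (G x (K1 v V + J1 x (X' v)) U + G x (J1 x V) (Y' v)) *\<^sub>R J1 x T)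
       + (G x (J2 x V) U *\<^sub>R (K2 v T + J2 x (W' v)) + (G x (K2 v V + J2 x (X' v)) U + G x (J2 x V) (Y' v)) *\<^sub>R J2 x T)
       + (G x (J3 x V) U *\<^sub>R (K3 v T + J3 x (W' v)) + (G x (K3 v V + J3 x (X' v)) U + G x (J3 x V) (Y' v)) *\<^sub>R J3 x T)))"
    (is "cd _ _ ?D")
    unfolding qwedge_def U_def V_def T_def K1_def K2_def K3_def
    by (intro cd_add cd_diff cd_scaleR x G_has_derivative cdJ Y X W)
  moreover have "?D v = q x (Y' v) (X x) (W x) + q x (Y x) (X' v) (W x) + q x (Y x) (X x) (W' v)" for v
  proof (rule x.G_eqI)
    fix z
    obtain a b c where "\<And>u. K1 v u = a *\<^sub>R J2 x u + b *\<^sub>R J3 x u" "\<And>u. K2 v u = - a *\<^sub>R J1 x u + c *\<^sub>R J3 x u"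
      "\<And>u. K3 v u = - b *\<^sub>R J1 x u - c *\<^sub>R J2 x u" using var[of v] unfolding K1_def K2_def K3_def by blast
    note K = this
    show "G x (?D v) z = G x (q x (Y' v) (X x) (W x) + q x (Y x) (X' v) (W x) + q x (Y x) (X x) (W' v)) z"
      unfolding U_def[symmetric] V_def[symmetric] T_def[symmetric] x.G_lin x.qwedge_simps K
      by (simp add: algebra_simps)
  qed
  ultimately show ?thesis by simp
qed

text \<open>
  The endomorphism \<open>\<Psi>\<close> stands for the two-form \<open>G (\<Psi> \<cdot>) \<cdot>\<close>; for \<open>c = 1 / (DIM('e) - 1)\<close> this form is
  compatible and conformal-Killing, with codifferential \<open>X\<close>.
\<close>

definition ck_pair :: "real \<Rightarrow> ('e \<Rightarrow> 'e \<Rightarrow> 'e) \<Rightarrow> ('e \<Rightarrow> 'e) \<Rightarrow> bool" where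
  "ck_pair c \<Psi> X \<longleftrightarrow> endfield \<Psi> \<and> smooth_on X S \<and>
     (\<forall>x\<in>S. skew x (\<Psi> x) \<and> normalises x (\<Psi> x) \<and> (\<forall>v u. nabE \<Gamma> \<Psi> x v u = - (c *\<^sub>R q x v (X x) u)))"

lemma ck_pairD:
  assumes "ck_pair c \<Psi> X"
  shows "endfield \<Psi>" "smooth_on X S" "x \<in> S \<Longrightarrow> skew x (\<Psi> x)" "x \<in> S \<Longrightarrow> normalises x (\<Psi> x)"
    "x \<in> S \<Longrightarrow> nabE \<Gamma> \<Psi> x v u = - (c *\<^sub>R q x v (X x) u)"
  using assms by (auto simp: ck_pair_def)

lemma nabE_qwedge:
  assumes X: "smooth_on X S" and Z: "smooth_on Z S" and x: "x \<in> S"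
  shows "nabE \<Gamma> (\<lambda>y u. q y (Z y) (X y) u) x v u = q x (nabV \<Gamma> Z x v) (X x) u + q x (Z x) (nabV \<Gamma> X x v) u"
  by (rule nabE_eqI) (rule cd_qwedge[OF x cd_nabV[OF Z x] cd_nabV[OF X x] cd_const])

text \<open>The first order equation is differentiated once more, \<open>qwedge\<close> being
  parallel, and antisymmetrised. By \<open>nabE_ricci\<close> the left-hand side is then the
  curvature acting on \<open>\<Psi>\<close>, and the terms with \<open>\<Gamma> x Y Z\<close> cancel
  by symmetry.\<close>

lemma ck_pair_curvature:
  assumes ck: "ck_pair c \<Psi> X" and x: "x \<in> S"
  shows "R x Y Z (\<Psi> x u) - \<Psi> x (R x Y Z u) =
    - (c *\<^sub>R (q x Z (nabV \<Gamma> X x Y) u - q x Y (nabV \<Gamma> X x Z) u))"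
proof -
  interpret x: quaternionic_space "G x" "J1 x" "J2 x" "J3 x" by (rule quat[OF x])
  note d = ck_pairD[OF ck]
  have e: "nabE \<Gamma> (\<lambda>y. nabE \<Gamma> \<Psi> y w) x v u = - (c *\<^sub>R (q x (\<Gamma> x v w) (X x) u + q x w (nabV \<Gamma> X x v) u))" for v w
  proof -
    have "cd (\<lambda>y. (- c) *\<^sub>R q y w (X y) u) x
       (\<lambda>v. (- c) *\<^sub>R (q x (\<Gamma> x v w) (X x) u + q x w (nabV \<Gamma> X x v) u + q x w (X x) (\<Gamma> x v u)) + 0 *\<^sub>R q x w (X x) u)"
      by (intro cd_scaleR x cd_qwedge cd_const cd_nabV d has_derivative_const)
    then have "cd (\<lambda>y. nabE \<Gamma> \<Psi> y w u) x
       (\<lambda>v. (- c) *\<^sub>R (q x (\<Gamma> x v w) (X x) u + q x w (nabV \<Gamma> X x v) u + q x w (X x) (\<Gamma> x v u)) + 0 *\<^sub>R q x w (X x) u)"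
      by (rule cd_cong[OF x]) (simp add: d(5))
    then show ?thesis
      by (intro nabE_eqI) (simp add: d(5)[OF x] algebra_simps)
  qed
  show ?thesis
    unfolding nabE_ricci[OF d(1) x, symmetric] e \<Gamma>_sym[OF x, of Y Z] by (simp add: algebra_simps)
qed

lemma ck_pair_prolongation:
  assumes ck: "ck_pair c \<Psi> X" and c: "c \<noteq> 0" and x: "x \<in> S"
  shows "skew x (nabV \<Gamma> X x)" "normalises x (nabV \<Gamma> X x)" "nabV \<Gamma> X x (\<Psi> x u) = \<Psi> x (nabV \<Gamma> X x u)"
proof -
  interpret x: quaternionic_space "G x" "J1 x" "J2 x" "J3 x" by (rule quat[OF x])
  note d = ck_pairD[OF ck]
  obtain B where B: "x.frame B" using x.frame_exists by blast
  have sk: "x.skew (R x u v)" for u v unfolding x.skew_def using R_skew[OF x] by blast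
  obtain m where m: "\<And>Y Z. \<exists>T. linear T \<and> x.skew T \<and> x.commutes T \<and>
      (\<forall>u. R x Y Z u = (m * G x (J1 x Y) Z) *\<^sub>R J1 x u + (m * G x (J2 x Y) Z) *\<^sub>R J2 x u + (m * G x (J3 x Y) Z) *\<^sub>R J3 x u + T u)"
    and ric: "\<And>Y. (\<Sum>e\<in>B. R x Y e e) = (- (real DIM('e) + 8) / 2 * m) *\<^sub>R Y"
    by (rule x.curvature_algebra[OF R_linear[OF x] R_anti sk R_bianchi[OF x] R_normalises[OF x] B]) (rule that)
  note * = x.prolongation_algebra[OF R_linear[OF x] R_anti R_bianchi[OF x] m B ric
      endfieldD(1)[OF d(1) x] d(3)[OF x] d(4)[OF x] linear_nabV[OF d(2) x] c ck_pair_curvature[OF ck x]]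
  show "skew x (nabV \<Gamma> X x)" "normalises x (nabV \<Gamma> X x)" "nabV \<Gamma> X x (\<Psi> x u) = \<Psi> x (nabV \<Gamma> X x u)"
    by (rule *)+
qed

text \<open>The endomorphism is the Lie derivative of \<open>\<Psi>2\<close> along
  \<open>X1\<close>: the covariant derivative along \<open>X1\<close>, which the first order
  equation provides, minus the commutator with \<open>nabV \<Gamma> X1\<close>. That it solves the
  same equation combines \<open>nabV_killing\<close> for \<open>X1\<close>, the integrability
  condition for \<open>\<Psi>2\<close>, and the equivariance of \<open>qwedge\<close> under
  \<open>nabV \<Gamma> X1\<close>.\<close>

lemma ck_pair_bracket:
  assumes ck1: "ck_pair c \<Psi>1 X1" and ck2: "ck_pair c \<Psi>2 X2" and c: "c \<noteq> 0"
  shows "ck_pair c (\<lambda>x u. (- c) *\<^sub>R q x (X1 x) (X2 x) u - (nabV \<Gamma> X1 x (\<Psi>2 x u) - \<Psi>2 x (nabV \<Gamma> X1 x u)))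
    (\<lambda>x. nabV \<Gamma> X2 x (X1 x) - nabV \<Gamma> X1 x (X2 x))"
proof -
  note d1 = ck_pairD[OF ck1] and d2 = ck_pairD[OF ck2]
  note p1 = ck_pair_prolongation[OF ck1 c] and p2 = ck_pair_prolongation[OF ck2 c]
  note eA1 = endfield_nabV[OF d1(2)] and eA2 = endfield_nabV[OF d2(2)]
  have eq: "endfield (\<lambda>x. q x (X1 x) (X2 x))"
    unfolding endfield_def
  proof (intro conjI ballI allI)
    fix x assume "x \<in> S"
    then show "linear (q x (X1 x) (X2 x))" by (rule quaternionic_space.linear_qwedge(1)[OF quat])
  next
    fix u show "smooth_on (\<lambda>x. q x (X1 x) (X2 x) u) S"
      unfolding qwedge_def
      by (intro smooth_on_add smooth_on_diff smooth_on_scaleR open_S smooth_G_apply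
          endfield_apply[OF endfield_J(1) d1(2)] endfield_apply[OF endfield_J(2) d1(2)] endfield_apply[OF endfield_J(3) d1(2)]
          endfield_apply[OF endfield_J(1) d2(2)] endfield_apply[OF endfield_J(2) d2(2)] endfield_apply[OF endfield_J(3) d2(2)]
          endfieldD(2)[OF endfield_J(1)] endfieldD(2)[OF endfield_J(2)] endfieldD(2)[OF endfield_J(3)]
          d1(2) d2(2) smooth_on_const)
  qed
  have eC: "endfield (\<lambda>x u. nabV \<Gamma> X1 x (\<Psi>2 x u) - \<Psi>2 x (nabV \<Gamma> X1 x u))"
    by (rule endfield_diff[OF endfield_comp[OF eA1 d2(1)] endfield_comp[OF d2(1) eA1]])
  have e\<Phi>: "endfield (\<lambda>x u. (- c) *\<^sub>R q x (X1 x) (X2 x) u - (nabV \<Gamma> X1 x (\<Psi>2 x u) - \<Psi>2 x (nabV \<Gamma> X1 x u)))"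
    using endfield_diff[OF endfield_scale[OF eq] eC] .
  show ?thesis
    unfolding ck_pair_def
  proof (intro conjI ballI allI)
    show "smooth_on (\<lambda>x. nabV \<Gamma> X2 x (X1 x) - nabV \<Gamma> X1 x (X2 x)) S"
      by (intro smooth_on_diff open_S endfield_apply[OF eA1 d2(2)] endfield_apply[OF eA2 d1(2)])
  next
    fix x assume x: "x \<in> S"
    interpret x: quaternionic_space "G x" "J1 x" "J2 x" "J3 x" by (rule quat[OF x])
    have lA: "linear (nabV \<Gamma> X1 x)" "linear (\<Psi>2 x)" using linear_nabV[OF d1(2) x] endfieldD(1)[OF d2(1) x] .
    note comm = x.normalises_commutator[OF lA(1) p1(1,2)[OF x] lA(2) d2(3,4)[OF x]]
    show "skew x (\<lambda>u. (- c) *\<^sub>R q x (X1 x) (X2 x) u - (nabV \<Gamma> X1 x (\<Psi>2 x u) - \<Psi>2 x (nabV \<Gamma> X1 x u)))"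
      using x.qwedge_skew comm(1) unfolding x.skew_def by (simp add: x.G_lin)
    have n: "normalises x (\<lambda>u. (nabV \<Gamma> X1 x (\<Psi>2 x u) - \<Psi>2 x (nabV \<Gamma> X1 x u)) + c *\<^sub>R q x (X1 x) (X2 x) u)"
      by (rule x.normalises_add_scale[OF comm(2) x.qwedge_normalises])
    have "normalises x (\<lambda>u. (nabV \<Gamma> X1 x (\<Psi>2 x u) - \<Psi>2 x (nabV \<Gamma> X1 x u)) + c *\<^sub>R q x (X1 x) (X2 x) u
       + (- 2) *\<^sub>R ((nabV \<Gamma> X1 x (\<Psi>2 x u) - \<Psi>2 x (nabV \<Gamma> X1 x u)) + c *\<^sub>R q x (X1 x) (X2 x) u))"
      by (rule x.normalises_add_scale[OF n n])
    \<comment> \<open>Negation by means of \<open>normalises_add_scale\<close>: twice the map is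
      subtracted from the map itself.\<close>
    moreover have "w + (- 2) *\<^sub>R w = - w" for w :: 'e by (simp add: scaleR_2)
    ultimately show "normalises x (\<lambda>u. (- c) *\<^sub>R q x (X1 x) (X2 x) u - (nabV \<Gamma> X1 x (\<Psi>2 x u) - \<Psi>2 x (nabV \<Gamma> X1 x u)))"
      by (simp only: minus_add minus_diff_eq) (simp add: algebra_simps)
    fix v u
    define A1 A2 P where "A1 = nabV \<Gamma> X1 x" and "A2 = nabV \<Gamma> X2 x" and "P = \<Psi>2 x"
    have k: "nabE \<Gamma> (nabV \<Gamma> X1) x v w = R x v (X1 x) w" for w
      by (rule nabV_killing[OF d1(2) x]) (use p1(1) in \<open>simp add: quaternionic_space.skew_def[OF quat]\<close>)
    have cur: "R x v (X1 x) (P u) - P (R x v (X1 x) u) = - (c *\<^sub>R (q x (X1 x) (A2 v) u - q x v (A2 (X1 x)) u))"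
      unfolding A2_def P_def by (rule ck_pair_curvature[OF ck2 x])
    have equi: "A1 (q x v (X2 x) u) - q x v (X2 x) (A1 u) = q x (A1 v) (X2 x) u + q x v (A1 (X2 x)) u"
      unfolding A1_def by (rule x.qwedge_equivariant[OF lA(1) p1(1,2)[OF x]])
    have "nabE \<Gamma> (\<lambda>x u. (- c) *\<^sub>R q x (X1 x) (X2 x) u - (nabV \<Gamma> X1 x (\<Psi>2 x u) - \<Psi>2 x (nabV \<Gamma> X1 x u))) x v u =
       nabE \<Gamma> (\<lambda>x u. (- c) *\<^sub>R q x (X1 x) (X2 x) u) x v u -
       ((nabE \<Gamma> (nabV \<Gamma> X1) x v (P u) + A1 (nabE \<Gamma> \<Psi>2 x v u)) - (nabE \<Gamma> \<Psi>2 x v (A1 u) + P (nabE \<Gamma> (nabV \<Gamma> X1) x v u)))"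
      unfolding A1_def P_def
      by (simp only: nabE_diff[OF endfield_scale[OF eq] eC x] nabE_diff[OF endfield_comp[OF eA1 d2(1)] endfield_comp[OF d2(1) eA1] x]
          nabE_comp[OF eA1 d2(1) x] nabE_comp[OF d2(1) eA1 x])
    also have "nabE \<Gamma> (\<lambda>x u. (- c) *\<^sub>R q x (X1 x) (X2 x) u) x v u = - (c *\<^sub>R (q x (A1 v) (X2 x) u + q x (X1 x) (A2 v) u))"
    proof -
      \<comment> \<open>The factor \<open>- c\<close> is treated as composition with a multiple of
        the identity, which is parallel, so that \<open>nabE_comp\<close> applies.\<close>
      have "endfield (\<lambda>y u. (- c) *\<^sub>R u)"
        unfolding endfield_def by (auto intro!: linear_compose_scale_right linear_id[unfolded id_def])
      from nabE_comp[OF this eq x, of v u] have "nabE \<Gamma> (\<lambda>x u. (- c) *\<^sub>R q x (X1 x) (X2 x) u) x v u =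
         nabE \<Gamma> (\<lambda>y u. (- c) *\<^sub>R u) x v (q x (X1 x) (X2 x) u) - c *\<^sub>R nabE \<Gamma> (\<lambda>x. q x (X1 x) (X2 x)) x v u" by simp
      moreover have "nabE \<Gamma> (\<lambda>y u. (- c) *\<^sub>R u) x v w = 0" for w
        by (simp add: nabE_def \<Gamma>_lin[OF x])
      ultimately show ?thesis using nabE_qwedge[OF d2(2) d1(2) x, of v u]
        by (simp add: A1_def A2_def)
    qed
    also have "- (c *\<^sub>R (q x (A1 v) (X2 x) u + q x (X1 x) (A2 v) u)) -
        ((nabE \<Gamma> (nabV \<Gamma> X1) x v (P u) + A1 (nabE \<Gamma> \<Psi>2 x v u)) - (nabE \<Gamma> \<Psi>2 x v (A1 u) + P (nabE \<Gamma> (nabV \<Gamma> X1) x v u))) =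
        - (c *\<^sub>R (q x (A1 v) (X2 x) u + q x (X1 x) (A2 v) u)) - (R x v (X1 x) (P u) - P (R x v (X1 x) u))
        + c *\<^sub>R (A1 (q x v (X2 x) u) - q x v (X2 x) (A1 u))"
      unfolding k d2(5)[OF x] using linear_neg[OF lA(1)] linear_scale[OF lA(1)]
      by (simp add: A1_def algebra_simps)
    also have "\<dots> = - (c *\<^sub>R q x v (A2 (X1 x) - A1 (X2 x)) u)"
      unfolding cur equi linear_diff[OF x.linear_qwedge(3)] by (simp add: algebra_simps)
    finally show "nabE \<Gamma> (\<lambda>x u. (- c) *\<^sub>R q x (X1 x) (X2 x) u - (nabV \<Gamma> X1 x (\<Psi>2 x u) - \<Psi>2 x (nabV \<Gamma> X1 x u))) x v u =
       - (c *\<^sub>R q x v (nabV \<Gamma> X2 x (X1 x) - nabV \<Gamma> X1 x (X2 x)) u)"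
      by (simp add: A1_def A2_def)
  qed (use e\<Phi> in auto)
qed

lemma ck_pair_zero: "ck_pair c (\<lambda>x u. 0) (\<lambda>x. 0)"
  unfolding ck_pair_def
proof (intro conjI ballI allI)
  show "endfield (\<lambda>x u. 0)" by (simp add: endfield_def linear_iff)
  fix x assume x: "x \<in> S"
  interpret x: quaternionic_space "G x" "J1 x" "J2 x" "J3 x" by (rule quat[OF x])
  show "skew x (\<lambda>u. 0)" by (simp add: x.skew_def x.G_lin)
  have "in_Q x (\<lambda>u. 0)" by (rule x.in_QI[of _ 0 0 0]) simp
  then show "normalises x (\<lambda>u. 0)" by (simp add: x.normalises_def x.J_lin)
  show "nabE \<Gamma> (\<lambda>x u. 0) x v u = - (c *\<^sub>R q x v 0 u)" for v u
    using linear_0[OF \<Gamma>_linear(1)[OF x]] linear_0[OF x.linear_qwedge(3)] by (simp add: nabE_def)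
qed simp

lemma ck_pair_lincomb:
  assumes ck1: "ck_pair c \<Psi>1 X1" and ck2: "ck_pair c \<Psi>2 X2"
  shows "ck_pair c (\<lambda>x u. r1 *\<^sub>R \<Psi>1 x u + r2 *\<^sub>R \<Psi>2 x u) (\<lambda>x. r1 *\<^sub>R X1 x + r2 *\<^sub>R X2 x)"
  unfolding ck_pair_def
proof (intro conjI ballI allI)
  note d1 = ck_pairD[OF ck1] and d2 = ck_pairD[OF ck2]
  show "endfield (\<lambda>x u. r1 *\<^sub>R \<Psi>1 x u + r2 *\<^sub>R \<Psi>2 x u)"
    using d1(1) d2(1) unfolding endfield_def
    by (auto intro!: linear_compose_add linear_compose_scale_right smooth_on_add smooth_on_scaleR open_S)
  show "smooth_on (\<lambda>x. r1 *\<^sub>R X1 x + r2 *\<^sub>R X2 x) S"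
    by (intro smooth_on_add smooth_on_scaleR open_S smooth_on_const d1 d2)
  fix x assume x: "x \<in> S"
  interpret x: quaternionic_space "G x" "J1 x" "J2 x" "J3 x" by (rule quat[OF x])
  show "skew x (\<lambda>u. r1 *\<^sub>R \<Psi>1 x u + r2 *\<^sub>R \<Psi>2 x u)"
    using d1(3)[OF x] d2(3)[OF x] unfolding x.skew_def by (simp add: x.G_lin)
  have "normalises x (\<lambda>u. 0)"
    using ck_pairD(4)[OF ck_pair_zero x] .
  from x.normalises_add_scale[OF x.normalises_add_scale[OF this d1(4)[OF x], of r1] d2(4)[OF x], of r2]
  show "normalises x (\<lambda>u. r1 *\<^sub>R \<Psi>1 x u + r2 *\<^sub>R \<Psi>2 x u)" by simp
  fix v u
  have "cd (\<lambda>y. r1 *\<^sub>R \<Psi>1 y u + r2 *\<^sub>R \<Psi>2 y u) x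
      (\<lambda>v. (r1 *\<^sub>R (nabE \<Gamma> \<Psi>1 x v u + \<Psi>1 x (\<Gamma> x v u)) + 0 *\<^sub>R \<Psi>1 x u) + (r2 *\<^sub>R (nabE \<Gamma> \<Psi>2 x v u + \<Psi>2 x (\<Gamma> x v u)) + 0 *\<^sub>R \<Psi>2 x u))"
    by (intro cd_add cd_scaleR x cd_endfield_const d1 d2 has_derivative_const)
  then have "nabE \<Gamma> (\<lambda>x u. r1 *\<^sub>R \<Psi>1 x u + r2 *\<^sub>R \<Psi>2 x u) x v u = r1 *\<^sub>R nabE \<Gamma> \<Psi>1 x v u + r2 *\<^sub>R nabE \<Gamma> \<Psi>2 x v u"
    by (intro nabE_eqI) (simp add: algebra_simps)
  also have "\<dots> = - (c *\<^sub>R q x v (r1 *\<^sub>R X1 x + r2 *\<^sub>R X2 x) u)"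
    by (simp add: d1(5)[OF x] d2(5)[OF x] linear_add[OF x.linear_qwedge(3)] linear_scale[OF x.linear_qwedge(3)] algebra_simps)
  finally show "nabE \<Gamma> (\<lambda>x u. r1 *\<^sub>R \<Psi>1 x u + r2 *\<^sub>R \<Psi>2 x u) x v u = - (c *\<^sub>R q x v (r1 *\<^sub>R X1 x + r2 *\<^sub>R X2 x) u)" .
qed

lemma ck_pair_cong:
  assumes "ck_pair c \<Psi> X" "\<And>x. x \<in> S \<Longrightarrow> X x = Y x"
  shows "ck_pair c \<Psi> Y"
  using assms smooth_on_cong[OF ck_pairD(2)[OF assms(1)] open_S] by (auto simp: ck_pair_def)

end

section \<open>The Levi-Civita connection and changes of charts\<close>

lemma has_derivative_bilinear_family:
  fixes h :: "'a::euclidean_space \<Rightarrow> 'b::euclidean_space \<Rightarrow> 'c::euclidean_space \<Rightarrow> 'd::real_normed_vector"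
  assumes N: "open N" "x \<in> N" and lin: "\<And>y. y \<in> N \<Longrightarrow> bilinear (h y)"
    and h: "\<And>a b. ((\<lambda>y. h y a b) has_derivative (\<lambda>v. h' v a b)) (at x)"
    and Y: "(Y has_derivative Y') (at x)" and Z: "(Z has_derivative Z') (at x)"
  shows "((\<lambda>y. h y (Y y) (Z y)) has_derivative (\<lambda>v. h' v (Y x) (Z x) + h x (Y' v) (Z x) + h x (Y x) (Z' v))) (at x)"
proof -
  have 1: "((\<lambda>y. h y a (Z y)) has_derivative (\<lambda>v. h' v a (Z x) + h x a (Z' v))) (at x)" for a
    by (rule has_derivative_apply[OF N, where M = "\<lambda>y. h y a"]) (use lin h Z in \<open>auto simp: bilinear_def\<close>)
  have "((\<lambda>y. h y (Y y) (Z y)) has_derivative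
     (\<lambda>v. (h' v (Y x) (Z x) + h x (Y x) (Z' v)) + h x (Y' v) (Z x))) (at x)"
    by (rule has_derivative_apply[OF N, where M = "\<lambda>y u. h y u (Z y)"]) (use lin 1 Y in \<open>auto simp: bilinear_def\<close>)
  then show ?thesis by (rule has_derivative_eq_rhs) auto
qed

text \<open>\<open>christoffel\<close> freed from atlas and chart, so that it makes sense for any
  metric on an open subset of the Euclidean space.\<close>

definition lc :: "('e::euclidean_space \<Rightarrow> 'e \<Rightarrow> 'e \<Rightarrow> real) \<Rightarrow> 'e \<Rightarrow> 'e \<Rightarrow> 'e \<Rightarrow> 'e" where
  "lc G x = (THE \<Gamma>. bilinear \<Gamma> \<and> (\<forall>u v. \<Gamma> u v = \<Gamma> v u) \<and>
     (\<forall>w u v. frechet_derivative (\<lambda>y. G y u v) (at x) w = G x (\<Gamma> w u) v + G x u (\<Gamma> w v)))"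

text \<open>The argument behind the uniqueness of the Levi-Civita connection: six alternating
  exchanges lead back to the start, and three of them change the sign.\<close>

lemma symmetric_skew_zero:
  fixes e :: "'a \<Rightarrow> 'a \<Rightarrow> 'a \<Rightarrow> real"
  assumes "\<And>u v w. e u v w = e v u w" "\<And>u v w. e u v w = - e u w v"
  shows "e u v w = 0"
proof -
  have "e u v w = - e u w v" by (rule assms)
  also have "\<dots> = - e w u v" by (simp add: assms(1)[of u w v])
  also have "\<dots> = e w v u" using assms(2)[of w u v] by simp
  also have "\<dots> = e v w u" by (rule assms)
  also have "\<dots> = - e v u w" by (rule assms)
  also have "\<dots> = - e u v w" by (simp add: assms(1)[of u v w])
  finally show ?thesis by simp
qed

lemma lc_unique:
  assumes "metric_form G" "\<And>u v. \<Gamma>1 u v = \<Gamma>1 v u" "\<And>u v. \<Gamma>2 u v = \<Gamma>2 v u"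
    and "\<And>w u v. G (\<Gamma>1 w u) v + G u (\<Gamma>1 w v) = G (\<Gamma>2 w u) v + G u (\<Gamma>2 w v)"
  shows "\<Gamma>1 = \<Gamma>2"
proof (intro ext)
  fix u v
  interpret metric_form G by fact
  have "G (\<Gamma>1 u v - \<Gamma>2 u v) w = 0" for w
  proof (rule symmetric_skew_zero[of "\<lambda>u v w. G (\<Gamma>1 u v - \<Gamma>2 u v) w"])
    show "G (\<Gamma>1 u v - \<Gamma>2 u v) w = G (\<Gamma>1 v u - \<Gamma>2 v u) w" for u v w
      by (simp only: assms(2)[of u v] assms(3)[of u v])
    show "G (\<Gamma>1 u v - \<Gamma>2 u v) w = - G (\<Gamma>1 u w - \<Gamma>2 u w) v" for u v w
      using assms(4)[of u v w] G_sym[of v "\<Gamma>1 u w"] G_sym[of v "\<Gamma>2 u w"] by (simp add: G_lin)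
  qed
  then have "\<Gamma>1 u v - \<Gamma>2 u v = 0" by (intro G_eqI) (simp add: G_lin)
  then show "\<Gamma>1 u v = \<Gamma>2 u v" by simp
qed

text \<open>Raising an index preserves smoothness. In coordinates the metric is the injective linear
  map that collects the values \<open>G x z b\<close>, and \<open>smooth_on_solve\<close> inverts
  it.\<close>

lemma smooth_metric_solve:
  fixes G :: "'e::euclidean_space \<Rightarrow> 'e \<Rightarrow> 'e \<Rightarrow> real"
  assumes S: "open S" and metric: "\<And>x. x \<in> S \<Longrightarrow> metric_form (G x)"
    and smooth: "\<And>u v. smooth_on (\<lambda>x. G x u v) S"
    and \<alpha>: "\<And>b. smooth_on (\<lambda>x. \<alpha> x b) S" and sol: "\<And>x b. x \<in> S \<Longrightarrow> G x (X x) b = \<alpha> x b"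
  shows "smooth_on X S"
proof (rule smooth_on_solve[OF S, where M = "\<lambda>x z. \<Sum>b\<in>Basis. G x z b *\<^sub>R b" and a = "\<lambda>x. \<Sum>b\<in>Basis. \<alpha> x b *\<^sub>R b"])
  show "linear (\<lambda>z. \<Sum>b\<in>Basis. G y z b *\<^sub>R b)" if "y \<in> S" for y
    by (rule linearI) (simp_all add: metric_form.G_lin[OF metric[OF that]] scaleR_add_left sum.distrib scaleR_sum_right)
  show "z = 0" if y: "y \<in> S" and z: "(\<Sum>b\<in>Basis. G y z b *\<^sub>R b) = 0" for y z
  proof (rule metric_form.G_eqI[OF metric[OF y]])
    fix w
    have "G y z b = 0" if "b \<in> Basis" for b
      using arg_cong[OF z, of "\<lambda>s. s \<bullet> b"] that by (simp add: inner_sum_left inner_Basis if_distrib cong: if_cong)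
    then have "(\<Sum>b\<in>Basis. (w \<bullet> b) *\<^sub>R G y z b) = 0" by simp
    then show "G y z w = G y 0 w"
      using linear_basis_expand[OF metric_form.G_linear(2)[OF metric[OF y], of z], of w]
      by (simp add: metric_form.G_lin[OF metric[OF y]])
  qed
  show "smooth_on (\<lambda>y. \<Sum>b\<in>Basis. G y z b *\<^sub>R b) S" "smooth_on (\<lambda>x. \<Sum>b\<in>Basis. \<alpha> x b *\<^sub>R b) S" for z
    by (intro smooth_on_sum smooth_on_scaleR S smooth \<alpha> smooth_on_const)+
qed (simp add: sol)

text \<open>Existence and smoothness by the Koszul formula: \<open>k\<close> is its right-hand side,
  and raising the last index gives the connection.\<close>

lemma lc_local_metric:
  fixes G :: "'e::euclidean_space \<Rightarrow> 'e \<Rightarrow> 'e \<Rightarrow> real"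
  assumes S: "open S" and metric: "\<And>x. x \<in> S \<Longrightarrow> metric_form (G x)"
    and smooth: "\<And>u v. smooth_on (\<lambda>x. G x u v) S"
  shows "local_metric S G (lc G)"
proof -
  define D where "D x w u v = frechet_derivative (\<lambda>y. G y u v) (at x) w" for x w u v
  define k where "k x u v w = (D x u v w + D x v u w - D x w u v) / 2" for x u v w
  have linD: "linear (\<lambda>w. D x w u v)" "linear (\<lambda>u. D x w u v)" "linear (D x w u)" if x: "x \<in> S" for x u v w
  proof -
    have l: "linear (\<lambda>u. G y u v)" "linear (G y u)" if "y \<in> S" for y u v
      using metric_form.G_linear[OF metric[OF that]] by auto
    show "linear (\<lambda>w. D x w u v)" unfolding D_def by (rule smooth_on_linear_derivative[OF smooth x])
    show "linear (\<lambda>u. D x w u v)" unfolding D_def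
      by (rule linear_family_derivative[OF S x l(1) smooth_on_differentiable[OF smooth x]])
    show "linear (D x w u)" unfolding D_def[abs_def]
      by (rule linear_family_derivative[OF S x l(2) smooth_on_differentiable[OF smooth x]])
  qed
  note D_lin = linear_add[OF linD(1)] linear_add[OF linD(2)] linear_add[OF linD(3)]
    linear_scale[OF linD(1)] linear_scale[OF linD(2)] linear_scale[OF linD(3)]
  have D_sym: "D x w u v = D x w v u" if "x \<in> S" for x w u v
    unfolding D_def
    using frechet_derivative_cong_open[OF S that, of "\<lambda>y. G y u v" "\<lambda>y. G y v u"] metric_form.G_sym[OF metric] by auto
  define \<Gamma> where "\<Gamma> x u v = (THE z. \<forall>w. G x z w = k x u v w)" for x u v
  have \<Gamma>: "G x (\<Gamma> x u v) w = k x u v w" if x: "x \<in> S" for x u v w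
  proof -
    have "linear (k x u v)" by (rule linearI) (simp_all add: k_def D_lin x field_simps)
    from theI'[OF metric_form.riesz[OF metric[OF x] this]] show ?thesis by (simp add: \<Gamma>_def)
  qed
  have \<Gamma>_eqI: "\<Gamma> x u v = z" if "x \<in> S" "\<And>w. k x u v w = G x z w" for x u v z
    by (rule metric_form.G_eqI[OF metric[OF that(1)]]) (simp add: \<Gamma>[OF that(1)] that(2))
  have bil: "bilinear (\<Gamma> x)" if x: "x \<in> S" for x
    unfolding bilinear_def
    by (intro conjI allI linearI; rule \<Gamma>_eqI[OF x];
        simp add: metric_form.G_lin[OF metric[OF x]] \<Gamma>[OF x]; simp add: k_def D_lin x field_simps)
  have sym: "\<Gamma> x u v = \<Gamma> x v u" if x: "x \<in> S" for x u v
    by (rule \<Gamma>_eqI[OF x]) (simp add: \<Gamma>[OF x] k_def D_sym[OF x, of _ u v])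
  have comp: "D x w u v = G x (\<Gamma> x w u) v + G x u (\<Gamma> x w v)" if x: "x \<in> S" for x u v w
    unfolding metric_form.G_sym[OF metric[OF x], of u "\<Gamma> x w v"] \<Gamma>[OF x] k_def
    using D_sym[OF x, of w u v] D_sym[OF x, of u w v] D_sym[OF x, of v w u] by (simp add: field_simps)
  have lc: "lc G x = \<Gamma> x" if x: "x \<in> S" for x
    unfolding lc_def
  proof (rule the_equality)
    show "bilinear (\<Gamma> x) \<and> (\<forall>u v. \<Gamma> x u v = \<Gamma> x v u) \<and>
      (\<forall>w u v. frechet_derivative (\<lambda>y. G y u v) (at x) w = G x (\<Gamma> x w u) v + G x u (\<Gamma> x w v))"
      using bil[OF x] sym[OF x] comp[OF x] unfolding D_def by blast
    show "\<Gamma>' = \<Gamma> x" if "bilinear \<Gamma>' \<and> (\<forall>u v. \<Gamma>' u v = \<Gamma>' v u) \<and>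
      (\<forall>w u v. frechet_derivative (\<lambda>y. G y u v) (at x) w = G x (\<Gamma>' w u) v + G x u (\<Gamma>' w v))" for \<Gamma>'
      by (rule lc_unique[OF metric[OF x]]) (use that sym[OF x] comp[OF x] in \<open>auto simp: D_def\<close>)
  qed
  have "smooth_on (\<lambda>x. \<Gamma> x u v) S" for u v
  proof (rule smooth_metric_solve[OF S metric smooth _ \<Gamma>])
    have "smooth_on (\<lambda>y. (1 / 2) * (D y u v b + D y v u b - D y b u v)) S" for b
      unfolding D_def
      by (intro smooth_on_mult smooth_on_add smooth_on_diff S smooth_on_const smooth_on_frechet_derivative smooth)
    then show "smooth_on (\<lambda>x. k x u v b) S" for b by (simp add: k_def)
  qed
  then have "smooth_on (\<lambda>x. lc G x u v) S" for u v
    by (rule smooth_on_cong[OF _ S]) (simp add: lc)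
  moreover have "bilinear (lc G x)" "lc G x u v = lc G x v u"
    "frechet_derivative (\<lambda>y. G y u v) (at x) w = G x (lc G x w u) v + G x u (lc G x w v)" if "x \<in> S" for x u v w
    unfolding lc[OF that] by (rule bil[OF that] sym[OF that] comp[OF that, unfolded D_def])+
  ultimately show ?thesis by (intro local_metric.intro S metric smooth)
qed

text \<open>\<open>\<phi>\<close> is the transition map, defined on the overlap \<open>N\<close> as
  seen in the first chart, and by \<open>G_change\<close> a local isometry.\<close>

locale chart_change = l: local_metric S G \<Gamma> + r: local_metric S' G' \<Gamma>'
  for S :: "'e::euclidean_space set" and G \<Gamma> and S' :: "'e set" and G' \<Gamma>' +
  fixes N :: "'e set" and \<phi> :: "'e \<Rightarrow> 'e"
  assumes open_N: "open N" and N_S: "N \<subseteq> S" and \<phi>_S': "\<phi> ` N \<subseteq> S'"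
    and smooth_\<phi>: "smooth_on \<phi> N"
    and surj: "x \<in> N \<Longrightarrow> surj (frechet_derivative \<phi> (at x))"
    and G_change: "x \<in> N \<Longrightarrow> G x u v = G' (\<phi> x) (frechet_derivative \<phi> (at x) u) (frechet_derivative \<phi> (at x) v)"
begin

abbreviation "M x \<equiv> frechet_derivative \<phi> (at x)"

definition H :: "'e \<Rightarrow> 'e \<Rightarrow> 'e \<Rightarrow> 'e" where
  "H x v u = frechet_derivative (\<lambda>y. M y u) (at x) v"

lemma M_linear: "x \<in> N \<Longrightarrow> linear (M x)"
  by (rule smooth_on_linear_derivative[OF smooth_\<phi>])

lemma M_derivative: "x \<in> N \<Longrightarrow> ((\<lambda>y. M y u) has_derivative (\<lambda>v. H x v u)) (at x)"
  unfolding H_def by (rule smooth_on_has_derivative[OF smooth_on_frechet_derivative[OF smooth_\<phi>]])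

lemma H_sym: "x \<in> N \<Longrightarrow> H x u v = H x v u"
  unfolding H_def by (rule second_derivative_symmetric[OF open_N smooth_\<phi>])

lemma pullback_derivative:
  assumes x: "x \<in> N" and f: "f differentiable (at (\<phi> x))"
  shows "((\<lambda>y. f (\<phi> y)) has_derivative (\<lambda>v. frechet_derivative f (at (\<phi> x)) (M x v))) (at x)"
  using f unfolding frechet_derivative_works
  by (rule has_derivative_compose[OF smooth_on_has_derivative[OF smooth_\<phi> x]])

lemma bilinear_pullback_derivative:
  fixes t :: "'e \<Rightarrow> 'e \<Rightarrow> 'e \<Rightarrow> real"
  assumes x: "x \<in> N" and bil: "\<And>y. y \<in> N \<Longrightarrow> bilinear (t (\<phi> y))"
    and d: "\<And>a b. (\<lambda>z. t z a b) differentiable (at (\<phi> x))"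
  shows "frechet_derivative (\<lambda>y. t (\<phi> y) (M y a) (M y b)) (at x) v =
    frechet_derivative (\<lambda>z. t z (M x a) (M x b)) (at (\<phi> x)) (M x v) + t (\<phi> x) (H x v a) (M x b) + t (\<phi> x) (M x a) (H x v b)"
  by (subst frechet_derivative_eqI[OF has_derivative_bilinear_family[OF open_N x, where h = "\<lambda>y. t (\<phi> y)",
      OF bil pullback_derivative[OF x d] M_derivative[OF x] M_derivative[OF x]]]) simp_all

text \<open>The inhomogeneous transformation law of the Christoffel symbols. The defect
  \<open>E\<close> is symmetric and, because the metrics correspond, skew, so it vanishes as in the
  uniqueness of the connection; by \<open>surj\<close> the vectors \<open>M x w\<close> exhaust the
  space.\<close>

lemma \<Gamma>_change:
  assumes x: "x \<in> N"
  shows "\<Gamma>' (\<phi> x) (M x u) (M x v) = M x (\<Gamma> x u v) - H x u v"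
proof -
  have xS: "x \<in> S" and xS': "\<phi> x \<in> S'" using x N_S \<phi>_S' by auto
  interpret m: metric_form "G' (\<phi> x)" by (rule r.metric[OF xS'])
  define E where "E u v = \<Gamma>' (\<phi> x) (M x u) (M x v) + H x u v - M x (\<Gamma> x u v)" for u v
  have E_sym: "E u v = E v u" for u v
    unfolding E_def by (simp only: r.\<Gamma>_sym[OF xS', of "M x u"] H_sym[OF x, of u] l.\<Gamma>_sym[OF xS, of u])
  have E_skew: "G' (\<phi> x) (E w u) (M x v) + G' (\<phi> x) (M x u) (E w v) = 0" for u v w
  proof -
    have "frechet_derivative (\<lambda>y. G y u v) (at x) w = frechet_derivative (\<lambda>y. G' (\<phi> y) (M y u) (M y v)) (at x) w"
      by (rule arg_cong[where f = "\<lambda>h. h w", OF frechet_derivative_cong_open[OF open_N x]]) (rule G_change)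
    also have "\<dots> = frechet_derivative (\<lambda>z. G' z (M x u) (M x v)) (at (\<phi> x)) (M x w)
       + G' (\<phi> x) (H x w u) (M x v) + G' (\<phi> x) (M x u) (H x w v)"
    proof (rule bilinear_pullback_derivative[OF x])
      show "bilinear (G' (\<phi> y))" if "y \<in> N" for y
        using metric_form.bilinear_G[OF r.metric] that \<phi>_S' by blast
    qed (rule smooth_on_differentiable[OF r.smooth_G xS'])
    finally have "G x (\<Gamma> x w u) v + G x u (\<Gamma> x w v) =
       (G' (\<phi> x) (\<Gamma>' (\<phi> x) (M x w) (M x u)) (M x v) + G' (\<phi> x) (M x u) (\<Gamma>' (\<phi> x) (M x w) (M x v)))
       + G' (\<phi> x) (H x w u) (M x v) + G' (\<phi> x) (M x u) (H x w v)"
      unfolding l.\<Gamma>_metric[OF xS] r.\<Gamma>_metric[OF xS'] .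
    then show ?thesis unfolding G_change[OF x] E_def by (simp add: m.G_lin)
  qed
  have "G' (\<phi> x) (E u v) (M x w) = 0" for w
  proof (rule symmetric_skew_zero[of "\<lambda>u v w. G' (\<phi> x) (E u v) (M x w)"])
    show "G' (\<phi> x) (E u v) (M x w) = G' (\<phi> x) (E v u) (M x w)" for u v w by (simp only: E_sym[of u v])
    show "G' (\<phi> x) (E u v) (M x w) = - G' (\<phi> x) (E u w) (M x v)" for u v w
      using E_skew[of u v w] m.G_sym[of "M x v" "E u w"] by simp
  qed
  then have "G' (\<phi> x) (E u v) z = 0" for z using surjD[OF surj[OF x], of z] by auto
  then have "E u v = 0" by (intro m.G_eqI) (simp add: m.G_lin)
  then show ?thesis by (simp add: E_def algebra_simps)
qed

text \<open>The Hessian \<open>H\<close> that arises from differentiating \<open>M y (X y)\<close>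
  is cancelled by the one in \<open>\<Gamma>_change\<close>. The same happens for the other two
  covariant derivatives.\<close>

lemma nabV_change:
  assumes x: "x \<in> N" and X: "\<And>y. y \<in> N \<Longrightarrow> X' (\<phi> y) = M y (X y)"
    and d: "X differentiable (at x)" "X' differentiable (at (\<phi> x))"
  shows "nabV \<Gamma>' X' (\<phi> x) (M x v) = M x (nabV \<Gamma> X x v)"
proof -
  have "((\<lambda>y. M y (X y)) has_derivative (\<lambda>v. H x v (X x) + M x (frechet_derivative X (at x) v))) (at x)"
    using d(1) unfolding frechet_derivative_works
    by (intro has_derivative_apply[OF open_N x, where M = "\<lambda>y. M y"] M_linear M_derivative x)
  then have "((\<lambda>y. X' (\<phi> y)) has_derivative (\<lambda>v. H x v (X x) + M x (frechet_derivative X (at x) v))) (at x)"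
    by (rule has_derivative_transform_within_open[OF _ open_N x]) (simp add: X)
  from fun_cong[OF has_derivative_unique[OF pullback_derivative[OF x d(2)] this], of v]
  show ?thesis
    by (simp add: nabV_def X[OF x] \<Gamma>_change[OF x] linear_add[OF M_linear[OF x]])
qed

lemma nab2_change:
  assumes x: "x \<in> N" and t: "\<And>y a b. y \<in> N \<Longrightarrow> t y a b = t' (\<phi> y) (M y a) (M y b)"
    and bil: "\<And>y. y \<in> N \<Longrightarrow> bilinear (t' (\<phi> y))"
    and d: "\<And>a b. (\<lambda>z. t' z a b) differentiable (at (\<phi> x))"
  shows "nab2 \<Gamma>' t' (\<phi> x) (M x v) (M x a) (M x b) = nab2 \<Gamma> t x v a b"
proof -
  have "frechet_derivative (\<lambda>y. t y a b) (at x) v = frechet_derivative (\<lambda>y. t' (\<phi> y) (M y a) (M y b)) (at x) v"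
    by (rule arg_cong[where f = "\<lambda>h. h v", OF frechet_derivative_cong_open[OF open_N x]]) (rule t)
  also have "\<dots> = frechet_derivative (\<lambda>z. t' z (M x a) (M x b)) (at (\<phi> x)) (M x v)
      + t' (\<phi> x) (H x v a) (M x b) + t' (\<phi> x) (M x a) (H x v b)"
    by (rule bilinear_pullback_derivative[OF x]) (use bil d in auto)
  finally have 1: "frechet_derivative (\<lambda>y. t y a b) (at x) v = \<dots>" .
  show ?thesis
    unfolding nab2_def t[OF x] 1
    by (simp add: \<Gamma>_change[OF x] bilinear_lsub[OF bil[OF x]] bilinear_rsub[OF bil[OF x]])
qed

text \<open>The extra neighbourhood \<open>T\<close> accounts for endomorphism fields that exist
  only locally, such as the almost complex structures.\<close>

lemma nabE_change:
  assumes x: "x \<in> N" and T: "open T" "x \<in> T"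
    and F: "\<And>y a. y \<in> N \<inter> T \<Longrightarrow> F' (\<phi> y) (M y a) = M y (F y a)"
    and lin: "\<And>y. y \<in> N \<inter> T \<Longrightarrow> linear (F' (\<phi> y))"
    and d: "\<And>u. (\<lambda>y. F y u) differentiable (at x)" "\<And>u. (\<lambda>y. F' y u) differentiable (at (\<phi> x))"
  shows "nabE \<Gamma>' F' (\<phi> x) (M x v) (M x a) = M x (nabE \<Gamma> F x v a)"
proof -
  have NT: "open (N \<inter> T)" "x \<in> N \<inter> T" using open_N x T by auto
  have "((\<lambda>y. M y (F y a)) has_derivative (\<lambda>v. H x v (F x a) + M x (frechet_derivative (\<lambda>y. F y a) (at x) v))) (at x)"
    using d(1)[of a] unfolding frechet_derivative_works
    by (intro has_derivative_apply[OF open_N x, where M = "\<lambda>y. M y"] M_linear M_derivative x)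
  then have 1: "((\<lambda>y. F' (\<phi> y) (M y a)) has_derivative (\<lambda>v. H x v (F x a) + M x (frechet_derivative (\<lambda>y. F y a) (at x) v))) (at x)"
    by (rule has_derivative_transform_within_open[OF _ NT]) (simp add: F)
  have "((\<lambda>y. F' (\<phi> y) (M y a)) has_derivative
     (\<lambda>v. frechet_derivative (\<lambda>z. F' z (M x a)) (at (\<phi> x)) (M x v) + F' (\<phi> x) (H x v a))) (at x)"
    by (intro has_derivative_apply[OF NT, where M = "\<lambda>y. F' (\<phi> y)"] lin pullback_derivative[OF x d(2)] M_derivative x)
  from fun_cong[OF has_derivative_unique[OF this 1], of v]
  have "frechet_derivative (\<lambda>z. F' z (M x a)) (at (\<phi> x)) (M x v) =
     H x v (F x a) + M x (frechet_derivative (\<lambda>y. F y a) (at x) v) - F' (\<phi> x) (H x v a)" by (simp add: algebra_simps)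
  then show ?thesis
    by (simp add: nabE_def F[OF NT(2)] \<Gamma>_change[OF x] linear_add[OF M_linear[OF x]] linear_diff[OF M_linear[OF x]]
        linear_diff[OF lin[OF NT(2)]])
qed

end

section \<open>Tensor fields in charts\<close>

locale riemannian_manifold =
  fixes A :: "('m::{t2_space,second_countable_topology}, 'e::euclidean_space) chart set"
    and g :: "('m, 'e) cov2"
  assumes atlas: "smooth_atlas A" and riem: "riemannian_metric A g"
begin

abbreviation "img c \<equiv> snd c ` fst c"
abbreviation "D c c' \<equiv> \<lambda>x. frechet_derivative (snd c' \<circ> chart_inv c) (at x)"
abbreviation "\<Gamma> c \<equiv> lc (cov2_rep A c g)"
abbreviation "gr c \<equiv> cov2_rep A c g"

section \<open>Charts, transition maps and coordinates in the preferred chart\<close>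

lemma chart_at: "chart_at A p \<in> A" "p \<in> fst (chart_at A p)"
proof -
  have "p \<in> (\<Union>c\<in>A. fst c)" using atlas by (simp add: smooth_atlas_def)
  then have "\<exists>c. c \<in> A \<and> p \<in> fst c" by auto
  from someI_ex[OF this] show "chart_at A p \<in> A" "p \<in> fst (chart_at A p)" by (auto simp: chart_at_def)
qed

lemma chart_open: "c \<in> A \<Longrightarrow> open (fst c)" "c \<in> A \<Longrightarrow> open (img c)"
  and chart_homeo: "c \<in> A \<Longrightarrow> homeomorphism (fst c) (img c) (snd c) (chart_inv c)"
  and transition_smooth: "c \<in> A \<Longrightarrow> c' \<in> A \<Longrightarrow> smooth_on (snd c' \<circ> chart_inv c) (snd c ` (fst c \<inter> fst c'))"
  using atlas by (auto simp: smooth_atlas_def)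

lemma chart_inv: "c \<in> A \<Longrightarrow> p \<in> fst c \<Longrightarrow> chart_inv c (snd c p) = p"
  using chart_homeo homeomorphism_apply1 by metis

lemma chart_image_open:
  assumes "c \<in> A" "open U"
  shows "open (snd c ` (fst c \<inter> U))"
proof -
  have "openin (top_of_set (img c)) (snd c ` (fst c \<inter> U))"
    by (rule homeomorphism_imp_open_map[OF chart_homeo[OF assms(1)]]) (use assms(2) in auto)
  then show ?thesis using chart_open[OF assms(1)] openin_open_eq by blast
qed

lemma overlap_open: "c \<in> A \<Longrightarrow> c' \<in> A \<Longrightarrow> open (snd c ` (fst c \<inter> fst c'))"
  using chart_image_open chart_open by blast

lemma D_linear: "c \<in> A \<Longrightarrow> c' \<in> A \<Longrightarrow> p \<in> fst c \<Longrightarrow> p \<in> fst c' \<Longrightarrow> linear (D c c' (snd c p))"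
  using smooth_on_linear_derivative[OF transition_smooth] by blast

lemma D_cocycle:
  assumes c: "c \<in> A" "c' \<in> A" "c'' \<in> A" and p: "p \<in> fst c" "p \<in> fst c'" "p \<in> fst c''"
  shows "D c' c'' (snd c' p) (D c c' (snd c p) u) = D c c'' (snd c p) u"
proof -
  let ?N = "snd c ` (fst c \<inter> (fst c' \<inter> fst c''))"
  have N: "open ?N" "snd c p \<in> ?N"
    using chart_image_open[OF c(1) open_Int[OF chart_open(1)[OF c(2)] chart_open(1)[OF c(3)]]] p by auto
  have 1: "((snd c' \<circ> chart_inv c) has_derivative D c c' (snd c p)) (at (snd c p))"
    using smooth_on_has_derivative[OF transition_smooth[OF c(1,2)]] p by blast
  have e: "(snd c' \<circ> chart_inv c) (snd c p) = snd c' p" using chart_inv[OF c(1) p(1)] by simp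
  have 2: "((snd c'' \<circ> chart_inv c') has_derivative D c' c'' (snd c' p)) (at ((snd c' \<circ> chart_inv c) (snd c p)))"
    unfolding e using smooth_on_has_derivative[OF transition_smooth[OF c(2,3)]] p by blast
  have "((snd c'' \<circ> chart_inv c') \<circ> (snd c' \<circ> chart_inv c) has_derivative D c' c'' (snd c' p) \<circ> D c c' (snd c p)) (at (snd c p))"
    by (rule diff_chain_at[OF 1 2])
  then have "((snd c'' \<circ> chart_inv c) has_derivative D c' c'' (snd c' p) \<circ> D c c' (snd c p)) (at (snd c p))"
    by (rule has_derivative_transform_within_open[OF _ N]) (auto simp: chart_inv[OF c(1)] chart_inv[OF c(2)])
  from frechet_derivative_eqI[OF this] show ?thesis by simp
qed

lemma D_self:
  assumes c: "c \<in> A" and p: "p \<in> fst c"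
  shows "D c c (snd c p) u = u"
proof -
  have "((snd c \<circ> chart_inv c) has_derivative (\<lambda>u. u)) (at (snd c p))"
    by (rule has_derivative_transform_within_open[OF has_derivative_ident chart_open(2)[OF c]])
      (use p chart_inv[OF c] in auto)
  then show ?thesis by (simp add: frechet_derivative_eqI)
qed

lemma to_chart_eq: "to_chart A c p = D (chart_at A p) c (snd (chart_at A p) p)"
  and from_chart_eq: "from_chart A c p = D c (chart_at A p) (snd c p)"
  by (simp_all add: to_chart_def from_chart_def base_pt_def)

lemma to_chart_linear: "c \<in> A \<Longrightarrow> p \<in> fst c \<Longrightarrow> linear (to_chart A c p)"
  and from_chart_linear: "c \<in> A \<Longrightarrow> p \<in> fst c \<Longrightarrow> linear (from_chart A c p)"
  unfolding to_chart_eq from_chart_eq using D_linear chart_at by blast+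

lemma to_from_chart [simp]: "c \<in> A \<Longrightarrow> p \<in> fst c \<Longrightarrow> to_chart A c p (from_chart A c p u) = u"
  and from_to_chart [simp]: "c \<in> A \<Longrightarrow> p \<in> fst c \<Longrightarrow> from_chart A c p (to_chart A c p u) = u"
  unfolding to_chart_eq from_chart_eq by (simp_all add: D_cocycle D_self chart_at)

lemma to_chart_change: "c \<in> A \<Longrightarrow> c' \<in> A \<Longrightarrow> p \<in> fst c \<Longrightarrow> p \<in> fst c' \<Longrightarrow>
    D c c' (snd c p) (to_chart A c p u) = to_chart A c' p u"
  and from_chart_change: "c \<in> A \<Longrightarrow> c' \<in> A \<Longrightarrow> p \<in> fst c \<Longrightarrow> p \<in> fst c' \<Longrightarrow>
    from_chart A c' p (D c c' (snd c p) u) = from_chart A c p u"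
  unfolding to_chart_eq from_chart_eq by (simp_all add: D_cocycle chart_at)

lemma to_chart_self [simp]: "to_chart A (chart_at A p) p u = u"
  and from_chart_self [simp]: "from_chart A (chart_at A p) p u = u"
  unfolding to_chart_eq from_chart_eq by (simp_all add: D_self chart_at)

lemma vf_rep_at: "c \<in> A \<Longrightarrow> p \<in> fst c \<Longrightarrow> vf_rep A c X (snd c p) = to_chart A c p (X p)"
  and cov2_rep_at: "c \<in> A \<Longrightarrow> p \<in> fst c \<Longrightarrow> cov2_rep A c t (snd c p) u v = t p (from_chart A c p u) (from_chart A c p v)"
  and end_rep_at: "c \<in> A \<Longrightarrow> p \<in> fst c \<Longrightarrow> end_rep A c S (snd c p) u = to_chart A c p (S p (from_chart A c p u))"
  by (simp_all add: vf_rep_def cov2_rep_def end_rep_def chart_inv)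

lemma christoffel_eq: "christoffel A g c = \<Gamma> c"
  by (rule ext) (simp add: christoffel_def lc_def)

lemma smooth_cov2_bilinear: "smooth_cov2 A t \<Longrightarrow> c \<in> A \<Longrightarrow> x \<in> img c \<Longrightarrow> bilinear (cov2_rep A c t x)"
proof -
  assume t: "smooth_cov2 A t" and c: "c \<in> A" and "x \<in> img c"
  then obtain p where p: "p \<in> fst c" "x = snd c p" by auto
  have "bilinear (t p)" using t by (simp add: smooth_cov2_def)
  then show ?thesis
    using from_chart_linear[OF c p(1)]
    by (simp add: bilinear_def linear_iff p(2) cov2_rep_at[OF c p(1)])
qed

lemma metric_form_g: "metric_form (g p)"
  using riem by (unfold_locales) (auto simp: riemannian_metric_def smooth_cov2_def)

lemma local_metric_chart: "c \<in> A \<Longrightarrow> local_metric (img c) (gr c) (\<Gamma> c)"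
proof (rule lc_local_metric)
  assume c: "c \<in> A"
  show "open (img c)" using chart_open c by blast
  have sm: "smooth_cov2 A g" using riem by (simp add: riemannian_metric_def)
  then show "smooth_on (\<lambda>x. gr c x u v) (img c)" for u v using c by (simp add: smooth_cov2_def)
  fix x assume x: "x \<in> img c"
  then obtain p where p: "p \<in> fst c" "x = snd c p" by auto
  interpret metric_form "g p" by (rule metric_form_g)
  show "metric_form (gr c x)"
  proof
    show "bilinear (gr c x)" by (rule smooth_cov2_bilinear[OF sm c x])
    show "gr c x u v = gr c x v u" for u v
      unfolding p(2) cov2_rep_at[OF c p(1)] by (rule G_sym)
    show "u \<noteq> 0 \<Longrightarrow> 0 < gr c x u u" for u
      unfolding p(2) cov2_rep_at[OF c p(1)]
      by (rule G_pos) (metis to_from_chart[OF c p(1)] linear_0[OF to_chart_linear[OF c p(1)]])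
  qed
qed

lemma chart_change_charts:
  assumes c: "c \<in> A" "c' \<in> A"
  shows "chart_change (img c) (gr c) (\<Gamma> c) (img c') (gr c') (\<Gamma> c') (snd c ` (fst c \<inter> fst c')) (snd c' \<circ> chart_inv c)"
proof (intro chart_change.intro chart_change_axioms.intro local_metric_chart c overlap_open transition_smooth)
  show "snd c ` (fst c \<inter> fst c') \<subseteq> img c" "(snd c' \<circ> chart_inv c) ` snd c ` (fst c \<inter> fst c') \<subseteq> img c'"
    using chart_inv[OF c(1)] by auto
  fix x assume "x \<in> snd c ` (fst c \<inter> fst c')"
  then obtain p where p: "p \<in> fst c" "p \<in> fst c'" and x: "x = snd c p" by auto
  show "surj (D c c' x)"
  proof (rule surjI)
    show "D c c' x (D c' c (snd c' p) u) = u" for u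
      using D_cocycle[OF c(2,1,2) p(2,1,2)] D_self[OF c(2) p(2)] by (simp add: x)
  qed
  show "gr c x u v = gr c' ((snd c' \<circ> chart_inv c) x) (D c c' x u) (D c c' x v)" for u v
    using chart_inv[OF c(1) p(1)]
    by (simp add: x cov2_rep_at c p from_chart_change)
qed

text \<open>The counterpart of \<open>nabla_cov2\<close> and \<open>nabla_end\<close> for vector
  fields; with it Lie derivatives and brackets are written covariantly.\<close>

definition nabla_vf :: "('m, 'e) vfield \<Rightarrow> 'm \<Rightarrow> 'e \<Rightarrow> 'e" where
  "nabla_vf X p v = dvf A X p v + conn_at A g p v (X p)"

lemma smooth_vfieldD: "smooth_vfield A X \<Longrightarrow> c \<in> A \<Longrightarrow> smooth_on (vf_rep A c X) (img c)"
  by (simp add: smooth_vfield_def)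

lemma smooth_cov2D: "smooth_cov2 A t \<Longrightarrow> c \<in> A \<Longrightarrow> smooth_on (\<lambda>x. cov2_rep A c t x u v) (img c)"
  by (simp add: smooth_cov2_def)

text \<open>The left-hand side is defined through \<open>chart_at A p\<close>, which need not vary
  continuously with \<open>p\<close>. Invariance under changes of charts lets all points of one
  chart \<open>c\<close> be treated together; the next two lemmas do the same for forms and
  endomorphisms.\<close>

lemma nabla_vf_rep:
  assumes X: "smooth_vfield A X" and c: "c \<in> A" and p: "p \<in> fst c"
  shows "to_chart A c p (nabla_vf X p v) = nabV (\<Gamma> c) (vf_rep A c X) (snd c p) (to_chart A c p v)"
proof -
  let ?c = "chart_at A p"
  interpret chart_change "img ?c" "gr ?c" "\<Gamma> ?c" "img c" "gr c" "\<Gamma> c" "snd ?c ` (fst ?c \<inter> fst c)" "snd c \<circ> chart_inv ?c"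
    by (rule chart_change_charts[OF chart_at(1) c])
  have e: "nabla_vf X p v = nabV (\<Gamma> ?c) (vf_rep A ?c X) (snd ?c p) v"
    by (simp add: nabla_vf_def nabV_def dvf_def conn_at_def christoffel_eq base_pt_def vf_rep_at chart_at)
  have "nabV (\<Gamma> c) (vf_rep A c X) ((snd c \<circ> chart_inv ?c) (snd ?c p)) (D ?c c (snd ?c p) v) =
     D ?c c (snd ?c p) (nabV (\<Gamma> ?c) (vf_rep A ?c X) (snd ?c p) v)"
  proof (rule nabV_change)
    show "snd ?c p \<in> snd ?c ` (fst ?c \<inter> fst c)" using p chart_at by auto
    show "vf_rep A c X ((snd c \<circ> chart_inv ?c) y) = D ?c c y (vf_rep A ?c X y)" if "y \<in> snd ?c ` (fst ?c \<inter> fst c)" for y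
      using that chart_at by (auto simp: vf_rep_at c chart_inv to_chart_change)
    show "vf_rep A ?c X differentiable at (snd ?c p)"
      by (rule smooth_on_differentiable[OF smooth_vfieldD[OF X chart_at(1)]]) (use chart_at in auto)
    have "snd c p \<in> img c" using p by auto
    then show "vf_rep A c X differentiable at ((snd c \<circ> chart_inv ?c) (snd ?c p))"
      using smooth_on_differentiable[OF smooth_vfieldD[OF X c]] by (simp add: chart_inv chart_at)
  qed
  then show ?thesis by (simp add: e to_chart_eq[of c] chart_inv chart_at)
qed

lemma nabla_cov2_rep:
  assumes t: "smooth_cov2 A t" and c: "c \<in> A" and p: "p \<in> fst c"
  shows "nabla_cov2 A g t p v a b = nab2 (\<Gamma> c) (cov2_rep A c t) (snd c p) (to_chart A c p v) (to_chart A c p a) (to_chart A c p b)"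
proof -
  let ?c = "chart_at A p"
  interpret chart_change "img ?c" "gr ?c" "\<Gamma> ?c" "img c" "gr c" "\<Gamma> c" "snd ?c ` (fst ?c \<inter> fst c)" "snd c \<circ> chart_inv ?c"
    by (rule chart_change_charts[OF chart_at(1) c])
  have e: "nabla_cov2 A g t p v a b = nab2 (\<Gamma> ?c) (cov2_rep A ?c t) (snd ?c p) v a b"
    by (simp add: nabla_cov2_def nab2_def dcov2_def conn_at_def christoffel_eq base_pt_def cov2_rep_at chart_at)
  have "nab2 (\<Gamma> c) (cov2_rep A c t) ((snd c \<circ> chart_inv ?c) (snd ?c p)) (D ?c c (snd ?c p) v) (D ?c c (snd ?c p) a) (D ?c c (snd ?c p) b) =
     nab2 (\<Gamma> ?c) (cov2_rep A ?c t) (snd ?c p) v a b"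
  proof (rule nab2_change)
    show "snd ?c p \<in> snd ?c ` (fst ?c \<inter> fst c)" using p chart_at by auto
    show "cov2_rep A ?c t y a b = cov2_rep A c t ((snd c \<circ> chart_inv ?c) y) (D ?c c y a) (D ?c c y b)"
      if "y \<in> snd ?c ` (fst ?c \<inter> fst c)" for y a b
      using that chart_at by (auto simp: cov2_rep_at c chart_inv from_chart_change)
    show "bilinear (cov2_rep A c t ((snd c \<circ> chart_inv ?c) y))" if "y \<in> snd ?c ` (fst ?c \<inter> fst c)" for y
      using that chart_at by (auto simp: chart_inv intro!: smooth_cov2_bilinear[OF t c])
    have "snd c p \<in> img c" using p by auto
    then show "(\<lambda>z. cov2_rep A c t z a b) differentiable at ((snd c \<circ> chart_inv ?c) (snd ?c p))" for a b
      using smooth_on_differentiable[OF smooth_cov2D[OF t c]] by (simp add: chart_inv chart_at)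
  qed
  then show ?thesis by (simp add: e to_chart_eq[of c] chart_inv chart_at)
qed

lemma nabla_end_rep:
  assumes U: "open U" and F: "smooth_endfield_on A U F" and c: "c \<in> A" and p: "p \<in> fst c" "p \<in> U"
  shows "to_chart A c p (nabla_end A g F p v a) = nabE (\<Gamma> c) (end_rep A c F) (snd c p) (to_chart A c p v) (to_chart A c p a)"
proof -
  let ?c = "chart_at A p"
  interpret chart_change "img ?c" "gr ?c" "\<Gamma> ?c" "img c" "gr c" "\<Gamma> c" "snd ?c ` (fst ?c \<inter> fst c)" "snd c \<circ> chart_inv ?c"
    by (rule chart_change_charts[OF chart_at(1) c])
  have sm: "smooth_on (\<lambda>x. end_rep A c F x u) (snd c ` (fst c \<inter> U))" if "c \<in> A" for c u
    using F that by (simp add: smooth_endfield_on_def)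
  have e: "nabla_end A g F p v a = nabE (\<Gamma> ?c) (end_rep A ?c F) (snd ?c p) v a"
    by (simp add: nabla_end_def nabE_def dend_def conn_at_def christoffel_eq base_pt_def end_rep_at chart_at)
  have "nabE (\<Gamma> c) (end_rep A c F) ((snd c \<circ> chart_inv ?c) (snd ?c p)) (D ?c c (snd ?c p) v) (D ?c c (snd ?c p) a) =
     D ?c c (snd ?c p) (nabE (\<Gamma> ?c) (end_rep A ?c F) (snd ?c p) v a)"
  proof (rule nabE_change)
    show "snd ?c p \<in> snd ?c ` (fst ?c \<inter> fst c)" using p chart_at by auto
    show "open (snd ?c ` (fst ?c \<inter> U))" by (rule chart_image_open[OF chart_at(1) U])
    show "snd ?c p \<in> snd ?c ` (fst ?c \<inter> U)" using p chart_at by auto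
    fix y assume y: "y \<in> snd ?c ` (fst ?c \<inter> fst c) \<inter> snd ?c ` (fst ?c \<inter> U)"
    then obtain q where q: "q \<in> fst ?c" "q \<in> fst c" "y = snd ?c q" by auto
    obtain q' where "q' \<in> fst ?c" "q' \<in> U" "y = snd ?c q'" using y by auto
    then have qU: "q \<in> U" using q chart_inv[OF chart_at(1)] by metis
    show "end_rep A c F ((snd c \<circ> chart_inv ?c) y) (D ?c c y a) = D ?c c y (end_rep A ?c F y a)" for a
      using q chart_at by (simp add: end_rep_at c chart_inv from_chart_change to_chart_change)
    have "linear (F q)" using F qU by (simp add: smooth_endfield_on_def)
    then have "linear (end_rep A c F (snd c q))"
      using from_chart_linear[OF c q(2)] to_chart_linear[OF c q(2)]
      by (simp add: linear_iff end_rep_at[OF c q(2)])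
    then show "linear (end_rep A c F ((snd c \<circ> chart_inv ?c) y))"
      using q by (simp add: chart_inv chart_at)
  next
    show "(\<lambda>y. end_rep A ?c F y u) differentiable at (snd ?c p)" for u
      by (rule smooth_on_differentiable[OF sm[OF chart_at(1)]]) (use chart_at p in auto)
    have "snd c p \<in> snd c ` (fst c \<inter> U)" using p by auto
    then show "(\<lambda>y. end_rep A c F y u) differentiable at ((snd c \<circ> chart_inv ?c) (snd ?c p))" for u
      using smooth_on_differentiable[OF sm[OF c]] by (simp add: chart_inv chart_at)
  qed
  then show ?thesis by (simp add: e to_chart_eq[of c] chart_inv chart_at)
qed

end

section \<open>Lie derivatives\<close>

definition locB :: "('e::euclidean_space \<Rightarrow> 'e) \<Rightarrow> ('e \<Rightarrow> 'e) \<Rightarrow> 'e \<Rightarrow> 'e" where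
  "locB X Y x = frechet_derivative Y (at x) (X x) - frechet_derivative X (at x) (Y x)"

definition locL :: "('e::euclidean_space \<Rightarrow> 'e) \<Rightarrow> ('e \<Rightarrow> 'e \<Rightarrow> 'e \<Rightarrow> real) \<Rightarrow> 'e \<Rightarrow> 'e \<Rightarrow> 'e \<Rightarrow> real" where
  "locL X t x a b = frechet_derivative (\<lambda>y. t y a b) (at x) (X x)
     + t x (frechet_derivative X (at x) a) b + t x a (frechet_derivative X (at x) b)"

locale open_region =
  fixes S :: "'e::euclidean_space set"
  assumes open_S: "open S"
begin

lemma smooth_derivative_apply:
  fixes f :: "'e \<Rightarrow> 'b::euclidean_space"
  shows "smooth_on f S \<Longrightarrow> smooth_on X S \<Longrightarrow> smooth_on (\<lambda>x. frechet_derivative f (at x) (X x)) S"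
  by (rule smooth_on_apply[OF open_S, where M = "\<lambda>x. frechet_derivative f (at x)"])
    (auto intro: smooth_on_linear_derivative smooth_on_frechet_derivative)

lemma smooth_locB: "smooth_on X S \<Longrightarrow> smooth_on Y S \<Longrightarrow> smooth_on (locB X Y) S"
  unfolding locB_def[abs_def] by (intro smooth_on_diff open_S smooth_derivative_apply)

definition bilinear_field :: "('e \<Rightarrow> 'e \<Rightarrow> 'e \<Rightarrow> real) \<Rightarrow> bool" where
  "bilinear_field t \<longleftrightarrow> (\<forall>x\<in>S. bilinear (t x)) \<and> (\<forall>a b. smooth_on (\<lambda>x. t x a b) S)"

lemma smooth_bilinear_apply:
  assumes t: "bilinear_field t" and Y: "smooth_on Y S" and Z: "smooth_on Z S"
  shows "smooth_on (\<lambda>y. t y (Y y) (Z y)) S"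
proof (rule smooth_on_apply[OF open_S _ _ Z, where M = "\<lambda>y. t y (Y y)"])
  show "smooth_on (\<lambda>y. t y (Y y) u) S" for u
    by (rule smooth_on_apply[OF open_S _ _ Y, where M = "\<lambda>y a. t y a u"])
      (use t in \<open>auto simp: bilinear_field_def bilinear_def\<close>)
qed (use t in \<open>auto simp: bilinear_field_def bilinear_def\<close>)

lemma bilinear_derivative:
  assumes t: "bilinear_field t" and x: "x \<in> S"
  shows "bilinear (\<lambda>a b. frechet_derivative (\<lambda>y. t y a b) (at x) v)"
proof -
  have d: "(\<lambda>y. t y a b) differentiable (at x)" for a b
    using t smooth_on_differentiable[OF _ x] by (auto simp: bilinear_field_def)
  have "linear (\<lambda>a. frechet_derivative (\<lambda>y. t y a b) (at x) v)" for b
    by (rule linear_family_derivative[OF open_S x _ d]) (use t in \<open>auto simp: bilinear_field_def bilinear_def\<close>)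
  moreover have "linear (\<lambda>b. frechet_derivative (\<lambda>y. t y a b) (at x) v)" for a
    by (rule linear_family_derivative[OF open_S x _ d]) (use t in \<open>auto simp: bilinear_field_def bilinear_def\<close>)
  ultimately show ?thesis by (simp add: bilinear_def)
qed

lemma bilinear_field_locL:
  assumes t: "bilinear_field t" and X: "smooth_on X S"
  shows "bilinear_field (locL X t)"
  unfolding bilinear_field_def
proof (intro conjI ballI allI)
  fix x assume x: "x \<in> S"
  have b: "bilinear (t x)" using t x by (simp add: bilinear_field_def)
  note 1 = bilinear_derivative[OF t x, of "X x"] and 2 = smooth_on_linear_derivative[OF X x]
  show "bilinear (locL X t x)"
    unfolding bilinear_def
    by (intro conjI allI linearI)
      (simp_all add: locL_def bilinear_ladd[OF b] bilinear_radd[OF b] bilinear_lmul[OF b] bilinear_rmul[OF b]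
        bilinear_ladd[OF 1] bilinear_radd[OF 1] bilinear_lmul[OF 1] bilinear_rmul[OF 1]
        linear_add[OF 2] linear_scale[OF 2] algebra_simps)
next
  fix a b
  have "smooth_on (\<lambda>y. t y a b) S" using t by (simp add: bilinear_field_def)
  then show "smooth_on (\<lambda>x. locL X t x a b) S"
    unfolding locL_def
    by (intro smooth_on_add open_S smooth_derivative_apply X smooth_bilinear_apply[OF t]
        smooth_on_frechet_derivative smooth_on_const)
qed

lemma locB_derivative:
  assumes X: "smooth_on X S" and Y: "smooth_on Y S" and x: "x \<in> S"
  shows "frechet_derivative (locB X Y) (at x) w =
    (frechet_derivative (\<lambda>y. frechet_derivative Y (at y) (X x)) (at x) w + frechet_derivative Y (at x) (frechet_derivative X (at x) w))
    - (frechet_derivative (\<lambda>y. frechet_derivative X (at y) (Y x)) (at x) w + frechet_derivative X (at x) (frechet_derivative Y (at x) w))"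
proof -
  have "((\<lambda>y. frechet_derivative Y (at y) (X y)) has_derivative
     (\<lambda>w. frechet_derivative (\<lambda>y. frechet_derivative Y (at y) (X x)) (at x) w + frechet_derivative Y (at x) (frechet_derivative X (at x) w))) (at x)"
    if X: "smooth_on X S" and Y: "smooth_on Y S" for X Y
    by (intro has_derivative_apply[OF open_S x, where M = "\<lambda>y. frechet_derivative Y (at y)"]
        smooth_on_linear_derivative[OF Y] smooth_on_has_derivative[OF smooth_on_frechet_derivative[OF Y] x]
        smooth_on_has_derivative[OF X x])
  from has_derivative_diff[OF this[OF X Y] this[OF Y X]] show ?thesis
    unfolding locB_def[abs_def] by (simp add: frechet_derivative_eqI)
qed

text \<open>All second derivatives cancel in pairs by their symmetry, and the products of first
  derivatives cancel as in the Jacobi identity for commutators.\<close>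

lemma locB_jacobi:
  assumes X: "smooth_on X S" and Y: "smooth_on Y S" and Z: "smooth_on Z S" and x: "x \<in> S"
  shows "locB X (locB Y Z) x + locB Y (locB Z X) x + locB Z (locB X Y) x = 0"
proof -
  have s: "frechet_derivative (\<lambda>y. frechet_derivative V (at y) u) (at x) w =
     frechet_derivative (\<lambda>y. frechet_derivative V (at y) w) (at x) u" if "smooth_on V S" for V :: "'e \<Rightarrow> 'e" and u w
    by (rule second_derivative_symmetric[OF open_S that x])
  note l = linear_diff[OF smooth_on_linear_derivative[OF X x]] linear_diff[OF smooth_on_linear_derivative[OF Y x]]
    linear_diff[OF smooth_on_linear_derivative[OF Z x]]
  show ?thesis
    unfolding locB_def[of _ "locB _ _"] locB_derivative[OF Y Z x] locB_derivative[OF Z X x] locB_derivative[OF X Y x]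
    using s[OF X, of "Y x" "Z x"] s[OF Y, of "Z x" "X x"] s[OF Z, of "X x" "Y x"]
    by (simp add: locB_def[of _ _ x] l)
qed

text \<open>The second derivatives of \<open>t\<close> cancel by symmetry, while those of
  \<open>X\<close> and \<open>Y\<close> combine to the derivative of the bracket.\<close>

lemma locL_commutator:
  assumes t: "bilinear_field t" and X: "smooth_on X S" and Y: "smooth_on Y S" and x: "x \<in> S"
  shows "locL (locB X Y) t x a b = locL X (locL Y t) x a b - locL Y (locL X t) x a b"
proof -
  define t1 where "t1 w a b = frechet_derivative (\<lambda>y. t y a b) (at x) w" for w a b
  define t2 where "t2 v w a b = frechet_derivative (\<lambda>y. frechet_derivative (\<lambda>z. t z a b) (at y) v) (at x) w" for v w a b
  have sm: "smooth_on (\<lambda>y. t y a b) S" for a b using t by (simp add: bilinear_field_def)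
  have b: "bilinear (t y)" if "y \<in> S" for y using t that by (simp add: bilinear_field_def)
  have D: "frechet_derivative (\<lambda>y. locL Y t y a b) (at x) w =
     (t2 (Y x) w a b + t1 (frechet_derivative Y (at x) w) a b)
     + (t1 w (frechet_derivative Y (at x) a) b + t x (frechet_derivative (\<lambda>y. frechet_derivative Y (at y) a) (at x) w) b)
     + (t1 w a (frechet_derivative Y (at x) b) + t x a (frechet_derivative (\<lambda>y. frechet_derivative Y (at y) b) (at x) w))"
    if Y: "smooth_on Y S" for Y w a b
  proof -
    have 1: "((\<lambda>y. frechet_derivative (\<lambda>z. t z a b) (at y) (Y y)) has_derivative
       (\<lambda>w. t2 (Y x) w a b + t1 (frechet_derivative Y (at x) w) a b)) (at x)"
      unfolding t1_def t2_def
      by (intro has_derivative_apply[OF open_S x, where M = "\<lambda>y. frechet_derivative (\<lambda>z. t z a b) (at y)"]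
          smooth_on_linear_derivative[OF sm] smooth_on_has_derivative[OF smooth_on_frechet_derivative[OF sm] x]
          smooth_on_has_derivative[OF Y x])
    have h: "((\<lambda>y. t y a b) has_derivative (\<lambda>v. t1 v a b)) (at x)" for a b
      unfolding t1_def by (rule smooth_on_has_derivative[OF sm x])
    have d: "((\<lambda>y. frechet_derivative Y (at y) a) has_derivative frechet_derivative (\<lambda>y. frechet_derivative Y (at y) a) (at x)) (at x)" for a
      by (rule smooth_on_has_derivative[OF smooth_on_frechet_derivative[OF Y] x])
    note 2 = has_derivative_bilinear_family[OF open_S x b h d has_derivative_const]
    note 3 = has_derivative_bilinear_family[OF open_S x b h has_derivative_const d]
    have "t x 0 b = 0" "t x a 0 = 0" for a b using bilinear_lzero[OF b[OF x]] bilinear_rzero[OF b[OF x]] by auto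
    with has_derivative_add[OF has_derivative_add[OF 1 2[of a b]] 3[of a b]] show ?thesis
      unfolding locL_def by (simp add: frechet_derivative_eqI)
  qed
  note bx = bilinear_ladd[OF b[OF x]] bilinear_radd[OF b[OF x]] bilinear_lsub[OF b[OF x]] bilinear_rsub[OF b[OF x]]
  have s2: "t2 (X x) (Y x) a b = t2 (Y x) (X x) a b"
    unfolding t2_def by (rule second_derivative_symmetric[OF open_S sm x])
  have sV: "frechet_derivative (\<lambda>y. frechet_derivative V (at y) u) (at x) w =
     frechet_derivative (\<lambda>y. frechet_derivative V (at y) w) (at x) u" if "smooth_on V S" for V :: "'e \<Rightarrow> 'e" and u w
    by (rule second_derivative_symmetric[OF open_S that x])
  have l1: "t1 (u - v) a b = t1 u a b - t1 v a b" for u v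
    unfolding t1_def by (rule linear_diff[OF smooth_on_linear_derivative[OF sm x]])
  show ?thesis
    unfolding locL_def[of _ "locL _ _"] D[OF X] D[OF Y] locL_def[of "locB _ _"] locB_derivative[OF X Y x]
    using s2 sV[OF X, of a "Y x"] sV[OF X, of b "Y x"] sV[OF Y, of a "X x"] sV[OF Y, of b "X x"]
    by (simp add: locL_def[of _ t x] locB_def[of X Y x] bx l1 flip: t1_def)
qed

end

context riemannian_manifold
begin

text \<open>The Christoffel terms cancel because the connection is torsion-free. Chart independence
  of the Lie derivative is obtained from this, as it has been established for covariant
  derivatives.\<close>

lemma lie_deriv_nabla:
  assumes "bilinear (t p)"
  shows "lie_deriv A X t p a b = nabla_cov2 A g t p (X p) a b + t p (nabla_vf X p a) b + t p a (nabla_vf X p b)"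
proof -
  let ?c = "chart_at A p"
  interpret local_metric "img ?c" "gr ?c" "\<Gamma> ?c" by (rule local_metric_chart[OF chart_at(1)])
  have "base_pt A p \<in> img ?c" using chart_at by (simp add: base_pt_def)
  then have "conn_at A g p u v = conn_at A g p v u" for u v
    unfolding conn_at_def christoffel_eq by (rule \<Gamma>_sym)
  from this[of "X p" a] this[of "X p" b] show ?thesis
    by (simp add: lie_deriv_def nabla_cov2_def nabla_vf_def bilinear_ladd[OF assms] bilinear_radd[OF assms])
qed

lemma lie_bracket_nabla: "lie_bracket A X Y p = nabla_vf Y p (X p) - nabla_vf X p (Y p)"
proof -
  let ?c = "chart_at A p"
  interpret local_metric "img ?c" "gr ?c" "\<Gamma> ?c" by (rule local_metric_chart[OF chart_at(1)])
  have "base_pt A p \<in> img ?c" using chart_at by (simp add: base_pt_def)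
  then have "conn_at A g p u v = conn_at A g p v u" for u v
    unfolding conn_at_def christoffel_eq by (rule \<Gamma>_sym)
  from this[of "X p" "Y p"] show ?thesis by (simp add: lie_bracket_def nabla_vf_def)
qed

lemma open_region_chart: "c \<in> A \<Longrightarrow> open_region (img c)"
  by unfold_locales (rule chart_open)

lemma bilinear_field_rep: "smooth_cov2 A t \<Longrightarrow> c \<in> A \<Longrightarrow> open_region.bilinear_field (img c) (cov2_rep A c t)"
  unfolding open_region.bilinear_field_def[OF open_region_chart] using smooth_cov2_bilinear smooth_cov2D by blast

lemma smooth_cov2_p: "smooth_cov2 A t \<Longrightarrow> bilinear (t p)"
  by (simp add: smooth_cov2_def)

lemma lie_deriv_nabla_rep:
  assumes t: "smooth_cov2 A t" and X: "smooth_vfield A X" and c: "c \<in> A" and x: "x \<in> img c"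
  shows "cov2_rep A c (lie_deriv A X t) x a b = nab2 (\<Gamma> c) (cov2_rep A c t) x (vf_rep A c X x) a b
     + cov2_rep A c t x (nabV (\<Gamma> c) (vf_rep A c X) x a) b + cov2_rep A c t x a (nabV (\<Gamma> c) (vf_rep A c X) x b)"
proof -
  obtain p where p: "p \<in> fst c" "x = snd c p" using x by auto
  have "from_chart A c p (nabV (\<Gamma> c) (vf_rep A c X) x a) = nabla_vf X p (from_chart A c p a)" for a
    using from_to_chart[OF c p(1), of "nabla_vf X p (from_chart A c p a)"]
    unfolding nabla_vf_rep[OF X c p(1)] to_from_chart[OF c p(1)] p(2) .
  then show ?thesis
    unfolding p(2) cov2_rep_at[OF c p(1)] lie_deriv_nabla[OF smooth_cov2_p[OF t]] nabla_cov2_rep[OF t c p(1)]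
    by (simp add: c p vf_rep_at)
qed

lemma lie_deriv_rep:
  assumes t: "smooth_cov2 A t" and X: "smooth_vfield A X" and c: "c \<in> A" and x: "x \<in> img c"
  shows "cov2_rep A c (lie_deriv A X t) x a b = locL (vf_rep A c X) (cov2_rep A c t) x a b"
proof -
  interpret local_metric "img c" "gr c" "\<Gamma> c" by (rule local_metric_chart[OF c])
  note b = smooth_cov2_bilinear[OF t c x]
  show ?thesis
    unfolding lie_deriv_nabla_rep[OF assms]
    by (simp add: nab2_def nabV_def locL_def bilinear_ladd[OF b] bilinear_radd[OF b] \<Gamma>_sym[OF x, of "vf_rep A c X x"])
qed

lemma lie_bracket_rep:
  assumes X: "smooth_vfield A X" and Y: "smooth_vfield A Y" and c: "c \<in> A" and x: "x \<in> img c"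
  shows "vf_rep A c (lie_bracket A X Y) x = nabV (\<Gamma> c) (vf_rep A c Y) x (vf_rep A c X x) - nabV (\<Gamma> c) (vf_rep A c X) x (vf_rep A c Y x)"
    "vf_rep A c (lie_bracket A X Y) x = locB (vf_rep A c X) (vf_rep A c Y) x"
proof -
  interpret local_metric "img c" "gr c" "\<Gamma> c" by (rule local_metric_chart[OF c])
  obtain p where p: "p \<in> fst c" "x = snd c p" using x by auto
  show "vf_rep A c (lie_bracket A X Y) x = nabV (\<Gamma> c) (vf_rep A c Y) x (vf_rep A c X x) - nabV (\<Gamma> c) (vf_rep A c X) x (vf_rep A c Y x)"
    unfolding p(2) vf_rep_at[OF c p(1)] lie_bracket_nabla linear_diff[OF to_chart_linear[OF c p(1)]]
      nabla_vf_rep[OF X c p(1)] nabla_vf_rep[OF Y c p(1)] ..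
  then show "vf_rep A c (lie_bracket A X Y) x = locB (vf_rep A c X) (vf_rep A c Y) x"
    by (simp add: nabV_def locB_def \<Gamma>_sym[OF x, of "vf_rep A c X x"])
qed

lemma smooth_lie_deriv:
  assumes t: "smooth_cov2 A t" and X: "smooth_vfield A X"
  shows "smooth_cov2 A (lie_deriv A X t)"
  unfolding smooth_cov2_def
proof (intro conjI allI ballI)
  have L: "open_region.bilinear_field (img c) (locL (vf_rep A c X) (cov2_rep A c t))" if c: "c \<in> A" for c
    by (rule open_region.bilinear_field_locL[OF open_region_chart bilinear_field_rep[OF t] smooth_vfieldD[OF X]]) (rule c)+
  fix p
  have x: "snd (chart_at A p) p \<in> img (chart_at A p)" using chart_at by auto
  have "lie_deriv A X t p = locL (vf_rep A (chart_at A p) X) (cov2_rep A (chart_at A p) t) (snd (chart_at A p) p)"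
    using lie_deriv_rep[OF t X chart_at(1) x] by (intro ext) (simp add: cov2_rep_at chart_at)
  then show "bilinear (lie_deriv A X t p)"
    using L[OF chart_at(1)] x unfolding open_region.bilinear_field_def[OF open_region_chart[OF chart_at(1)]] by metis
next
  fix c u v assume c: "c \<in> A"
  have "smooth_on (\<lambda>x. locL (vf_rep A c X) (cov2_rep A c t) x u v) (img c)"
    using open_region.bilinear_field_locL[OF open_region_chart[OF c] bilinear_field_rep[OF t c] smooth_vfieldD[OF X c]]
    unfolding open_region.bilinear_field_def[OF open_region_chart[OF c]] by blast
  then show "smooth_on (\<lambda>x. cov2_rep A c (lie_deriv A X t) x u v) (img c)"
    by (rule smooth_on_cong[OF _ chart_open(2)[OF c]]) (simp add: lie_deriv_rep[OF t X c])
qed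

lemma smooth_lie_bracket:
  assumes X: "smooth_vfield A X" and Y: "smooth_vfield A Y"
  shows "smooth_vfield A (lie_bracket A X Y)"
  unfolding smooth_vfield_def
proof
  fix c assume c: "c \<in> A"
  have "smooth_on (locB (vf_rep A c X) (vf_rep A c Y)) (img c)"
    by (rule open_region.smooth_locB[OF open_region_chart[OF c] smooth_vfieldD[OF X c] smooth_vfieldD[OF Y c]])
  then show "smooth_on (vf_rep A c (lie_bracket A X Y)) (img c)"
    by (rule smooth_on_cong[OF _ chart_open(2)[OF c]]) (simp add: lie_bracket_rep(2)[OF X Y c])
qed

section \<open>Linearity, commutator formulas and the Lie algebra of Killing fields\<close>

lemma cov2_eqI: "(\<And>c x a b. c \<in> A \<Longrightarrow> x \<in> img c \<Longrightarrow> cov2_rep A c s x a b = cov2_rep A c t x a b) \<Longrightarrow> s = t"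
proof (intro ext)
  fix p a b
  assume "\<And>c x a b. c \<in> A \<Longrightarrow> x \<in> img c \<Longrightarrow> cov2_rep A c s x a b = cov2_rep A c t x a b"
  from this[of "chart_at A p" "snd (chart_at A p) p" a b] show "s p a b = t p a b" by (simp add: cov2_rep_at chart_at)
qed

lemma vf_eqI: "(\<And>c x. c \<in> A \<Longrightarrow> x \<in> img c \<Longrightarrow> vf_rep A c X x = vf_rep A c Y x) \<Longrightarrow> X = Y"
proof (intro ext)
  fix p
  assume "\<And>c x. c \<in> A \<Longrightarrow> x \<in> img c \<Longrightarrow> vf_rep A c X x = vf_rep A c Y x"
  from this[of "chart_at A p" "snd (chart_at A p) p"] show "X p = Y p" by (simp add: vf_rep_at chart_at)
qed

lemma cov2_rep_linear:
  "cov2_rep A c (s + t) x a b = cov2_rep A c s x a b + cov2_rep A c t x a b"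
  "cov2_rep A c (s - t) x a b = cov2_rep A c s x a b - cov2_rep A c t x a b"
  "cov2_rep A c (r *\<^sub>R t) x a b = r * cov2_rep A c t x a b"
  "cov2_rep A c 0 x a b = 0"
  by (simp_all add: cov2_rep_def scaleR_fun_def)

lemma vf_rep_linear:
  assumes "c \<in> A" "x \<in> img c"
  shows "vf_rep A c (X + Y) x = vf_rep A c X x + vf_rep A c Y x" "vf_rep A c (X - Y) x = vf_rep A c X x - vf_rep A c Y x"
  "vf_rep A c (r *\<^sub>R X) x = r *\<^sub>R vf_rep A c X x" "vf_rep A c 0 x = 0"
proof -
  obtain p where p: "p \<in> fst c" "x = snd c p" using assms by auto
  note l = to_chart_linear[OF assms(1) p(1)]
  show "vf_rep A c (X + Y) x = vf_rep A c X x + vf_rep A c Y x" "vf_rep A c (X - Y) x = vf_rep A c X x - vf_rep A c Y x"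
    "vf_rep A c (r *\<^sub>R X) x = r *\<^sub>R vf_rep A c X x" "vf_rep A c 0 x = 0"
    by (simp_all add: p(2) vf_rep_at[OF assms(1) p(1)] linear_add[OF l] linear_diff[OF l] linear_scale[OF l] linear_0[OF l] scaleR_fun_def)
qed

lemma smooth_cov2_lincomb:
  assumes s: "smooth_cov2 A s" and t: "smooth_cov2 A t"
  shows "smooth_cov2 A (r *\<^sub>R s + r' *\<^sub>R t)"
  unfolding smooth_cov2_def
proof (intro conjI allI ballI)
  fix p
  have "bilinear (s p)" "bilinear (t p)" using s t by (auto simp: smooth_cov2_def)
  then show "bilinear ((r *\<^sub>R s + r' *\<^sub>R t) p)"
    by (simp add: bilinear_def linear_iff scaleR_fun_def algebra_simps)
next
  fix c u v assume c: "c \<in> A"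
  show "smooth_on (\<lambda>x. cov2_rep A c (r *\<^sub>R s + r' *\<^sub>R t) x u v) (img c)"
    unfolding cov2_rep_linear
    by (intro smooth_on_add smooth_on_mult smooth_on_const chart_open c smooth_cov2D s t)
qed

lemma smooth_vfield_lincomb:
  assumes X: "smooth_vfield A X" and Y: "smooth_vfield A Y"
  shows "smooth_vfield A (r *\<^sub>R X + r' *\<^sub>R Y)"
  unfolding smooth_vfield_def
proof
  fix c assume c: "c \<in> A"
  have "smooth_on (\<lambda>x. r *\<^sub>R vf_rep A c X x + r' *\<^sub>R vf_rep A c Y x) (img c)"
    by (intro smooth_on_add smooth_on_scaleR smooth_on_const chart_open c smooth_vfieldD X Y)
  then show "smooth_on (vf_rep A c (r *\<^sub>R X + r' *\<^sub>R Y)) (img c)"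
    by (rule smooth_on_cong[OF _ chart_open(2)[OF c]]) (simp add: vf_rep_linear[OF c])
qed

lemma lincomb_derivative:
  assumes "open S" "x \<in> S" "smooth_on X S" "smooth_on Y S" "\<And>y. y \<in> S \<Longrightarrow> Z y = r *\<^sub>R X y + r' *\<^sub>R Y y"
  shows "frechet_derivative Z (at x) v = r *\<^sub>R frechet_derivative X (at x) v + r' *\<^sub>R frechet_derivative Y (at x) v"
proof -
  have "((\<lambda>y. r *\<^sub>R X y + r' *\<^sub>R Y y) has_derivative (\<lambda>v. r *\<^sub>R frechet_derivative X (at x) v + r' *\<^sub>R frechet_derivative Y (at x) v)) (at x)"
    by (intro has_derivative_add has_derivative_scaleR_right smooth_on_has_derivative[OF assms(3,2)] smooth_on_has_derivative[OF assms(4,2)])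
  then have "(Z has_derivative (\<lambda>v. r *\<^sub>R frechet_derivative X (at x) v + r' *\<^sub>R frechet_derivative Y (at x) v)) (at x)"
    by (rule has_derivative_transform_within_open[OF _ assms(1,2)]) (simp add: assms(5))
  then show ?thesis by (simp add: frechet_derivative_eqI)
qed

lemma lie_deriv_lincomb:
  assumes s: "smooth_cov2 A s" and t: "smooth_cov2 A t" and X: "smooth_vfield A X" and Y: "smooth_vfield A Y"
  shows "lie_deriv A X (r *\<^sub>R s + r' *\<^sub>R t) = r *\<^sub>R lie_deriv A X s + r' *\<^sub>R lie_deriv A X t"
    "lie_deriv A (r *\<^sub>R X + r' *\<^sub>R Y) t = r *\<^sub>R lie_deriv A X t + r' *\<^sub>R lie_deriv A Y t"
proof -
  have "frechet_derivative (\<lambda>x. cov2_rep A c (r *\<^sub>R s + r' *\<^sub>R t) x a b) (at x) v =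
     r *\<^sub>R frechet_derivative (\<lambda>x. cov2_rep A c s x a b) (at x) v + r' *\<^sub>R frechet_derivative (\<lambda>x. cov2_rep A c t x a b) (at x) v"
    if "c \<in> A" "x \<in> img c" for c x a b v
    by (rule lincomb_derivative[OF chart_open(2)[OF that(1)] that(2) smooth_cov2D[OF s that(1)] smooth_cov2D[OF t that(1)]])
      (simp add: cov2_rep_linear)
  then show "lie_deriv A X (r *\<^sub>R s + r' *\<^sub>R t) = r *\<^sub>R lie_deriv A X s + r' *\<^sub>R lie_deriv A X t"
    by (intro cov2_eqI) (simp add: lie_deriv_rep[OF smooth_cov2_lincomb[OF s t] X] lie_deriv_rep[OF s X] lie_deriv_rep[OF t X]
        cov2_rep_linear locL_def algebra_simps)
  have e: "frechet_derivative (vf_rep A c (r *\<^sub>R X + r' *\<^sub>R Y)) (at x) v =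
     r *\<^sub>R frechet_derivative (vf_rep A c X) (at x) v + r' *\<^sub>R frechet_derivative (vf_rep A c Y) (at x) v"
    if "c \<in> A" "x \<in> img c" for c x v
    by (rule lincomb_derivative[OF chart_open(2)[OF that(1)] that(2) smooth_vfieldD[OF X that(1)] smooth_vfieldD[OF Y that(1)]])
      (simp add: vf_rep_linear that)
  show "lie_deriv A (r *\<^sub>R X + r' *\<^sub>R Y) t = r *\<^sub>R lie_deriv A X t + r' *\<^sub>R lie_deriv A Y t"
  proof (rule cov2_eqI)
    fix c x a b assume c: "c \<in> A" and x: "x \<in> img c"
    note bi = smooth_cov2_bilinear[OF t c x] and l = smooth_on_linear_derivative[OF smooth_cov2D[OF t c] x]
    show "cov2_rep A c (lie_deriv A (r *\<^sub>R X + r' *\<^sub>R Y) t) x a b = cov2_rep A c (r *\<^sub>R lie_deriv A X t + r' *\<^sub>R lie_deriv A Y t) x a b"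
      by (simp add: lie_deriv_rep[OF t smooth_vfield_lincomb[OF X Y] c x] lie_deriv_rep[OF t X c x] lie_deriv_rep[OF t Y c x]
          cov2_rep_linear locL_def vf_rep_linear[OF c x] e[OF c x] bilinear_ladd[OF bi] bilinear_radd[OF bi] bilinear_lmul[OF bi]
          bilinear_rmul[OF bi] linear_add[OF l] linear_scale[OF l] algebra_simps)
  qed
qed

lemma lie_bracket_lincomb:
  assumes X: "smooth_vfield A X" and Y: "smooth_vfield A Y" and Z: "smooth_vfield A Z"
  shows "lie_bracket A (r *\<^sub>R X + r' *\<^sub>R Y) Z = r *\<^sub>R lie_bracket A X Z + r' *\<^sub>R lie_bracket A Y Z"
proof (rule vf_eqI)
  fix c x assume c: "c \<in> A" and x: "x \<in> img c"
  note l = smooth_on_linear_derivative[OF smooth_vfieldD[OF Z c] x]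
  have "frechet_derivative (vf_rep A c (r *\<^sub>R X + r' *\<^sub>R Y)) (at x) v =
     r *\<^sub>R frechet_derivative (vf_rep A c X) (at x) v + r' *\<^sub>R frechet_derivative (vf_rep A c Y) (at x) v" for v
    by (rule lincomb_derivative[OF chart_open(2)[OF c] x smooth_vfieldD[OF X c] smooth_vfieldD[OF Y c]])
      (simp add: vf_rep_linear c)
  then show "vf_rep A c (lie_bracket A (r *\<^sub>R X + r' *\<^sub>R Y) Z) x = vf_rep A c (r *\<^sub>R lie_bracket A X Z + r' *\<^sub>R lie_bracket A Y Z) x"
    by (simp add: lie_bracket_rep(2)[OF smooth_vfield_lincomb[OF X Y] Z c x] lie_bracket_rep(2)[OF X Z c x]
        lie_bracket_rep(2)[OF Y Z c x] vf_rep_linear[OF c x] locB_def linear_add[OF l] linear_scale[OF l] algebra_simps)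
qed

lemma lie_bracket_swap: "lie_bracket A X Y = - lie_bracket A Y X"
  by (simp add: lie_bracket_def fun_eq_iff)

lemma lie_bracket_jacobi:
  assumes X: "smooth_vfield A X" and Y: "smooth_vfield A Y" and Z: "smooth_vfield A Z"
  shows "lie_bracket A X (lie_bracket A Y Z) + lie_bracket A Y (lie_bracket A Z X) + lie_bracket A Z (lie_bracket A X Y) = 0"
proof (rule vf_eqI)
  fix c x assume c: "c \<in> A" and x: "x \<in> img c"
  \<comment> \<open>The inner bracket agrees with \<open>locB\<close> on the image of the chart
    only; there it may be replaced under the derivative, since the image is open.\<close>
  have e: "vf_rep A c (lie_bracket A X (lie_bracket A Y Z)) x = locB (vf_rep A c X) (locB (vf_rep A c Y) (vf_rep A c Z)) x"
    if "smooth_vfield A X" "smooth_vfield A Y" "smooth_vfield A Z" for X Y Z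
    unfolding lie_bracket_rep(2)[OF that(1) smooth_lie_bracket[OF that(2,3)] c x]
    using frechet_derivative_cong_open[OF chart_open(2)[OF c] x lie_bracket_rep(2)[OF that(2,3) c]]
    by (simp add: locB_def[of "vf_rep A c X"] lie_bracket_rep(2)[OF that(2,3) c x])
  show "vf_rep A c (lie_bracket A X (lie_bracket A Y Z) + lie_bracket A Y (lie_bracket A Z X) + lie_bracket A Z (lie_bracket A X Y)) x = vf_rep A c 0 x"
    by (simp add: vf_rep_linear[OF c x] e X Y Z
        open_region.locB_jacobi[OF open_region_chart[OF c] smooth_vfieldD[OF X c] smooth_vfieldD[OF Y c] smooth_vfieldD[OF Z c] x])
qed

lemma lie_deriv_commutator:
  assumes t: "smooth_cov2 A t" and X: "smooth_vfield A X" and Y: "smooth_vfield A Y"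
  shows "lie_deriv A (lie_bracket A X Y) t = lie_deriv A X (lie_deriv A Y t) - lie_deriv A Y (lie_deriv A X t)"
proof (rule cov2_eqI)
  fix c x a b assume c: "c \<in> A" and x: "x \<in> img c"
  have e: "cov2_rep A c (lie_deriv A X (lie_deriv A Y t)) x a b = locL (vf_rep A c X) (locL (vf_rep A c Y) (cov2_rep A c t)) x a b"
    if "smooth_vfield A X" "smooth_vfield A Y" for X Y
    unfolding lie_deriv_rep[OF smooth_lie_deriv[OF t that(2)] that(1) c x]
    using frechet_derivative_cong_open[OF chart_open(2)[OF c] x lie_deriv_rep[OF t that(2) c]]
    by (simp add: locL_def[of "vf_rep A c X"] lie_deriv_rep[OF t that(2) c x])
  have "cov2_rep A c (lie_deriv A (lie_bracket A X Y) t) x a b = locL (locB (vf_rep A c X) (vf_rep A c Y)) (cov2_rep A c t) x a b"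
    unfolding lie_deriv_rep[OF t smooth_lie_bracket[OF X Y] c x]
    using frechet_derivative_cong_open[OF chart_open(2)[OF c] x lie_bracket_rep(2)[OF X Y c]]
    by (simp add: locL_def lie_bracket_rep(2)[OF X Y c x])
  then show "cov2_rep A c (lie_deriv A (lie_bracket A X Y) t) x a b = cov2_rep A c (lie_deriv A X (lie_deriv A Y t) - lie_deriv A Y (lie_deriv A X t)) x a b"
    by (simp add: cov2_rep_linear e X Y
        open_region.locL_commutator[OF open_region_chart[OF c] bilinear_field_rep[OF t c] smooth_vfieldD[OF X c] smooth_vfieldD[OF Y c] x])
qed

lemma smooth_g: "smooth_cov2 A g"
  using riem by (simp add: riemannian_metric_def)

text \<open>Closure under the bracket is \<open>lie_deriv_commutator\<close> applied to
  \<open>g\<close>.\<close>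

lemma lie_algebra_isom: "lie_algebra (isom A g) (lie_bracket A)"
proof -
  have smooth: "smooth_vfield A X" and kill: "lie_deriv A X g = 0" if "X \<in> isom A g" for X
    using that by (auto simp: isom_def)
  have lincomb: "r *\<^sub>R X + r' *\<^sub>R Y \<in> isom A g" if "X \<in> isom A g" "Y \<in> isom A g" for X Y r r'
    using that smooth_vfield_lincomb lie_deriv_lincomb(2)[OF smooth_g smooth_g] by (simp add: isom_def)
  have zero: "0 \<in> isom A g"
  proof -
    have "smooth_vfield A 0"
      unfolding smooth_vfield_def
    proof
      fix c assume c: "c \<in> A"
      show "smooth_on (vf_rep A c 0) (img c)"
        by (rule smooth_on_cong[OF smooth_on_const chart_open(2)[OF c]]) (simp add: vf_rep_linear(4)[OF c])
    qed
    then show ?thesis using lie_deriv_lincomb(2)[OF smooth_g smooth_g, of 0 0 0 0] by (simp add: isom_def)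
  qed
  have br: "lie_bracket A X Y \<in> isom A g" if "X \<in> isom A g" "Y \<in> isom A g" for X Y
  proof -
    have "lie_deriv A X 0 = 0" if "smooth_vfield A X" for X
      using lie_deriv_lincomb(1)[OF smooth_g smooth_g that that, of 0 0] by simp
    then show ?thesis
      using that smooth_lie_bracket lie_deriv_commutator[OF smooth_g] by (simp add: isom_def)
  qed
  have right: "lie_bracket A Z (r *\<^sub>R X + r' *\<^sub>R Y) = r *\<^sub>R lie_bracket A Z X + r' *\<^sub>R lie_bracket A Z Y"
    if "smooth_vfield A X" "smooth_vfield A Y" "smooth_vfield A Z" for X Y Z r r'
    unfolding lie_bracket_swap[of Z] lie_bracket_lincomb[OF that] by simp
  have "subspace (isom A g)"
    unfolding subspace_def
  proof (intro conjI ballI allI)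
    fix X Y r assume "X \<in> isom A g" "Y \<in> isom A g"
    then show "X + Y \<in> isom A g" "r *\<^sub>R X \<in> isom A g" using lincomb[of X Y 1 1] lincomb[of X X r 0] by simp_all
  qed (rule zero)
  moreover have "lie_bracket A X X = 0" for X by (simp add: lie_bracket_def fun_eq_iff)
  ultimately show ?thesis
    unfolding lie_algebra_def by (simp add: br right lie_bracket_lincomb lie_bracket_jacobi smooth)
qed

end

section \<open>Compatible conformal-Killing two-forms\<close>

lemma local_metric_subset:
  assumes "local_metric S G \<Gamma>" "open T" "T \<subseteq> S"
  shows "local_metric T G \<Gamma>"
proof -
  interpret local_metric S G \<Gamma> by fact
  show ?thesis
    by (rule local_metric.intro)
      (use assms(2,3) metric smooth_on_subset[OF smooth_G] \<Gamma>_bilinear \<Gamma>_sym smooth_on_subset[OF smooth_\<Gamma>] \<Gamma>_metric in auto)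
qed

text \<open>Orthogonality together with the square \<open>- id\<close> amounts to skewness, and the
  remaining products follow from the given ones by anticommutation.\<close>

lemma quaternionic_triple_space:
  fixes G :: "('m, 'e::euclidean_space) cov2"
  assumes m: "metric_form (G p)" and d: "DIM('e) \<ge> 8" and t: "quaternionic_triple G p J1 J2 J3"
  shows "quaternionic_space (G p) J1 J2 J3"
proof -
  interpret metric_form "G p" by (rule m)
  have lin: "linear J1" "linear J2" "linear J3" using t by (auto simp: quaternionic_triple_def)
  have sq: "J1 (J1 u) = - u" "J2 (J2 u) = - u" "J3 (J3 u) = - u"
    and anti: "J1 (J2 u) = - J2 (J1 u)" "J2 (J3 u) = - J3 (J2 u)" "J1 (J3 u) = - J3 (J1 u)" and 3: "J3 u = J1 (J2 u)"
    and iso: "G p (J1 u) (J1 v) = G p u v" "G p (J2 u) (J2 v) = G p u v" "G p (J3 u) (J3 v) = G p u v" for u v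
    using t by (auto simp: quaternionic_triple_def fun_eq_iff)
  have mult: "J1 (J2 u) = J3 u" "J2 (J3 u) = J1 u" "J3 (J1 u) = J2 u" "J2 (J1 u) = - J3 u" "J3 (J2 u) = - J1 u" "J1 (J3 u) = - J2 u" for u
  proof -
    show 1: "J1 (J2 u) = J3 u" for u by (simp add: 3)
    show 2: "J2 (J1 u) = - J3 u" for u using anti(1)[of u] by (simp add: 3)
    show 4: "J3 (J2 u) = - J1 u" for u using 1[of "J2 u"] by (simp add: sq linear_neg[OF lin(1)])
    show 5: "J1 (J3 u) = - J2 u" for u using sq(1)[of "J2 u"] by (simp add: 1)
    show "J2 (J3 u) = J1 u" "J3 (J1 u) = J2 u" using anti(2,3)[of u] 4[of u] 5[of u] by simp_all
  qed
  have skew: "G p (J u) v = - G p u (J v)" if "\<And>u v. G p (J u) (J v) = G p u v" "\<And>u. J (J u) = - u" for J u v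
    using that(1)[of "J u" v] by (simp add: that(2) G_lin)
  show ?thesis
    by (intro quaternionic_space.intro quaternionic_space_axioms.intro m lin)
      (rule sq mult skew[OF iso(1) sq(1)] skew[OF iso(2) sq(2)] skew[OF iso(3) sq(3)] d)+
qed

lemma span_triple_iff:
  fixes f1 f2 f3 :: "'a::real_vector"
  shows "f \<in> span {f1, f2, f3} \<longleftrightarrow> (\<exists>a b c. f = a *\<^sub>R f1 + b *\<^sub>R f2 + c *\<^sub>R f3)"
  by (simp add: span_insert span_breakdown_eq algebra_simps)

lemma (in quaternionic_space) span_iff_in_Q: "F \<in> span {J1, J2, J3} \<longleftrightarrow> in_Q F"
  by (simp add: span_triple_iff in_Q_def fun_eq_iff scaleR_fun_def)

context riemannian_manifold
begin

section \<open>Two-forms as skew endomorphisms, and the codifferential\<close>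

definition endo :: "('m, 'e) cov2 \<Rightarrow> ('m, 'e) endfield" where
  "endo \<psi> q u = sharp g q (\<psi> q u)"

lemma g_endo:
  assumes "bilinear (\<psi> q)"
  shows "g q (endo \<psi> q u) v = \<psi> q u v"
proof -
  have "linear (\<psi> q u)" using assms by (simp add: bilinear_def)
  from theI'[OF metric_form.riesz[OF metric_form_g this]] show ?thesis
    unfolding endo_def sharp_def by blast
qed

lemma endo_linear:
  assumes "bilinear (\<psi> q)"
  shows "linear (endo \<psi> q)"
proof -
  interpret metric_form "g q" by (rule metric_form_g)
  note e = g_endo[where \<psi> = \<psi> and q = q, OF assms]
  show ?thesis
    by (rule linearI; rule G_eqI) (simp_all add: G_lin e bilinear_ladd[OF assms] bilinear_lmul[OF assms])
qed

lemma gr_endo: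
  assumes t: "smooth_cov2 A \<psi>" and c: "c \<in> A" and x: "x \<in> img c"
  shows "gr c x (end_rep A c (endo \<psi>) x a) b = cov2_rep A c \<psi> x a b"
proof -
  obtain p where p: "p \<in> fst c" "x = snd c p" using x by auto
  show ?thesis
    by (simp add: p(2) cov2_rep_at[OF c p(1)] end_rep_at[OF c p(1)] c p g_endo[where \<psi> = \<psi> and q = p, OF smooth_cov2_p[OF t]])
qed

lemma endo_endfield:
  assumes t: "smooth_cov2 A \<psi>" and c: "c \<in> A"
  shows "local_metric.endfield (img c) (end_rep A c (endo \<psi>))"
proof -
  interpret local_metric "img c" "gr c" "\<Gamma> c" by (rule local_metric_chart[OF c])
  show ?thesis
    unfolding endfield_def
  proof (intro conjI ballI allI)
    fix x assume "x \<in> img c"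
    then obtain p where p: "p \<in> fst c" "x = snd c p" by auto
    show "linear (end_rep A c (endo \<psi>) x)"
      using from_chart_linear[OF c p(1)] to_chart_linear[OF c p(1)] endo_linear[where \<psi> = \<psi>, OF smooth_cov2_p[OF t], of p]
      by (simp add: linear_iff p(2) end_rep_at[OF c p(1)])
  next
    show "smooth_on (\<lambda>x. end_rep A c (endo \<psi>) x u) (img c)" for u
      by (rule smooth_metric_solve[OF open_S metric smooth_G smooth_cov2D[OF t c] gr_endo[OF t c]])
  qed
qed

lemma two_formD:
  assumes "two_form A \<psi>"
  shows "smooth_cov2 A \<psi>" "bilinear (\<psi> p)" "\<psi> p u u = 0" "\<psi> p u v = - \<psi> p v u"
proof -
  show s: "smooth_cov2 A \<psi>" and z: "\<psi> p u u = 0" for u using assms by (auto simp: two_form_def)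
  show b: "bilinear (\<psi> p)" by (rule smooth_cov2_p[OF s])
  show "\<psi> p u v = - \<psi> p v u"
    using z[of "u + v"] z[of u] z[of v] by (simp add: bilinear_ladd[OF b] bilinear_radd[OF b])
qed

text \<open>The Christoffel terms cancel in the alternating sum, again because the connection is
  torsion-free.\<close>

lemma ext_d_nabla:
  assumes "two_form A \<psi>"
  shows "ext_d A \<psi> p a b c = nabla_cov2 A g \<psi> p a b c - nabla_cov2 A g \<psi> p b a c + nabla_cov2 A g \<psi> p c a b"
proof -
  let ?c = "chart_at A p"
  interpret local_metric "img ?c" "gr ?c" "\<Gamma> ?c" by (rule local_metric_chart[OF chart_at(1)])
  have "base_pt A p \<in> img ?c" using chart_at by (simp add: base_pt_def)
  then have "conn_at A g p u v = conn_at A g p v u" for u v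
    unfolding conn_at_def christoffel_eq by (rule \<Gamma>_sym)
  from this[of a b] this[of a c] this[of b c] show ?thesis
    using two_formD(4)[OF assms, of p "conn_at A g p a c" b]
    by (simp add: ext_d_def nabla_cov2_def)
qed

lemma on_frame: "metric_form.frame (g p) (on_frame g p)"
proof -
  interpret metric_form "g p" by (rule metric_form_g)
  have eq: "orthonormal_frame g p B \<longleftrightarrow> frame B" for B by (simp add: orthonormal_frame_def frame_def)
  show ?thesis using someI_ex[OF frame_exists] unfolding on_frame_def eq .
qed

lemma nabla_endo:
  assumes t: "smooth_cov2 A \<psi>" and c: "c \<in> A" and p: "p \<in> fst c"
  shows "nabla_cov2 A g \<psi> p v a b = gr c (snd c p)
    (nabE (\<Gamma> c) (end_rep A c (endo \<psi>)) (snd c p) (to_chart A c p v) (to_chart A c p a)) (to_chart A c p b)"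
proof -
  interpret local_metric "img c" "gr c" "\<Gamma> c" by (rule local_metric_chart[OF c])
  have "snd c p \<in> img c" using p by auto
  from nab2_eq_nabE[OF endo_endfield[OF t c] this, of "cov2_rep A c \<psi>"] show ?thesis
    unfolding nabla_cov2_rep[OF t c p] by (simp add: gr_endo[OF t c])
qed

lemma endo_rep_skew:
  assumes \<psi>: "two_form A \<psi>" and c: "c \<in> A" and x: "x \<in> img c"
  shows "gr c x (end_rep A c (endo \<psi>) x a) b = - gr c x a (end_rep A c (endo \<psi>) x b)"
proof -
  interpret m: metric_form "gr c x" by (rule local_metric.metric[OF local_metric_chart[OF c] x])
  note e = gr_endo[OF two_formD(1)[OF \<psi>] c x]
  show ?thesis
    unfolding e m.G_sym[of a "end_rep A c (endo \<psi>) x b"]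
    unfolding cov2_rep_def by (rule two_formD(4)[OF \<psi>])
qed

text \<open>\<open>on_frame g p\<close> is an unspecified choice. The isometry
  \<open>to_chart\<close> carries it into the chart, where any other frame \<open>B\<close> gives
  the same contraction.\<close>

lemma codiff_rep:
  assumes \<psi>: "two_form A \<psi>" and c: "c \<in> A" and p: "p \<in> fst c" and B: "metric_form.frame (gr c (snd c p)) B"
  shows "gr c (snd c p) (vf_rep A c (codiff A g \<psi>) (snd c p)) u =
    - (\<Sum>e\<in>B. gr c (snd c p) (nabE (\<Gamma> c) (end_rep A c (endo \<psi>)) (snd c p) e e) u)"
proof -
  interpret l: local_metric "img c" "gr c" "\<Gamma> c" by (rule local_metric_chart[OF c])
  have x: "snd c p \<in> img c" using p by auto
  interpret m: metric_form "g p" by (rule metric_form_g)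
  interpret x: metric_form "gr c (snd c p)" by (rule l.metric[OF x])
  let ?N = "nabE (\<Gamma> c) (end_rep A c (endo \<psi>)) (snd c p)" and ?to = "to_chart A c p"
  note t = two_formD(1)[OF \<psi>] and to_lin = to_chart_linear[OF c p]
  note nab = nabla_endo[OF t c p]
  have gr_to: "gr c (snd c p) (?to a) (?to b) = g p a b" for a b by (simp add: cov2_rep_at c p)
  have lin: "linear (\<lambda>v. - (\<Sum>e\<in>on_frame g p. nabla_cov2 A g \<psi> p e e v))"
    by (rule linearI) (simp_all add: nab linear_add[OF to_lin] linear_scale[OF to_lin] x.G_lin sum.distrib sum_distrib_left)
  from theI'[OF m.riesz[OF lin]]
  have "g p (codiff A g \<psi> p) v = - (\<Sum>e\<in>on_frame g p. nabla_cov2 A g \<psi> p e e v)" for v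
    unfolding codiff_def sharp_def by blast
  then have "gr c (snd c p) (vf_rep A c (codiff A g \<psi>) (snd c p)) u = - (\<Sum>e\<in>on_frame g p. gr c (snd c p) (?N (?to e) (?to e)) u)"
    by (simp add: cov2_rep_at vf_rep_at c p nab)
  also have "(\<Sum>e\<in>on_frame g p. gr c (snd c p) (?N (?to e) (?to e)) u) = (\<Sum>e\<in>?to ` on_frame g p. gr c (snd c p) (?N e e) u)"
    using from_to_chart[OF c p] by (subst sum.reindex) (auto intro: inj_on_inverseI)
  also have "\<dots> = (\<Sum>e\<in>B. gr c (snd c p) (?N e e) u)"
  proof (rule x.frame_independent[where h = "\<lambda>e f. gr c (snd c p) (?N e f) u", OF _ B])
    have "inj_on ?to (on_frame g p)" using from_to_chart[OF c p] by (rule inj_on_inverseI)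
    then show "x.frame (?to ` on_frame g p)"
      using on_frame[of p] unfolding x.frame_def m.frame_def by (auto simp: card_image gr_to inj_on_def)
    show "bilinear (\<lambda>e f. gr c (snd c p) (?N e f) u)"
      using l.linear_nabE_direction[OF endo_endfield[OF t c] x] l.endfieldD(1)[OF l.endfield_nabE[OF endo_endfield[OF t c]] x]
      unfolding bilinear_def by (auto simp: linear_iff x.G_lin)
  qed
  finally show ?thesis .
qed

text \<open>A frame chosen pointwise shows no smoothness. By skewness the contraction is the trace
  of the linear map \<open>\<lambda>e. ?N x e u\<close>, which can be taken over the constant
  \<open>Basis\<close>.\<close>

lemma smooth_codiff:
  assumes \<psi>: "two_form A \<psi>"
  shows "smooth_vfield A (codiff A g \<psi>)"
  unfolding smooth_vfield_def
proof
  fix c assume c: "c \<in> A"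
  interpret l: local_metric "img c" "gr c" "\<Gamma> c" by (rule local_metric_chart[OF c])
  let ?N = "\<lambda>x. nabE (\<Gamma> c) (end_rep A c (endo \<psi>)) x"
  note ef = endo_endfield[OF two_formD(1)[OF \<psi>] c]
  show "smooth_on (vf_rep A c (codiff A g \<psi>)) (img c)"
  proof (rule smooth_metric_solve[OF l.open_S l.metric l.smooth_G])
    show "smooth_on (\<lambda>x. \<Sum>b\<in>Basis. ?N x b u \<bullet> b) (img c)" for u
      by (intro smooth_on_sum smooth_on_inner smooth_on_const l.open_S l.endfieldD(2) l.endfield_nabE ef)
    fix x u assume x: "x \<in> img c"
    then obtain p where p: "p \<in> fst c" "x = snd c p" by auto
    interpret x: metric_form "gr c x" by (rule l.metric[OF x])
    obtain B where B: "x.frame B" using x.frame_exists by blast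
    have "gr c x (?N x e e) u = - gr c x (?N x e u) e" for e
      using l.nabE_skew[OF ef x endo_rep_skew[OF \<psi> c], of e e u] x.G_sym[of e "?N x e u"] by simp
    then have "gr c x (vf_rep A c (codiff A g \<psi>) x) u = (\<Sum>e\<in>B. gr c x (?N x e u) e)"
      using codiff_rep[OF \<psi> c p(1) B[unfolded p(2)], of u] by (simp add: p(2)[symmetric] sum_negf)
    also have "\<dots> = (\<Sum>b\<in>Basis. ?N x b u \<bullet> b)"
      by (rule x.frame_Basis_trace[OF B l.linear_nabE_direction[OF ef x], symmetric])
    finally show "gr c x (vf_rep A c (codiff A g \<psi>) x) u = (\<Sum>b\<in>Basis. ?N x b u \<bullet> b)" .
  qed
qed

end

locale qk_manifold =
  fixes A :: "('m::{t2_space,second_countable_topology}, 'e::euclidean_space) chart set"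
    and g :: "('m, 'e) cov2" and Q :: "'m \<Rightarrow> ('e \<Rightarrow> 'e) set"
  assumes qk: "quaternionic_kahler A g Q"
begin

sublocale riemannian_manifold A g
  by unfold_locales (use qk in \<open>auto simp: quaternionic_kahler_def\<close>)

lemma dim8: "DIM('e) \<ge> 8"
  using qk by (auto simp: quaternionic_kahler_def)

text \<open>Local trivialisations of \<open>Q\<close>. They need not be chart domains, hence the
  intersections \<open>fst c \<inter> U\<close> from here on.\<close>

definition loc :: "'m set \<Rightarrow> ('m, 'e) endfield \<Rightarrow> ('m, 'e) endfield \<Rightarrow> ('m, 'e) endfield \<Rightarrow> bool" where
  "loc U J1 J2 J3 \<longleftrightarrow> open U \<and> (\<forall>J\<in>{J1, J2, J3}. smooth_endfield_on A U J) \<and>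
     (\<forall>q\<in>U. quaternionic_triple g q (J1 q) (J2 q) (J3 q) \<and> Q q = span {J1 q, J2 q, J3 q})"

lemma loc_exists: "\<exists>U J1 J2 J3. p \<in> U \<and> loc U J1 J2 J3"
  using qk unfolding quaternionic_kahler_def loc_def by blast

lemma triple_space: "quaternionic_triple g q J1 J2 J3 \<Longrightarrow> quaternionic_space (g q) J1 J2 J3"
  by (rule quaternionic_triple_space[OF metric_form_g dim8])

lemma loc_space: "loc U J1 J2 J3 \<Longrightarrow> q \<in> U \<Longrightarrow> quaternionic_space (g q) (J1 q) (J2 q) (J3 q)"
  unfolding loc_def using triple_space by blast

lemma in_Q_rep:
  assumes c: "c \<in> A" and p: "p \<in> fst c"
    and Q: "quaternionic_space (g p) (J1 p) (J2 p) (J3 p)" "quaternionic_space.in_Q (J1 p) (J2 p) (J3 p) F"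
    and Q': "quaternionic_space G' (end_rep A c J1 (snd c p)) (end_rep A c J2 (snd c p)) (end_rep A c J3 (snd c p))"
    and F': "\<And>u. F' (to_chart A c p u) = to_chart A c p (F u)"
  shows "quaternionic_space.in_Q (end_rep A c J1 (snd c p)) (end_rep A c J2 (snd c p)) (end_rep A c J3 (snd c p)) F'"
proof -
  obtain r1 r2 r3 where F: "\<And>u. F u = r1 *\<^sub>R J1 p u + r2 *\<^sub>R J2 p u + r3 *\<^sub>R J3 p u"
    using Q(2) unfolding quaternionic_space.in_Q_def[OF Q(1)] by blast
  note l = to_chart_linear[OF c p]
  show ?thesis
  proof (rule quaternionic_space.in_QI[OF Q'])
    fix u
    have "F' (to_chart A c p (from_chart A c p u)) = to_chart A c p (F (from_chart A c p u))" by (rule F')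
    then show "F' u = r1 *\<^sub>R end_rep A c J1 (snd c p) u + r2 *\<^sub>R end_rep A c J2 (snd c p) u + r3 *\<^sub>R end_rep A c J3 (snd c p) u"
      by (simp add: F c p end_rep_at linear_add[OF l] linear_scale[OF l])
  qed
qed

lemma quaternionic_space_rep:
  assumes c: "c \<in> A" and p: "p \<in> fst c" and "quaternionic_space (g p) (J1 p) (J2 p) (J3 p)"
  shows "quaternionic_space (gr c (snd c p)) (end_rep A c J1 (snd c p)) (end_rep A c J2 (snd c p)) (end_rep A c J3 (snd c p))"
proof -
  interpret p: quaternionic_space "g p" "J1 p" "J2 p" "J3 p" by fact
  have x: "snd c p \<in> img c" using p by auto
  note t = to_chart_linear[OF c p] and f = from_chart_linear[OF c p]
  have lin: "linear (end_rep A c J (snd c p))" if "linear (J p)" for J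
    using t f that by (simp add: linear_iff end_rep_at[OF c p])
  show ?thesis
    by (intro quaternionic_space.intro quaternionic_space_axioms.intro local_metric.metric[OF local_metric_chart[OF c] x]
        lin p.linear_J dim8)
      (simp_all add: end_rep_at[OF c p] cov2_rep_at[OF c p] c p p.J_sq p.J_mult p.J_skew linear_neg[OF t])
qed

lemma loc_chart:
  assumes U: "loc U J1 J2 J3" and c: "c \<in> A"
  shows "local_qk (snd c ` (fst c \<inter> U)) (gr c) (\<Gamma> c) (end_rep A c J1) (end_rep A c J2) (end_rep A c J3)"
proof -
  let ?S = "snd c ` (fst c \<inter> U)"
  have oU: "open U" using U by (simp add: loc_def)
  interpret local_metric ?S "gr c" "\<Gamma> c"
    by (rule local_metric_subset[OF local_metric_chart[OF c] chart_image_open[OF c oU]]) auto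
  have sm: "smooth_endfield_on A U J" if "J \<in> {J1, J2, J3}" for J using U that by (auto simp: loc_def)
  have quat: "quaternionic_space (gr c x) (end_rep A c J1 x) (end_rep A c J2 x) (end_rep A c J3 x)" if "x \<in> ?S" for x
    using that quaternionic_space_rep[where ?J1.0 = J1 and ?J2.0 = J2 and ?J3.0 = J3, OF c _ loc_space[OF U]] by auto
  have ef: "endfield (end_rep A c J)" if "J \<in> {J1, J2, J3}" for J
    unfolding endfield_def
  proof (intro conjI ballI allI)
    show "linear (end_rep A c J x)" if "x \<in> ?S" for x
      using quaternionic_space.linear_J[OF quat[OF that]] \<open>J \<in> _\<close> by auto
    show "smooth_on (\<lambda>x. end_rep A c J x u) ?S" for u
      using sm[OF \<open>J \<in> _\<close>] c by (simp add: smooth_endfield_on_def)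
  qed
  have nab: "quaternionic_space.in_Q (end_rep A c J1 x) (end_rep A c J2 x) (end_rep A c J3 x) (nabE (\<Gamma> c) (end_rep A c J) x v)"
    if J: "J \<in> {J1, J2, J3}" and x: "x \<in> ?S" for J x v
  proof -
    obtain q where q: "q \<in> fst c" "q \<in> U" "x = snd c q" using x by auto
    interpret q: quaternionic_space "g q" "J1 q" "J2 q" "J3 q" by (rule loc_space[OF U q(2)])
    have "\<forall>r\<in>U. J r \<in> Q r" using U J unfolding loc_def by (auto intro: span_base)
    then have "nabla_end A g J q (from_chart A c q v) \<in> Q q"
      using qk sm[OF J] oU q(2) unfolding quaternionic_kahler_def by blast
    then have Q: "q.in_Q (nabla_end A g J q (from_chart A c q v))"
      using U q(2) unfolding loc_def by (simp flip: q.span_iff_in_Q)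
    show ?thesis unfolding q(3)
      by (rule in_Q_rep[OF c q(1) q.quaternionic_space_axioms Q quat[OF x, unfolded q(3)]])
        (simp add: nabla_end_rep[OF oU sm[OF J] c q(1,2)] c q)
  qed
  show ?thesis
    by (intro local_qk.intro local_qk_axioms.intro local_metric_axioms)
      (assumption | rule quat ef nab | simp)+
qed

text \<open>The triples \<open>K\<close> and \<open>L\<close> of the two summands may differ from
  the \<open>J\<close> of the trivialisation, but all of them span \<open>Q q\<close>. Every
  \<open>J\<close> in \<open>Q q\<close> is a combination of the \<open>L\<close> and so commutes
  with the \<open>S2E\<close>-part; it is also a combination of the \<open>K\<close>, so its
  commutator with the \<open>S2H\<close>-part lies in \<open>Q q\<close>.\<close>

lemma compatible_normalises:
  assumes comp: "compatible g Q \<psi>" and b: "bilinear (\<psi> q)" and U: "loc U J1 J2 J3" and q: "q \<in> U"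
  shows "quaternionic_space.normalises (J1 q) (J2 q) (J3 q) (endo \<psi> q)"
proof -
  interpret q: quaternionic_space "g q" "J1 q" "J2 q" "J3 q" by (rule loc_space[OF U q])
  have Qq: "Q q = span {J1 q, J2 q, J3 q}" using U q by (simp add: loc_def)
  obtain \<sigma> \<tau> where st: "\<sigma> \<in> S2H g Q q" "\<tau> \<in> S2E g Q q" "\<psi> q = \<sigma> + \<tau>" using comp unfolding compatible_def by blast
  obtain K1 K2 K3 s1 s2 s3 where K: "quaternionic_triple g q K1 K2 K3" "Q q = span {K1, K2, K3}"
    and \<sigma>: "\<sigma> = s1 *\<^sub>R kahler_form g q K1 + s2 *\<^sub>R kahler_form g q K2 + s3 *\<^sub>R kahler_form g q K3"
    using st(1) unfolding S2H_def span_triple_iff by blast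
  obtain L1 L2 L3 where L: "quaternionic_triple g q L1 L2 L3" "Q q = span {L1, L2, L3}"
    and \<tau>: "bilinear \<tau>" "\<And>u v. \<tau> (L1 u) (L1 v) = \<tau> u v" "\<And>u v. \<tau> (L2 u) (L2 v) = \<tau> u v" "\<And>u v. \<tau> (L3 u) (L3 v) = \<tau> u v"
    using st(2) unfolding S2E_def by blast
  interpret K: quaternionic_space "g q" K1 K2 K3 by (rule triple_space[OF K(1)])
  interpret L: quaternionic_space "g q" L1 L2 L3 by (rule triple_space[OF L(1)])
  note \<tau>l = bilinear_ladd[OF \<tau>(1)] bilinear_radd[OF \<tau>(1)] bilinear_lmul[OF \<tau>(1)] bilinear_rmul[OF \<tau>(1)] bilinear_rneg[OF \<tau>(1)]
  have "q.in_Q (\<lambda>u. endo \<psi> q (J u) - J (endo \<psi> q u))" if J: "J \<in> Q q" and Jsk: "\<And>u v. g q (J u) v = - g q u (J v)" for J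
  proof -
    obtain l1 l2 l3 where Jl: "\<And>u. J u = l1 *\<^sub>R L1 u + l2 *\<^sub>R L2 u + l3 *\<^sub>R L3 u"
      using J unfolding L(2) L.span_iff_in_Q L.in_Q_def by blast
    obtain k1 k2 k3 where Jk: "\<And>u. J u = k1 *\<^sub>R K1 u + k2 *\<^sub>R K2 u + k3 *\<^sub>R K3 u"
      using J unfolding K(2) K.span_iff_in_Q K.in_Q_def by blast
    have "\<tau> (L1 u) v = - \<tau> u (L1 v)" "\<tau> (L2 u) v = - \<tau> u (L2 v)" "\<tau> (L3 u) v = - \<tau> u (L3 v)" for u v
      using \<tau>(2)[of u "L1 v"] \<tau>(3)[of u "L2 v"] \<tau>(4)[of u "L3 v"] by (simp_all add: L.J_sq \<tau>l)
    then have "\<tau> (J u) v + \<tau> u (J v) = 0" for u v by (simp add: Jl \<tau>l)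
    then have *: "\<psi> q (J u) v + \<psi> q u (J v) = \<sigma> (J u) v + \<sigma> u (J v)" for u v
      by (simp add: st(3) algebra_simps)
    have "endo \<psi> q (J u) - J (endo \<psi> q u) = (2 * (s2 * k3 - s3 * k2)) *\<^sub>R K1 u + (2 * (s3 * k1 - s1 * k3)) *\<^sub>R K2 u
       + (2 * (s1 * k2 - s2 * k1)) *\<^sub>R K3 u" for u
    proof (rule q.G_eqI)
      fix v
      have "g q (endo \<psi> q (J u) - J (endo \<psi> q u)) v = \<psi> q (J u) v + \<psi> q u (J v)"
        by (simp add: q.G_lin Jsk g_endo[where \<psi> = \<psi> and q = q, OF b])
      also have "\<dots> = g q ((2 * (s2 * k3 - s3 * k2)) *\<^sub>R K1 u + (2 * (s3 * k1 - s1 * k3)) *\<^sub>R K2 u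
         + (2 * (s1 * k2 - s2 * k1)) *\<^sub>R K3 u) v"
        unfolding *
        by (simp add: \<sigma> Jk kahler_form_def scaleR_fun_def q.G_lin K.J_simps)
          (simp add: K.J_skew K.J_simps q.G_lin algebra_simps)
      finally show "g q (endo \<psi> q (J u) - J (endo \<psi> q u)) v = g q ((2 * (s2 * k3 - s3 * k2)) *\<^sub>R K1 u + (2 * (s3 * k1 - s1 * k3)) *\<^sub>R K2 u
         + (2 * (s1 * k2 - s2 * k1)) *\<^sub>R K3 u) v" .
    qed
    then have "K.in_Q (\<lambda>u. endo \<psi> q (J u) - J (endo \<psi> q u))" by (rule K.in_QI)
    then show ?thesis using K(2) Qq by (simp flip: q.span_iff_in_Q K.span_iff_in_Q)
  qed
  moreover have "J1 q \<in> Q q" "J2 q \<in> Q q" "J3 q \<in> Q q" unfolding Qq by (auto intro: span_base)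
  ultimately show ?thesis unfolding q.normalises_def using q.J_skew by blast
qed

text \<open>Couples a form with its codifferential, so that membership in \<open>C2\<close> and
  formulas for \<open>codiff\<close> are obtained together. Ranging over all trivialisations and
  charts makes the local results available around every point.\<close>

definition is_pair :: "('m, 'e) cov2 \<Rightarrow> ('m, 'e) vfield \<Rightarrow> bool" where
  "is_pair \<psi> X \<longleftrightarrow> smooth_cov2 A \<psi> \<and> smooth_vfield A X \<and>
     (\<forall>U J1 J2 J3. loc U J1 J2 J3 \<longrightarrow> (\<forall>c\<in>A. \<exists>\<Psi>.
        local_qk.ck_pair (snd c ` (fst c \<inter> U)) (gr c) (\<Gamma> c) (end_rep A c J1) (end_rep A c J2) (end_rep A c J3) (1 / (real DIM('e) - 1)) \<Psi> (vf_rep A c X) \<and>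
        (\<forall>x\<in>snd c ` (fst c \<inter> U). \<forall>a b. cov2_rep A c \<psi> x a b = gr c x (\<Psi> x a) b)))"

lemma is_pairE:
  assumes "is_pair \<psi> X" "loc U J1 J2 J3" "c \<in> A"
  obtains \<Psi> where "local_qk.ck_pair (snd c ` (fst c \<inter> U)) (gr c) (\<Gamma> c) (end_rep A c J1) (end_rep A c J2) (end_rep A c J3) (1 / (real DIM('e) - 1)) \<Psi> (vf_rep A c X)"
    "\<And>x a b. x \<in> snd c ` (fst c \<inter> U) \<Longrightarrow> cov2_rep A c \<psi> x a b = gr c x (\<Psi> x a) b"
  using assms unfolding is_pair_def by blast

text \<open>Compatibility enters through \<open>nabE_normalises\<close>: the covariant derivative of
  the endomorphism normalises \<open>Q\<close>, which \<open>conformal_killing_algebra\<close>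
  requires beside the conformal-Killing equation.\<close>

lemma C2_is_pair:
  assumes "\<psi> \<in> C2 A g Q"
  shows "is_pair \<psi> (codiff A g \<psi>)"
proof -
  have ck: "conformal_killing A g \<psi>" and comp: "compatible g Q \<psi>" using assms by (auto simp: C2_def)
  have \<psi>: "two_form A \<psi>" using ck by (simp add: conformal_killing_def)
  note t = two_formD(1)[OF \<psi>] and X = smooth_codiff[OF \<psi>]
  show ?thesis
    unfolding is_pair_def
  proof (intro conjI allI impI ballI)
    fix U J1 J2 J3 c assume U: "loc U J1 J2 J3" and c: "c \<in> A"
    let ?S = "snd c ` (fst c \<inter> U)"
    interpret l: local_metric "img c" "gr c" "\<Gamma> c" by (rule local_metric_chart[OF c])
    interpret L: local_qk ?S "gr c" "\<Gamma> c" "end_rep A c J1" "end_rep A c J2" "end_rep A c J3" by (rule loc_chart[OF U c])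
    have SS: "?S \<subseteq> img c" by auto
    define \<Psi> where "\<Psi> = end_rep A c (endo \<psi>)"
    note ef' = endo_endfield[OF t c, folded \<Psi>_def]
    have ef: "L.endfield \<Psi>"
      using ef' smooth_on_subset[OF _ SS] unfolding l.endfield_def L.endfield_def by auto
    have nrm: "L.normalises x (\<Psi> x)" if x: "x \<in> ?S" for x
    proof -
      obtain q where q: "q \<in> fst c" "q \<in> U" "x = snd c q" using x by auto
      interpret q: quaternionic_space "g q" "J1 q" "J2 q" "J3 q" by (rule loc_space[OF U q(2)])
      interpret x: quaternionic_space "gr c x" "end_rep A c J1 x" "end_rep A c J2 x" "end_rep A c J3 x" by (rule L.quat[OF x])
      have n: "q.normalises (endo \<psi> q)" by (rule compatible_normalises[OF comp two_formD(2)[OF \<psi>] U q(2)])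
      have "x.in_Q (\<lambda>u. \<Psi> x (end_rep A c J x u) - end_rep A c J x (\<Psi> x u))"
        if "q.in_Q (\<lambda>u. endo \<psi> q (J q u) - J q (endo \<psi> q u))" for J
        unfolding q(3)
        by (rule in_Q_rep[OF c q(1) q.quaternionic_space_axioms that x.quaternionic_space_axioms[unfolded q(3)]])
          (simp add: \<Psi>_def end_rep_at c q linear_diff[OF to_chart_linear[OF c q(1)]])
      then show ?thesis using n unfolding q.normalises_def x.normalises_def by blast
    qed
    have "L.ck_pair (1 / (real DIM('e) - 1)) \<Psi> (vf_rep A c (codiff A g \<psi>))"
      unfolding L.ck_pair_def
    proof (intro conjI ballI allI ef)
      show "smooth_on (vf_rep A c (codiff A g \<psi>)) ?S"
        by (rule smooth_on_subset[OF smooth_vfieldD[OF X c] SS])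
      fix x assume x: "x \<in> ?S"
      then obtain q where q: "q \<in> fst c" "q \<in> U" "x = snd c q" by auto
      have x': "x \<in> img c" using q by auto
      interpret x: quaternionic_space "gr c x" "end_rep A c J1 x" "end_rep A c J2 x" "end_rep A c J3 x" by (rule L.quat[OF x])
      show "L.skew x (\<Psi> x)" unfolding x.skew_def \<Psi>_def using endo_rep_skew[OF \<psi> c x'] by blast
      show "L.normalises x (\<Psi> x)" by (rule nrm[OF x])
      fix v u
      let ?N = "nabE (\<Gamma> c) \<Psi> x" and ?X = "vf_rep A c (codiff A g \<psi>) x"
      have N_nab: "gr c x (?N Y a) b = nabla_cov2 A g \<psi> q (from_chart A c q Y) (from_chart A c q a) (from_chart A c q b)" for Y a b
        unfolding nabla_endo[OF t c q(1)] by (simp add: \<Psi>_def c q)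
      show "?N v u = - ((1 / (real DIM('e) - 1)) *\<^sub>R L.q x v ?X u)"
      proof (rule x.conformal_killing_algebra)
        show "bilinear ?N"
          using l.linear_nabE_direction[OF ef' x'] l.endfieldD(1)[OF l.endfield_nabE[OF ef'] x'] by (simp add: bilinear_def)
        show "x.skew (?N Y)" for Y
          unfolding x.skew_def \<Psi>_def using l.nabE_skew[OF endo_endfield[OF t c] x' endo_rep_skew[OF \<psi> c]] by blast
        show "x.normalises (?N Y)" for Y by (rule L.nabE_normalises[OF ef nrm x])
        show "gr c x (?N Y u) v = 1 / 3 * (gr c x (?N Y u) v - gr c x (?N u Y) v + gr c x (?N v Y) u)
            - (1 / (real DIM('e) - 1)) * (gr c x Y u * gr c x ?X v - gr c x Y v * gr c x ?X u)" for Y u v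
          unfolding N_nab unfolding q(3) cov2_rep_at[OF c q(1)] vf_rep_at[OF c q(1)] from_to_chart[OF c q(1)]
            ext_d_nabla[OF \<psi>, symmetric]
          using ck unfolding conformal_killing_def wedge_def by blast
      qed
    qed
    moreover have "\<forall>x\<in>?S. \<forall>a b. cov2_rep A c \<psi> x a b = gr c x (\<Psi> x a) b"
      using gr_endo[OF t c] SS unfolding \<Psi>_def by fastforce
    ultimately show "\<exists>\<Psi>. L.ck_pair (1 / (real DIM('e) - 1)) \<Psi> (vf_rep A c (codiff A g \<psi>)) \<and> (\<forall>x\<in>?S. \<forall>a b. cov2_rep A c \<psi> x a b = gr c x (\<Psi> x a) b)"
      by blast
  qed (rule t X)+
qed

text \<open>All claims are pointwise, so at each \<open>p\<close> the preferred chart suffices;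
  there the coordinate expressions coincide with the fields themselves.\<close>

lemma is_pair_C2:
  assumes pair: "is_pair \<psi> X"
  shows "\<psi> \<in> C2 A g Q" "codiff A g \<psi> = X"
proof -
  have t: "smooth_cov2 A \<psi>" and X: "smooth_vfield A X" using pair by (auto simp: is_pair_def)
  have "\<exists>J1 J2 J3 P. quaternionic_triple g p J1 J2 J3 \<and> Q p = span {J1, J2, J3} \<and>
      quaternionic_space.skew (g p) P \<and> quaternionic_space.normalises J1 J2 J3 P \<and> linear P \<and>
      (\<forall>a b. \<psi> p a b = g p (P a) b) \<and>
      (\<forall>Y a b. nabla_cov2 A g \<psi> p Y a b = - (1 / (real DIM('e) - 1)) * g p (qwedge (g p) J1 J2 J3 Y (X p) a) b)" for p
  proof -
    obtain U J1 J2 J3 where p: "p \<in> U" and U: "loc U J1 J2 J3" using loc_exists by blast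
    let ?c = "chart_at A p" and ?x = "snd (chart_at A p) p"
    let ?S = "snd ?c ` (fst ?c \<inter> U)"
    interpret L: local_qk ?S "gr ?c" "\<Gamma> ?c" "end_rep A ?c J1" "end_rep A ?c J2" "end_rep A ?c J3"
      by (rule loc_chart[OF U chart_at(1)])
    obtain \<Psi> where \<Psi>: "L.ck_pair (1 / (real DIM('e) - 1)) \<Psi> (vf_rep A ?c X)" and eq: "\<And>x a b. x \<in> ?S \<Longrightarrow> cov2_rep A ?c \<psi> x a b = gr ?c x (\<Psi> x a) b"
      by (rule is_pairE[OF pair U chart_at(1)]) blast
    have x: "?x \<in> ?S" using chart_at p by auto
    have same: "gr ?c ?x = g p" "end_rep A ?c J ?x = J p" for J
      by (auto simp: fun_eq_iff cov2_rep_at end_rep_at chart_at)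
    note d = L.ck_pairD[OF \<Psi>]
    have "nabla_cov2 A g \<psi> p Y a b = - (1 / (real DIM('e) - 1)) * g p (qwedge (g p) (J1 p) (J2 p) (J3 p) Y (X p) a) b" for Y a b
      using L.nab2_eq_nabE[OF d(1) x eq, of Y a b] metric_form.G_lin[OF metric_form_g]
      unfolding nabla_cov2_rep[OF t chart_at] by (simp add: d(5)[OF x] same vf_rep_at chart_at)
    moreover have "\<psi> p a b = g p (\<Psi> ?x a) b" for a b
      using eq[OF x, of a b] by (simp add: same cov2_rep_at chart_at)
    ultimately show ?thesis
      using d(3)[OF x] d(4)[OF x] L.endfieldD(1)[OF d(1) x] U p unfolding same loc_def by blast
  qed
  note ex = this
  have alt: "\<psi> p u u = 0" for p u
  proof -
    obtain J1 J2 J3 P where J: "quaternionic_triple g p J1 J2 J3" and P: "quaternionic_space.skew (g p) P" "\<And>a b. \<psi> p a b = g p (P a) b"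
      using ex[of p] by blast
    interpret quaternionic_space "g p" J1 J2 J3 by (rule triple_space[OF J])
    have "g p (P u) u = - g p u (P u)" using P(1) unfolding skew_def by blast
    then show ?thesis using G_sym[of u "P u"] by (simp add: P(2))
  qed
  then have \<psi>: "two_form A \<psi>" using t by (simp add: two_form_def)
  show X_eq: "codiff A g \<psi> = X"
  proof
    fix p
    obtain J1 J2 J3 where J: "quaternionic_triple g p J1 J2 J3"
      and nab: "\<And>Y a b. nabla_cov2 A g \<psi> p Y a b = - (1 / (real DIM('e) - 1)) * g p (qwedge (g p) J1 J2 J3 Y (X p) a) b"
      using ex[of p] by blast
    interpret quaternionic_space "g p" J1 J2 J3 by (rule triple_space[OF J])
    have "- (\<Sum>e\<in>on_frame g p. nabla_cov2 A g \<psi> p e e v) = g p (X p) v" for v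
      using qwedge_trace[OF on_frame, of "X p" v] dim8
      by (simp add: nab sum_negf sum_divide_distrib[symmetric] field_simps)
    then show "codiff A g \<psi> p = X p"
      unfolding codiff_def by (intro sharp_eqI metric_form_axioms) simp
  qed
  have "nabla_cov2 A g \<psi> p Y u v = 1 / 3 * ext_d A \<psi> p Y u v - (1 / (real DIM('e) - 1)) * wedge g p Y (codiff A g \<psi> p) u v" for p Y u v
  proof -
    obtain J1 J2 J3 where J: "quaternionic_triple g p J1 J2 J3"
      and nab: "\<And>Y a b. nabla_cov2 A g \<psi> p Y a b = - (1 / (real DIM('e) - 1)) * g p (qwedge (g p) J1 J2 J3 Y (X p) a) b"
      using ex[of p] by blast
    interpret quaternionic_space "g p" J1 J2 J3 by (rule triple_space[OF J])
    show ?thesis unfolding ext_d_nabla[OF \<psi>] wedge_def X_eq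
      by (rule qwedge_conformal_killing) (rule nab)
  qed
  then have "conformal_killing A g \<psi>" using \<psi> by (simp add: conformal_killing_def)
  moreover have "compatible g Q \<psi>"
    unfolding compatible_def
  proof
    fix p
    obtain J1 J2 J3 P where J: "quaternionic_triple g p J1 J2 J3" "Q p = span {J1, J2, J3}" and P: "quaternionic_space.skew (g p) P"
      "quaternionic_space.normalises J1 J2 J3 P" "linear P" "\<And>a b. \<psi> p a b = g p (P a) b"
      using ex[of p] by blast
    interpret quaternionic_space "g p" J1 J2 J3 by (rule triple_space[OF J(1)])
    \<comment> \<open>The \<open>Q\<close>-part of \<open>P\<close> is the endomorphism of a form in
      \<open>S2H\<close>, and the skew part commuting with \<open>Q\<close> that of a form in
      \<open>S2E\<close>.\<close>
    obtain a b c T where T: "linear T" "skew T" "commutes T" and P_eq: "\<And>u. P u = a *\<^sub>R J1 u + b *\<^sub>R J2 u + c *\<^sub>R J3 u + T u"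
      using decomposition[OF P(2,1,3)] by metis
    note T' = T(3)[unfolded commutes_def, rule_format]
    define \<sigma> where "\<sigma> = a *\<^sub>R kahler_form g p J1 + b *\<^sub>R kahler_form g p J2 + c *\<^sub>R kahler_form g p J3"
    define \<tau> where "\<tau> u v = g p (T u) v" for u v
    have "\<sigma> \<in> S2H g Q p" unfolding S2H_def span_triple_iff using J \<sigma>_def by blast
    moreover have "\<tau> \<in> S2E g Q p"
    proof -
      have "bilinear \<tau>" using T(1) by (simp add: bilinear_def linear_iff \<tau>_def G_lin)
      moreover have "\<tau> u u = 0" for u
      proof -
        have "g p (T u) u = - g p u (T u)" using T(2) unfolding skew_def by blast
        then show ?thesis using G_sym[of u "T u"] by (simp add: \<tau>_def)
      qed
      moreover have "\<forall>K\<in>{J1, J2, J3}. \<forall>u v. \<tau> (K u) (K v) = \<tau> u v" by (simp add: \<tau>_def T' J_iso)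
      ultimately show ?thesis unfolding S2E_def using J by blast
    qed
    moreover have "\<psi> p = \<sigma> + \<tau>"
      by (intro ext) (simp add: P(4) P_eq \<sigma>_def \<tau>_def kahler_form_def scaleR_fun_def G_lin)
    ultimately show "\<exists>\<sigma>\<in>S2H g Q p. \<exists>\<tau>\<in>S2E g Q p. \<psi> p = \<sigma> + \<tau>" by blast
  qed
  ultimately show "\<psi> \<in> C2 A g Q" by (simp add: C2_def)
qed

lemma is_pair_lincomb:
  assumes 1: "is_pair \<psi>1 X1" and 2: "is_pair \<psi>2 X2"
  shows "is_pair (r1 *\<^sub>R \<psi>1 + r2 *\<^sub>R \<psi>2) (r1 *\<^sub>R X1 + r2 *\<^sub>R X2)"
  unfolding is_pair_def
proof (intro conjI allI impI ballI)
  have s: "smooth_cov2 A \<psi>1" "smooth_cov2 A \<psi>2" "smooth_vfield A X1" "smooth_vfield A X2" using 1 2 by (auto simp: is_pair_def)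
  show "smooth_cov2 A (r1 *\<^sub>R \<psi>1 + r2 *\<^sub>R \<psi>2)" "smooth_vfield A (r1 *\<^sub>R X1 + r2 *\<^sub>R X2)"
    by (intro smooth_cov2_lincomb smooth_vfield_lincomb s)+
  fix U J1 J2 J3 c assume U: "loc U J1 J2 J3" and c: "c \<in> A"
  let ?S = "snd c ` (fst c \<inter> U)"
  interpret L: local_qk ?S "gr c" "\<Gamma> c" "end_rep A c J1" "end_rep A c J2" "end_rep A c J3" by (rule loc_chart[OF U c])
  obtain \<Psi>1 where p1: "L.ck_pair (1 / (real DIM('e) - 1)) \<Psi>1 (vf_rep A c X1)"
    and e1: "\<And>x a b. x \<in> ?S \<Longrightarrow> cov2_rep A c \<psi>1 x a b = gr c x (\<Psi>1 x a) b"
    by (rule is_pairE[OF 1 U c]) blast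
  obtain \<Psi>2 where p2: "L.ck_pair (1 / (real DIM('e) - 1)) \<Psi>2 (vf_rep A c X2)"
    and e2: "\<And>x a b. x \<in> ?S \<Longrightarrow> cov2_rep A c \<psi>2 x a b = gr c x (\<Psi>2 x a) b"
    by (rule is_pairE[OF 2 U c]) blast
  note p = p1 p2 and e = e1 e2
  have "L.ck_pair (1 / (real DIM('e) - 1)) (\<lambda>x u. r1 *\<^sub>R \<Psi>1 x u + r2 *\<^sub>R \<Psi>2 x u) (vf_rep A c (r1 *\<^sub>R X1 + r2 *\<^sub>R X2))"
  proof (rule L.ck_pair_cong[OF L.ck_pair_lincomb[OF p]])
    fix x assume "x \<in> ?S"
    then have "x \<in> img c" by auto
    then show "r1 *\<^sub>R vf_rep A c X1 x + r2 *\<^sub>R vf_rep A c X2 x = vf_rep A c (r1 *\<^sub>R X1 + r2 *\<^sub>R X2) x"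
      by (simp add: vf_rep_linear c)
  qed
  moreover have "cov2_rep A c (r1 *\<^sub>R \<psi>1 + r2 *\<^sub>R \<psi>2) x a b = gr c x (r1 *\<^sub>R \<Psi>1 x a + r2 *\<^sub>R \<Psi>2 x a) b" if "x \<in> ?S" for x a b
    by (simp add: cov2_rep_linear e[OF that] metric_form.G_lin[OF L.metric[OF that]])
  ultimately show "\<exists>\<Psi>. L.ck_pair (1 / (real DIM('e) - 1)) \<Psi> (vf_rep A c (r1 *\<^sub>R X1 + r2 *\<^sub>R X2)) \<and>
    (\<forall>x\<in>?S. \<forall>a b. cov2_rep A c (r1 *\<^sub>R \<psi>1 + r2 *\<^sub>R \<psi>2) x a b = gr c x (\<Psi> x a) b)"
    by blast
qed

lemma is_pair_zero: "is_pair 0 0"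
  unfolding is_pair_def
proof (intro conjI allI impI ballI)
  show "smooth_cov2 A 0" using smooth_cov2_lincomb[OF smooth_g smooth_g, of 0 0] by simp
  show "smooth_vfield A 0" using lie_algebra_isom unfolding lie_algebra_def by (auto simp: subspace_def isom_def)
  fix U J1 J2 J3 c assume U: "loc U J1 J2 J3" and c: "c \<in> A"
  let ?S = "snd c ` (fst c \<inter> U)"
  interpret L: local_qk ?S "gr c" "\<Gamma> c" "end_rep A c J1" "end_rep A c J2" "end_rep A c J3" by (rule loc_chart[OF U c])
  have "L.ck_pair (1 / (real DIM('e) - 1)) (\<lambda>x u. 0) (vf_rep A c 0)"
  proof (rule L.ck_pair_cong[OF L.ck_pair_zero])
    fix x assume "x \<in> ?S"
    then have "x \<in> img c" by auto
    then show "0 = vf_rep A c 0 x" by (simp add: vf_rep_linear c)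
  qed
  moreover have "\<forall>x\<in>?S. \<forall>a b. cov2_rep A c 0 x a b = gr c x 0 b"
    using metric_form.G_lin[OF L.metric] by (simp add: cov2_rep_linear)
  ultimately show "\<exists>\<Psi>. L.ck_pair (1 / (real DIM('e) - 1)) \<Psi> (vf_rep A c 0) \<and> (\<forall>x\<in>?S. \<forall>a b. cov2_rep A c 0 x a b = gr c x (\<Psi> x a) b)"
    by blast
qed

lemma c0_nonzero: "1 / (real DIM('e) - 1) \<noteq> 0"
  using dim8 by auto

text \<open>The first order equation supplies the covariant derivative of the second form along
  \<open>X1\<close>. The two remaining terms of the Lie derivative combine to a commutator because
  \<open>nabV\<close> of \<open>X1\<close> is skew.\<close>

lemma lie_deriv_pair:
  assumes s: "smooth_cov2 A \<psi>2" "smooth_vfield A X1" and U: "loc U J1 J2 J3" and c: "c \<in> A"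
    and p: "local_qk.ck_pair (snd c ` (fst c \<inter> U)) (gr c) (\<Gamma> c) (end_rep A c J1) (end_rep A c J2) (end_rep A c J3) (1 / (real DIM('e) - 1)) \<Psi>1 (vf_rep A c X1)"
      "local_qk.ck_pair (snd c ` (fst c \<inter> U)) (gr c) (\<Gamma> c) (end_rep A c J1) (end_rep A c J2) (end_rep A c J3) (1 / (real DIM('e) - 1)) \<Psi>2 (vf_rep A c X2)"
    and e: "\<And>x a b. x \<in> snd c ` (fst c \<inter> U) \<Longrightarrow> cov2_rep A c \<psi>2 x a b = gr c x (\<Psi>2 x a) b"
    and x: "x \<in> snd c ` (fst c \<inter> U)"
  shows "cov2_rep A c (lie_deriv A X1 \<psi>2) x a b = gr c x ((- (1 / (real DIM('e) - 1))) *\<^sub>R qwedge (gr c x) (end_rep A c J1 x) (end_rep A c J2 x) (end_rep A c J3 x)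
      (vf_rep A c X1 x) (vf_rep A c X2 x) a - (nabV (\<Gamma> c) (vf_rep A c X1) x (\<Psi>2 x a) - \<Psi>2 x (nabV (\<Gamma> c) (vf_rep A c X1) x a))) b"
proof -
  let ?S = "snd c ` (fst c \<inter> U)" and ?A = "nabV (\<Gamma> c) (vf_rep A c X1) x"
  interpret L: local_qk ?S "gr c" "\<Gamma> c" "end_rep A c J1" "end_rep A c J2" "end_rep A c J3" by (rule loc_chart[OF U c])
  interpret x: quaternionic_space "gr c x" "end_rep A c J1 x" "end_rep A c J2 x" "end_rep A c J3 x" by (rule L.quat[OF x])
  have x': "x \<in> img c" using x by auto
  have sk: "gr c x (\<Psi>2 x a) (?A b) = - gr c x (?A (\<Psi>2 x a)) b"
    using L.ck_pair_prolongation(1)[OF p(1) c0_nonzero x] unfolding x.skew_def by simp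
  have n: "nab2 (\<Gamma> c) (cov2_rep A c \<psi>2) x v u w = gr c x (nabE (\<Gamma> c) \<Psi>2 x v u) w" for v u w
    by (rule L.nab2_eq_nabE[OF L.ck_pairD(1)[OF p(2)] x]) (rule e)
  show ?thesis
    unfolding lie_deriv_nabla_rep[OF s c x'] n L.ck_pairD(5)[OF p(2) x] e[OF x]
    by (simp add: x.G_lin sk)
qed

text \<open>Together with \<open>is_pair_C2\<close> this gives both the closure of \<open>C2\<close>
  under the bracket and the homomorphism property of \<open>codiff\<close>.\<close>

lemma is_pair_lie_deriv:
  assumes 1: "is_pair \<psi>1 X1" and 2: "is_pair \<psi>2 X2"
  shows "is_pair (lie_deriv A X1 \<psi>2) (lie_bracket A X1 X2)"
  unfolding is_pair_def
proof (intro conjI allI impI ballI)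
  have s: "smooth_cov2 A \<psi>2" "smooth_vfield A X1" "smooth_vfield A X2" using 1 2 by (auto simp: is_pair_def)
  show "smooth_cov2 A (lie_deriv A X1 \<psi>2)" "smooth_vfield A (lie_bracket A X1 X2)"
    by (intro smooth_lie_deriv smooth_lie_bracket s)+
  fix U J1 J2 J3 c assume U: "loc U J1 J2 J3" and c: "c \<in> A"
  let ?S = "snd c ` (fst c \<inter> U)"
  interpret L: local_qk ?S "gr c" "\<Gamma> c" "end_rep A c J1" "end_rep A c J2" "end_rep A c J3" by (rule loc_chart[OF U c])
  obtain \<Psi>1 where p1: "L.ck_pair (1 / (real DIM('e) - 1)) \<Psi>1 (vf_rep A c X1)"
    by (rule is_pairE[OF 1 U c]) blast
  obtain \<Psi>2 where p2: "L.ck_pair (1 / (real DIM('e) - 1)) \<Psi>2 (vf_rep A c X2)"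
    and e: "\<And>x a b. x \<in> ?S \<Longrightarrow> cov2_rep A c \<psi>2 x a b = gr c x (\<Psi>2 x a) b"
    by (rule is_pairE[OF 2 U c]) blast
  note p = p1 p2
  note b = L.ck_pair_bracket[OF p c0_nonzero]
  have "vf_rep A c (lie_bracket A X1 X2) x = nabV (\<Gamma> c) (vf_rep A c X2) x (vf_rep A c X1 x) - nabV (\<Gamma> c) (vf_rep A c X1) x (vf_rep A c X2 x)"
    if "x \<in> ?S" for x using lie_bracket_rep(1)[OF s(2,3) c, of x] that by blast
  then have "L.ck_pair (1 / (real DIM('e) - 1)) (\<lambda>x u. (- (1 / (real DIM('e) - 1))) *\<^sub>R L.q x (vf_rep A c X1 x) (vf_rep A c X2 x) u
      - (nabV (\<Gamma> c) (vf_rep A c X1) x (\<Psi>2 x u) - \<Psi>2 x (nabV (\<Gamma> c) (vf_rep A c X1) x u))) (vf_rep A c (lie_bracket A X1 X2))"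
    by (intro L.ck_pair_cong[OF b]) simp
  then show "\<exists>\<Psi>. L.ck_pair (1 / (real DIM('e) - 1)) \<Psi> (vf_rep A c (lie_bracket A X1 X2)) \<and>
      (\<forall>x\<in>?S. \<forall>a b. cov2_rep A c (lie_deriv A X1 \<psi>2) x a b = gr c x (\<Psi> x a) b)"
    using lie_deriv_pair[OF s(1,2) U c p] e by blast
qed

lemma chart_loc: "c \<in> A \<Longrightarrow> x \<in> img c \<Longrightarrow> \<exists>U J1 J2 J3. loc U J1 J2 J3 \<and> x \<in> snd c ` (fst c \<inter> U)"
  using loc_exists by blast

text \<open>Skewness of \<open>\<nabla>X\<close> makes \<open>X\<close> a Killing field. In the Lie
  derivative of \<open>\<psi>\<close> the term \<open>qwedge\<close> with both vectors equal to
  \<open>X\<close> vanishes, and so does the commutator of \<open>\<nabla>X\<close> with the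
  endomorphism of \<open>\<psi>\<close>.\<close>

lemma is_pair_killing:
  assumes 1: "is_pair \<psi> X"
  shows "X \<in> isom A g" "lie_deriv A X \<psi> = 0"
proof -
  have s: "smooth_cov2 A \<psi>" "smooth_vfield A X" using 1 by (auto simp: is_pair_def)
  have "cov2_rep A c (lie_deriv A X g) x a b = 0 \<and> cov2_rep A c (lie_deriv A X \<psi>) x a b = 0" if c: "c \<in> A" and x': "x \<in> img c" for c x a b
  proof -
    obtain U J1 J2 J3 where U: "loc U J1 J2 J3" and x: "x \<in> snd c ` (fst c \<inter> U)" using chart_loc[OF c x'] by blast
    let ?S = "snd c ` (fst c \<inter> U)"
    interpret L: local_qk ?S "gr c" "\<Gamma> c" "end_rep A c J1" "end_rep A c J2" "end_rep A c J3" by (rule loc_chart[OF U c])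
    interpret x: quaternionic_space "gr c x" "end_rep A c J1 x" "end_rep A c J2 x" "end_rep A c J3 x" by (rule L.quat[OF x])
    obtain \<Psi> where p: "L.ck_pair (1 / (real DIM('e) - 1)) \<Psi> (vf_rep A c X)"
      and e: "\<And>x a b. x \<in> ?S \<Longrightarrow> cov2_rep A c \<psi> x a b = gr c x (\<Psi> x a) b"
      by (rule is_pairE[OF 1 U c]) blast
    note pr = L.ck_pair_prolongation[OF p c0_nonzero x]
    have "cov2_rep A c (lie_deriv A X g) x a b = 0"
      unfolding lie_deriv_nabla_rep[OF smooth_g s(2) c x'] nab2_def L.\<Gamma>_metric[OF x]
      using pr(1) unfolding x.skew_def by simp
    moreover have "cov2_rep A c (lie_deriv A X \<psi>) x a b = 0"
      by (subst lie_deriv_pair[OF s U c p p _ x]) (simp_all add: e pr(3) x.G_lin)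
    ultimately show ?thesis by blast
  qed
  then have "lie_deriv A X g = 0" "lie_deriv A X \<psi> = 0"
    by (auto intro!: cov2_eqI simp: cov2_rep_linear)
  then show "X \<in> isom A g" "lie_deriv A X \<psi> = 0" using s by (auto simp: isom_def)
qed

text \<open>By polarisation of \<open>L\<^bsub>\<delta>\<psi>\<^esub> \<psi> = 0\<close>; hence \<open>[\<psi>\<^sub>1, \<psi>\<^sub>2]\<close> is just \<open>L\<^bsub>\<delta>\<psi>\<^sub>1\<^esub> \<psi>\<^sub>2\<close>.\<close>

lemma is_pair_antisym:
  assumes 1: "is_pair \<psi>1 X1" and 2: "is_pair \<psi>2 X2"
  shows "lie_deriv A X1 \<psi>2 = - lie_deriv A X2 \<psi>1"
proof -
  have s: "smooth_cov2 A \<psi>1" "smooth_cov2 A \<psi>2" "smooth_vfield A X1" "smooth_vfield A X2" using 1 2 by (auto simp: is_pair_def)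
  have s3: "smooth_cov2 A (\<psi>1 + \<psi>2)" using smooth_cov2_lincomb[OF s(1,2), of 1 1] by simp
  have "lie_deriv A (X1 + X2) (\<psi>1 + \<psi>2) = 0"
    using is_pair_killing(2)[OF is_pair_lincomb[OF 1 2, of 1 1]] by simp
  moreover have "lie_deriv A (X1 + X2) (\<psi>1 + \<psi>2) = lie_deriv A X1 (\<psi>1 + \<psi>2) + lie_deriv A X2 (\<psi>1 + \<psi>2)"
    using lie_deriv_lincomb(2)[OF s3 s3 s(3,4), of 1 1] by simp
  moreover have "lie_deriv A X (\<psi>1 + \<psi>2) = lie_deriv A X \<psi>1 + lie_deriv A X \<psi>2" if "smooth_vfield A X" for X
    using lie_deriv_lincomb(1)[OF s(1,2) that that, of 1 1] by simp
  ultimately show ?thesis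
    using is_pair_killing(2)[OF 1] is_pair_killing(2)[OF 2] s by (simp add: eq_neg_iff_add_eq_0)
qed

end

theorem corollary12:
  fixes A :: "('m::{t2_space,second_countable_topology}, 'e::euclidean_space) chart set"
    and g :: "('m, 'e) cov2"
    and Q :: "'m \<Rightarrow> ('e \<Rightarrow> 'e) set"
  assumes "connected (UNIV :: 'm set)"
    and "quaternionic_kahler A g Q"
  shows "(\<forall>\<psi>1\<in>C2 A g Q. \<forall>\<psi>2\<in>C2 A g Q. ck_bracket A g \<psi>1 \<psi>2 \<in> C2 A g Q) \<and>
         (\<not> ricci_flat A g \<longrightarrow>
            lie_algebra (C2 A g Q) (ck_bracket A g) \<and>
            lie_algebra_hom (C2 A g Q) (ck_bracket A g) (isom A g) (lie_bracket A) (codiff A g))"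
proof -
  interpret qk_manifold A g Q by unfold_locales (rule assms(2))
  let ?C = "C2 A g Q" and ?\<delta> = "codiff A g" and ?br = "ck_bracket A g"
  note P = C2_is_pair and P' = is_pair_C2
  have sm: "smooth_cov2 A \<psi>" "smooth_vfield A (?\<delta> \<psi>)" if "\<psi> \<in> ?C" for \<psi>
    using P[OF that] by (auto simp: is_pair_def)
  have br: "?br \<psi>1 \<psi>2 = lie_deriv A (?\<delta> \<psi>1) \<psi>2" if "\<psi>1 \<in> ?C" "\<psi>2 \<in> ?C" for \<psi>1 \<psi>2
  proof -
    have "w + w = 2 *\<^sub>R w" for w :: "('m, 'e) cov2" by (simp add: scaleR_2)
    then show ?thesis
      unfolding ck_bracket_def is_pair_antisym[OF P[OF that(2)] P[OF that(1)]] by simp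
  qed
  have br_C: "?br \<psi>1 \<psi>2 \<in> ?C" and \<delta>_br: "?\<delta> (?br \<psi>1 \<psi>2) = lie_bracket A (?\<delta> \<psi>1) (?\<delta> \<psi>2)"
    if "\<psi>1 \<in> ?C" "\<psi>2 \<in> ?C" for \<psi>1 \<psi>2
    unfolding br[OF that] using P'[OF is_pair_lie_deriv[OF P[OF that(1)] P[OF that(2)]]] by auto
  have lin_C: "r1 *\<^sub>R \<psi>1 + r2 *\<^sub>R \<psi>2 \<in> ?C" and \<delta>_lin: "?\<delta> (r1 *\<^sub>R \<psi>1 + r2 *\<^sub>R \<psi>2) = r1 *\<^sub>R ?\<delta> \<psi>1 + r2 *\<^sub>R ?\<delta> \<psi>2"
    if "\<psi>1 \<in> ?C" "\<psi>2 \<in> ?C" for \<psi>1 \<psi>2 r1 r2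
    using P'[OF is_pair_lincomb[OF P[OF that(1)] P[OF that(2)]]] by auto
  have anti: "?br \<psi>1 \<psi>2 = - ?br \<psi>2 \<psi>1" if "\<psi>1 \<in> ?C" "\<psi>2 \<in> ?C" for \<psi>1 \<psi>2
    unfolding br[OF that] br[OF that(2,1)] by (rule is_pair_antisym[OF P[OF that(1)] P[OF that(2)]])
  have "subspace ?C"
    unfolding subspace_def
  proof (intro conjI ballI allI)
    fix x y r assume "x \<in> ?C" "y \<in> ?C"
    then show "x + y \<in> ?C" "r *\<^sub>R x \<in> ?C" using lin_C[of x y 1 1] lin_C[of x x r 0] by simp_all
  qed (rule P'(1)[OF is_pair_zero])
  moreover have right: "?br z (a *\<^sub>R x + b *\<^sub>R y) = a *\<^sub>R ?br z x + b *\<^sub>R ?br z y" if "x \<in> ?C" "y \<in> ?C" "z \<in> ?C" for x y z a b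
    using lie_deriv_lincomb(1)[OF sm(1)[OF that(1)] sm(1)[OF that(2)] sm(2)[OF that(3)] sm(2)[OF that(3)]]
    by (simp add: br that lin_C)
  moreover have "?br (a *\<^sub>R x + b *\<^sub>R y) z = a *\<^sub>R ?br x z + b *\<^sub>R ?br y z" if "x \<in> ?C" "y \<in> ?C" "z \<in> ?C" for x y z a b
    using lie_deriv_lincomb(2)[OF sm(1)[OF that(3)] sm(1)[OF that(3)] sm(2)[OF that(1)] sm(2)[OF that(2)]]
    by (simp add: br that lin_C \<delta>_lin)
  moreover have "?br x x = 0" if "x \<in> ?C" for x
    using is_pair_killing(2)[OF P[OF that]] br[OF that that] by simp
  moreover have "?br x (?br y z) + ?br y (?br z x) + ?br z (?br x y) = 0" if C: "x \<in> ?C" "y \<in> ?C" "z \<in> ?C" for x y z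
  proof -
    \<comment> \<open>Antisymmetry brings the cyclic sum into the form of the commutator formula;
      right linearity with the coefficients \<open>-1\<close> and \<open>0\<close> pulls the sign
      out of the inner bracket.\<close>
    have "?br y (?br z x) = - ?br y (?br x z)"
      using right[OF br_C[OF C(1,3)] br_C[OF C(1,3)] C(2), of "-1" 0] by (simp add: anti[OF C(3,1)])
    moreover have "?br z (?br x y) = - ?br (?br x y) z" by (rule anti[OF C(3) br_C[OF C(1,2)]])
    moreover have "?br (?br x y) z = ?br x (?br y z) - ?br y (?br x z)"
      unfolding br[OF br_C[OF C(1,2)] C(3)] \<delta>_br[OF C(1,2)]
        lie_deriv_commutator[OF sm(1)[OF C(3)] sm(2)[OF C(1)] sm(2)[OF C(2)]]
      using br[OF C(1) br_C[OF C(2,3)]] br[OF C(2) br_C[OF C(1,3)]] unfolding br[OF C(2,3)] br[OF C(1,3)] by simp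
    ultimately show ?thesis by simp
  qed
  ultimately have la: "lie_algebra ?C ?br" unfolding lie_algebra_def using br_C by simp
  have "?\<delta> \<psi> \<in> isom A g" if "\<psi> \<in> ?C" for \<psi> by (rule is_pair_killing(1)[OF P[OF that]])
  then have "lie_algebra_hom ?C ?br (isom A g) (lie_bracket A) ?\<delta>"
    unfolding lie_algebra_hom_def using la lie_algebra_isom \<delta>_lin \<delta>_br by simp
  with la br_C show ?thesis by blast
qed

end
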